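(* Let $d\ge2$, let $\mathbb T^d=\mathbb R^d/\mathbb Z^d$ carry its standard flat metric, and let $P=\mathbb T^d\times\mathrm{SU}(2)$ be the trivial bundle with product connection $\Theta$. Choose $p>d$ and let $X_d,Y_d,\mathcal E_{\mathrm{gf},d},\mathcal M_d$ be as in the context. Then the Lyapunov--Schmidt correction with respect to the harmonic splitting vanishes identically and, writing a harmonic one-form as $k=\sum_{i=1}^d\xi_i\,dx_i$ with $\xi_i\in\mathfrak{su}(2)$, the reduced energy is $$\Gamma_d(\xi_1,\ldots,\xi_d)=\kappa_d\sum_{1\le i<j\le d}\|[\xi_i,\xi_j]\|^2$$ for a constant $\kappa_d>0$. Consequently, $$\theta_{\mathrm{LS}}(\mathcal E_{\mathrm{gf},d},\Theta)=\frac34.$$ Moreover, every sufficiently small nonzero constant flat connection $\Theta+k_0$ has optimal exponent $1/2$ for $\mathcal E_{\mathrm{gf},d}$, i.e. $\theta_{\mathrm{LS}}(\mathcal E_{\mathrm{gf},d},\Theta+k_0)=\frac12$ for every sufficiently small nonzero constant-coefficient one-form $k_0=\sum_i\xi_i^0\,dx_i$ with $F_{\Theta+k_0}=0$.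
   Context: $\mathfrak{su}(2)$ carries an $\operatorname{Ad}$-invariant inner product. $X_d=W^{1,p}(\mathbb T^d;\Lambda^1\otimes\mathfrak{su}(2))$, $Y_d=(W^{1,p'}(\mathbb T^d;\Lambda^1\otimes\mathfrak{su}(2)))^*$, $p'=p/(p-1)$, with the duality pairing $\langle\cdot,\cdot\rangle_{Y_d,X_d}$ (using $X_d\hookrightarrow W^{1,p'}$). Connections are written $\Theta+a$, $a\in X_d$, with curvature $F_{\Theta+a}=da+\frac12[a\wedge a]$, $\frac12[a\wedge a](v,w)=[a(v),a(w)]$. The gauge-fixed functional and gradient map are $$\mathcal E_{\mathrm{gf},d}(a)=\frac12\|F_{\Theta+a}\|_{L^2}^2+\frac12\|d^*a\|_{L^2}^2,\qquad \mathcal M_d(a)=d_{\Theta+a}^*F_{\Theta+a}+dd^*a\in Y_d,$$ where $d^*_{\Theta+a}$ is the formal $L^2$-adjoint of $d_{\Theta+a}=d+[a\wedge\cdot\,]$; so $d\mathcal E_{\mathrm{gf},d}(a)[b]=\langle\mathcal M_d(a),b\rangle$. Harmonic splitting. $D\mathcal M_d(0)=\Delta_H=d^*d+dd^*:X_d\to Y_d$, with kernel $K_d=\{\sum_i\xi_i\,dx_i:\xi_i\in\mathfrak{su}(2)\}$, the constant one-forms. $Z$ is the $L^2$-orthogonal complement of $K_d$ in $X_d$; $K_d$ is embedded in $Y_d$ by the $L^2$ pairing; $Y_d=\operatorname{Ran}\Delta_H\oplus K_d$ and $R:Y_d\to\operatorname{Ran}\Delta_H$ is the projection along $K_d$. The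 Lyapunov--Schmidt correction is the unique real analytic germ $\psi:(K_d,0)\to(Z,0)$ with $R\mathcal M_d(k+\psi(k))=0$, and the reduced energy is $\Gamma_d(k)=\mathcal E_{\mathrm{gf},d}(k+\psi(k))$. For $a_0\in X_d$ with $\mathcal M_d(a_0)=0$, $\theta_{\mathrm{LS}}(\mathcal E_{\mathrm{gf},d},\Theta+a_0)$ is the infimum of all $\theta\in[1/2,1)$ for which there is $C>0$ with $\|\mathcal M_d(a)\|_{Y_d}\ge C|\mathcal E_{\mathrm{gf},d}(a)-\mathcal E_{\mathrm{gf},d}(a_0)|^\theta$ for all $a\in X_d$ sufficiently close to $a_0$; $\theta_{\mathrm{LS}}(\mathcal E_{\mathrm{gf},d},\Theta)$ is the case $a_0=0$. *)

theory Defs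
  imports "HOL-Analysis.Analysis"
begin

section \<open>The Lie algebra su(2)\<close>

definition herm :: "complex^'n^'m \<Rightarrow> complex^'m^'n" where
  "herm A = map_matrix cnj (transpose A)"

lemma herm_nth [simp]: "herm A $ i $ j = cnj (A $ j $ i)"
  by (simp add: herm_def transpose_def)

lemma herm_mult: "herm (A ** B) = herm B ** herm A"
  by (simp add: vec_eq_iff matrix_matrix_mult_def mult.commute)

lemma herm_herm [simp]: "herm (herm A) = A"
  by (simp add: vec_eq_iff)

definition SU2 :: "(complex^2^2) set" where
  "SU2 = {U. U ** herm U = mat 1 \<and> det U = 1}"

typedef su2 = "{A :: complex^2^2. herm A = - A \<and> trace A = 0}"
  by (rule exI[of _ 0]) (simp add: vec_eq_iff trace_def)

setup_lifting type_definition_su2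

instantiation su2 :: real_inner
begin

lift_definition zero_su2 :: su2 is 0
  by (simp add: vec_eq_iff trace_def)

lift_definition plus_su2 :: "su2 \<Rightarrow> su2 \<Rightarrow> su2" is "(+)"
  by (simp add: vec_eq_iff trace_add)

lift_definition minus_su2 :: "su2 \<Rightarrow> su2 \<Rightarrow> su2" is "(-)"
  by (simp add: vec_eq_iff trace_sub)

lift_definition uminus_su2 :: "su2 \<Rightarrow> su2" is uminus
  by (simp add: vec_eq_iff trace_def sum_negf)

lift_definition scaleR_su2 :: "real \<Rightarrow> su2 \<Rightarrow> su2" is scaleR
  by (simp add: vec_eq_iff trace_def complex_cnj_scaleR flip: scaleR_sum_right)

text \<open>The inner product of the type class is the Frobenius one,
  \<open>Re (tr (A\<^sup>* B)) = - tr (A B)\<close>. It only serves to topologise the type.\<close>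

lift_definition inner_su2 :: "su2 \<Rightarrow> su2 \<Rightarrow> real" is inner .

lift_definition norm_su2 :: "su2 \<Rightarrow> real" is norm .

definition dist_su2 :: "su2 \<Rightarrow> su2 \<Rightarrow> real" where
  "dist_su2 x y = norm (x - y)"

definition sgn_su2 :: "su2 \<Rightarrow> su2" where
  "sgn_su2 x = inverse (norm x) *\<^sub>R x"

definition uniformity_su2 :: "(su2 \<times> su2) filter" where
  "uniformity_su2 = (INF e\<in>{0<..}. principal {(x, y). dist x y < e})"

definition open_su2 :: "su2 set \<Rightarrow> bool" where
  "open_su2 S \<longleftrightarrow> (\<forall>x\<in>S. \<forall>\<^sub>F (x', y) in uniformity. x' = x \<longrightarrow> y \<in> S)"

instance
proof
  fix x y z :: su2 and r s :: real and S :: "su2 set"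
  show "x + y + z = x + (y + z)" by transfer simp
  show "x + y = y + x" by transfer simp
  show "0 + x = x" by transfer simp
  show "- x + x = 0" by transfer simp
  show "x - y = x + - y" by transfer simp
  show "r *\<^sub>R (x + y) = r *\<^sub>R x + r *\<^sub>R y" by transfer (simp add: scaleR_add_right)
  show "(r + s) *\<^sub>R x = r *\<^sub>R x + s *\<^sub>R x" by transfer (simp add: scaleR_add_left)
  show "r *\<^sub>R s *\<^sub>R x = (r * s) *\<^sub>R x" by transfer simp
  show "1 *\<^sub>R x = x" by transfer simp
  show "dist x y = norm (x - y)" by (rule dist_su2_def)
  show "sgn x = inverse (norm x) *\<^sub>R x" by (rule sgn_su2_def)
  show "(uniformity :: (su2 \<times> su2) filter) = (INF e\<in>{0<..}. principal {(x, y). dist x y < e})"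
    by (rule uniformity_su2_def)
  show "open S \<longleftrightarrow> (\<forall>x\<in>S. \<forall>\<^sub>F (x', y) in uniformity. x' = x \<longrightarrow> y \<in> S)"
    by (rule open_su2_def)
  show "inner x y = inner y x" by transfer (rule inner_commute)
  show "inner (x + y) z = inner x z + inner y z" by transfer (rule inner_add_left)
  show "inner (r *\<^sub>R x) y = r * inner x y" by transfer simp
  show "0 \<le> inner x x" by transfer simp
  show "inner x x = 0 \<longleftrightarrow> x = 0" by transfer simp
  show "norm x = sqrt (inner x x)" by transfer (rule norm_eq_sqrt_inner)
qed

end

lift_definition su2_mk :: "real \<Rightarrow> real \<Rightarrow> real \<Rightarrow> su2" is
  "\<lambda>a b c. vector [vector [Complex 0 a, Complex b c], vector [Complex (- b) c, Complex 0 (- a)]]"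
  by (simp add: vec_eq_iff forall_2 trace_def sum_2 complex_eq_iff)

lemma su2_mk_surj: "\<exists>a b c. x = su2_mk a b c"
proof transfer
  fix A :: "complex^2^2"
  assume A: "herm A = - A \<and> trace A = 0"
  have "cnj (A $ j $ i) = - (A $ i $ j)" for i j
    using A by (metis herm_nth vector_uminus_component)
  then have "Re (A $ i $ j) = - Re (A $ j $ i)" "Im (A $ i $ j) = Im (A $ j $ i)" for i j
    by (metis complex_cnj_cancel_iff complex_cnj_minus cnj.simps(1) uminus_complex.simps(1) minus_minus,
        metis cnj.simps(2) uminus_complex.simps(2) neg_equal_iff_equal)
  from this(1)[of 1 1] this(1)[of 2 2] this(1)[of 2 1] this(2)[of 2 1]
  have "Re (A$1$1) = 0" "Re (A$2$2) = 0" "Re (A$2$1) = - Re (A$1$2)" "Im (A$2$1) = Im (A$1$2)"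
    by simp_all
  moreover have "Im (A$2$2) = - Im (A$1$1)"
    using arg_cong[where f = Im, OF conjunct2[OF A]] by (simp add: trace_def sum_2)
  ultimately have "A = vector [vector [Complex 0 (Im (A$1$1)), Complex (Re (A$1$2)) (Im (A$1$2))],
      vector [Complex (- Re (A$1$2)) (Im (A$1$2)), Complex 0 (- Im (A$1$1))]]"
    by (simp add: vec_eq_iff forall_2 complex_eq_iff)
  then show "\<exists>a b c. A = vector [vector [Complex 0 a, Complex b c],
      vector [Complex (- b) c, Complex 0 (- a)]]"
    by blast
qed

lemma inner_su2_mk: "inner (su2_mk a b c) (su2_mk a' b' c') = 2 * (a * a' + b * b' + c * c')"
  by transfer (simp add: inner_vec_def sum_2 inner_complex_def)

instantiation su2 :: euclidean_space
begin

definition Basis_su2 :: "su2 set" where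
  "Basis_su2 = {su2_mk (1 / sqrt 2) 0 0, su2_mk 0 (1 / sqrt 2) 0, su2_mk 0 0 (1 / sqrt 2)}"

instance
proof
  show "(Basis :: su2 set) \<noteq> {}" "finite (Basis :: su2 set)"
    by (simp_all add: Basis_su2_def)
  have ne: "su2_mk a b c \<noteq> su2_mk a' b' c'" if "a \<noteq> a' \<or> b \<noteq> b' \<or> c \<noteq> c'" for a b c a' b' c'
    using that by transfer (auto simp: vec_eq_iff forall_2 complex_eq_iff)
  fix u v x :: su2
  show "inner u v = (if u = v then 1 else 0)" if "u \<in> Basis" "v \<in> Basis"
    using that by (auto simp: Basis_su2_def inner_su2_mk ne)
  have zero: "su2_mk 0 0 0 = 0"
    by transfer (simp add: vec_eq_iff forall_2 complex_eq_iff)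
  obtain a b c where x: "x = su2_mk a b c"
    using su2_mk_surj by blast
  have "x = 0 \<longleftrightarrow> a = 0 \<and> b = 0 \<and> c = 0"
    unfolding x using zero ne[of a 0 b 0 c 0] by auto
  then show "(\<forall>u\<in>Basis. inner x u = 0) \<longleftrightarrow> x = 0"
    unfolding x by (simp add: Basis_su2_def inner_su2_mk)
qed

end

lift_definition lie_bracket :: "su2 \<Rightarrow> su2 \<Rightarrow> su2" is "\<lambda>A B. A ** B - B ** A"
proof -
  fix A B :: "complex^2^2"
  assume A: "herm A = - A \<and> trace A = 0" and B: "herm B = - B \<and> trace B = 0"
  have neg: "(- X) ** (- Y) = X ** Y" for X Y :: "complex^2^2"
    by (simp add: vec_eq_iff matrix_matrix_mult_def)
  have "herm (A ** B - B ** A) = herm (A ** B) - herm (B ** A)"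
    by (simp add: vec_eq_iff)
  then have "herm (A ** B - B ** A) = - (A ** B - B ** A)"
    using A B by (simp add: herm_mult neg)
  moreover have "trace (A ** B - B ** A) = 0"
    using trace_mul_sym[of A B] by (simp only: trace_sub diff_self)
  ultimately show "herm (A ** B - B ** A) = - (A ** B - B ** A) \<and> trace (A ** B - B ** A) = 0"
    by (rule conjI)
qed

definition Ad :: "complex^2^2 \<Rightarrow> su2 \<Rightarrow> su2" where
  "Ad U x = Abs_su2 (U ** Rep_su2 x ** herm U)"

lemma Rep_Ad:
  assumes "U \<in> SU2"
  shows "Rep_su2 (Ad U x) = U ** Rep_su2 x ** herm U"
proof -
  have x: "herm (Rep_su2 x) = - Rep_su2 x" "trace (Rep_su2 x) = 0"
    using Rep_su2[of x] by auto
  have "herm U ** U = mat 1"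
    using assms unfolding SU2_def by (blast intro: matrix_left_right_inverse[THEN iffD1])
  then have "trace (U ** Rep_su2 x ** herm U) = 0"
    using x(2) trace_mul_sym[of "U ** Rep_su2 x" "herm U"] by (simp add: matrix_mul_assoc)
  moreover have "U ** (- Rep_su2 x) ** herm U = - (U ** Rep_su2 x ** herm U)"
    by (simp add: vec_eq_iff matrix_matrix_mult_def sum_negf)
  then have "herm (U ** Rep_su2 x ** herm U) = - (U ** Rep_su2 x ** herm U)"
    by (simp add: herm_mult x(1) matrix_mul_assoc)
  ultimately show ?thesis
    unfolding Ad_def by (subst Abs_su2_inverse) auto
qed

definition Ad_invariant_inner_product :: "(su2 \<Rightarrow> su2 \<Rightarrow> real) \<Rightarrow> bool" where
  "Ad_invariant_inner_product ip \<longleftrightarrow>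
     bilinear ip \<and> (\<forall>x y. ip x y = ip y x) \<and> (\<forall>x. x \<noteq> 0 \<longrightarrow> 0 < ip x x) \<and>
     (\<forall>U\<in>SU2. \<forall>x y. ip (Ad U x) (Ad U y) = ip x y)"


section \<open>Sobolev spaces on the torus\<close>

text \<open>Functions on the torus are \<open>\<int>\<^sup>d\<close>-periodic functions on \<open>real^'n\<close>, and the
  torus integral is the integral over the unit cube. Sobolev functions are represented by
  periodic Borel functions; everything below depends on a representative only up to null sets, so
  that \<open>sobolev_norm\<close> is the norm of the class.\<close>

definition periodic :: "(real^'n \<Rightarrow> 'b) \<Rightarrow> bool" where
  "periodic f \<longleftrightarrow> (\<forall>x i. f (x + axis i 1) = f x)"

definition torus :: "(real^'n) measure" where
  "torus = restrict_space lborel (cbox 0 1)"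

definition partial :: "'n \<Rightarrow> (real^'n \<Rightarrow> real) \<Rightarrow> real^'n \<Rightarrow> real" where
  "partial i f x = frechet_derivative f (at x) (axis i 1)"

primrec Ck :: "nat \<Rightarrow> (real^'n \<Rightarrow> real) \<Rightarrow> bool" where
  "Ck 0 f \<longleftrightarrow> continuous_on UNIV f"
| "Ck (Suc k) f \<longleftrightarrow> f differentiable_on UNIV \<and> (\<forall>i. Ck k (partial i f))"

definition test_function :: "(real^'n \<Rightarrow> real) \<Rightarrow> bool" where
  "test_function \<phi> \<longleftrightarrow> periodic \<phi> \<and> (\<forall>k. Ck k \<phi>)"

definition Lp :: "real \<Rightarrow> (real^'n \<Rightarrow> 'b::euclidean_space) set" where
  "Lp p = {f. periodic f \<and> f \<in> borel_measurable borel \<and> integrable torus (\<lambda>x. norm (f x) powr p)}"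

definition weak_partial ::
    "'n \<Rightarrow> (real^'n \<Rightarrow> 'b::euclidean_space) \<Rightarrow> (real^'n \<Rightarrow> 'b) \<Rightarrow> bool" where
  "weak_partial i f g \<longleftrightarrow> (\<forall>\<phi>. test_function \<phi> \<longrightarrow>
     (LINT x|torus. partial i \<phi> x *\<^sub>R f x) = - (LINT x|torus. \<phi> x *\<^sub>R g x))"

text \<open>A representative of the weak partial derivative, if there is one (it is unique up to null
  sets).\<close>

definition wd :: "'n \<Rightarrow> (real^'n \<Rightarrow> 'b::euclidean_space) \<Rightarrow> real^'n \<Rightarrow> 'b" where
  "wd i f = (SOME g. g \<in> Lp 1 \<and> weak_partial i f g)"

definition W1p :: "real \<Rightarrow> (real^'n \<Rightarrow> 'b::euclidean_space) set" where
  "W1p p = {f \<in> Lp p. \<forall>i. \<exists>g\<in>Lp p. weak_partial i f g}"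

definition sobolev_norm :: "real \<Rightarrow> (real^'n \<Rightarrow> 'b::euclidean_space) \<Rightarrow> real" where
  "sobolev_norm p f =
     ((LINT x|torus. norm (f x) powr p) + (\<Sum>i\<in>UNIV. LINT x|torus. norm (wd i f x) powr p))
       powr (1 / p)"


section \<open>Forms with values in su(2)\<close>

text \<open>A one-form \<open>\<Sum>\<^sub>i a\<^sub>i dx\<^sub>i\<close> has values in \<open>su2^'n\<close>. A two-form \<open>\<omega>\<close> has values in
  \<open>su2^'n^'n\<close>, with \<open>\<omega> $ i $ j\<close> standing for \<open>\<omega>(\<partial>\<^sub>i, \<partial>\<^sub>j)\<close>; its pointwise norm is that of the
  coefficients of \<open>dx\<^sub>i \<and> dx\<^sub>j\<close> for \<open>i < j\<close>.\<close>

type_synonym 'n covec = "su2^'n"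
type_synonym 'n covec2 = "su2^'n^'n"
type_synonym 'n one_form = "real^'n \<Rightarrow> su2^'n"

definition inner1 :: "(su2 \<Rightarrow> su2 \<Rightarrow> real) \<Rightarrow> su2^'n \<Rightarrow> su2^'n \<Rightarrow> real" where
  "inner1 ip v w = (\<Sum>i\<in>UNIV. ip (v $ i) (w $ i))"

definition inner2 ::
    "(su2 \<Rightarrow> su2 \<Rightarrow> real) \<Rightarrow> ('n::{finite,linorder}) covec2 \<Rightarrow> 'n covec2 \<Rightarrow> real" where
  "inner2 ip v w = (\<Sum>(i, j) | i < j. ip (v $ i $ j) (w $ i $ j))"

definition ext_d :: "'n one_form \<Rightarrow> real^'n \<Rightarrow> su2^'n^'n" where
  "ext_d a x = (\<chi> i j. wd i a x $ j - wd j a x $ i)"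

definition codiff :: "'n one_form \<Rightarrow> real^'n \<Rightarrow> su2" where
  "codiff a x = - (\<Sum>i\<in>UNIV. wd i a x $ i)"

text \<open>\<open>[v \<and> w](X, Y) = [v(X), w(Y)] - [v(Y), w(X)]\<close>, so that \<open>1/2 [v \<and> v](X, Y) = [v(X), v(Y)]\<close>.\<close>

definition bracket_wedge :: "su2^'n \<Rightarrow> su2^'n \<Rightarrow> su2^'n^'n" where
  "bracket_wedge v w = (\<chi> i j. lie_bracket (v $ i) (w $ j) - lie_bracket (v $ j) (w $ i))"

definition curv :: "'n one_form \<Rightarrow> real^'n \<Rightarrow> su2^'n^'n" where
  "curv a x = ext_d a x + (1/2) *\<^sub>R bracket_wedge (a x) (a x)"

definition cov_d :: "'n one_form \<Rightarrow> 'n one_form \<Rightarrow> real^'n \<Rightarrow> su2^'n^'n" where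
  "cov_d a b x = ext_d b x + bracket_wedge (a x) (b x)"


section \<open>The gauge-fixed functional and its gradient map\<close>

definition energy :: "(su2 \<Rightarrow> su2 \<Rightarrow> real) \<Rightarrow> 'n::{finite,linorder} one_form \<Rightarrow> real" where
  "energy ip a =
     1/2 * (LINT x|torus. inner2 ip (curv a x) (curv a x)) +
     1/2 * (LINT x|torus. ip (codiff a x) (codiff a x))"

abbreviation conj_exp :: "real \<Rightarrow> real" where
  "conj_exp p \<equiv> p / (p - 1)"

text \<open>Elements of the dual \<open>Y\<close> of \<open>W1p (conj_exp p)\<close> are functionals, of which only the values on
  \<open>W1p (conj_exp p)\<close> matter.\<close>

definition Y_space :: "real \<Rightarrow> ('n::finite one_form \<Rightarrow> real) set" where
  "Y_space p = {L.
     (\<forall>a\<in>W1p (conj_exp p). \<forall>b\<in>W1p (conj_exp p). L (\<lambda>x. a x + b x) = L a + L b) \<and>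
     (\<forall>c. \<forall>b\<in>W1p (conj_exp p). L (\<lambda>x. c *\<^sub>R b x) = c * L b) \<and>
     (\<exists>B. \<forall>b\<in>W1p (conj_exp p). \<bar>L b\<bar> \<le> B * sobolev_norm (conj_exp p) b)}"

definition Y_norm :: "real \<Rightarrow> ('n::finite one_form \<Rightarrow> real) \<Rightarrow> real" where
  "Y_norm p L = (SUP b \<in> {b \<in> W1p (conj_exp p). sobolev_norm (conj_exp p) b \<le> 1}. \<bar>L b\<bar>)"

text \<open>\<open>gradient ip a b\<close> is the pairing of \<open>d\<^sub>a\<^sup>* F\<^sub>a + d d\<^sup>* a\<close> with \<open>b\<close>; both terms are only
  defined through the formal adjoints. Likewise for \<open>d\<^sup>* d + d d\<^sup>*\<close> below.\<close>

definition gradient ::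
    "(su2 \<Rightarrow> su2 \<Rightarrow> real) \<Rightarrow> 'n::{finite,linorder} one_form \<Rightarrow> 'n one_form \<Rightarrow> real" where
  "gradient ip a b =
     (LINT x|torus. inner2 ip (curv a x) (cov_d a b x)) +
     (LINT x|torus. ip (codiff a x) (codiff b x))"

definition hodge_laplacian ::
    "(su2 \<Rightarrow> su2 \<Rightarrow> real) \<Rightarrow> 'n::{finite,linorder} one_form \<Rightarrow> 'n one_form \<Rightarrow> real" where
  "hodge_laplacian ip a b =
     (LINT x|torus. inner2 ip (ext_d a x) (ext_d b x)) +
     (LINT x|torus. ip (codiff a x) (codiff b x))"


section \<open>Lyapunov--Schmidt reduction along the harmonic splitting\<close>

definition const_form :: "su2^'n \<Rightarrow> 'n one_form" where
  "const_form \<xi> = (\<lambda>x. \<xi>)"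

definition L2_pairing :: "(su2 \<Rightarrow> su2 \<Rightarrow> real) \<Rightarrow> 'n::finite one_form \<Rightarrow> 'n one_form \<Rightarrow> real" where
  "L2_pairing ip a b = (LINT x|torus. inner1 ip (a x) (b x))"

definition Z_space :: "real \<Rightarrow> (su2 \<Rightarrow> su2 \<Rightarrow> real) \<Rightarrow> 'n::finite one_form set" where
  "Z_space p ip = {z \<in> W1p p. \<forall>\<xi>. L2_pairing ip z (const_form \<xi>) = 0}"

definition in_Ran :: "real \<Rightarrow> (su2 \<Rightarrow> su2 \<Rightarrow> real) \<Rightarrow>
    ('n::{finite,linorder} one_form \<Rightarrow> real) \<Rightarrow> bool" where
  "in_Ran p ip L \<longleftrightarrow> (\<exists>a\<in>W1p p. \<forall>b\<in>W1p (conj_exp p). L b = hodge_laplacian ip a b)"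

definition in_K :: "real \<Rightarrow> (su2 \<Rightarrow> su2 \<Rightarrow> real) \<Rightarrow> ('n::finite one_form \<Rightarrow> real) \<Rightarrow> bool" where
  "in_K p ip L \<longleftrightarrow> (\<exists>\<xi>. \<forall>b\<in>W1p (conj_exp p). L b = L2_pairing ip (const_form \<xi>) b)"

text \<open>The graph of the projection \<open>R\<close> of \<open>Y\<close> onto the range of the Hodge Laplacian along the
  constant forms: \<open>proj_R p ip L r\<close> means \<open>R L = r\<close>.\<close>

definition proj_R :: "real \<Rightarrow> (su2 \<Rightarrow> su2 \<Rightarrow> real) \<Rightarrow>
    ('n::{finite,linorder} one_form \<Rightarrow> real) \<Rightarrow> ('n one_form \<Rightarrow> real) \<Rightarrow> bool" where
  "proj_R p ip L r \<longleftrightarrow> L \<in> Y_space p \<and> in_Ran p ip r \<and> in_K p ip (\<lambda>b. L b - r b)"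

text \<open>A map from constant forms to \<open>W1p p\<close> is real analytic near 0: it is given there by a power
  series in the coordinates of \<open>\<xi>\<close>, with coefficients \<open>c \<alpha>\<close> in \<open>W1p p\<close> indexed by the
  multi-indices \<open>\<alpha>\<close>, that converges in \<open>W1p p\<close>, absolutely on a polydisc of radius \<open>r\<close>.\<close>

definition analytic_germ :: "real \<Rightarrow> (su2^'n \<Rightarrow> 'n one_form) \<Rightarrow> bool" where
  "analytic_germ p \<psi> \<longleftrightarrow> (\<exists>(c :: (su2^'n \<Rightarrow> nat) \<Rightarrow> 'n one_form) r. 0 < r \<and>
     (\<forall>\<alpha>. c \<alpha> \<in> W1p p) \<and>
     (\<lambda>\<alpha>. sobolev_norm p (c \<alpha>) * r ^ (\<Sum>e\<in>Basis. \<alpha> e)) summable_on (Basis \<rightarrow>\<^sub>E UNIV) \<and>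
     (\<forall>\<xi>. norm \<xi> < r \<longrightarrow> \<psi> \<xi> \<in> W1p p \<and>
       ((\<lambda>S. sobolev_norm p
           (\<lambda>x. \<psi> \<xi> x - (\<Sum>\<alpha>\<in>S. (\<Prod>e\<in>Basis. (\<xi> \<bullet> e) ^ \<alpha> e) *\<^sub>R c \<alpha> x))) \<longlongrightarrow> 0)
         (finite_subsets_at_top (Basis \<rightarrow>\<^sub>E UNIV))))"

text \<open>\<open>\<psi>\<close> represents a Lyapunov--Schmidt correction: a real analytic germ
  \<open>(K, 0) \<rightarrow> (Z, 0)\<close> with \<open>R M(k + \<psi>(k)) = 0\<close>.\<close>

definition LS_correction ::
    "real \<Rightarrow> (su2 \<Rightarrow> su2 \<Rightarrow> real) \<Rightarrow> ('n::{finite,linorder} covec \<Rightarrow> 'n one_form) \<Rightarrow> bool" where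
  "LS_correction p ip \<psi> \<longleftrightarrow> analytic_germ p \<psi> \<and> (AE x in lborel. \<psi> 0 x = 0) \<and>
     (\<forall>\<^sub>F \<xi> in nhds 0. \<psi> \<xi> \<in> Z_space p ip \<and>
       proj_R p ip (gradient ip (\<lambda>x. const_form \<xi> x + \<psi> \<xi> x)) (\<lambda>b. 0))"

definition reduced_energy ::
    "(su2 \<Rightarrow> su2 \<Rightarrow> real) \<Rightarrow> ('n::{finite,linorder} covec \<Rightarrow> 'n one_form) \<Rightarrow> 'n covec \<Rightarrow> real" where
  "reduced_energy ip \<psi> \<xi> = energy ip (\<lambda>x. const_form \<xi> x + \<psi> \<xi> x)"


section \<open>The Lojasiewicz--Simon exponent\<close>

definition theta_LS ::
    "real \<Rightarrow> (su2 \<Rightarrow> su2 \<Rightarrow> real) \<Rightarrow> 'n::{finite,linorder} one_form \<Rightarrow> real" where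
  "theta_LS p ip a0 = Inf {\<theta>. 1/2 \<le> \<theta> \<and> \<theta> < 1 \<and> (\<exists>C>0. \<exists>\<delta>>0. \<forall>a\<in>W1p p.
     sobolev_norm p (\<lambda>x. a x - a0 x) < \<delta> \<longrightarrow>
       Y_norm p (gradient ip a) \<ge> C * \<bar>energy ip a - energy ip a0\<bar> powr \<theta>)}"

end

theory Submission
  imports Defs "HOL-Probability.Probability" "HOL-Real_Asymp.Real_Asymp"
begin

text \<open>A Sobolev function satisfies \<open>f (x + w) - f x = \<integral>\<^sub>0\<^sup>1 \<nabla>f (x + t w) \<bullet> w dt\<close> almost everywhere, as one
  sees by pairing with test functions; averaging over \<open>w\<close> in the unit cube gives the Poincare
  inequality and, for \<open>p > d\<close>, the embedding into bounded functions. Write \<open>a = k + z\<close> with \<open>k\<close> the mean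
  of \<open>a\<close> and let \<open>\<Gamma>\<close> be the energy on constant forms. By the Hodge identity, testing the gradient with
  \<open>z\<close> bounds it from below by a multiple of \<open>\<parallel>\<nabla>z\<parallel>\<close> in \<open>L\<^sup>2\<close>, and testing it with constants gives the
  derivative of \<open>\<Gamma>\<close> at \<open>k\<close> up to \<open>O(\<parallel>\<nabla>z\<parallel>\<^sup>2)\<close>. In particular \<open>z = 0\<close> solves the reduced equation, and the
  exponents are those of the quartic form \<open>\<Gamma>\<close>: it satisfies \<open>|\<nabla>\<Gamma> k| \<ge> c |k| sqrt (\<Gamma> k)\<close>, which gives the
  exponent \<open>1/2\<close> away from \<open>k = 0\<close> and \<open>3/4\<close> at \<open>k = 0\<close>, the latter being sharp by homogeneity.\<close>

section \<open>Integration on the torus\<close>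

text \<open>Everything is compared with the Dirichlet integral S of z. What makes this work is a
  cancellation: in the expansion of the gradient around a constant form, the terms linear in z or in
  its derivatives are paired with constants, and z has mean 0 while weak derivatives always
  integrate to 0. Only quadratic errors survive, and for small pointwise bounds on k and z the Hodge
  identity and the Poincare inequality absorb them. This pointwise smallness is where p > d enters.
  As the conjugate exponent is at most 2, z divided by a multiple of sqrt S lies in the unit ball of
  test forms. Of the projection R one consequence drives uniqueness: R L = 0 says that L is the
  pairing with a constant form, hence L kills every mean-free test form, in particular z itself. An
  Ad-invariant inner product on su(2) is a positive multiple of the Frobenius one, and rescaling it
  leaves the exponents unchanged, so the analysis is done for the Frobenius product. Weak
  derivatives are representatives picked by choice; therefore most identities between them hold
  almost everywhere only.\<close>

lemma space_torus: "space torus = cbox 0 1"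
  by (simp add: torus_def space_restrict_space)

lemma measurable_torus: "f \<in> borel_measurable borel \<Longrightarrow> f \<in> borel_measurable torus"
  unfolding torus_def by (intro measurable_restrict_space1) simp

lemma measurable_id_torus: "(\<lambda>x. x) \<in> borel_measurable torus"
  by (rule measurable_torus) simp

text \<open>A strict fundamental domain: it meets every orbit of the integer translations exactly
  once. The closed cube that carries \<open>torus\<close> differs from it by part of the boundary, a
  null set.\<close>

definition half_open_cube :: "(real^'n) set" where
  "half_open_cube = {x. \<forall>i. 0 \<le> x $ i \<and> x $ i < 1}"

lemma measurable_vec_nth [measurable]: "(\<lambda>x::real^'n. x $ i) \<in> borel_measurable borel"
  by (intro borel_measurable_continuous_onI continuous_intros)

lemma half_open_cube_measurable [measurable]: "half_open_cube \<in> sets borel"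
  unfolding half_open_cube_def by measurable

lemma emeasure_unit_cube: "emeasure lborel (cbox 0 1 :: (real^'n) set) = 1"
  by (subst emeasure_lborel_cbox)
    (auto simp: Basis_vec_def inner_axis intro!: prod.neutral)

lemma AE_half_open_cube: "AE x::real^'n in lborel. (x \<in> cbox 0 1) = (x \<in> half_open_cube)"
proof -
  have "cbox 0 1 - box 0 (1::real^'n) \<in> null_sets lborel"
    using negligible_frontier_interval[of 0 "1::real^'n"]
    by (simp add: negligible_iff_null_sets null_sets_completion_iff)
  then have "AE x in lborel. x \<notin> cbox 0 1 - box 0 (1::real^'n)"
    by (rule AE_not_in)
  then show ?thesis
    by eventually_elim
      (auto simp: half_open_cube_def mem_box_cart intro: less_imp_le)
qed

interpretation torus: prob_space "torus :: (real^'n) measure"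
  by (rule prob_spaceI) (simp add: torus_def emeasure_restrict_space space_restrict_space emeasure_unit_cube)

lemma nn_integral_torus: "(\<integral>\<^sup>+x. f x \<partial>torus) = (\<integral>\<^sup>+x. f x * indicator half_open_cube x \<partial>lborel)"
proof -
  have "(\<integral>\<^sup>+x. f x \<partial>torus) = (\<integral>\<^sup>+x. f x * indicator (cbox 0 1) x \<partial>lborel)"
    unfolding torus_def by (subst nn_integral_restrict_space) auto
  also have "\<dots> = (\<integral>\<^sup>+x. f x * indicator half_open_cube x \<partial>lborel)"
    using AE_half_open_cube
    by (intro nn_integral_cong_AE, eventually_elim) (auto simp: indicator_def)
  finally show ?thesis .
qed

section \<open>Integer translations and periodic functions\<close>

definition int_vecs :: "(real^'n) set" where
  "int_vecs = {k. \<forall>i. k $ i \<in> \<int>}"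

lemma countable_int_vecs: "countable (int_vecs :: (real^'n) set)"
proof -
  have "int_vecs \<subseteq> range (\<lambda>k :: int^'n. \<chi> i. real_of_int (k $ i))"
  proof
    fix x :: "real^'n" assume "x \<in> int_vecs"
    then have "x = (\<chi> i. real_of_int ((\<chi> i. \<lfloor>x $ i\<rfloor>) $ i))"
      by (simp add: int_vecs_def vec_eq_iff)
    then show "x \<in> range (\<lambda>k :: int^'n. \<chi> i. real_of_int (k $ i))"
      by blast
  qed
  then show ?thesis
    by (rule countable_subset) simp
qed

lemma uminus_int_vecs [simp]: "- k \<in> int_vecs \<longleftrightarrow> k \<in> int_vecs"
  by (simp add: int_vecs_def)

lemma periodic_int_vecs:
  fixes f :: "real^'n \<Rightarrow> 'b"
  assumes "periodic f" "k \<in> int_vecs"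
  shows "f (x + k) = f x"
proof -
  \<comment> \<open>Integer multiples of one axis vector, by induction in both directions; a general
    lattice vector is then reached by adding one axis after the other.\<close>
  have axis: "f (x + axis i (of_int m)) = f x" for x i m
  proof (induction m rule: int_induct[where k = 0])
    case (step1 m)
    have "axis i (of_int (m + 1)) = axis i (of_int m) + axis i (1::real)"
      by (simp add: vec_eq_iff axis_def)
    then show ?case
      using step1 assms(1) by (simp add: periodic_def flip: add.assoc)
  next
    case (step2 m)
    have "axis i (of_int (m - 1)) + axis i (1::real) = axis i (of_int m)"
      by (simp add: vec_eq_iff axis_def)
    then have "f (x + axis i (of_int m)) = f (x + axis i (of_int (m - 1)))"
      using assms(1) by (metis periodic_def add.assoc)
    with step2 show ?case
      by simp
  qed (simp add: axis_def vec_eq_iff[symmetric] zero_vec_def[symmetric])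
  have "f (x + (\<Sum>i\<in>I. axis i (of_int \<lfloor>k $ i\<rfloor>))) = f x" if "finite I" for I :: "'n set"
    using that
  proof (induction I)
    case (insert i I)
    have "f (x + (\<Sum>i\<in>insert i I. axis i (of_int \<lfloor>k $ i\<rfloor>)))
        = f ((x + (\<Sum>i\<in>I. axis i (of_int \<lfloor>k $ i\<rfloor>))) + axis i (of_int \<lfloor>k $ i\<rfloor>))"
      using insert by (simp add: algebra_simps)
    then show ?case
      using insert axis by simp
  qed simp
  moreover have "(\<Sum>i\<in>UNIV. axis i (of_int \<lfloor>k $ i\<rfloor>)) = k"
    using assms(2) by (simp add: int_vecs_def vec_eq_iff axis_def)
  ultimately show ?thesis
    by (metis finite)
qed

text \<open>A Borel retraction onto the half-open cube along the orbits. A periodic function does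
  not change under composition with it, which lets translations of the torus be expressed through
  image measures.\<close>

definition torus_rep :: "real^'n \<Rightarrow> real^'n" where
  "torus_rep x = (\<chi> i. frac (x $ i))"

lemma torus_rep_measurable [measurable]: "torus_rep \<in> borel_measurable borel"
  by (subst borel_measurable_euclidean_space) (auto simp: torus_rep_def Basis_vec_def inner_axis frac_def)

lemma torus_rep_in: "torus_rep x \<in> half_open_cube"
  by (simp add: torus_rep_def half_open_cube_def frac_lt_1)

lemma torus_rep_diff: "torus_rep x - x \<in> int_vecs"
  by (simp add: torus_rep_def int_vecs_def frac_def)

lemma periodic_torus_rep: "periodic f \<Longrightarrow> f (torus_rep x) = f x"
  using periodic_int_vecs[of f "torus_rep x - x" x] torus_rep_diff[of x] by simp

lemma torus_rep_periodic: "periodic torus_rep"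
  by (auto simp: periodic_def torus_rep_def vec_eq_iff axis_def frac_def)

lemma half_open_cube_unique:
  assumes "x \<in> half_open_cube" "y \<in> half_open_cube" "x - y \<in> int_vecs"
  shows "x = y"
proof -
  have "x $ i = y $ i" for i
  proof -
    have "\<bar>x $ i - y $ i\<bar> < 1" "x $ i - y $ i \<in> \<int>"
      using assms by (auto simp: half_open_cube_def int_vecs_def abs_if not_less intro: less_le_trans)
        (smt (verit))+
    then obtain z where "\<bar>of_int z :: real\<bar> < 1" "x $ i - y $ i = of_int z"
      by (metis Ints_cases)
    then show ?thesis
      by (simp flip: of_int_abs)
  qed
  then show ?thesis by (simp add: vec_eq_iff)
qed

text \<open>The translates of the half-open cube tile the space: by uniqueness of representatives,
  \<open>torus_rep x - x\<close> is the only integer vector that carries x into the cube.\<close>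

lemma half_open_cube_partition:
  "(\<integral>\<^sup>+k. indicator half_open_cube (x + k) \<partial>count_space int_vecs) = 1"
proof -
  let ?k = "torus_rep x - x"
  have "indicator half_open_cube (x + k) = (indicator {?k} k :: ennreal)" if "k \<in> int_vecs" for k
  proof (cases "x + k \<in> half_open_cube")
    case True
    have "x + k - torus_rep x \<in> int_vecs"
      using that torus_rep_diff[of x] by (simp add: int_vecs_def algebra_simps) (metis Ints_diff add_diff_cancel_left' diff_add_eq_diff_diff_swap diff_diff_eq2)
    then have "x + k = torus_rep x"
      using True torus_rep_in by (intro half_open_cube_unique)
    then show ?thesis
      using True by (simp add: algebra_simps)
  next
    case False
    then have "k \<noteq> ?k" using torus_rep_in[of x] by auto
    then show ?thesis using False by simp
  qed
  then have "(\<integral>\<^sup>+k. indicator half_open_cube (x + k) \<partial>count_space int_vecs)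
      = (\<integral>\<^sup>+k. indicator {?k} k \<partial>count_space int_vecs)"
    by (intro nn_integral_cong) auto
  also have "\<dots> = 1"
    using torus_rep_diff[of x] by (subst nn_integral_indicator) auto
  finally show ?thesis .
qed

lemma nn_integral_lborel_shift:
  fixes f :: "real^'n \<Rightarrow> ennreal"
  assumes [measurable]: "f \<in> borel_measurable borel"
  shows "(\<integral>\<^sup>+x. f (x + c) \<partial>lborel) = (\<integral>\<^sup>+x. f x \<partial>lborel)"
proof -
  have "(\<integral>\<^sup>+x. f x \<partial>lborel) = (\<integral>\<^sup>+x. f x \<partial>distr lborel borel ((+) c))"
    by (simp add: lborel_distr_plus)
  also have "\<dots> = (\<integral>\<^sup>+x. f (x + c) \<partial>lborel)"
    by (subst nn_integral_distr) (auto simp: add.commute)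
  finally show ?thesis ..
qed

text \<open>Unfolding: insert the tiling as a factor 1, exchange the countable sum with the
  integral, and translate each term back into the cube.\<close>

lemma nn_integral_lborel_eq_torus:
  fixes f :: "real^'n \<Rightarrow> ennreal"
  assumes [measurable]: "f \<in> borel_measurable borel"
  shows "(\<integral>\<^sup>+x. f x \<partial>lborel) = (\<integral>\<^sup>+x. (\<integral>\<^sup>+k. f (x - k) \<partial>count_space int_vecs) \<partial>torus)"
proof -
  have "(\<integral>\<^sup>+x. f x \<partial>lborel)
      = (\<integral>\<^sup>+x. (\<integral>\<^sup>+k. f x * indicator half_open_cube (x + k) \<partial>count_space int_vecs) \<partial>lborel)"
    by (simp add: nn_integral_cmult half_open_cube_partition)
  also have "\<dots> = (\<integral>\<^sup>+k. (\<integral>\<^sup>+x. f x * indicator half_open_cube (x + k) \<partial>lborel) \<partial>count_space int_vecs)"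
    by (intro nn_integral_count_space_nn_integral countable_int_vecs) measurable
  also have "\<dots> = (\<integral>\<^sup>+k. (\<integral>\<^sup>+x. f (x - k) * indicator half_open_cube x \<partial>lborel) \<partial>count_space int_vecs)"
  proof (rule nn_integral_cong)
    fix k :: "real^'n"
    show "(\<integral>\<^sup>+x. f x * indicator half_open_cube (x + k) \<partial>lborel)
        = (\<integral>\<^sup>+x. f (x - k) * indicator half_open_cube x \<partial>lborel)"
      by (subst nn_integral_lborel_shift[symmetric, where c = k])
        (auto intro!: nn_integral_lborel_shift[of "\<lambda>x. f (x - k) * indicator half_open_cube x" k, simplified])
  qed
  also have "\<dots> = (\<integral>\<^sup>+x. (\<integral>\<^sup>+k. f (x - k) * indicator half_open_cube x \<partial>count_space int_vecs) \<partial>lborel)"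
    by (intro nn_integral_count_space_nn_integral[symmetric] countable_int_vecs) measurable
  also have "\<dots> = (\<integral>\<^sup>+x. (\<integral>\<^sup>+k. f (x - k) \<partial>count_space int_vecs) \<partial>torus)"
    by (simp add: nn_integral_torus nn_integral_multc)
  finally show ?thesis .
qed

text \<open>Unfold the integral over the translated cube along the orbits. Periodicity takes f out
  of the sum, and what remains is the number of translates of the cube through one point, which is
  1.\<close>

lemma nn_integral_torus_shift:
  fixes f :: "real^'n \<Rightarrow> ennreal"
  assumes [measurable]: "f \<in> borel_measurable borel" and per: "periodic f"
  shows "(\<integral>\<^sup>+x. f (x + y) \<partial>torus) = (\<integral>\<^sup>+x. f x \<partial>torus)"
proof -
  have "(\<integral>\<^sup>+x. f (x + y) \<partial>torus) = (\<integral>\<^sup>+x. f (x + y) * indicator half_open_cube x \<partial>lborel)"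
    by (rule nn_integral_torus)
  also have "\<dots> = (\<integral>\<^sup>+x. f x * indicator half_open_cube (x - y) \<partial>lborel)"
    using nn_integral_lborel_shift[of "\<lambda>x. f x * indicator half_open_cube (x - y)" y] by simp
  also have "\<dots> = (\<integral>\<^sup>+x. (\<integral>\<^sup>+k. f (x - k) * indicator half_open_cube (x - k - y) \<partial>count_space int_vecs) \<partial>torus)"
    by (rule nn_integral_lborel_eq_torus) measurable
  also have "\<dots> = (\<integral>\<^sup>+x. (\<integral>\<^sup>+k. f x * indicator half_open_cube (x - y + - k) \<partial>count_space int_vecs) \<partial>torus)"
  proof (intro nn_integral_cong)
    fix x k :: "real^'n" assume "k \<in> space (count_space int_vecs)"
    then show "f (x - k) * indicator half_open_cube (x - k - y) = f x * indicator half_open_cube (x - y + - k)"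
      using periodic_int_vecs[OF per, of "- k" x] by (simp add: algebra_simps)
  qed
  also have "\<dots> = (\<integral>\<^sup>+x. f x * (\<integral>\<^sup>+k. indicator half_open_cube (x - y + - k) \<partial>count_space int_vecs) \<partial>torus)"
    by (simp add: nn_integral_cmult)
  also have "\<dots> = (\<integral>\<^sup>+x. f x * (\<integral>\<^sup>+k. indicator half_open_cube (x - y + k) \<partial>count_space int_vecs) \<partial>torus)"
  proof -
    \<comment> \<open>The unfolded sum runs over x - y - k, the tiling identity over x - y + k;
      reflection of the lattice matches them.\<close>
    have "bij_betw uminus int_vecs (int_vecs :: (real^'n) set)"
      by (rule bij_betw_byWitness[where f' = uminus]) auto
    from nn_integral_bij_count_space[OF this, of "\<lambda>k. indicator half_open_cube (x - y + k)" for x]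
    show ?thesis
      by simp
  qed
  finally show ?thesis
    by (simp add: half_open_cube_partition)
qed

section \<open>Translation invariance of vector-valued integrals\<close>

lemma periodic_comp: "periodic f \<Longrightarrow> periodic (\<lambda>x. h (f x))"
  by (simp add: periodic_def)

lemma periodic_comp2: "periodic f \<Longrightarrow> periodic g \<Longrightarrow> periodic (\<lambda>x. h (f x) (g x))"
  by (simp add: periodic_def)

lemma periodic_const: "periodic (\<lambda>x. c)"
  by (simp add: periodic_def)

lemma periodic_shift: "periodic f \<Longrightarrow> periodic (\<lambda>x. f (x + y))"
  unfolding periodic_def by (metis add.assoc add.commute)

lemma torus_rep_shift_measurable: "(\<lambda>x. torus_rep (x + y)) \<in> borel_measurable torus"
  by (rule measurable_torus) measurable

text \<open>Invariance for nonnegative functions, restated as an equality of image measures. In this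
  form integrability and integrals of vector-valued periodic functions transfer at once.\<close>

lemma distr_torus_shift: "distr torus borel (\<lambda>x. torus_rep (x + y)) = distr torus borel torus_rep"
proof (rule measure_eqI)
  fix A :: "(real^'a) set" assume "A \<in> sets (distr torus borel (\<lambda>x. torus_rep (x + y)))"
  then have [measurable]: "A \<in> sets borel" by simp
  have "emeasure (distr torus borel (\<lambda>x. torus_rep (x + y))) A
      = (\<integral>\<^sup>+x. indicator A x \<partial>distr torus borel (\<lambda>x. torus_rep (x + y)))"
    by simp
  also have "\<dots> = (\<integral>\<^sup>+x. indicator A (torus_rep (x + y)) \<partial>torus)"
    by (subst nn_integral_distr) (auto intro: torus_rep_shift_measurable)
  also have "\<dots> = (\<integral>\<^sup>+x. indicator A (torus_rep x) \<partial>torus)"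
    by (rule nn_integral_torus_shift) (auto intro: periodic_comp torus_rep_periodic)
  also have "\<dots> = (\<integral>\<^sup>+x. indicator A x \<partial>distr torus borel torus_rep)"
    using torus_rep_shift_measurable[of 0] by (subst nn_integral_distr) auto
  finally show "emeasure (distr torus borel (\<lambda>x. torus_rep (x + y))) A = emeasure (distr torus borel torus_rep) A"
    by simp
qed simp

lemma
  fixes f :: "real^'n \<Rightarrow> 'b::euclidean_space"
  assumes [measurable]: "f \<in> borel_measurable borel" and per: "periodic f"
  shows integrable_torus_shift: "integrable torus (\<lambda>x. f (x + y)) \<longleftrightarrow> integrable torus f"
    and integral_torus_shift: "(LINT x|torus. f (x + y)) = (LINT x|torus. f x)"
proof -
  have "integrable torus (\<lambda>x. f (torus_rep (x + y))) \<longleftrightarrow> integrable (distr torus borel (\<lambda>x. torus_rep (x + y))) f" for y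
    by (simp add: integrable_distr_eq torus_rep_shift_measurable)
  from this[of y] this[of 0] show "integrable torus (\<lambda>x. f (x + y)) \<longleftrightarrow> integrable torus f"
    by (simp add: distr_torus_shift periodic_torus_rep[OF per])
  have "(LINT x|torus. f (torus_rep (x + y))) = (LINT x|distr torus borel (\<lambda>x. torus_rep (x + y)). f x)" for y
    by (simp add: integral_distr torus_rep_shift_measurable)
  from this[of y] this[of 0] show "(LINT x|torus. f (x + y)) = (LINT x|torus. f x)"
    by (simp add: distr_torus_shift periodic_torus_rep[OF per])
qed

text \<open>The exceptional set is a union of orbits, so unfolding computes its Lebesgue measure as
  an integral over the torus of a count that vanishes for almost every orbit.\<close>

lemma AE_torus_imp_lborel:
  fixes P :: "real^'n \<Rightarrow> bool"
  assumes "AE x in torus. P x" and [measurable]: "Measurable.pred borel P" and per: "periodic P"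
  shows "AE x in lborel. P x"
proof -
  have "(\<integral>\<^sup>+x. indicator {x. \<not> P x} x \<partial>lborel)
      = (\<integral>\<^sup>+x. (\<integral>\<^sup>+k. indicator {x. \<not> P x} (x - k) \<partial>count_space int_vecs) \<partial>torus)"
    by (rule nn_integral_lborel_eq_torus) measurable
  also have "\<dots> = (\<integral>\<^sup>+(x::real^'n). 0 \<partial>torus)"
  proof (rule nn_integral_cong_AE)
    show "AE x in torus. (\<integral>\<^sup>+k. indicator {x. \<not> P x} (x - k) \<partial>count_space int_vecs) = 0"
      using assms(1)
    proof eventually_elim
      case (elim x)
      have "P (x - k)" if "k \<in> int_vecs" for k
        using periodic_int_vecs[OF per, of "- k" x] that elim by simp
      then have "(\<integral>\<^sup>+k. indicator {x. \<not> P x} (x - k) \<partial>count_space int_vecs) = (\<integral>\<^sup>+k. 0 \<partial>count_space (int_vecs :: (real^'n) set))"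
        by (intro nn_integral_cong) simp
      then show ?case by simp
    qed
  qed
  finally have "emeasure lborel {x. \<not> P x} = 0"
    by simp
  then show ?thesis
    by (intro AE_I[where N = "{x. \<not> P x}"]) auto
qed

lemma AE_lborel_imp_torus: "AE x in lborel. P x \<Longrightarrow> AE x in torus. P x"
  unfolding torus_def by (subst AE_restrict_space_iff) auto

section \<open>Test functions\<close>

lemma partial_eq:
  "(f has_derivative f') (at x) \<Longrightarrow> partial i f x = f' (axis i 1)"
  by (simp add: partial_def frechet_derivative_at[symmetric])

lemma Ck_imp_continuous_on: "Ck k f \<Longrightarrow> continuous_on UNIV f"
  by (cases k) (auto intro: differentiable_imp_continuous_on)

lemma Ck_Suc_imp_has_derivative:
  assumes "Ck (Suc k) f"
  shows "(f has_derivative frechet_derivative f (at x)) (at x)"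
  using assms by (auto simp: differentiable_on_def frechet_derivative_works)

lemma Ck_Suc_mono: "Ck (Suc k) f \<Longrightarrow> Ck k f"
proof (induction k arbitrary: f)
  case 0
  then show ?case using Ck_imp_continuous_on[of "Suc 0" f] by simp
next
  case (Suc k)
  then have "f differentiable_on UNIV" "\<And>i. Ck (Suc k) (partial i f)"
    by simp_all
  with Suc.IH show ?case by simp
qed

text \<open>\<open>Ck\<close> recurses through \<open>partial\<close>, which goes back to a chosen
  derivative. This rule lets explicit formulas for the total derivative be used in the inductions
  below.\<close>

lemma Ck_SucI:
  assumes "\<And>x. (f has_derivative f' x) (at x)" "\<And>i. Ck k (\<lambda>x. f' x (axis i 1))"
  shows "Ck (Suc k) f"
proof -
  have "partial i f = (\<lambda>x. f' x (axis i 1))" for i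
    using partial_eq[OF assms(1)] by (rule ext)
  then show ?thesis
    using assms by (auto simp: differentiable_on_def differentiable_def)
qed

lemma Ck_const: "Ck k (\<lambda>x. c)"
proof (induction k arbitrary: c)
  case (Suc k)
  show ?case
    by (rule Ck_SucI[where f' = "\<lambda>x y. 0"]) (auto intro: Suc)
qed (simp add: continuous_on_const)

lemma Ck_add:
  assumes "Ck k f" "Ck k g"
  shows "Ck k (\<lambda>x. f x + g x)"
  using assms
proof (induction k arbitrary: f g)
  case (Suc k)
  show ?case
  proof (rule Ck_SucI)
    show "((\<lambda>x. f x + g x) has_derivative
        (\<lambda>y. frechet_derivative f (at x) y + frechet_derivative g (at x) y)) (at x)" for x
      by (intro has_derivative_add Ck_Suc_imp_has_derivative[OF Suc.prems(1)] Ck_Suc_imp_has_derivative[OF Suc.prems(2)])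
    show "Ck k (\<lambda>x. frechet_derivative f (at x) (axis i 1) + frechet_derivative g (at x) (axis i 1))" for i
      using Suc.prems Suc.IH[of "partial i f" "partial i g"] by (simp add: partial_def[abs_def])
  qed
qed (simp add: continuous_on_add)

lemma Ck_mult:
  assumes "Ck k f" "Ck k g"
  shows "Ck k (\<lambda>x. f x * g x)"
  using assms
proof (induction k arbitrary: f g)
  case (Suc k)
  show ?case
  proof (rule Ck_SucI)
    show "((\<lambda>x. f x * g x) has_derivative
        (\<lambda>y. f x * frechet_derivative g (at x) y + frechet_derivative f (at x) y * g x)) (at x)" for x
      by (intro has_derivative_mult Ck_Suc_imp_has_derivative[OF Suc.prems(1)] Ck_Suc_imp_has_derivative[OF Suc.prems(2)])
    have "Ck k (\<lambda>x. f x * partial i g x)" "Ck k (\<lambda>x. partial i f x * g x)" for i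
      using Suc.prems by (auto intro!: Suc.IH intro: Ck_Suc_mono)
    then show "Ck k (\<lambda>x. f x * frechet_derivative g (at x) (axis i 1)
        + frechet_derivative f (at x) (axis i 1) * g x)" for i
      unfolding partial_def by (intro Ck_add)
  qed
qed (simp add: continuous_on_mult)

lemma Ck_exp:
  assumes "Ck k f"
  shows "Ck k (\<lambda>x. exp (f x))"
  using assms
proof (induction k arbitrary: f)
  case (Suc k)
  show ?case
  proof (rule Ck_SucI)
    show "((\<lambda>x. exp (f x)) has_derivative
        (\<lambda>y. exp (f x) * frechet_derivative f (at x) y)) (at x)" for x
      using Ck_Suc_imp_has_derivative[OF Suc.prems, of x]
      by (auto intro!: derivative_eq_intros)
    have "Ck k (\<lambda>x. exp (f x) * partial i f x)" for i
      using Suc.prems by (auto intro!: Ck_mult Suc.IH intro: Ck_Suc_mono)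
    then show "Ck k (\<lambda>x. exp (f x) * frechet_derivative f (at x) (axis i 1))" for i
      by (simp add: partial_def)
  qed
qed (simp add: continuous_on_exp)

text \<open>The phase is general because differentiating the sine only shifts it by a quarter
  period: up to constant factors the family is closed under derivatives.\<close>

lemma Ck_sin: "Ck k (\<lambda>x. sin (\<alpha> * x $ j + \<beta>))"
proof (induction k arbitrary: \<beta>)
  case 0
  show ?case by (auto intro!: continuous_intros)
next
  case (Suc k)
  show ?case
  proof (rule Ck_SucI)
    show "((\<lambda>x. sin (\<alpha> * x $ j + \<beta>)) has_derivative
        (\<lambda>y. sin (\<alpha> * x $ j + (\<beta> + pi / 2)) * (\<alpha> * y $ j))) (at x)" for x
      using bounded_linear_imp_has_derivative[OF bounded_linear_vec_nth, of j "at x"]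
      by (auto intro!: derivative_eq_intros simp: sin_add cos_add algebra_simps)
    show "Ck k (\<lambda>x. sin (\<alpha> * x $ j + (\<beta> + pi / 2)) * (\<alpha> * axis i 1 $ j))" for i
      by (intro Ck_mult Suc.IH Ck_const)
  qed
qed

lemma Ck_sum: "finite I \<Longrightarrow> (\<And>i. i \<in> I \<Longrightarrow> Ck k (f i)) \<Longrightarrow> Ck k (\<lambda>x. \<Sum>i\<in>I. f i x)"
  by (induction I rule: finite_induct) (auto intro: Ck_add Ck_const)

lemma Ck_shift:
  assumes "Ck k f"
  shows "Ck k (\<lambda>x. f (x + y))"
  using assms
proof (induction k arbitrary: f)
  case 0
  then show ?case
    by (auto intro!: continuous_on_compose2[of UNIV f] continuous_intros)
next
  case (Suc k)
  show ?case
  proof (rule Ck_SucI)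
    have "((\<lambda>x. x + y) has_derivative (\<lambda>z. z)) (at x)" for x
      by (auto intro!: derivative_eq_intros)
    then show "((\<lambda>x. f (x + y)) has_derivative frechet_derivative f (at (x + y))) (at x)" for x
      using has_derivative_compose[of "\<lambda>x. x + y" "\<lambda>z. z" x UNIV f, OF _ Ck_Suc_imp_has_derivative[OF Suc.prems]]
      by simp
    show "Ck k (\<lambda>x. frechet_derivative f (at (x + y)) (axis i 1))" for i
      using Suc.prems Suc.IH[of "partial i f"] by (simp add: partial_def[abs_def])
  qed
qed

lemma partial_shift:
  assumes "test_function \<phi>"
  shows "partial i (\<lambda>x. \<phi> (x + y)) x = partial i \<phi> (x + y)"
proof -
  have "(\<phi> has_derivative frechet_derivative \<phi> (at (x + y))) (at (x + y))"
    using assms by (intro Ck_Suc_imp_has_derivative) (auto simp: test_function_def)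
  moreover have "((\<lambda>x. x + y) has_derivative (\<lambda>z. z)) (at x)"
    by (auto intro!: derivative_eq_intros)
  ultimately have "((\<lambda>x. \<phi> (x + y)) has_derivative frechet_derivative \<phi> (at (x + y))) (at x)"
    using has_derivative_compose[of "\<lambda>x. x + y" "\<lambda>z. z" x UNIV \<phi>] by simp
  from partial_eq[OF this] show ?thesis
    by (simp add: partial_def)
qed

lemma test_function_shift: "test_function \<phi> \<Longrightarrow> test_function (\<lambda>x. \<phi> (x + y))"
  by (auto simp: test_function_def intro: periodic_shift Ck_shift)

lemma test_function_partial:
  assumes "test_function \<phi>"
  shows "test_function (partial i \<phi>)"
proof -
  have "Ck k (partial i \<phi>)" for k
    using assms by (metis test_function_def Ck.simps(2))
  moreover have "partial i \<phi> (x + axis j 1) = partial i \<phi> x" for x j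
  proof -
    have "(\<lambda>x. \<phi> (x + axis j 1)) = \<phi>"
      using assms by (auto simp: test_function_def periodic_def)
    with partial_shift[OF assms, of i "axis j 1" x] show ?thesis by simp
  qed
  ultimately show ?thesis
    by (simp add: test_function_def periodic_def)
qed

lemma test_function_continuous: "test_function \<phi> \<Longrightarrow> continuous_on UNIV \<phi>"
  by (auto simp: test_function_def intro: Ck_imp_continuous_on)

lemma test_function_measurable: "test_function \<phi> \<Longrightarrow> \<phi> \<in> borel_measurable borel"
  by (intro borel_measurable_continuous_onI test_function_continuous)

lemma test_function_bounded:
  assumes "test_function \<phi>"
  obtains B where "0 < B" "\<And>x. \<bar>\<phi> x\<bar> \<le> B"
proof -
  have "compact (\<phi> ` cbox 0 1)"
    using assms by (intro compact_continuous_image compact_cbox continuous_on_subset[OF test_function_continuous]) auto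
  then obtain B where "0 < B" and B: "\<And>x. x \<in> cbox 0 1 \<Longrightarrow> \<bar>\<phi> x\<bar> \<le> B"
    by (auto dest!: compact_imp_bounded simp: bounded_pos)
  have "\<bar>\<phi> x\<bar> \<le> B" for x
  proof -
    have "torus_rep x \<in> cbox 0 1"
      using torus_rep_in[of x] by (auto simp: half_open_cube_def mem_box_cart intro: less_imp_le)
    then show ?thesis
      using B[of "torus_rep x"] periodic_torus_rep[of \<phi> x] assms by (auto simp: test_function_def)
  qed
  with \<open>0 < B\<close> show ?thesis by (rule that)
qed

lemma test_function_const: "test_function (\<lambda>x. c)"
  by (simp add: test_function_def Ck_const periodic_const)

lemma partial_const [simp]: "partial i (\<lambda>x. c) x = 0"
  by (simp add: partial_def frechet_derivative_const)

lemma test_function_has_derivative: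
  assumes "test_function \<phi>"
  shows "(\<phi> has_derivative (\<lambda>y. \<Sum>i\<in>UNIV. y $ i * partial i \<phi> x)) (at x)"
proof -
  have D: "(\<phi> has_derivative frechet_derivative \<phi> (at x)) (at x)"
    using assms by (intro Ck_Suc_imp_has_derivative) (auto simp: test_function_def)
  then have lin: "linear (frechet_derivative \<phi> (at x))"
    by (rule has_derivative_linear)
  have "frechet_derivative \<phi> (at x) y = (\<Sum>i\<in>UNIV. y $ i * partial i \<phi> x)" for y
  proof -
    have "y = (\<Sum>i\<in>UNIV. y $ i *\<^sub>R axis i 1)"
      by (rule basis_expansion[of y, unfolded scalar_mult_eq_scaleR, symmetric])
    then have "frechet_derivative \<phi> (at x) y = frechet_derivative \<phi> (at x) (\<Sum>i\<in>UNIV. y $ i *\<^sub>R axis i 1)"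
      by (rule arg_cong)
    also have "\<dots> = (\<Sum>i\<in>UNIV. y $ i * partial i \<phi> x)"
      by (simp only: linear_sum[OF lin] linear_scale[OF lin] partial_def real_scaleR_def)
    finally show ?thesis .
  qed
  then have "frechet_derivative \<phi> (at x) = (\<lambda>y. \<Sum>i\<in>UNIV. y $ i * partial i \<phi> x)"
    by (rule ext)
  with D show ?thesis by simp
qed

section \<open>The fundamental theorem of calculus for test functions\<close>

definition unit_interval :: "real measure" where
  "unit_interval = restrict_space lborel {0..1}"

interpretation unit_interval: prob_space unit_interval
  by (rule prob_spaceI) (simp add: unit_interval_def emeasure_restrict_space space_restrict_space)

lemma measurable_unit_interval: "f \<in> borel_measurable borel \<Longrightarrow> f \<in> borel_measurable unit_interval"
  unfolding unit_interval_def by (intro measurable_restrict_space1) simp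

lemma test_function_FTC:
  assumes "test_function \<phi>"
  shows "\<phi> (x + w) - \<phi> x = (LINT t|unit_interval. (\<Sum>i\<in>UNIV. w $ i * partial i \<phi> (x + t *\<^sub>R w)))"
proof -
  have "(LINT t|unit_interval. (\<Sum>i\<in>UNIV. w $ i * partial i \<phi> (x + t *\<^sub>R w)))
      = (LINT t|lborel. indicator {0..1} t *\<^sub>R (\<Sum>i\<in>UNIV. w $ i * partial i \<phi> (x + t *\<^sub>R w)))"
    unfolding unit_interval_def by (rule integral_restrict_space) simp
  also have "\<dots> = \<phi> (x + 1 *\<^sub>R w) - \<phi> (x + 0 *\<^sub>R w)"
  proof (rule integral_FTC_atLeastAtMost)
    fix t :: real
    have D: "((\<lambda>t. x + t *\<^sub>R w) has_derivative (\<lambda>s. s *\<^sub>R w)) (at t within {0..1})"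
      by (auto intro!: derivative_eq_intros)
    show "((\<lambda>t. \<phi> (x + t *\<^sub>R w)) has_vector_derivative (\<Sum>i\<in>UNIV. w $ i * partial i \<phi> (x + t *\<^sub>R w)))
        (at t within {0..1})"
      unfolding has_vector_derivative_def
      using has_derivative_compose[of "\<lambda>t. x + t *\<^sub>R w" "\<lambda>s. s *\<^sub>R w" t "{0..1}" \<phi>, OF _ test_function_has_derivative[OF assms]] D
      by (simp add: sum_distrib_left mult.assoc)
    show "continuous_on {0..1} (\<lambda>t. \<Sum>i\<in>UNIV. w $ i * partial i \<phi> (x + t *\<^sub>R w))"
      by (intro continuous_intros continuous_on_compose2[OF test_function_continuous[OF test_function_partial[OF assms]]]) auto
  qed simp
  finally show ?thesis by simp
qed

subsection \<open>Test functions separate integrable functions\<close>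

text \<open>The product of the two sines has period 1 in each variable and, on the unit cube, is positive
  exactly on the box, so that \<open>box_bump a b N\<close> tends to the indicator of the box as \<open>N \<rightarrow> \<infinity>\<close>.\<close>

definition box_bump :: "real^'n \<Rightarrow> real^'n \<Rightarrow> real \<Rightarrow> real^'n \<Rightarrow> real" where
  "box_bump a b N x = exp (- (\<Sum>i\<in>UNIV. N * exp (- N * (sin (pi * (x $ i - a $ i)) * sin (pi * (b $ i - x $ i))))))"

lemma test_function_box_bump: "test_function (box_bump a b N)"
proof -
  have "Ck k (box_bump a b N)" for k
  proof -
    have "Ck k (\<lambda>x. exp (- 1 * (\<Sum>i\<in>UNIV. N * exp (- N * (sin (pi * x $ i + (- pi * a $ i)) * sin (- pi * x $ i + pi * b $ i))))))"
      by (intro Ck_exp Ck_mult Ck_const Ck_sum Ck_sin) auto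
    then show ?thesis
      by (simp add: box_bump_def[abs_def] algebra_simps)
  qed
  moreover have "sin (pi * (x $ i + axis j 1 $ i - a $ i)) * sin (pi * (b $ i - (x $ i + axis j 1 $ i)))
      = sin (pi * (x $ i - a $ i)) * sin (pi * (b $ i - x $ i))" for x i j
    by (cases "i = j") (auto simp: axis_def algebra_simps sin_diff sin_add cos_diff cos_add)
  then have "box_bump a b N (x + axis j 1) = box_bump a b N x" for x j
    by (simp add: box_bump_def)
  ultimately show ?thesis
    by (simp add: test_function_def periodic_def)
qed

lemma box_bump_bounds: "0 \<le> N \<Longrightarrow> 0 \<le> box_bump a b N x" "0 \<le> N \<Longrightarrow> box_bump a b N x \<le> 1"
  by (simp_all add: box_bump_def sum_nonneg)

text \<open>Both arguments u = x - a and u = b - x lie in [-1, 1], where sin (pi u) vanishes or has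
  the sign of u. Outside the open interval exactly one of the two is nonpositive, so the product of
  the sines is not positive.\<close>

lemma sin_product_pos_iff:
  assumes "0 \<le> a" "a < b" "b \<le> 1" "0 \<le> x" "x \<le> (1::real)"
  shows "0 < sin (pi * (x - a)) * sin (pi * (b - x)) \<longleftrightarrow> a < x \<and> x < b"
proof -
  have pos: "0 \<le> sin (pi * u)" if "0 \<le> u" "u \<le> 1" for u
    using that by (intro sin_ge_zero) (auto simp: mult_left_le)
  have pos': "0 < sin (pi * u)" if "0 < u" "u < 1" for u
    using that by (intro sin_gt_zero) auto
  consider "x \<le> a" | "b \<le> x" | "a < x" "x < b" by linarith
  then show ?thesis
  proof cases
    case 1
    have "0 \<le> sin (pi * (a - x))" "0 \<le> sin (pi * (b - x))"
      using 1 assms by (auto intro!: pos)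
    moreover have "sin (pi * (x - a)) = - sin (pi * (a - x))"
      by (simp add: algebra_simps flip: sin_minus)
    ultimately have "sin (pi * (x - a)) * sin (pi * (b - x)) \<le> 0"
      by (simp add: mult_nonneg_nonneg)
    then show ?thesis using 1 by auto
  next
    case 2
    have "0 \<le> sin (pi * (x - a))" "0 \<le> sin (pi * (x - b))"
      using 2 assms by (auto intro!: pos)
    moreover have "sin (pi * (b - x)) = - sin (pi * (x - b))"
      by (simp add: algebra_simps flip: sin_minus)
    ultimately have "sin (pi * (x - a)) * sin (pi * (b - x)) \<le> 0"
      by (simp add: mult_nonneg_nonneg)
    then show ?thesis using 2 by auto
  next
    case 3
    then show ?thesis using assms by (auto intro!: mult_pos_pos pos')
  qed
qed

text \<open>N exp (- N h) tends to 0 if h > 0 and is at least N if h <= 0. So the sum in the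
  exponent tends to 0 inside the box, while outside a single bad coordinate makes it
  diverge.\<close>

lemma box_bump_tendsto:
  fixes a b x :: "real^'n"
  assumes "\<And>i. 0 \<le> a $ i" "\<And>i. a $ i < b $ i" "\<And>i. b $ i \<le> 1" "x \<in> cbox 0 1"
  shows "(\<lambda>N. box_bump a b (real N) x) \<longlonglongrightarrow> indicator (box a b) x"
proof -
  define h where "h i = sin (pi * (x $ i - a $ i)) * sin (pi * (b $ i - x $ i))" for i
  have h: "0 < h i \<longleftrightarrow> a $ i < x $ i \<and> x $ i < b $ i" for i
    unfolding h_def using assms by (intro sin_product_pos_iff) (auto simp: mem_box_cart)
  have pos: "((\<lambda>N. real N * exp (- real N * c)) \<longlonglongrightarrow> 0)" if "0 < c" for c
    using that by real_asymp
  show ?thesis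
  proof (cases "x \<in> box a b")
    case True
    then have "0 < h i" for i by (simp add: h mem_box_cart)
    then have "(\<lambda>N. exp (- (\<Sum>i\<in>UNIV. real N * exp (- real N * h i)))) \<longlonglongrightarrow> exp (- (\<Sum>i\<in>(UNIV::'n set). 0))"
      by (intro tendsto_intros pos)
    then show ?thesis using True by (simp add: box_bump_def h_def)
  next
    case False
    then obtain i where i: "h i \<le> 0" by (auto simp: h mem_box_cart not_less[symmetric])
    have "(\<lambda>N. box_bump a b (real N) x) \<longlonglongrightarrow> 0"
    proof (rule tendsto_sandwich)
      show "\<forall>\<^sub>F N in sequentially. 0 \<le> box_bump a b (real N) x"
        by (simp add: box_bump_bounds)
      show "\<forall>\<^sub>F N in sequentially. box_bump a b (real N) x \<le> exp (- real N)"
      proof (intro always_eventually allI)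
        fix N
        have "real N \<le> real N * exp (- real N * h i)"
          using i by (simp add: mult_le_cancel_left1 mult_nonneg_nonpos)
        also have "\<dots> \<le> (\<Sum>i\<in>UNIV. real N * exp (- real N * h i))"
          by (rule member_le_sum) auto
        finally show "box_bump a b (real N) x \<le> exp (- real N)"
          by (simp add: box_bump_def h_def)
      qed
      show "(\<lambda>N. exp (- real N)) \<longlonglongrightarrow> 0" by real_asymp
    qed simp
    then show ?thesis using False by simp
  qed
qed

lemma AE_torus_interior: "AE x::real^'n in torus. x \<in> box 0 1"
proof -
  have "cbox 0 1 - box 0 (1::real^'n) \<in> null_sets lborel"
    using negligible_frontier_interval[of 0 "1::real^'n"]
    by (simp add: negligible_iff_null_sets null_sets_completion_iff)
  then have "AE x in lborel. x \<notin> cbox 0 1 - box 0 (1::real^'n)"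
    by (rule AE_not_in)
  then show ?thesis
    unfolding torus_def by (subst AE_restrict_space_iff) (auto elim: eventually_mono)
qed

lemma integrable_torus_iff:
  "integrable torus (f :: real^'n \<Rightarrow> 'b::euclidean_space) \<longleftrightarrow> integrable lborel (\<lambda>x. indicator (cbox 0 1) x *\<^sub>R f x)"
  unfolding torus_def by (rule integrable_restrict_space) simp

lemma integral_torus_eq:
  "(LINT x|torus. f x :: 'b::euclidean_space) = (LINT x|lborel. indicator (cbox 0 1) x *\<^sub>R f x)"
  unfolding torus_def by (rule integral_restrict_space) simp

lemma integral_box_eq_0:
  fixes g :: "real^'n \<Rightarrow> 'b::euclidean_space"
  assumes g: "integrable torus g" and 0: "\<And>\<phi>. test_function \<phi> \<Longrightarrow> (LINT x|torus. \<phi> x *\<^sub>R g x) = 0"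
  shows "(LINT x|torus. indicator (box a b) x *\<^sub>R g x) = 0"
proof -
  \<comment> \<open>Clipping the box to the unit cube, where the bump functions are controlled,
    changes the indicator only outside the open cube, hence on a null set of the torus.\<close>
  define a' where "a' = (\<chi> i. max 0 (a $ i))"
  define b' where "b' = (\<chi> i. min 1 (b $ i))"
  have ind: "(indicator (box c d) :: real^'n \<Rightarrow> real) \<in> borel_measurable torus" for c d
    by (intro measurable_torus) simp
  have "AE x in torus. indicator (box a b) x *\<^sub>R g x = indicator (box a' b') x *\<^sub>R g x"
    using AE_torus_interior
    by eventually_elim (auto simp: indicator_def mem_box_cart a'_def b'_def)
  then have "(LINT x|torus. indicator (box a b) x *\<^sub>R g x) = (LINT x|torus. indicator (box a' b') x *\<^sub>R g x)"
    using g by (intro integral_cong_AE borel_measurable_scaleR ind) auto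
  also have "\<dots> = 0"
  proof (cases "\<forall>i. a' $ i < b' $ i")
    case False
    then have "box a' b' = {}" by (auto simp: interval_eq_empty_cart not_less)
    then show ?thesis by simp
  next
    case True
    have "(\<lambda>N. LINT x|torus. box_bump a' b' (real N) x *\<^sub>R g x) \<longlonglongrightarrow> (LINT x|torus. indicator (box a' b') x *\<^sub>R g x)"
    proof (rule integral_dominated_convergence)
      show "integrable torus (\<lambda>x. norm (g x))" using g by simp
      show "AE x in torus. (\<lambda>N. box_bump a' b' (real N) x *\<^sub>R g x) \<longlonglongrightarrow> indicator (box a' b') x *\<^sub>R g x"
        using True by (intro AE_I2 tendsto_intros box_bump_tendsto) (auto simp: a'_def b'_def space_torus)
      show "AE x in torus. norm (box_bump a' b' (real N) x *\<^sub>R g x) \<le> norm (g x)" for N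
        by (intro AE_I2) (simp add: box_bump_bounds abs_of_nonneg mult_left_le_one_le)
      show "(\<lambda>x. indicator (box a' b') x *\<^sub>R g x) \<in> borel_measurable torus"
        using g by (intro borel_measurable_scaleR ind) auto
      show "(\<lambda>x. box_bump a' b' (real N) x *\<^sub>R g x) \<in> borel_measurable torus" for N
        using g by (intro borel_measurable_scaleR measurable_torus[OF test_function_measurable[OF test_function_box_bump]]) auto
    qed
    then show ?thesis
      by (simp add: 0[OF test_function_box_bump] LIMSEQ_const_iff)
  qed
  finally show ?thesis .
qed

text \<open>Boxes are stable under intersection and generate the Borel sets, and the sets over which
  the extension of g by 0 has integral 0 form a Dynkin system. A function whose integral over every
  Borel set is 0 vanishes almost everywhere.\<close>

theorem test_functions_separate:
  fixes g :: "real^'n \<Rightarrow> 'b::euclidean_space"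
  assumes g: "integrable torus g" and 0: "\<And>\<phi>. test_function \<phi> \<Longrightarrow> (LINT x|torus. \<phi> x *\<^sub>R g x) = 0"
  shows "AE x in torus. g x = 0"
proof -
  define G where "G x = indicator (cbox 0 1) x *\<^sub>R g x" for x
  have G: "integrable lborel G"
    using g unfolding G_def[abs_def] by (simp only: integrable_torus_iff)
  have "(LINT x:A|lborel. G x) = 0" if "A \<in> sets lborel" for A
  proof -
    have gen: "A \<in> sigma_sets UNIV (range (\<lambda>(a, b). box a b :: (real^'n) set))"
      using that by (simp add: borel_eq_box)
    have "Int_stable (range (\<lambda>(a, b). box a b :: (real^'n) set))"
      by (force simp: Int_stable_def box_Int_box)
    moreover have "range (\<lambda>(a, b). box a b :: (real^'n) set) \<subseteq> Pow UNIV"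
      by simp
    ultimately show ?thesis
      using gen
    proof (induction rule: sigma_sets_induct_disjoint[consumes 3])
      case (basic A)
      then obtain a b where A: "A = box a b" by auto
      have "(LINT x:A|lborel. G x) = (LINT x|torus. indicator (box a b) x *\<^sub>R g x)"
        by (simp add: integral_torus_eq set_lebesgue_integral_def G_def A mult.commute)
      then show ?case
        using integral_box_eq_0[OF g 0] by simp
    next
      case (compl A)
      then have A: "A \<in> sets lborel" by (simp add: borel_eq_box)
      \<comment> \<open>Complements require the integral over the whole space, which is handled by
        the constant test function 1.\<close>
      have "(LINT x|lborel. G x) = 0"
        using 0[OF test_function_const[of 1]] by (simp add: integral_torus_eq G_def)
      moreover have "(LINT x:UNIV - A|lborel. G x) = (LINT x|lborel. G x) - (LINT x:A|lborel. G x)"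
      proof -
        have "integrable lborel (\<lambda>x. indicator A x *\<^sub>R G x)"
          using A G by (rule integrable_mult_indicator)
        from Bochner_Integration.integral_diff[OF G this]
        have "(LINT x|lborel. G x - indicator A x *\<^sub>R G x) = (LINT x|lborel. G x) - (LINT x:A|lborel. G x)"
          by (simp only: set_lebesgue_integral_def)
        moreover have "indicator (UNIV - A) x *\<^sub>R G x = G x - indicator A x *\<^sub>R G x" for x
          by (cases "x \<in> A") auto
        ultimately show ?thesis
          by (simp only: set_lebesgue_integral_def)
      qed
      ultimately show ?case using compl by simp
    next
      case (union A)
      then have A: "\<And>i. A i \<in> sets lborel" by (auto simp: borel_eq_box)
      have "(LINT x:(\<Union>i. A i)|lborel. G x) = (\<Sum>i. (LINT x:(A i)|lborel. G x))"
        using A G union(1) by (intro lebesgue_integral_countable_add)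
          (auto simp: disjoint_family_on_def set_integrable_def intro!: integrable_mult_indicator)
      then show ?case using union by simp
    qed (simp add: set_lebesgue_integral_def)
  qed
  from sigma_finite_measure.density_zero[OF lborel.sigma_finite_measure_axioms G this] have "AE x in lborel. G x = 0" .
  then show ?thesis
    unfolding torus_def by (subst AE_restrict_space_iff) (auto simp: G_def elim: eventually_mono)
qed

section \<open>Lebesgue spaces and weak derivatives\<close>

text \<open>Stands in for Hoelder's inequality on a probability space: it gives the inclusions
  between the Lebesgue spaces and, after rescaling x, comparisons of norms up to a factor.\<close>

lemma powr_le_one_plus: "0 \<le> q \<Longrightarrow> q \<le> p \<Longrightarrow> 0 \<le> x \<Longrightarrow> x powr q \<le> 1 + x powr (p::real)"
proof (cases "x \<le> 1")
  case True
  assume "0 \<le> q" "0 \<le> x"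
  with True have "x powr q \<le> 1 powr q" by (intro powr_mono2) auto
  then show ?thesis by (simp add: add_increasing2)
next
  case False
  assume "q \<le> p"
  with False have "x powr q \<le> x powr p" by (intro powr_mono) auto
  then show ?thesis by simp
qed

text \<open>Every summand is at most the largest one, whose power is among the terms on the
  right.\<close>

lemma powr_sum_le:
  fixes x :: "'i \<Rightarrow> real"
  assumes "finite I" "0 \<le> p" "\<And>i. i \<in> I \<Longrightarrow> 0 \<le> x i"
  shows "(\<Sum>i\<in>I. x i) powr p \<le> real (card I) powr p * (\<Sum>i\<in>I. x i powr p)"
proof (cases "I = {}")
  case False
  define m where "m = Max (x ` I)"
  have "m \<in> x ` I" unfolding m_def using False assms by (intro Max_in) auto
  then obtain j where j: "j \<in> I" "m = x j" by auto
  have "(\<Sum>i\<in>I. x i) \<le> real (card I) * m"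
    using assms by (intro sum_bounded_above[of I x m, simplified]) (auto simp: m_def)
  then have "(\<Sum>i\<in>I. x i) powr p \<le> (real (card I) * m) powr p"
    using assms by (intro powr_mono2 sum_nonneg) auto
  also have "\<dots> = real (card I) powr p * x j powr p"
    using assms j by (simp add: powr_mult)
  also have "\<dots> \<le> real (card I) powr p * (\<Sum>i\<in>I. x i powr p)"
    using assms j by (intro mult_left_mono member_le_sum) auto
  finally show ?thesis .
qed simp

lemma powr_add_le:
  fixes x y :: real
  assumes "0 \<le> x" "0 \<le> y" "0 \<le> p"
  shows "(x + y) powr p \<le> 2 powr p * (x powr p + y powr p)"
  using powr_sum_le[of UNIV p "\<lambda>b. if b then x else y"] assms by (simp add: UNIV_bool add.commute)

lemma LpD:
  assumes "f \<in> Lp p"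
  shows "periodic f" "f \<in> borel_measurable borel" "integrable torus (\<lambda>x. norm (f x) powr p)"
    "f \<in> borel_measurable torus"
  using assms by (auto simp: Lp_def intro: measurable_torus)

lemma LpI_bound:
  assumes "periodic g" "g \<in> borel_measurable borel" "integrable torus h"
    "AE x in torus. norm (g x) powr p \<le> h x"
  shows "g \<in> Lp p"
proof -
  have "integrable torus (\<lambda>x. norm (g x) powr p)"
    using assms(3) measurable_torus[OF assms(2)]
    by (rule_tac Bochner_Integration.integrable_bound[OF assms(3)])
      (auto intro: eventually_mono[OF assms(4)])
  with assms show ?thesis by (simp add: Lp_def)
qed

lemma Lp_add:
  assumes "f \<in> Lp p" "g \<in> Lp p" "0 \<le> p"
  shows "(\<lambda>x. f x + g x) \<in> Lp p"
proof (rule LpI_bound)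
  show "integrable torus (\<lambda>x. 2 powr p * (norm (f x) powr p + norm (g x) powr p))"
    using LpD(3)[OF assms(1)] LpD(3)[OF assms(2)] by simp
  show "AE x in torus. norm (f x + g x) powr p \<le> 2 powr p * (norm (f x) powr p + norm (g x) powr p)"
  proof (rule AE_I2)
    fix x
    have "norm (f x + g x) powr p \<le> (norm (f x) + norm (g x)) powr p"
      using assms by (intro powr_mono2 norm_triangle_ineq) auto
    also have "\<dots> \<le> 2 powr p * (norm (f x) powr p + norm (g x) powr p)"
      using assms by (intro powr_add_le) auto
    finally show "norm (f x + g x) powr p \<le> 2 powr p * (norm (f x) powr p + norm (g x) powr p)" .
  qed
  show "periodic (\<lambda>x. f x + g x)"
    by (rule periodic_comp2[OF LpD(1)[OF assms(1)] LpD(1)[OF assms(2)]])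
qed (use LpD[OF assms(1)] LpD[OF assms(2)] in auto)

lemma Lp_bounded_linear:
  assumes "bounded_linear T" "f \<in> Lp p" "0 \<le> p"
  shows "(\<lambda>x. T (f x)) \<in> Lp p"
proof -
  obtain K where K: "0 < K" "\<And>x. norm (T x) \<le> norm x * K"
    using bounded_linear.pos_bounded[OF assms(1)] by auto
  have "T \<in> borel_measurable borel"
    using assms(1) by (intro borel_measurable_continuous_onI linear_continuous_on)
  show ?thesis
  proof (rule LpI_bound)
    show "integrable torus (\<lambda>x. norm (f x) powr p * K powr p)"
      using LpD(3)[OF assms(2)] by simp
    show "AE x in torus. norm (T (f x)) powr p \<le> norm (f x) powr p * K powr p"
    proof (rule AE_I2)
      fix x
      have "norm (T (f x)) powr p \<le> (norm (f x) * K) powr p"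
        using assms K by (intro powr_mono2) auto
      then show "norm (T (f x)) powr p \<le> norm (f x) powr p * K powr p"
        using K by (simp add: powr_mult)
    qed
    show "(\<lambda>x. T (f x)) \<in> borel_measurable borel"
      using LpD(2)[OF assms(2)] \<open>T \<in> borel_measurable borel\<close> by (rule measurable_compose)
    show "periodic (\<lambda>x. T (f x))"
      by (rule periodic_comp[OF LpD(1)[OF assms(2)]])
  qed
qed

lemma Lp_const: "(\<lambda>x. c) \<in> Lp p"
  by (simp add: Lp_def periodic_const)

lemma Lp_mono:
  assumes "f \<in> Lp p" "0 \<le> q" "q \<le> p"
  shows "f \<in> Lp q"
proof (rule LpI_bound)
  show "integrable torus (\<lambda>x. 1 + norm (f x) powr p)"
    using LpD(3)[OF assms(1)] by simp
qed (use LpD[OF assms(1)] assms in \<open>auto intro!: powr_le_one_plus\<close>)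

lemma Lp_integrable:
  assumes "f \<in> Lp p" "1 \<le> p"
  shows "integrable torus f"
proof -
  have f: "f \<in> Lp 1" using assms by (intro Lp_mono[OF assms(1)]) auto
  show ?thesis
    using LpD(3)[OF f] by (intro integrable_norm_cancel[OF _ LpD(4)[OF f]]) simp
qed

lemma Lp_shift:
  assumes "f \<in> Lp p"
  shows "(\<lambda>x. f (x + y)) \<in> Lp p"
proof -
  note [measurable] = LpD(2)[OF assms]
  have "integrable torus (\<lambda>x. norm (f (x + y)) powr p)"
    using LpD(3)[OF assms] integrable_torus_shift[OF _ periodic_comp[OF LpD(1)[OF assms]], of "\<lambda>z. norm z powr p" y] by simp
  then show ?thesis
    using periodic_shift[OF LpD(1)[OF assms]] by (simp add: Lp_def)
qed

lemma integrable_test_scaleR: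
  assumes "test_function \<phi>" "integrable torus f"
  shows "integrable torus (\<lambda>x. \<phi> x *\<^sub>R (f x :: 'b::euclidean_space))"
proof -
  obtain B where B: "0 < B" "\<And>x. \<bar>\<phi> x\<bar> \<le> B"
    using test_function_bounded[OF assms(1)] by blast
  show ?thesis
  proof (rule Bochner_Integration.integrable_bound)
    show "integrable torus (\<lambda>x. B *\<^sub>R f x)" using assms(2) by simp
    show "(\<lambda>x. \<phi> x *\<^sub>R f x) \<in> borel_measurable torus"
      using assms(2) measurable_torus[OF test_function_measurable[OF assms(1)]] by auto
    show "AE x in torus. norm (\<phi> x *\<^sub>R f x) \<le> norm (B *\<^sub>R f x)"
      using B by (auto intro!: AE_I2 mult_right_mono)
  qed
qed

text \<open>The difference of two weak derivatives is orthogonal to all test functions. This makes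
  the choice in \<open>wd\<close> harmless up to null sets.\<close>

lemma weak_partial_unique:
  assumes "g \<in> Lp 1" "h \<in> Lp 1" "weak_partial i f g" "weak_partial i f h"
  shows "AE x in torus. g x = h x"
proof -
  have gh: "integrable torus g" "integrable torus h"
    using assms by (auto intro: Lp_integrable)
  have "AE x in torus. g x - h x = 0"
  proof (rule test_functions_separate)
    fix \<phi> :: "real^'a \<Rightarrow> real" assume \<phi>: "test_function \<phi>"
    have "(LINT x|torus. \<phi> x *\<^sub>R g x) = (LINT x|torus. \<phi> x *\<^sub>R h x)"
      using assms(3,4) \<phi> unfolding weak_partial_def by (metis neg_equal_iff_equal)
    then show "(LINT x|torus. \<phi> x *\<^sub>R (g x - h x)) = 0"
      using gh \<phi> by (simp add: scaleR_diff_right integrable_test_scaleR)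
  qed (use gh in simp)
  then show ?thesis by simp
qed

lemma weak_partial_add:
  assumes "weak_partial i f f'" "weak_partial i g g'"
    "integrable torus f" "integrable torus f'" "integrable torus g" "integrable torus g'"
  shows "weak_partial i (\<lambda>x. f x + g x) (\<lambda>x. f' x + g' x)"
  using assms
  by (simp add: weak_partial_def scaleR_add_right integrable_test_scaleR test_function_partial)

lemma weak_partial_bounded_linear:
  fixes f :: "real^'n \<Rightarrow> 'b::euclidean_space" and T :: "'b \<Rightarrow> 'c::euclidean_space"
  assumes "bounded_linear T" "weak_partial i f f'" "integrable torus f" "integrable torus f'"
  shows "weak_partial i (\<lambda>x. T (f x)) (\<lambda>x. T (f' x))"
proof -
  have "(LINT x|torus. \<phi> x *\<^sub>R T (h x)) = T (LINT x|torus. \<phi> x *\<^sub>R h x)"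
    if "test_function \<phi>" "integrable torus h" for \<phi> and h :: "real^'n \<Rightarrow> 'b"
    using integral_bounded_linear[OF assms(1) integrable_test_scaleR[OF that]]
    by (simp add: linear_scale[OF bounded_linear.linear[OF assms(1)]])
  with assms show ?thesis
    by (simp add: weak_partial_def test_function_partial linear_neg bounded_linear.linear)
qed

lemma wd_weak_partial:
  assumes "g \<in> Lp 1" "weak_partial i f g"
  shows "wd i f \<in> Lp 1" "weak_partial i f (wd i f)"
  unfolding wd_def using someI[of "\<lambda>g. g \<in> Lp 1 \<and> weak_partial i f g" g] assms by auto

lemma wd_eq_AE:
  assumes "g \<in> Lp 1" "weak_partial i f g"
  shows "AE x in torus. wd i f x = g x"
  using wd_weak_partial[OF assms] assms by (intro weak_partial_unique)

lemma W1p_Lp: "f \<in> W1p p \<Longrightarrow> f \<in> Lp p"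
  by (simp add: W1p_def)

text \<open>\<open>wd\<close> is chosen among integrable functions only. Its p-integrability comes
  from the derivative that \<open>W1p\<close> supplies, with which it agrees almost
  everywhere.\<close>

lemma W1p_weak_partial:
  assumes "f \<in> W1p p" "1 \<le> p"
  shows "wd i f \<in> Lp p" "weak_partial i f (wd i f)"
proof -
  obtain g where g: "g \<in> Lp p" "weak_partial i f g"
    using assms by (auto simp: W1p_def)
  then have g1: "g \<in> Lp 1" using assms by (auto intro: Lp_mono)
  show "weak_partial i f (wd i f)" using wd_weak_partial[OF g1 g(2)] by simp
  have "wd i f \<in> Lp 1" using wd_weak_partial[OF g1 g(2)] by simp
  moreover have "AE x in torus. norm (wd i f x) powr p \<le> norm (g x) powr p"
    using wd_eq_AE[OF g1 g(2)] by eventually_elim simp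
  ultimately show "wd i f \<in> Lp p"
    using LpD(3)[OF g(1)] LpD[of "wd i f" 1] by (intro LpI_bound) auto
qed

lemma W1p_I:
  assumes "f \<in> Lp p" "\<And>i. g i \<in> Lp p" "\<And>i. weak_partial i f (g i)"
  shows "f \<in> W1p p"
  using assms by (auto simp: W1p_def)

lemma W1p_integrable:
  assumes "f \<in> W1p p" "1 \<le> p"
  shows "integrable torus f" "integrable torus (wd i f)"
  using Lp_integrable[OF W1p_Lp[OF assms(1)]] Lp_integrable[OF W1p_weak_partial(1)[OF assms]] assms by auto

lemma
  assumes "f \<in> W1p p" "g \<in> W1p p" "1 \<le> p"
  shows W1p_add: "(\<lambda>x. f x + g x) \<in> W1p p"
    and wd_add: "AE x in torus. wd i (\<lambda>x. f x + g x) x = wd i f x + wd i g x"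
proof -
  have wp: "weak_partial i (\<lambda>x. f x + g x) (\<lambda>x. wd i f x + wd i g x)" for i
    by (rule weak_partial_add[OF W1p_weak_partial(2)[OF assms(1,3)] W1p_weak_partial(2)[OF assms(2,3)]
          W1p_integrable[OF assms(1,3)] W1p_integrable[OF assms(2,3)]])
  have Lp: "(\<lambda>x. wd i f x + wd i g x) \<in> Lp p" for i
    using Lp_add[OF W1p_weak_partial(1)[OF assms(1,3)] W1p_weak_partial(1)[OF assms(2,3)]] assms(3) by simp
  show "(\<lambda>x. f x + g x) \<in> W1p p"
    using Lp_add[OF W1p_Lp[OF assms(1)] W1p_Lp[OF assms(2)]] assms(3) by (intro W1p_I[OF _ Lp wp]) auto
  show "AE x in torus. wd i (\<lambda>x. f x + g x) x = wd i f x + wd i g x"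
    using Lp_mono[OF Lp, of 1] assms(3) by (intro wd_eq_AE wp) auto
qed

lemma
  assumes "f \<in> W1p p" "1 \<le> p" "bounded_linear T"
  shows W1p_bounded_linear: "(\<lambda>x. T (f x)) \<in> W1p p"
    and wd_bounded_linear: "AE x in torus. wd i (\<lambda>x. T (f x)) x = T (wd i f x)"
proof -
  have wp: "weak_partial i (\<lambda>x. T (f x)) (\<lambda>x. T (wd i f x))" for i
    by (rule weak_partial_bounded_linear[OF assms(3) W1p_weak_partial(2)[OF assms(1,2)] W1p_integrable[OF assms(1,2)]])
  have Lp: "(\<lambda>x. T (wd i f x)) \<in> Lp p" for i
    using Lp_bounded_linear[OF assms(3) W1p_weak_partial(1)[OF assms(1,2)]] assms(2) by simp
  show "(\<lambda>x. T (f x)) \<in> W1p p"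
    using Lp_bounded_linear[OF assms(3) W1p_Lp[OF assms(1)]] assms(2) by (intro W1p_I[OF _ Lp wp]) auto
  show "AE x in torus. wd i (\<lambda>x. T (f x)) x = T (wd i f x)"
    using Lp_mono[OF Lp, of 1] assms by (intro wd_eq_AE wp) auto
qed

lemmas W1p_scaleR = W1p_bounded_linear[OF _ _ bounded_linear_scaleR_right]
lemmas wd_scaleR = wd_bounded_linear[OF _ _ bounded_linear_scaleR_right]

lemma W1p_mono: "f \<in> W1p p \<Longrightarrow> 0 \<le> q \<Longrightarrow> q \<le> p \<Longrightarrow> f \<in> W1p q"
  unfolding W1p_def by (blast intro: Lp_mono)

text \<open>The derivatives are equal as functions: changing f on a null set does not affect the
  integrals that define weak derivatives, so both choices are made from the same predicate.\<close>

lemma wd_cong_AE: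
  fixes f g :: "real^'n \<Rightarrow> 'b::euclidean_space"
  assumes "AE x in torus. f x = g x" "f \<in> borel_measurable torus" "g \<in> borel_measurable torus"
  shows "wd i f = wd i g"
proof -
  have "weak_partial i f h \<longleftrightarrow> weak_partial i g h" for h
  proof -
    have "(LINT x|torus. partial i \<phi> x *\<^sub>R f x) = (LINT x|torus. partial i \<phi> x *\<^sub>R g x)"
      if "test_function \<phi>" for \<phi>
      using assms measurable_torus[OF test_function_measurable[OF test_function_partial[OF that]]]
      by (intro integral_cong_AE) (auto elim: eventually_mono)
    then show ?thesis by (auto simp: weak_partial_def)
  qed
  then show ?thesis by (simp add: wd_def)
qed

subsection \<open>The fundamental theorem of calculus along segments\<close>

interpretation interval_torus: pair_prob_space unit_interval "torus :: (real^'n) measure" ..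

lemma measurable_id_pair:
  fixes M :: "'a::euclidean_space measure" and N :: "'b::euclidean_space measure"
  assumes "(\<lambda>x. x) \<in> borel_measurable M" "(\<lambda>x. x) \<in> borel_measurable N"
  shows "(\<lambda>z. z) \<in> borel_measurable (M \<Otimes>\<^sub>M N)"
proof -
  have "(\<lambda>z. (fst z, snd z)) \<in> M \<Otimes>\<^sub>M N \<rightarrow>\<^sub>M borel \<Otimes>\<^sub>M borel"
    by (intro measurable_Pair measurable_compose[OF measurable_fst assms(1)] measurable_compose[OF measurable_snd assms(2)])
  then show ?thesis by (simp add: borel_prod)
qed

lemma measurable_id_unit_interval: "(\<lambda>x. x) \<in> borel_measurable unit_interval"
  by (rule measurable_unit_interval) simp

lemma measurable_interval_torus:
  "f \<in> borel_measurable borel \<Longrightarrow> f \<in> borel_measurable (unit_interval \<Otimes>\<^sub>M torus)"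
  by (rule measurable_compose[OF measurable_id_pair[OF measurable_id_unit_interval measurable_id_torus]])

lemma segment_measurable:
  fixes g :: "real^'n \<Rightarrow> 'b::euclidean_space"
  assumes "g \<in> borel_measurable borel"
  shows "(\<lambda>(t, x). g (x + t *\<^sub>R w)) \<in> borel_measurable borel"
proof -
  have "(\<lambda>z :: real \<times> (real^'n). snd z + fst z *\<^sub>R w) \<in> borel_measurable borel"
    by (intro borel_measurable_continuous_onI continuous_intros)
  from measurable_compose[OF this assms] show ?thesis
    by (simp add: case_prod_beta)
qed

text \<open>Fubini with the segment parameter outside: by translation invariance each slice has the
  same norm integral as g, so the iterated integral is finite. A bounded factor preserves
  integrability.\<close>

lemma integrable_segment:
  fixes g :: "real^'n \<Rightarrow> 'b::euclidean_space"
  assumes g: "g \<in> Lp 1" and \<psi>: "\<psi> \<in> borel_measurable borel" and B: "\<And>z. \<bar>\<psi> z\<bar> \<le> B"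
  shows "integrable (unit_interval \<Otimes>\<^sub>M torus) (\<lambda>(t, x). \<psi> (t, x) *\<^sub>R g (x + t *\<^sub>R w))"
proof -
  have meas: "(\<lambda>(t, x). g (x + t *\<^sub>R w)) \<in> borel_measurable (unit_interval \<Otimes>\<^sub>M torus)"
    by (intro measurable_interval_torus segment_measurable LpD[OF g])
  have "integrable (unit_interval \<Otimes>\<^sub>M torus) (\<lambda>(t, x). g (x + t *\<^sub>R w))"
  proof (rule interval_torus.Fubini_integrable[OF meas])
    have "(LINT x|torus. norm (g (x + t *\<^sub>R w))) = (LINT x|torus. norm (g x))" for t
      using integral_torus_shift[OF _ periodic_comp[OF LpD(1)[OF g]], of norm] LpD(2)[OF g] by simp
    then show "integrable unit_interval (\<lambda>t. LINT x|torus. norm (case (t, x) of (t, x) \<Rightarrow> g (x + t *\<^sub>R w)))"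
      by simp
    show "AE t in unit_interval. integrable torus (\<lambda>x. case (t, x) of (t, x) \<Rightarrow> g (x + t *\<^sub>R w))"
      using Lp_integrable[OF Lp_shift[OF g]] by simp
  qed
  then have int: "integrable (unit_interval \<Otimes>\<^sub>M torus) (\<lambda>z. B *\<^sub>R (case z of (t, x) \<Rightarrow> g (x + t *\<^sub>R w)))"
    by simp
  show ?thesis
  proof (rule Bochner_Integration.integrable_bound[OF int])
    have "(\<lambda>z. \<psi> z *\<^sub>R (case z of (t, x) \<Rightarrow> g (x + t *\<^sub>R w))) \<in> borel_measurable (unit_interval \<Otimes>\<^sub>M torus)"
      using meas measurable_interval_torus[OF \<psi>] by (rule borel_measurable_scaleR[rotated])
    then show "(\<lambda>(t, x). \<psi> (t, x) *\<^sub>R g (x + t *\<^sub>R w)) \<in> borel_measurable (unit_interval \<Otimes>\<^sub>M torus)"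
      by (simp add: case_prod_beta')
    have "\<bar>\<psi> z\<bar> \<le> \<bar>B\<bar>" for z using B[of z] by linarith
    then show "AE z in unit_interval \<Otimes>\<^sub>M torus. norm (case z of (t, x) \<Rightarrow> \<psi> (t, x) *\<^sub>R g (x + t *\<^sub>R w))
        \<le> norm (B *\<^sub>R (case z of (t, x) \<Rightarrow> g (x + t *\<^sub>R w)))"
      by (auto intro!: AE_I2 mult_right_mono)
  qed
qed

lemma integral_test_shift:
  fixes f :: "real^'n \<Rightarrow> 'b::euclidean_space"
  assumes f: "f \<in> Lp 1" and \<phi>: "test_function \<phi>"
  shows "(LINT x|torus. \<phi> x *\<^sub>R f (x + w)) = (LINT x|torus. \<phi> (x - w) *\<^sub>R f x)"
proof -
  note [measurable] = LpD(2)[OF f] test_function_measurable[OF \<phi>]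
  have "periodic (\<lambda>x. \<phi> x *\<^sub>R f (x + w))"
    using periodic_comp2[of \<phi> "\<lambda>x. f (x + w)" scaleR] periodic_shift[OF LpD(1)[OF f]] \<phi>
    by (simp add: test_function_def)
  from integral_torus_shift[OF _ this, of "- w"] show ?thesis
    by simp
qed

text \<open>For each t the weak derivative is tested against the translate of \<phi> by t w, and the
  translation is then moved onto g. Fubini on both sides turns this into a statement about averages
  along the segment.\<close>

lemma integral_segment_weak_partial:
  fixes f :: "real^'n \<Rightarrow> 'b::euclidean_space"
  assumes f: "f \<in> Lp 1" and g: "g \<in> Lp 1" "weak_partial i f g" and \<phi>: "test_function \<phi>"
  shows "(LINT x|torus. (LINT t|unit_interval. partial i \<phi> (x - t *\<^sub>R w) *\<^sub>R f x))
      = - (LINT x|torus. \<phi> x *\<^sub>R (LINT t|unit_interval. g (x + t *\<^sub>R w)))"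
    and "integrable torus (\<lambda>x. LINT t|unit_interval. partial i \<phi> (x - t *\<^sub>R w) *\<^sub>R f x)"
    and "AE x in torus. integrable unit_interval (\<lambda>t. partial i \<phi> (x - t *\<^sub>R w) *\<^sub>R f x)"
proof -
  obtain B where B: "\<And>x. \<bar>partial i \<phi> x\<bar> \<le> B"
    using test_function_bounded[OF test_function_partial[OF \<phi>]] by metis
  obtain B' where B': "\<And>x. \<bar>\<phi> x\<bar> \<le> B'"
    using test_function_bounded[OF \<phi>] by metis
  have "(\<lambda>(t, x). partial i \<phi> (x + t *\<^sub>R (- w))) \<in> borel_measurable borel"
    by (intro segment_measurable test_function_measurable test_function_partial \<phi>)
  \<comment> \<open>Displacement 0 leaves f itself in place; the bounded factor is the translated
    derivative of the test function.\<close>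
  from integrable_segment[OF f this, of B 0]
  have 1: "integrable (unit_interval \<Otimes>\<^sub>M torus) (\<lambda>(t, x). partial i \<phi> (x - t *\<^sub>R w) *\<^sub>R f x)"
    by (simp add: B case_prod_beta')
  have "(\<lambda>z :: real \<times> (real^'n). \<phi> (snd z)) \<in> borel_measurable borel"
    by (intro borel_measurable_continuous_onI continuous_on_compose2[OF test_function_continuous[OF \<phi>]] continuous_intros) auto
  from integrable_segment[OF g(1) this, of B' w]
  have 2: "integrable (unit_interval \<Otimes>\<^sub>M torus) (\<lambda>(t, x). \<phi> x *\<^sub>R g (x + t *\<^sub>R w))"
    by (simp add: B')
  have "(LINT x|torus. (LINT t|unit_interval. partial i \<phi> (x - t *\<^sub>R w) *\<^sub>R f x))
      = (LINT t|unit_interval. (LINT x|torus. partial i \<phi> (x - t *\<^sub>R w) *\<^sub>R f x))"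
    using interval_torus.Fubini_integral[OF 1] by simp
  also have "\<dots> = (LINT t|unit_interval. - (LINT x|torus. \<phi> x *\<^sub>R g (x + t *\<^sub>R w)))"
  proof (rule Bochner_Integration.integral_cong)
    fix t
    have "(LINT x|torus. partial i (\<lambda>x. \<phi> (x + - (t *\<^sub>R w))) x *\<^sub>R f x)
        = - (LINT x|torus. \<phi> (x + - (t *\<^sub>R w)) *\<^sub>R g x)"
      using g(2) test_function_shift[OF \<phi>] unfolding weak_partial_def by blast
    moreover have "partial i (\<lambda>x. \<phi> (x - t *\<^sub>R w)) x = partial i \<phi> (x - t *\<^sub>R w)" for x
      using partial_shift[OF \<phi>, of i "- (t *\<^sub>R w)" x] by simp
    ultimately show "(LINT x|torus. partial i \<phi> (x - t *\<^sub>R w) *\<^sub>R f x)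
        = - (LINT x|torus. \<phi> x *\<^sub>R g (x + t *\<^sub>R w))"
      by (simp add: integral_test_shift[OF g(1) \<phi>])
  qed simp
  also have "\<dots> = - (LINT t|unit_interval. (LINT x|torus. \<phi> x *\<^sub>R g (x + t *\<^sub>R w)))"
    by simp
  also have "\<dots> = - (LINT x|torus. (LINT t|unit_interval. \<phi> x *\<^sub>R g (x + t *\<^sub>R w)))"
    using interval_torus.Fubini_integral[OF 2] by simp
  finally show "(LINT x|torus. (LINT t|unit_interval. partial i \<phi> (x - t *\<^sub>R w) *\<^sub>R f x))
      = - (LINT x|torus. \<phi> x *\<^sub>R (LINT t|unit_interval. g (x + t *\<^sub>R w)))"
    by simp
  show "integrable torus (\<lambda>x. LINT t|unit_interval. partial i \<phi> (x - t *\<^sub>R w) *\<^sub>R f x)"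
    using interval_torus.integrable_snd[OF 1] by simp
  show "AE x in torus. integrable unit_interval (\<lambda>t. partial i \<phi> (x - t *\<^sub>R w) *\<^sub>R f x)"
    using interval_torus.AE_integrable_snd[OF 1] by simp
qed

text \<open>By separation it is enough to integrate against \<phi>. Moving the translation to \<phi>
  reduces the claim to the classical formula for \<phi>, whose derivatives then pass to f as weak
  derivatives.\<close>

theorem weak_FTC:
  fixes f :: "real^'n \<Rightarrow> 'b::euclidean_space"
  assumes f: "f \<in> Lp 1" and g: "\<And>i. g i \<in> Lp 1" "\<And>i. weak_partial i f (g i)"
  shows "AE x in torus. f (x + w) - f x = (\<Sum>i\<in>UNIV. w $ i *\<^sub>R (LINT t|unit_interval. g i (x + t *\<^sub>R w)))"
proof -
  define R where "R i x = (LINT t|unit_interval. g i (x + t *\<^sub>R w))" for i x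
  have "integrable (unit_interval \<Otimes>\<^sub>M torus) (\<lambda>(t, x). g i (x + t *\<^sub>R w))" for i
    using integrable_segment[OF g(1)[of i], of "\<lambda>_. 1" 1 w] by simp
  then have R: "integrable torus (R i)" for i
    using interval_torus.integrable_snd[of "\<lambda>t x. g i (x + t *\<^sub>R w)"] by (simp add: R_def[abs_def])
  have f_int: "integrable torus f" "integrable torus (\<lambda>x. f (x + w))"
    using f Lp_shift[OF f] by (auto intro: Lp_integrable)
  have "AE x in torus. f (x + w) - f x - (\<Sum>i\<in>UNIV. w $ i *\<^sub>R R i x) = 0"
  proof (rule test_functions_separate)
    show "integrable torus (\<lambda>x. f (x + w) - f x - (\<Sum>i\<in>UNIV. w $ i *\<^sub>R R i x))"
      using f_int R by simp
    fix \<phi> :: "real^'n \<Rightarrow> real" assume \<phi>: "test_function \<phi>"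
    note seg = integral_segment_weak_partial[OF f g(1) g(2) \<phi>, of _ w]
    have \<phi>': "test_function (\<lambda>x. \<phi> (x - w))"
      using test_function_shift[OF \<phi>, of "- w"] by simp
    have "(LINT x|torus. \<phi> x *\<^sub>R (f (x + w) - f x)) = (LINT x|torus. \<phi> x *\<^sub>R f (x + w)) - (LINT x|torus. \<phi> x *\<^sub>R f x)"
      using f_int \<phi> by (simp add: scaleR_diff_right integrable_test_scaleR)
    also have "\<dots> = (LINT x|torus. \<phi> (x - w) *\<^sub>R f x) - (LINT x|torus. \<phi> x *\<^sub>R f x)"
      by (simp add: integral_test_shift[OF f \<phi>])
    also have "\<dots> = (LINT x|torus. (\<phi> (x - w) - \<phi> x) *\<^sub>R f x)"
      using f_int \<phi> \<phi>' by (simp add: scaleR_diff_left integrable_test_scaleR)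
    \<comment> \<open>The classical formula along the segment from x to x - w. Its minus sign
      cancels the one in the definition of the weak derivative.\<close>
    also have "\<dots> = (LINT x|torus. (\<Sum>i\<in>UNIV. - (w $ i) *\<^sub>R (LINT t|unit_interval. partial i \<phi> (x - t *\<^sub>R w) *\<^sub>R f x)))"
    proof (rule integral_cong_AE)
      show "(\<lambda>x. (\<phi> (x - w) - \<phi> x) *\<^sub>R f x) \<in> borel_measurable torus"
        using f_int measurable_torus[OF test_function_measurable[OF \<phi>]] measurable_torus[OF test_function_measurable[OF \<phi>']]
        by (intro borel_measurable_scaleR borel_measurable_diff) auto
      show "(\<lambda>x. \<Sum>i\<in>UNIV. - (w $ i) *\<^sub>R (LINT t|unit_interval. partial i \<phi> (x - t *\<^sub>R w) *\<^sub>R f x)) \<in> borel_measurable torus"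
        by (intro borel_measurable_sum borel_measurable_scaleR borel_measurable_const borel_measurable_integrable seg(2))
      show "AE x in torus. (\<phi> (x - w) - \<phi> x) *\<^sub>R f x
          = (\<Sum>i\<in>UNIV. - (w $ i) *\<^sub>R (LINT t|unit_interval. partial i \<phi> (x - t *\<^sub>R w) *\<^sub>R f x))"
      proof (rule AE_I2)
        fix x
        have int: "integrable unit_interval (\<lambda>t. partial i \<phi> (x - t *\<^sub>R w))" for i
        proof -
          obtain B where B: "\<And>x. \<bar>partial i \<phi> x\<bar> \<le> B"
            using test_function_bounded[OF test_function_partial[OF \<phi>]] by metis
          have "(\<lambda>t. partial i \<phi> (x - t *\<^sub>R w)) \<in> borel_measurable borel"
            by (intro borel_measurable_continuous_onI continuous_on_compose2[OF test_function_continuous[OF test_function_partial[OF \<phi>]]] continuous_intros) auto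
          then show ?thesis
            using B by (intro unit_interval.integrable_const_bound[of _ B] measurable_unit_interval) auto
        qed
        have "\<phi> (x - w) - \<phi> x = (LINT t|unit_interval. (\<Sum>i\<in>UNIV. - (w $ i) * partial i \<phi> (x - t *\<^sub>R w)))"
          using test_function_FTC[OF \<phi>, of x "- w"] by simp
        also have "\<dots> = (\<Sum>i\<in>UNIV. - (w $ i) * (LINT t|unit_interval. partial i \<phi> (x - t *\<^sub>R w)))"
          using int by (subst Bochner_Integration.integral_sum) auto
        finally show "(\<phi> (x - w) - \<phi> x) *\<^sub>R f x
          = (\<Sum>i\<in>UNIV. - (w $ i) *\<^sub>R (LINT t|unit_interval. partial i \<phi> (x - t *\<^sub>R w) *\<^sub>R f x))"
          using int by (simp add: scaleR_sum_left)
      qed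
    qed
    also have "\<dots> = (\<Sum>i\<in>UNIV. - (w $ i) *\<^sub>R (LINT x|torus. (LINT t|unit_interval. partial i \<phi> (x - t *\<^sub>R w) *\<^sub>R f x)))"
      using seg(2) by (subst Bochner_Integration.integral_sum) auto
    also have "\<dots> = (\<Sum>i\<in>UNIV. w $ i *\<^sub>R (LINT x|torus. \<phi> x *\<^sub>R R i x))"
      by (simp add: seg(1) R_def)
    also have "\<dots> = (LINT x|torus. \<phi> x *\<^sub>R (\<Sum>i\<in>UNIV. w $ i *\<^sub>R R i x))"
    proof -
      have "integrable torus (\<lambda>x. w $ i *\<^sub>R (\<phi> x *\<^sub>R R i x))" for i
        using R \<phi> by (intro integrable_scaleR_right integrable_test_scaleR)
      then have "(LINT x|torus. (\<Sum>i\<in>UNIV. w $ i *\<^sub>R (\<phi> x *\<^sub>R R i x))) = (\<Sum>i\<in>UNIV. (LINT x|torus. w $ i *\<^sub>R (\<phi> x *\<^sub>R R i x)))"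
        by (rule Bochner_Integration.integral_sum)
      moreover have "\<phi> x *\<^sub>R (\<Sum>i\<in>UNIV. w $ i *\<^sub>R R i x) = (\<Sum>i\<in>UNIV. w $ i *\<^sub>R (\<phi> x *\<^sub>R R i x))" for x
        by (simp only: scaleR_sum_right scaleR_left_commute)
      ultimately show ?thesis
        by (simp only: integral_scaleR_right)
    qed
    finally show "(LINT x|torus. \<phi> x *\<^sub>R (f (x + w) - f x - (\<Sum>i\<in>UNIV. w $ i *\<^sub>R R i x))) = 0"
      using f_int R \<phi> by (simp add: scaleR_diff_right integrable_test_scaleR)
  qed
  then show ?thesis by (simp add: R_def)
qed

text \<open>A constant has weak derivative 0 because derivatives of test functions have integral 0:
  for a unit vector e of the lattice, \<phi> (x + e) - \<phi> x = 0 is an average over translates of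
  the derivative along e, and all translates have the same integral.\<close>

lemma
  fixes c :: "'b::euclidean_space"
  shows W1p_const: "(\<lambda>x :: real^'n. c) \<in> W1p p"
    and wd_const: "AE x :: real^'n in torus. wd i (\<lambda>x. c) x = 0"
proof -
  have "(LINT x|torus. partial i \<phi> x *\<^sub>R c) = 0" if \<phi>: "test_function \<phi>" for \<phi> :: "real^'n \<Rightarrow> real" and i
  proof -
    note \<phi>i = test_function_partial[OF \<phi>, of i]
    have per: "periodic (partial i \<phi>)" using \<phi>i by (simp add: test_function_def)
    obtain B where B: "\<And>x. \<bar>partial i \<phi> x\<bar> \<le> B"
      using test_function_bounded[OF \<phi>i] by metis
    have "(\<lambda>(t, x). partial i \<phi> (x + t *\<^sub>R axis i 1)) \<in> borel_measurable borel"
      by (intro segment_measurable test_function_measurable \<phi>i)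
    from integrable_segment[OF Lp_const[of "1::real"] this, of B]
    have 1: "integrable (unit_interval \<Otimes>\<^sub>M torus) (\<lambda>(t, x). partial i \<phi> (x + t *\<^sub>R axis i 1))"
      by (simp add: B case_prod_beta')
    have "0 = (LINT x|torus. \<phi> (x + axis i 1) - \<phi> x)"
      using \<phi> by (simp add: test_function_def periodic_def)
    also have "\<dots> = (LINT x|torus. (LINT t|unit_interval. partial i \<phi> (x + t *\<^sub>R axis i 1)))"
      by (simp add: test_function_FTC[OF \<phi>] axis_def if_distrib[where f = "\<lambda>u. u * _"] cong: if_cong)
    also have "\<dots> = (LINT t|unit_interval. (LINT x|torus. partial i \<phi> (x + t *\<^sub>R axis i 1)))"
      using interval_torus.Fubini_integral[OF 1] by simp
    also have "\<dots> = (LINT x|torus. partial i \<phi> x)"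
      using integral_torus_shift[OF test_function_measurable[OF \<phi>i] per] by (simp add: unit_interval.prob_space)
    finally have "(LINT x|torus. partial i \<phi> x) = 0" by simp
    moreover have "integrable torus (partial i \<phi>)"
      using B by (intro torus.integrable_const_bound[of _ B] measurable_torus test_function_measurable \<phi>i) auto
    ultimately show ?thesis by simp
  qed
  then have wp: "weak_partial i (\<lambda>x :: real^'n. c) (\<lambda>x. 0)" for i
    by (simp add: weak_partial_def)
  show "(\<lambda>x :: real^'n. c) \<in> W1p p"
    by (rule W1p_I[OF Lp_const Lp_const wp])
  show "AE x :: real^'n in torus. wd i (\<lambda>x. c) x = 0"
    by (rule wd_eq_AE[OF Lp_const wp])
qed

section \<open>Oscillation around the mean\<close>

interpretation torus_torus: pair_prob_space "torus :: (real^'n) measure" "torus :: (real^'n) measure" ..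

lemma measurable_torus_torus:
  "f \<in> borel_measurable borel \<Longrightarrow> f \<in> borel_measurable (torus \<Otimes>\<^sub>M torus)"
  by (rule measurable_compose[OF measurable_id_pair[OF measurable_id_torus measurable_id_torus]])

lemma measurable_borel_interval:
  fixes f :: "'a::euclidean_space \<times> real \<Rightarrow> 'b::topological_space"
  shows "f \<in> borel_measurable borel \<Longrightarrow> f \<in> borel_measurable (borel \<Otimes>\<^sub>M unit_interval)"
  by (rule measurable_compose[OF measurable_id_pair[OF _ measurable_id_unit_interval]]) simp

lemma nn_integral_segment_measurable:
  fixes G :: "real^'n \<Rightarrow> ennreal"
  assumes "G \<in> borel_measurable borel"
  shows "(\<lambda>z. \<integral>\<^sup>+t. G (fst z + t *\<^sub>R snd z) \<partial>unit_interval) \<in> borel_measurable borel"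
proof (rule unit_interval.borel_measurable_nn_integral)
  have "(\<lambda>z :: ((real^'n) \<times> (real^'n)) \<times> real. fst (fst z) + snd z *\<^sub>R snd (fst z)) \<in> borel_measurable borel"
    by (intro borel_measurable_continuous_onI continuous_intros)
  from measurable_compose[OF this assms]
  show "(\<lambda>(z, t). G (fst z + t *\<^sub>R snd z)) \<in> borel_measurable (borel \<Otimes>\<^sub>M unit_interval)"
    by (intro measurable_borel_interval) (simp add: case_prod_beta')
qed

lemma nn_integral_line_measurable:
  fixes G :: "real^'n \<Rightarrow> ennreal"
  assumes "G \<in> borel_measurable borel"
  shows "(\<lambda>t. G (x + t *\<^sub>R w)) \<in> borel_measurable unit_interval"
proof (rule measurable_unit_interval)
  have "(\<lambda>t. x + t *\<^sub>R w) \<in> borel_measurable borel"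
    by (intro borel_measurable_continuous_onI continuous_intros)
  from measurable_compose[OF this assms] show "(\<lambda>t. G (x + t *\<^sub>R w)) \<in> borel_measurable borel" .
qed

text \<open>For a function that is not integrable the Bochner integral has the default value 0, and
  the bound is trivial.\<close>

lemma norm_integral_le_nn_integral:
  "ennreal (norm (LINT x|M. (f x :: 'b::euclidean_space))) \<le> (\<integral>\<^sup>+x. ennreal (norm (f x)) \<partial>M)"
proof (cases "integrable M f")
  case True
  then show ?thesis by (rule integral_norm_bound_ennreal)
qed (simp add: not_integrable_integral_eq)

lemma weak_increment_bound:
  fixes f :: "real^'n \<Rightarrow> 'b::euclidean_space"
  assumes f: "f \<in> Lp 1" and g: "\<And>i. g i \<in> Lp 1" "\<And>i. weak_partial i f (g i)" and w: "w \<in> cbox 0 1"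
  defines "G \<equiv> \<lambda>x. ennreal (\<Sum>i\<in>UNIV. norm (g i x))"
  shows "AE x in torus. ennreal (norm (f (x + w) - f x)) \<le> (\<integral>\<^sup>+t. G (x + t *\<^sub>R w) \<partial>unit_interval)"
  using weak_FTC[OF f g, of w]
proof eventually_elim
  case (elim x)
  have meas: "(\<lambda>t. ennreal (norm (g i (x + t *\<^sub>R w)))) \<in> borel_measurable unit_interval" for i
    using LpD(2)[OF g(1)[of i]] by (intro nn_integral_line_measurable[where G = "\<lambda>x. ennreal (norm (g i x))"]) auto
  have "norm (f (x + w) - f x) \<le> (\<Sum>i\<in>UNIV. norm (LINT t|unit_interval. g i (x + t *\<^sub>R w)))"
    unfolding elim
  proof (rule order.trans[OF norm_sum sum_mono])
    fix i
    have "\<bar>w $ i\<bar> \<le> 1" using w by (auto simp: mem_box_cart abs_le_iff intro: order.trans[of _ 0])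
    then show "norm (w $ i *\<^sub>R (LINT t|unit_interval. g i (x + t *\<^sub>R w)))
        \<le> norm (LINT t|unit_interval. g i (x + t *\<^sub>R w))"
      by (simp add: mult_left_le_one_le)
  qed
  then have "ennreal (norm (f (x + w) - f x)) \<le> (\<Sum>i\<in>UNIV. ennreal (norm (LINT t|unit_interval. g i (x + t *\<^sub>R w))))"
    by (simp add: ennreal_leI)
  also have "\<dots> \<le> (\<Sum>i\<in>UNIV. \<integral>\<^sup>+t. ennreal (norm (g i (x + t *\<^sub>R w))) \<partial>unit_interval)"
    by (intro sum_mono norm_integral_le_nn_integral)
  also have "\<dots> = (\<integral>\<^sup>+t. G (x + t *\<^sub>R w) \<partial>unit_interval)"
    using meas by (simp add: G_def nn_integral_sum flip: sum_ennreal)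
  finally show ?case .
qed

text \<open>By translation invariance the mean of f is the average of f (x + w) over w in the cube,
  so the oscillation is an average of increments. The increment bound holds for almost every x with
  w fixed; joint measurability allows x to be fixed instead.\<close>

theorem mean_oscillation_bound:
  fixes f :: "real^'n \<Rightarrow> 'b::euclidean_space"
  assumes f: "f \<in> Lp 1" and g: "\<And>i. g i \<in> Lp 1" "\<And>i. weak_partial i f (g i)"
  defines "G \<equiv> \<lambda>x. ennreal (\<Sum>i\<in>UNIV. norm (g i x))"
  shows "AE x in torus. ennreal (norm (f x - (LINT y|torus. f y)))
    \<le> (\<integral>\<^sup>+w. (\<integral>\<^sup>+t. G (x + t *\<^sub>R w) \<partial>unit_interval) \<partial>torus)"
proof -
  have G: "G \<in> borel_measurable borel"
    using LpD(2)[OF g(1)] unfolding G_def by auto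
  define P where "P x w \<longleftrightarrow> ennreal (norm (f (x + w) - f x)) \<le> (\<integral>\<^sup>+t. G (x + t *\<^sub>R w) \<partial>unit_interval)" for x w
  have "AE w in torus. AE x in torus. P x w"
    unfolding P_def G_def by (rule AE_I2, rule weak_increment_bound[OF f g]) (simp add: space_torus)
  moreover have "(AE x in torus. AE w in torus. P x w) \<longleftrightarrow> (AE w in torus. AE x in torus. P x w)"
  proof (rule torus_torus.AE_commute)
    have add: "(\<lambda>z :: (real^'n) \<times> (real^'n). fst z + snd z) \<in> borel_measurable borel"
      and fst: "(\<lambda>z :: (real^'n) \<times> (real^'n). fst z) \<in> borel_measurable borel"
      by (intro borel_measurable_continuous_onI continuous_intros)+
    have "(\<lambda>z. ennreal (norm (f (fst z + snd z) - f (fst z)))) \<in> borel_measurable borel"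
      using measurable_compose[OF add LpD(2)[OF f]] measurable_compose[OF fst LpD(2)[OF f]] by simp
    from measurable_torus_torus[OF this] measurable_torus_torus[OF nn_integral_segment_measurable[OF G]]
    show "{z \<in> space (torus \<Otimes>\<^sub>M torus). P (fst z) (snd z)} \<in> sets (torus \<Otimes>\<^sub>M torus)"
      unfolding P_def by (rule borel_measurable_le)
  qed
  ultimately have "AE x in torus. AE w in torus. P x w" by simp
  then show ?thesis
  proof eventually_elim
    case (elim x)
    have int: "integrable torus (\<lambda>w. f (w + x))"
      by (rule Lp_integrable[OF Lp_shift[OF f]]) simp
    have "(LINT y|torus. f y) - f x = (LINT w|torus. f (w + x) - f x)"
      using int integral_torus_shift[OF LpD(2)[OF f] LpD(1)[OF f], of x] by (simp add: torus.prob_space)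
    then have "ennreal (norm (f x - (LINT y|torus. f y))) = ennreal (norm (LINT w|torus. f (w + x) - f x))"
      by (metis norm_minus_commute)
    also have "\<dots> \<le> (\<integral>\<^sup>+w. ennreal (norm (f (w + x) - f x)) \<partial>torus)"
      by (rule norm_integral_le_nn_integral)
    also have "\<dots> \<le> (\<integral>\<^sup>+w. (\<integral>\<^sup>+t. G (x + t *\<^sub>R w) \<partial>unit_interval) \<partial>torus)"
      using elim unfolding P_def by (intro nn_integral_mono_AE) (auto simp: add.commute)
    finally show ?case .
  qed
qed

section \<open>The Poincare inequality\<close>

lemma nn_integral_square_le:
  assumes "prob_space M" "f \<in> borel_measurable M"
  shows "(\<integral>\<^sup>+x. f x \<partial>M)\<^sup>2 \<le> (\<integral>\<^sup>+x. (f x)\<^sup>2 \<partial>M)"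
  using Cauchy_Schwarz_nn_integral[OF assms(2), of "\<lambda>_. 1"] prob_space.emeasure_space_1[OF assms(1)] by simp

text \<open>Cauchy-Schwarz in w and in t moves the square inside the averages. When x is integrated
  first, translation invariance makes the inner integral independent of w and t, so the constant is
  1.\<close>

theorem poincare_inequality:
  fixes f :: "real^'n \<Rightarrow> 'b::euclidean_space"
  assumes f: "f \<in> Lp 1" and g: "\<And>i. g i \<in> Lp 1" "\<And>i. weak_partial i f (g i)"
  defines "G \<equiv> \<lambda>x. ennreal (\<Sum>i\<in>UNIV. norm (g i x))"
  shows "(\<integral>\<^sup>+x. (ennreal (norm (f x - (LINT y|torus. f y))))\<^sup>2 \<partial>torus) \<le> (\<integral>\<^sup>+x. (G x)\<^sup>2 \<partial>torus)"
proof -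
  have G: "G \<in> borel_measurable borel" "(\<lambda>x. (G x)\<^sup>2) \<in> borel_measurable borel"
    using LpD(2)[OF g(1)] unfolding G_def by auto
  have perG: "periodic (\<lambda>x. (G x)\<^sup>2)"
    using LpD(1)[OF g(1)] by (simp add: G_def periodic_def)
  define S where "S z = (\<integral>\<^sup>+t. G (fst z + t *\<^sub>R snd z) \<partial>unit_interval)" for z
  define S2 where "S2 z = (\<integral>\<^sup>+t. (G (fst z + t *\<^sub>R snd z))\<^sup>2 \<partial>unit_interval)" for z
  have S: "S \<in> borel_measurable borel" and S2: "S2 \<in> borel_measurable borel"
    unfolding S_def[abs_def] S2_def[abs_def]
    by (rule nn_integral_segment_measurable[OF G(1)], rule nn_integral_segment_measurable[OF G(2)])
  have SS2: "(S z)\<^sup>2 \<le> S2 z" for z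
    unfolding S_def S2_def using G(1)
    by (intro nn_integral_square_le nn_integral_line_measurable unit_interval.prob_space_axioms)
  have slice: "(\<lambda>w. S (x, w)) \<in> borel_measurable torus" for x
    using S by (intro measurable_torus) (auto intro!: borel_measurable_continuous_onI continuous_intros intro: measurable_compose[of "\<lambda>w. (x, w)"])
  have "(\<integral>\<^sup>+x. (ennreal (norm (f x - (LINT y|torus. f y))))\<^sup>2 \<partial>torus) \<le> (\<integral>\<^sup>+x. (\<integral>\<^sup>+w. S2 (x, w) \<partial>torus) \<partial>torus)"
  proof (rule nn_integral_mono_AE)
    show "AE x in torus. (ennreal (norm (f x - (LINT y|torus. f y))))\<^sup>2 \<le> (\<integral>\<^sup>+w. S2 (x, w) \<partial>torus)"
      using mean_oscillation_bound[OF f g]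
    proof eventually_elim
      case (elim x)
      then have "(ennreal (norm (f x - (LINT y|torus. f y))))\<^sup>2 \<le> (\<integral>\<^sup>+w. S (x, w) \<partial>torus)\<^sup>2"
        by (intro power_mono) (auto simp: S_def G_def)
      also have "\<dots> \<le> (\<integral>\<^sup>+w. (S (x, w))\<^sup>2 \<partial>torus)"
        by (intro nn_integral_square_le torus.prob_space_axioms slice)
      also have "\<dots> \<le> (\<integral>\<^sup>+w. S2 (x, w) \<partial>torus)"
        by (intro nn_integral_mono SS2)
      finally show ?case .
    qed
  qed
  also have "\<dots> = (\<integral>\<^sup>+w. (\<integral>\<^sup>+x. S2 (x, w) \<partial>torus) \<partial>torus)"
    using torus_torus.Fubini'[of "\<lambda>x w. S2 (x, w)"] measurable_torus_torus[OF S2] by simp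
  also have "\<dots> = (\<integral>\<^sup>+(w::real^'n). (\<integral>\<^sup>+x. (G x)\<^sup>2 \<partial>torus) \<partial>torus)"
  proof (rule nn_integral_cong)
    fix w :: "real^'n"
    have "(\<lambda>(t, x). (G (x + t *\<^sub>R w))\<^sup>2) \<in> borel_measurable (unit_interval \<Otimes>\<^sub>M torus)"
    proof (rule measurable_interval_torus)
      have "(\<lambda>z :: real \<times> (real^'n). snd z + fst z *\<^sub>R w) \<in> borel_measurable borel"
        by (intro borel_measurable_continuous_onI continuous_intros)
      from measurable_compose[OF this G(2)]
      show "(\<lambda>(t, x). (G (x + t *\<^sub>R w))\<^sup>2) \<in> borel_measurable borel"
        by (simp add: case_prod_beta')
    qed
    then have "(\<integral>\<^sup>+x. S2 (x, w) \<partial>torus) = (\<integral>\<^sup>+t. (\<integral>\<^sup>+x. (G (x + t *\<^sub>R w))\<^sup>2 \<partial>torus) \<partial>unit_interval)"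
      unfolding S2_def using interval_torus.Fubini'[of "\<lambda>t x. (G (x + t *\<^sub>R w))\<^sup>2"] by simp
    also have "\<dots> = (\<integral>\<^sup>+x. (G x)\<^sup>2 \<partial>torus)"
      by (simp add: nn_integral_torus_shift[OF G(2) perG] unit_interval.emeasure_space_1)
    finally show "(\<integral>\<^sup>+x. S2 (x, w) \<partial>torus) = (\<integral>\<^sup>+x. (G x)\<^sup>2 \<partial>torus)" .
  qed
  also have "\<dots> = (\<integral>\<^sup>+x. (G x)\<^sup>2 \<partial>torus)"
    by (simp add: torus.emeasure_space_1)
  finally show ?thesis .
qed

text \<open>The map from w to x + t w sends the unit cube to a cube of side t, with Jacobian t to
  the power d. As t is at most 1, this cube lies in a translate of the unit cube, over which the
  integral of F does not depend on x.\<close>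

lemma nn_integral_torus_scaled:
  fixes F :: "real^'n \<Rightarrow> ennreal"
  assumes F: "F \<in> borel_measurable borel" and per: "periodic F" and t: "0 < t" "t \<le> 1"
  shows "(\<integral>\<^sup>+w. F (x + t *\<^sub>R w) \<partial>torus) \<le> ennreal (1 / t ^ CARD('n)) * (\<integral>\<^sup>+w. F w \<partial>torus)"
proof -
  note [measurable] = F
  define K where "K v = F v * indicator (cbox 0 1) ((1 / t) *\<^sub>R (v - x))" for v
  have [measurable]: "(\<lambda>v. (1 / t) *\<^sub>R (v - x)) \<in> borel_measurable borel" "(\<lambda>v. x + t *\<^sub>R v) \<in> borel_measurable borel"
    "(\<lambda>v. v + x) \<in> borel_measurable borel"
    by (intro borel_measurable_continuous_onI continuous_intros)+
  have [measurable]: "K \<in> borel_measurable borel" unfolding K_def by measurable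
  have "(\<integral>\<^sup>+v. K v \<partial>lborel) = (\<integral>\<^sup>+v. K v \<partial>density (distr lborel borel (\<lambda>v. x + t *\<^sub>R v)) (\<lambda>_. ennreal (\<bar>t\<bar> ^ DIM(real^'n))))"
    using lborel_affine[of t x] t by simp
  also have "\<dots> = ennreal (t ^ CARD('n)) * (\<integral>\<^sup>+w. K (x + t *\<^sub>R w) \<partial>lborel)"
    using t by (simp add: nn_integral_density nn_integral_distr nn_integral_cmult)
  also have "(\<integral>\<^sup>+w. K (x + t *\<^sub>R w) \<partial>lborel) = (\<integral>\<^sup>+w. F (x + t *\<^sub>R w) \<partial>torus)"
    unfolding torus_def using t by (subst nn_integral_restrict_space) (auto simp: K_def)
  finally have eq: "(\<integral>\<^sup>+v. K v \<partial>lborel) = ennreal (t ^ CARD('n)) * (\<integral>\<^sup>+w. F (x + t *\<^sub>R w) \<partial>torus)" .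
  have "(\<integral>\<^sup>+v. K v \<partial>lborel) = (\<integral>\<^sup>+v. K (v + x) \<partial>lborel)"
    by (rule nn_integral_lborel_shift[symmetric]) measurable
  also have "\<dots> \<le> (\<integral>\<^sup>+v. F (v + x) * indicator (cbox 0 1) v \<partial>lborel)"
  proof (rule nn_integral_mono)
    fix v :: "real^'n"
    have "v \<in> cbox 0 1" if "(1 / t) *\<^sub>R v \<in> cbox 0 1"
    proof -
      have "0 \<le> v $ i \<and> v $ i \<le> 1" for i
      proof -
        have "0 \<le> v $ i / t" "v $ i / t \<le> 1"
          using that by (simp_all add: mem_box_cart)
        then have "0 \<le> v $ i" "v $ i \<le> t"
          using t by (simp_all add: zero_le_divide_iff divide_le_eq)
        then show ?thesis using t by linarith
      qed
      then show ?thesis by (simp add: mem_box_cart)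
    qed
    then show "K (v + x) \<le> F (v + x) * indicator (cbox 0 1) v"
      by (auto simp: K_def indicator_def)
  qed
  also have "\<dots> = (\<integral>\<^sup>+v. F (v + x) \<partial>torus)"
    unfolding torus_def by (subst nn_integral_restrict_space) auto
  also have "\<dots> = (\<integral>\<^sup>+v. F v \<partial>torus)"
    by (rule nn_integral_torus_shift[OF F per])
  finally have le: "ennreal (t ^ CARD('n)) * (\<integral>\<^sup>+w. F (x + t *\<^sub>R w) \<partial>torus) \<le> (\<integral>\<^sup>+v. F v \<partial>torus)"
    by (simp add: eq)
  have "(\<integral>\<^sup>+w. F (x + t *\<^sub>R w) \<partial>torus)
      = ennreal (1 / t ^ CARD('n)) * (ennreal (t ^ CARD('n)) * (\<integral>\<^sup>+w. F (x + t *\<^sub>R w) \<partial>torus))"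
    using t by (simp flip: mult.assoc ennreal_mult)
  also have "\<dots> \<le> ennreal (1 / t ^ CARD('n)) * (\<integral>\<^sup>+w. F w \<partial>torus)"
    by (intro mult_left_mono le) simp
  finally show ?thesis .
qed

text \<open>Young's inequality in a crude form. With \<mu> of the size of the p-norm it acts as
  Hoelder's inequality, at the price of a factor 2.\<close>

lemma le_scaled_powr:
  fixes u :: real
  assumes "0 < \<mu>" "0 \<le> u" "1 \<le> p"
  shows "u \<le> \<mu> * (1 + (u / \<mu>) powr p)"
proof -
  have "u / \<mu> \<le> 1 + (u / \<mu>) powr p"
    using powr_le_one_plus[of 1 p "u / \<mu>"] assms by simp
  then show ?thesis using assms by (simp add: field_simps)
qed

lemma nn_integral_powr_interval:
  assumes "0 \<le> \<alpha>" "\<alpha> < 1"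
  shows "(\<integral>\<^sup>+t. ennreal (t powr (- \<alpha>)) \<partial>unit_interval) = ennreal (1 / (1 - \<alpha>))"
proof -
  have "((\<lambda>t. t powr (- \<alpha>)) has_integral (1 powr (- \<alpha> + 1) / (- \<alpha> + 1))) {0..1}"
    using assms by (intro has_integral_powr_from_0) auto
  then have "((\<lambda>t. indicator {0..1} t * t powr (- \<alpha>)) has_integral (1 / (1 - \<alpha>))) UNIV"
    using has_integral_restrict_UNIV[of "{0..1}" "\<lambda>t. t powr (- \<alpha>)"]
    by (simp add: indicator_def of_bool_def if_distrib[where f = "\<lambda>x. x * _"] cong: if_cong)
  then have "(\<integral>\<^sup>+t. ennreal (indicator {0..1} t * t powr (- \<alpha>)) \<partial>lborel) = ennreal (1 / (1 - \<alpha>))"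
    by (intro nn_integral_has_integral_lborel) auto
  moreover have "(\<integral>\<^sup>+t. ennreal (t powr (- \<alpha>)) \<partial>unit_interval) = (\<integral>\<^sup>+t. ennreal (indicator {0..1} t * t powr (- \<alpha>)) \<partial>lborel)"
    unfolding unit_interval_def
    by (subst nn_integral_restrict_space) (auto intro!: nn_integral_cong simp: indicator_def)
  ultimately show ?thesis by simp
qed

text \<open>The average over w of the gradient at x + t w is a mean over a cube of side t, hence at
  most 2 s t powr (- d / p). For p > d this power is integrable at 0, and its integral is the factor
  1 / (1 - d / p).\<close>

theorem morrey_inequality:
  fixes f :: "real^'n \<Rightarrow> 'b::euclidean_space"
  assumes f: "f \<in> Lp 1" and g: "\<And>i. g i \<in> Lp 1" "\<And>i. weak_partial i f (g i)"
    and p: "real CARD('n) < p" and s: "0 < s"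
    and bound: "(\<integral>\<^sup>+x. ennreal ((\<Sum>i\<in>UNIV. norm (g i x)) powr p) \<partial>torus) \<le> ennreal (s powr p)"
  shows "AE x in torus. norm (f x - (LINT y|torus. f y)) \<le> 2 * s / (1 - real CARD('n) / p)"
proof -
  let ?d = "real CARD('n)"
  define G where "G x = (\<Sum>i\<in>UNIV. norm (g i x))" for x
  have p1: "1 \<le> p" "0 < p" using p zero_less_card_finite[where 'a = 'n] by linarith+
  have G0: "0 \<le> G x" for x by (simp add: G_def sum_nonneg)
  have Gm [measurable]: "G \<in> borel_measurable borel"
    using LpD(2)[OF g(1)] unfolding G_def[abs_def] by auto
  have perG: "periodic (\<lambda>x. ennreal (G x powr p))"
    using LpD(1)[OF g(1)] by (simp add: G_def periodic_def)
  have slice: "(\<integral>\<^sup>+w. ennreal (G (x + t *\<^sub>R w)) \<partial>torus) \<le> ennreal (2 * s * t powr (- (?d / p)))"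
    if t: "0 < t" "t \<le> 1" for x t
  proof -
    \<comment> \<open>A bound for the p-norm of the rescaled function: by
      \<open>nn_integral_torus_scaled\<close> the integral of the p-th power grows at most by the
      factor \<open>1 / t ^ CARD('n)\<close>.\<close>
    define \<mu> where "\<mu> = s * t powr (- (?d / p))"
    have \<mu>: "0 < \<mu>" using s t by (simp add: \<mu>_def)
    have \<mu>p: "\<mu> powr p = s powr p / t ^ CARD('n)"
    proof -
      have "(t powr (- (?d / p))) powr p = 1 / t ^ CARD('n)"
      proof -
        have "(t powr (- (?d / p))) powr p = t powr (- ?d)"
          using p1 by (simp only: powr_powr) simp
        then show ?thesis
          using t by (simp add: powr_minus powr_realpow divide_inverse)
      qed
      then show ?thesis using s t by (simp add: \<mu>_def powr_mult)
    qed
    have [measurable]: "(\<lambda>w. G (x + t *\<^sub>R w)) \<in> borel_measurable torus"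
    proof (rule measurable_torus)
      have "(\<lambda>w. x + t *\<^sub>R w) \<in> borel_measurable borel"
        by (intro borel_measurable_continuous_onI continuous_intros)
      from measurable_compose[OF this Gm] show "(\<lambda>w. G (x + t *\<^sub>R w)) \<in> borel_measurable borel" .
    qed
    have "(\<integral>\<^sup>+w. ennreal (G (x + t *\<^sub>R w)) \<partial>torus)
        \<le> (\<integral>\<^sup>+w. ennreal \<mu> * (1 + ennreal (1 / \<mu> powr p) * ennreal (G (x + t *\<^sub>R w) powr p)) \<partial>torus)"
    proof (rule nn_integral_mono)
      fix w
      have "G (x + t *\<^sub>R w) \<le> \<mu> * (1 + (1 / \<mu> powr p) * G (x + t *\<^sub>R w) powr p)"
        using le_scaled_powr[OF \<mu> G0 p1(1), of "x + t *\<^sub>R w"] \<mu> G0 by (simp add: powr_divide)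
      then have "ennreal (G (x + t *\<^sub>R w)) \<le> ennreal (\<mu> * (1 + (1 / \<mu> powr p) * G (x + t *\<^sub>R w) powr p))"
        by (rule ennreal_leI)
      also have "\<dots> = ennreal \<mu> * (1 + ennreal (1 / \<mu> powr p) * ennreal (G (x + t *\<^sub>R w) powr p))"
      proof -
        have "ennreal (1 / \<mu> powr p) * ennreal (G (x + t *\<^sub>R w) powr p) = ennreal (G (x + t *\<^sub>R w) powr p / \<mu> powr p)"
          by (simp flip: ennreal_mult)
        then show ?thesis using \<mu> by (simp add: ennreal_mult)
      qed
      finally show "ennreal (G (x + t *\<^sub>R w)) \<le> ennreal \<mu> * (1 + ennreal (1 / \<mu> powr p) * ennreal (G (x + t *\<^sub>R w) powr p))" .
    qed
    also have "\<dots> = ennreal \<mu> * (1 + ennreal (1 / \<mu> powr p) * (\<integral>\<^sup>+w. ennreal (G (x + t *\<^sub>R w) powr p) \<partial>torus))"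
      by (simp add: nn_integral_cmult nn_integral_add torus.emeasure_space_1)
    also have "\<dots> \<le> ennreal \<mu> * (1 + ennreal (1 / \<mu> powr p) * (ennreal (1 / t ^ CARD('n)) * ennreal (s powr p)))"
    proof (intro mult_left_mono add_left_mono)
      have "(\<integral>\<^sup>+w. ennreal (G (x + t *\<^sub>R w) powr p) \<partial>torus) \<le> ennreal (1 / t ^ CARD('n)) * (\<integral>\<^sup>+w. ennreal (G w powr p) \<partial>torus)"
        using t by (intro nn_integral_torus_scaled perG) measurable
      also have "\<dots> \<le> ennreal (1 / t ^ CARD('n)) * ennreal (s powr p)"
        using bound by (intro mult_left_mono) (auto simp: G_def)
      finally show "(\<integral>\<^sup>+w. ennreal (G (x + t *\<^sub>R w) powr p) \<partial>torus) \<le> ennreal (1 / t ^ CARD('n)) * ennreal (s powr p)" .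
    qed simp_all
    also have "\<dots> = ennreal (\<mu> * (1 + (1 / \<mu> powr p) * (1 / t ^ CARD('n) * s powr p)))"
    proof -
      have "ennreal (1 / \<mu> powr p) * (ennreal (1 / t ^ CARD('n)) * ennreal (s powr p)) = ennreal ((1 / \<mu> powr p) * (1 / t ^ CARD('n) * s powr p))"
        using t by (simp flip: ennreal_mult)
      then show ?thesis using \<mu> t by (simp add: ennreal_mult)
    qed
    also have "\<mu> * (1 + (1 / \<mu> powr p) * (1 / t ^ CARD('n) * s powr p)) = 2 * s * t powr (- (?d / p))"
      using s t by (simp add: \<mu>p) (simp add: \<mu>_def)
    finally show ?thesis .
  qed
  show ?thesis
    using mean_oscillation_bound[OF f g]
  proof eventually_elim
    case (elim x)
    have "(\<lambda>(t, w). ennreal (G (x + t *\<^sub>R w))) \<in> borel_measurable (unit_interval \<Otimes>\<^sub>M torus)"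
    proof (rule measurable_interval_torus)
      have "(\<lambda>z :: real \<times> (real^'n). x + fst z *\<^sub>R snd z) \<in> borel_measurable borel"
        by (intro borel_measurable_continuous_onI continuous_intros)
      from measurable_compose[OF this Gm]
      show "(\<lambda>(t, w). ennreal (G (x + t *\<^sub>R w))) \<in> borel_measurable borel"
        by (simp add: case_prod_beta')
    qed
    from interval_torus.Fubini'[OF this]
    have "ennreal (norm (f x - (LINT y|torus. f y))) \<le> (\<integral>\<^sup>+t. (\<integral>\<^sup>+w. ennreal (G (x + t *\<^sub>R w)) \<partial>torus) \<partial>unit_interval)"
      using elim by (simp add: G_def)
    also have "\<dots> \<le> (\<integral>\<^sup>+t. ennreal (2 * s) * ennreal (t powr (- (?d / p))) \<partial>unit_interval)"
    proof (rule nn_integral_mono_AE)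
      have "AE t in unit_interval. t \<noteq> 0"
        using AE_lborel_singleton[of "0::real"] unfolding unit_interval_def
        by (subst AE_restrict_space_iff) (auto elim: eventually_mono)
      then show "AE t in unit_interval. (\<integral>\<^sup>+w. ennreal (G (x + t *\<^sub>R w)) \<partial>torus) \<le> ennreal (2 * s) * ennreal (t powr (- (?d / p)))"
        using AE_space
      proof eventually_elim
        case (elim t)
        then show ?case
          using slice[of t x] s by (simp add: unit_interval_def space_restrict_space ennreal_mult)
      qed
    qed
    also have "\<dots> = ennreal (2 * s) * ennreal (1 / (1 - ?d / p))"
      using p p1 by (subst nn_integral_cmult) (auto simp: nn_integral_powr_interval intro!: measurable_unit_interval)
    also have "\<dots> = ennreal (2 * s / (1 - ?d / p))"
      using s p p1 by (simp flip: ennreal_mult)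
    finally show ?case
      using s p p1 by (simp add: ennreal_le_iff)
  qed
qed

section \<open>Square-integrable functions\<close>

text \<open>Square integrability over an arbitrary measure. Segment averages and pointwise
  combinations of derivatives are known to be measurable on \<open>torus\<close>, and this is all
  that is asked of a member.\<close>

definition L2 :: "'a measure \<Rightarrow> ('a \<Rightarrow> 'b::euclidean_space) set" where
  "L2 M = {f. f \<in> borel_measurable M \<and> integrable M (\<lambda>x. (norm (f x))\<^sup>2)}"

lemma L2D: "f \<in> L2 M \<Longrightarrow> f \<in> borel_measurable M" "f \<in> L2 M \<Longrightarrow> integrable M (\<lambda>x. (norm (f x))\<^sup>2)"
  by (auto simp: L2_def)

lemma L2I_bound:
  assumes "f \<in> borel_measurable M" "integrable M h" "AE x in M. (norm (f x))\<^sup>2 \<le> h x"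
  shows "f \<in> L2 M"
proof -
  have "integrable M (\<lambda>x. (norm (f x))\<^sup>2)"
    using assms(1) by (rule_tac Bochner_Integration.integrable_bound[OF assms(2)]) (auto intro: eventually_mono[OF assms(3)])
  then show ?thesis using assms(1) by (simp add: L2_def)
qed

lemma norm_add_square_le: "(norm (x + y))\<^sup>2 \<le> 2 * (norm x)\<^sup>2 + 2 * (norm (y :: 'b::real_normed_vector))\<^sup>2"
proof -
  have "(norm (x + y))\<^sup>2 \<le> (norm x + norm y)\<^sup>2"
    by (intro power_mono norm_triangle_ineq) simp
  also have "\<dots> \<le> 2 * (norm x)\<^sup>2 + 2 * (norm y)\<^sup>2"
    using sum_squares_bound[of "norm x" "norm y"] by (simp add: power2_sum)
  finally show ?thesis .
qed

lemma L2_add: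
  assumes "f \<in> L2 M" "g \<in> L2 M"
  shows "(\<lambda>x. f x + g x) \<in> L2 M"
proof (rule L2I_bound)
  show "integrable M (\<lambda>x. 2 * (norm (f x))\<^sup>2 + 2 * (norm (g x))\<^sup>2)"
    using L2D(2)[OF assms(1)] L2D(2)[OF assms(2)] by simp
  show "(\<lambda>x. f x + g x) \<in> borel_measurable M"
    using L2D(1)[OF assms(1)] L2D(1)[OF assms(2)] by simp
qed (simp add: norm_add_square_le)

lemma L2_bounded_linear:
  assumes "bounded_linear T" "f \<in> L2 M"
  shows "(\<lambda>x. T (f x)) \<in> L2 M"
proof -
  obtain K where K: "0 < K" "\<And>x. norm (T x) \<le> norm x * K"
    using bounded_linear.pos_bounded[OF assms(1)] by auto
  show ?thesis
  proof (rule L2I_bound)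
    show "(\<lambda>x. T (f x)) \<in> borel_measurable M"
      by (rule borel_measurable_continuous_on[OF linear_continuous_on[OF assms(1)] L2D(1)[OF assms(2)]])
    show "integrable M (\<lambda>x. (norm (f x))\<^sup>2 * K\<^sup>2)" using L2D[OF assms(2)] by simp
    have "(norm (T (f x)))\<^sup>2 \<le> (norm (f x) * K)\<^sup>2" for x
      using K by (intro power_mono) auto
    then show "AE x in M. (norm (T (f x)))\<^sup>2 \<le> (norm (f x))\<^sup>2 * K\<^sup>2"
      by (simp add: power_mult_distrib)
  qed
qed

lemma L2_diff: "f \<in> L2 M \<Longrightarrow> g \<in> L2 M \<Longrightarrow> (\<lambda>x. f x - g x) \<in> L2 M"
  using L2_add[OF _ L2_bounded_linear[OF bounded_linear_minus[OF bounded_linear_ident]], of f M g] by simp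

lemma integrable_bounded_bilinear_L2:
  assumes "bounded_bilinear P" "f \<in> L2 M" "g \<in> L2 M"
  shows "integrable M (\<lambda>x. P (f x) (g x) :: 'c::euclidean_space)"
proof -
  obtain K where K: "0 < K" "\<And>a b. norm (P a b) \<le> norm a * norm b * K"
    using bounded_bilinear.pos_bounded[OF assms(1)] by auto
  show ?thesis
  proof (rule Bochner_Integration.integrable_bound)
    show "integrable M (\<lambda>x. ((norm (f x))\<^sup>2 + (norm (g x))\<^sup>2) * K)"
      using L2D(2)[OF assms(2)] L2D(2)[OF assms(3)] by simp
    have "continuous_on UNIV (\<lambda>z. P (fst z) (snd z))"
      by (intro bounded_bilinear.continuous_on[OF assms(1)] continuous_intros)
    then show "(\<lambda>x. P (f x) (g x)) \<in> borel_measurable M"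
      by (rule borel_measurable_continuous_Pair[OF L2D(1)[OF assms(2)] L2D(1)[OF assms(3)]])
    show "AE x in M. norm (P (f x) (g x)) \<le> norm (((norm (f x))\<^sup>2 + (norm (g x))\<^sup>2) * K)"
    proof (rule AE_I2)
      fix x
      have "norm (f x) * norm (g x) \<le> (norm (f x))\<^sup>2 + (norm (g x))\<^sup>2"
      proof -
        have "0 \<le> norm (f x) * norm (g x)" by simp
        moreover have "2 * (norm (f x) * norm (g x)) \<le> (norm (f x))\<^sup>2 + (norm (g x))\<^sup>2"
          using sum_squares_bound[of "norm (f x)" "norm (g x)"] by (simp only: mult.assoc)
        ultimately show ?thesis by linarith
      qed
      then have "norm (f x) * norm (g x) * K \<le> ((norm (f x))\<^sup>2 + (norm (g x))\<^sup>2) * K"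
        using K(1) by (intro mult_right_mono) auto
      then have "norm (P (f x) (g x)) \<le> ((norm (f x))\<^sup>2 + (norm (g x))\<^sup>2) * K"
        by (rule order.trans[OF K(2)])
      then show "norm (P (f x) (g x)) \<le> norm (((norm (f x))\<^sup>2 + (norm (g x))\<^sup>2) * K)"
        unfolding real_norm_def by (rule order.trans[OF _ abs_ge_self])
    qed
  qed
qed

lemma integral_inner_L2_le:
  assumes "f \<in> L2 M" "g \<in> L2 M"
  shows "\<bar>LINT x|M. f x \<bullet> g x\<bar> \<le> sqrt (LINT x|M. (norm (f x))\<^sup>2) * sqrt (LINT x|M. (norm (g x))\<^sup>2)"
proof -
  let ?a = "LINT x|M. (norm (f x))\<^sup>2" and ?b = "LINT x|M. (norm (g x))\<^sup>2"
  have nn: "(\<integral>\<^sup>+x. (ennreal (norm (h x)))\<^sup>2 \<partial>M) = ennreal (LINT x|M. (norm (h x))\<^sup>2)" if "h \<in> L2 M" for h :: "'a \<Rightarrow> 'b"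
    using nn_integral_eq_integral[OF L2D(2)[OF that]] by (simp add: ennreal_power)
  have "ennreal \<bar>LINT x|M. f x \<bullet> g x\<bar> \<le> (\<integral>\<^sup>+x. ennreal (norm (f x \<bullet> g x)) \<partial>M)"
    using norm_integral_le_nn_integral[of M "\<lambda>x. f x \<bullet> g x"] by simp
  also have "\<dots> \<le> (\<integral>\<^sup>+x. ennreal (norm (f x)) * ennreal (norm (g x)) \<partial>M)"
    by (intro nn_integral_mono) (auto simp flip: ennreal_mult intro!: ennreal_leI Cauchy_Schwarz_ineq2)
  finally have "(ennreal \<bar>LINT x|M. f x \<bullet> g x\<bar>)\<^sup>2 \<le> (\<integral>\<^sup>+x. ennreal (norm (f x)) * ennreal (norm (g x)) \<partial>M)\<^sup>2"
    by (intro power_mono) auto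
  also have "\<dots> \<le> (\<integral>\<^sup>+x. (ennreal (norm (f x)))\<^sup>2 \<partial>M) * (\<integral>\<^sup>+x. (ennreal (norm (g x)))\<^sup>2 \<partial>M)"
    using L2D(1)[OF assms(1)] L2D(1)[OF assms(2)] by (intro Cauchy_Schwarz_nn_integral) auto
  also have "\<dots> = ennreal (?a * ?b)"
    by (simp add: nn assms ennreal_mult)
  finally have "\<bar>LINT x|M. f x \<bullet> g x\<bar>\<^sup>2 \<le> ?a * ?b"
    by (simp add: ennreal_power)
  then have "sqrt (\<bar>LINT x|M. f x \<bullet> g x\<bar>\<^sup>2) \<le> sqrt (?a * ?b)"
    by (rule real_sqrt_le_mono)
  then show ?thesis by (simp add: real_sqrt_mult)
qed

text \<open>Both factors vary with n, so the product is expanded around the limits into three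
  pieces, each of which is small by Cauchy-Schwarz.\<close>

lemma integral_inner_tendsto_L2:
  fixes A B :: "nat \<Rightarrow> 'a \<Rightarrow> 'b::euclidean_space"
  assumes L2: "\<And>n. A n \<in> L2 M" "\<And>n. B n \<in> L2 M" "a \<in> L2 M" "b \<in> L2 M"
    and lim: "(\<lambda>n. LINT x|M. (norm (A n x - a x))\<^sup>2) \<longlonglongrightarrow> 0" "(\<lambda>n. LINT x|M. (norm (B n x - b x))\<^sup>2) \<longlonglongrightarrow> 0"
  shows "(\<lambda>n. LINT x|M. A n x \<bullet> B n x) \<longlonglongrightarrow> (LINT x|M. a x \<bullet> b x)"
proof -
  have int: "integrable M (\<lambda>x. f x \<bullet> g x)" if "f \<in> L2 M" "g \<in> L2 M" for f g :: "'a \<Rightarrow> 'b"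
    using that by (rule integrable_bounded_bilinear_L2[OF bounded_bilinear_inner])
  have dL2: "(\<lambda>x. A n x - a x) \<in> L2 M" "(\<lambda>x. B n x - b x) \<in> L2 M" for n
    using L2 by (auto intro: L2_diff)
  define \<alpha> where "\<alpha> n = sqrt (LINT x|M. (norm (A n x - a x))\<^sup>2)" for n
  define \<beta> where "\<beta> n = sqrt (LINT x|M. (norm (B n x - b x))\<^sup>2)" for n
  have \<alpha>: "\<alpha> \<longlonglongrightarrow> 0" and \<beta>: "\<beta> \<longlonglongrightarrow> 0"
    unfolding \<alpha>_def[abs_def] \<beta>_def[abs_def] using tendsto_real_sqrt[OF lim(1)] tendsto_real_sqrt[OF lim(2)] by simp_all
  have "(\<lambda>n. (LINT x|M. A n x \<bullet> B n x) - (LINT x|M. a x \<bullet> b x)) \<longlonglongrightarrow> 0"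
  proof (rule Lim_null_comparison)
    show "\<forall>\<^sub>F n in sequentially. norm ((LINT x|M. A n x \<bullet> B n x) - (LINT x|M. a x \<bullet> b x))
        \<le> \<alpha> n * \<beta> n + \<alpha> n * sqrt (LINT x|M. (norm (b x))\<^sup>2) + sqrt (LINT x|M. (norm (a x))\<^sup>2) * \<beta> n"
    proof (intro always_eventually allI)
      fix n
      have "(LINT x|M. A n x \<bullet> B n x) - (LINT x|M. a x \<bullet> b x) = (LINT x|M. A n x \<bullet> B n x - a x \<bullet> b x)"
        using int[OF L2(1)[of n] L2(2)[of n]] int[OF L2(3,4)] by (intro Bochner_Integration.integral_diff[symmetric])
      also have "\<dots> = (LINT x|M. ((A n x - a x) \<bullet> (B n x - b x) + (A n x - a x) \<bullet> b x) + a x \<bullet> (B n x - b x))"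
        by (simp add: algebra_simps)
      also have "\<dots> = (LINT x|M. (A n x - a x) \<bullet> (B n x - b x)) + (LINT x|M. (A n x - a x) \<bullet> b x) + (LINT x|M. a x \<bullet> (B n x - b x))"
        using int[OF dL2(1)[of n] dL2(2)[of n]] int[OF dL2(1)[of n] L2(4)] int[OF L2(3) dL2(2)[of n]]
        by (simp only: Bochner_Integration.integral_add Bochner_Integration.integrable_add)
      finally show "norm ((LINT x|M. A n x \<bullet> B n x) - (LINT x|M. a x \<bullet> b x))
        \<le> \<alpha> n * \<beta> n + \<alpha> n * sqrt (LINT x|M. (norm (b x))\<^sup>2) + sqrt (LINT x|M. (norm (a x))\<^sup>2) * \<beta> n"
        using integral_inner_L2_le[OF dL2(1)[of n] dL2(2)[of n]] integral_inner_L2_le[OF dL2(1)[of n] L2(4)]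
          integral_inner_L2_le[OF L2(3) dL2(2)[of n]]
        unfolding \<alpha>_def \<beta>_def by (simp only: real_norm_def)
    qed
    have "(\<lambda>n. \<alpha> n * \<beta> n + \<alpha> n * sqrt (LINT x|M. (norm (b x))\<^sup>2) + sqrt (LINT x|M. (norm (a x))\<^sup>2) * \<beta> n)
        \<longlonglongrightarrow> 0 * 0 + 0 * sqrt (LINT x|M. (norm (b x))\<^sup>2) + sqrt (LINT x|M. (norm (a x))\<^sup>2) * 0"
      by (intro tendsto_intros \<alpha> \<beta>)
    then show "(\<lambda>n. \<alpha> n * \<beta> n + \<alpha> n * sqrt (LINT x|M. (norm (b x))\<^sup>2) + sqrt (LINT x|M. (norm (a x))\<^sup>2) * \<beta> n) \<longlonglongrightarrow> 0"
      by simp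
  qed
  then show ?thesis by (rule LIM_zero_cancel)
qed

lemma Lp_2_iff_L2: "f \<in> Lp 2 \<longleftrightarrow> periodic f \<and> f \<in> borel_measurable borel \<and> f \<in> L2 torus"
  by (auto simp: Lp_def L2_def intro: measurable_torus)

lemma Lp_imp_L2: "f \<in> Lp p \<Longrightarrow> 2 \<le> p \<Longrightarrow> f \<in> L2 torus"
  using Lp_mono[of f p 2] by (simp add: Lp_2_iff_L2)

subsection \<open>Continuity of translations\<close>

text \<open>Truncation by the nearest point of a large ball. The ball contains 0, so the error is at
  most the norm of f, and at each x it vanishes once the ball contains f x; dominated convergence
  applies.\<close>

lemma L2_approx_bounded:
  fixes f :: "real^'n \<Rightarrow> 'b::euclidean_space"
  assumes f: "f \<in> Lp 2" and e: "0 < e"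
  obtains M where "0 < M" "(LINT x|torus. (norm (f x - closest_point (cball 0 M) (f x)))\<^sup>2) \<le> e"
proof -
  define \<pi> where "\<pi> k = closest_point (cball 0 (real (Suc k)) :: 'b set)" for k
  have cont: "continuous_on UNIV (\<pi> k)" for k
    unfolding \<pi>_def by (intro continuous_on_closest_point) auto
  have "(\<lambda>k. LINT x|torus. (norm (f x - \<pi> k (f x)))\<^sup>2) \<longlonglongrightarrow> (LINT x|torus. (0 :: real) * norm (f x))"
  proof (rule integral_dominated_convergence)
    show "integrable torus (\<lambda>x. (norm (f x))\<^sup>2)" using f by (simp add: Lp_2_iff_L2 L2_def)
    show "(\<lambda>x. (norm (f x - \<pi> k (f x)))\<^sup>2) \<in> borel_measurable torus" for k
      using LpD(4)[OF f] borel_measurable_continuous_on[OF cont LpD(4)[OF f], of k] by simp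
    show "(\<lambda>x. 0 * norm (f x)) \<in> borel_measurable torus" by simp
    show "AE x in torus. (\<lambda>k. (norm (f x - \<pi> k (f x)))\<^sup>2) \<longlonglongrightarrow> 0 * norm (f x)"
    proof (rule AE_I2)
      fix x
      have "\<forall>\<^sub>F k in sequentially. (norm (f x - \<pi> k (f x)))\<^sup>2 = 0"
      proof (rule eventually_sequentiallyI)
        fix k assume "nat \<lceil>norm (f x)\<rceil> \<le> k"
        then have "norm (f x) \<le> real (Suc k)" by linarith
        then show "(norm (f x - \<pi> k (f x)))\<^sup>2 = 0" by (simp add: \<pi>_def closest_point_self)
      qed
      then show "(\<lambda>k. (norm (f x - \<pi> k (f x)))\<^sup>2) \<longlonglongrightarrow> 0 * norm (f x)"
        by (simp add: tendsto_eventually)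
    qed
    show "AE x in torus. norm ((norm (f x - \<pi> k (f x)))\<^sup>2) \<le> (norm (f x))\<^sup>2" for k
    proof (rule AE_I2)
      fix x
      have "dist (f x) (\<pi> k (f x)) \<le> dist (f x) 0"
        unfolding \<pi>_def by (intro closest_point_le) auto
      then show "norm ((norm (f x - \<pi> k (f x)))\<^sup>2) \<le> (norm (f x))\<^sup>2"
        by (simp add: dist_norm power_mono)
    qed
  qed
  then have "\<forall>\<^sub>F k in sequentially. (LINT x|torus. (norm (f x - \<pi> k (f x)))\<^sup>2) < e"
    using e by (intro order_tendstoD(2)) auto
  then obtain k where "(LINT x|torus. (norm (f x - \<pi> k (f x)))\<^sup>2) < e"
    by (auto simp: eventually_sequentially)
  then show ?thesis
    by (intro that[of "real (Suc k)"]) (auto simp: \<pi>_def less_imp_le)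
qed

text \<open>A Lebesgue measurable function is almost everywhere a limit of continuous ones.
  Projecting these to the ball as well makes them uniformly bounded, hence convergent in mean square
  on bounded cubes. Since h is not known to be periodic, the estimate is made on a cube that
  contains all small translates of the unit cube.\<close>

lemma bounded_approx_continuous:
  fixes f :: "real^'n \<Rightarrow> 'b::euclidean_space"
  assumes f: "f \<in> borel_measurable borel" and M: "0 < M" and e: "0 < e"
  obtains h where "continuous_on UNIV h"
    "(\<integral>\<^sup>+x. (ennreal (norm (closest_point (cball 0 M) (f x) - h x)))\<^sup>2 * indicator (cbox (- 1) 2) x \<partial>lborel) \<le> ennreal e"
proof -
  define \<pi> where "\<pi> = closest_point (cball 0 M :: 'b set)"
  have cont: "continuous_on UNIV \<pi>"
    unfolding \<pi>_def using M by (intro continuous_on_closest_point) auto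
  have \<pi>M: "norm (\<pi> y) \<le> M" for y
    using closest_point_in_set[of "cball 0 M" y] M by (simp add: \<pi>_def)
  have "f measurable_on UNIV"
    using f by (intro lebesgue_measurable_imp_measurable_on measurable_completion) simp_all
  then obtain N g where N: "negligible N" and g: "\<And>n. continuous_on UNIV (g n)"
    and lim: "\<And>x. x \<notin> N \<Longrightarrow> (\<lambda>n. g n x) \<longlonglongrightarrow> f x"
    by (auto simp: measurable_on_def)
  have h: "continuous_on UNIV (\<lambda>x. \<pi> (g n x))" for n
    using cont g by (rule continuous_on_compose2) simp
  let ?K = "cbox (- 1) 2 :: (real^'n) set"
  have AE: "AE x in lborel. x \<notin> N"
    using AE_not_in[of N lebesgue] N by (simp add: negligible_iff_null_sets AE_completion_iff)
  have "(\<lambda>n. LINT x|lborel. (norm (\<pi> (f x) - \<pi> (g n x)))\<^sup>2 * indicator ?K x) \<longlonglongrightarrow> (LINT x|lborel. (0::real) * norm (f x))"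
  proof (rule integral_dominated_convergence)
    show "integrable lborel (\<lambda>x. (2 * M)\<^sup>2 * indicator ?K x :: real)"
      by (intro integrable_mult_right integrable_real_indicator) (simp_all add: emeasure_lborel_cbox_finite[unfolded infinity_ennreal_def])
    show "(\<lambda>x. 0 * norm (f x)) \<in> borel_measurable lborel" by simp
    show "(\<lambda>x. (norm (\<pi> (f x) - \<pi> (g n x)))\<^sup>2 * indicator ?K x) \<in> borel_measurable lborel" for n
      using borel_measurable_continuous_on[OF cont f] borel_measurable_continuous_onI[OF h[of n]] by simp
    show "AE x in lborel. (\<lambda>n. (norm (\<pi> (f x) - \<pi> (g n x)))\<^sup>2 * indicator ?K x) \<longlonglongrightarrow> 0 * norm (f x)"
      using AE
    proof eventually_elim
      case (elim x)
      have "(\<lambda>n. \<pi> (g n x)) \<longlonglongrightarrow> \<pi> (f x)"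
        using cont by (intro continuous_on_tendsto_compose[OF cont lim[OF elim]]) auto
      then have "(\<lambda>n. (norm (\<pi> (f x) - \<pi> (g n x)))\<^sup>2 * indicator ?K x) \<longlonglongrightarrow> (norm (\<pi> (f x) - \<pi> (f x)))\<^sup>2 * indicator ?K x"
        by (intro tendsto_intros)
      then show ?case by simp
    qed
    show "AE x in lborel. norm ((norm (\<pi> (f x) - \<pi> (g n x)))\<^sup>2 * indicator ?K x) \<le> (2 * M)\<^sup>2 * indicator ?K x" for n
    proof (rule AE_I2)
      fix x
      have "norm (\<pi> (f x) - \<pi> (g n x)) \<le> 2 * M"
        using norm_triangle_ineq4[of "\<pi> (f x)" "\<pi> (g n x)"] \<pi>M[of "f x"] \<pi>M[of "g n x"] by linarith
      then have "(norm (\<pi> (f x) - \<pi> (g n x)))\<^sup>2 \<le> (2 * M)\<^sup>2"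
        by (intro power_mono) auto
      then show "norm ((norm (\<pi> (f x) - \<pi> (g n x)))\<^sup>2 * indicator ?K x) \<le> (2 * M)\<^sup>2 * indicator ?K x"
        by (simp add: indicator_def)
    qed
  qed
  then have "\<forall>\<^sub>F n in sequentially. (LINT x|lborel. (norm (\<pi> (f x) - \<pi> (g n x)))\<^sup>2 * indicator ?K x) < e"
    using e by (intro order_tendstoD(2)) auto
  then obtain n where n: "(LINT x|lborel. (norm (\<pi> (f x) - \<pi> (g n x)))\<^sup>2 * indicator ?K x) < e"
    by (auto simp: eventually_sequentially)
  have int: "integrable lborel (\<lambda>x. (norm (\<pi> (f x) - \<pi> (g n x)))\<^sup>2 * indicator ?K x)"
  proof (rule Bochner_Integration.integrable_bound)
    show "integrable lborel (\<lambda>x. (2 * M)\<^sup>2 * indicator ?K x :: real)"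
      by (intro integrable_mult_right integrable_real_indicator) (simp_all add: emeasure_lborel_cbox_finite[unfolded infinity_ennreal_def])
    show "(\<lambda>x. (norm (\<pi> (f x) - \<pi> (g n x)))\<^sup>2 * indicator ?K x) \<in> borel_measurable lborel"
      using borel_measurable_continuous_on[OF cont f] borel_measurable_continuous_onI[OF h[of n]] by simp
    show "AE x in lborel. norm ((norm (\<pi> (f x) - \<pi> (g n x)))\<^sup>2 * indicator ?K x) \<le> norm ((2 * M)\<^sup>2 * indicator ?K x)"
    proof (rule AE_I2)
      fix x
      have "norm (\<pi> (f x) - \<pi> (g n x)) \<le> 2 * M"
        using norm_triangle_ineq4[of "\<pi> (f x)" "\<pi> (g n x)"] \<pi>M[of "f x"] \<pi>M[of "g n x"] by linarith
      then have "(norm (\<pi> (f x) - \<pi> (g n x)))\<^sup>2 \<le> (2 * M)\<^sup>2"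
        by (intro power_mono) auto
      then show "norm ((norm (\<pi> (f x) - \<pi> (g n x)))\<^sup>2 * indicator ?K x) \<le> norm ((2 * M)\<^sup>2 * indicator ?K x)"
        by (simp add: indicator_def)
    qed
  qed
  have "(\<integral>\<^sup>+x. (ennreal (norm (\<pi> (f x) - \<pi> (g n x))))\<^sup>2 * indicator ?K x \<partial>lborel)
      = (\<integral>\<^sup>+x. ennreal ((norm (\<pi> (f x) - \<pi> (g n x)))\<^sup>2 * indicator ?K x) \<partial>lborel)"
    by (intro nn_integral_cong) (auto simp: ennreal_power indicator_def)
  also have "\<dots> = ennreal (LINT x|lborel. (norm (\<pi> (f x) - \<pi> (g n x)))\<^sup>2 * indicator ?K x)"
    by (intro nn_integral_eq_integral int) auto
  also have "\<dots> \<le> ennreal e" using n by (intro ennreal_leI) simp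
  finally show ?thesis
    using h[of n] by (intro that[of "\<lambda>x. \<pi> (g n x)"]) (auto simp: \<pi>_def)
qed

text \<open>The increment of f is split through its truncation k and the continuous approximant h.
  The error f - k is periodic and keeps its integral under translation; the translate of k - h is
  estimated on the larger cube; the increment of h is small there by uniform continuity.\<close>

theorem L2_translation_continuous:
  fixes f :: "real^'n \<Rightarrow> 'b::euclidean_space"
  assumes f: "f \<in> Lp 2" and e: "0 < e"
  obtains \<delta> where "0 < \<delta>" "\<And>y. norm y < \<delta> \<Longrightarrow> (\<integral>\<^sup>+x. (ennreal (norm (f (x + y) - f x)))\<^sup>2 \<partial>torus) \<le> ennreal e"
proof -
  \<comment> \<open>Four mean-square errors with weight 8 and the increment of h with weight 4, each
    at most e', add up to 36 e'.\<close>
  define e' where "e' = e / 36"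
  have e': "0 < e'" using e by (simp add: e'_def)
  obtain M where M: "0 < M" and fM: "(LINT x|torus. (norm (f x - closest_point (cball 0 M) (f x)))\<^sup>2) \<le> e'"
    using L2_approx_bounded[OF f e'] by blast
  define k where "k x = closest_point (cball 0 M) (f x)" for x
  have fb: "f \<in> borel_measurable borel" and fp: "periodic f"
    using LpD[OF f] by auto
  obtain h where h: "continuous_on UNIV h"
    and kh: "(\<integral>\<^sup>+x. (ennreal (norm (k x - h x)))\<^sup>2 * indicator (cbox (- 1) 2) x \<partial>lborel) \<le> ennreal e'"
    using bounded_approx_continuous[OF fb M e'] unfolding k_def by blast
  have cont: "continuous_on UNIV (closest_point (cball 0 M :: 'b set))"
    using M by (intro continuous_on_closest_point) auto
  have kb: "k \<in> borel_measurable borel" unfolding k_def by (rule borel_measurable_continuous_on[OF cont fb])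
  have hb: "h \<in> borel_measurable borel" by (rule borel_measurable_continuous_onI[OF h])
  have kp: "periodic k" using fp by (simp add: k_def periodic_def)
  note [measurable] = fb kb hb
  define u where "u x = (ennreal (norm (f x - k x)))\<^sup>2" for x
  define v where "v x = (ennreal (norm (k x - h x)))\<^sup>2" for x
  have um: "u \<in> borel_measurable borel" and vm: "v \<in> borel_measurable borel"
    unfolding u_def[abs_def] v_def[abs_def] by measurable
  have up: "periodic u" using fp kp by (simp add: u_def periodic_def)
  have u_le: "(\<integral>\<^sup>+x. u x \<partial>torus) \<le> ennreal e'"
  proof -
    have "integrable torus (\<lambda>x. (norm (f x - k x))\<^sup>2)"
    proof (rule Bochner_Integration.integrable_bound)
      show "integrable torus (\<lambda>x. (norm (f x))\<^sup>2)" using f by (simp add: Lp_2_iff_L2 L2_def)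
      show "(\<lambda>x. (norm (f x - k x))\<^sup>2) \<in> borel_measurable torus" by (intro measurable_torus) measurable
      have "dist (f x) (k x) \<le> dist (f x) 0" for x
        unfolding k_def using M by (intro closest_point_le) auto
      then show "AE x in torus. norm ((norm (f x - k x))\<^sup>2) \<le> norm ((norm (f x))\<^sup>2)"
        by (auto intro!: AE_I2 power_mono simp: dist_norm)
    qed
    then have "(\<integral>\<^sup>+x. ennreal ((norm (f x - k x))\<^sup>2) \<partial>torus) = ennreal (LINT x|torus. (norm (f x - k x))\<^sup>2)"
      by (rule nn_integral_eq_integral) auto
    then show ?thesis
      using fM by (simp add: u_def ennreal_power k_def ennreal_leI)
  qed
  have uc: "uniformly_continuous_on (cbox (- 1) 2) h"
    by (intro compact_uniformly_continuous continuous_on_subset[OF h] compact_cbox) simp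
  have "0 < sqrt e'" using e' by simp
  from uc[unfolded uniformly_continuous_on_def, rule_format, OF this]
  obtain \<delta>0 where \<delta>0: "0 < \<delta>0"
    and hu: "\<And>x x'. x \<in> cbox (- 1) 2 \<Longrightarrow> x' \<in> cbox (- 1) 2 \<Longrightarrow> dist x' x < \<delta>0 \<Longrightarrow> dist (h x') (h x) < sqrt e'"
    by blast
  show ?thesis
  proof (rule that[of "min \<delta>0 1"])
    show "0 < min \<delta>0 1" using \<delta>0 by simp
    fix y :: "real^'n" assume y: "norm y < min \<delta>0 1"
    have in_K: "x \<in> cbox (- 1) 2" "x + y \<in> cbox (- 1) 2" if "x \<in> cbox 0 1" for x
    proof -
      have "\<bar>y $ i\<bar> < 1" for i using component_le_norm_cart[of y i] y by simp
      then have "-1 \<le> x $ i + y $ i \<and> x $ i + y $ i \<le> 2" for i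
        using that by (simp add: mem_box_cart) (smt (verit, best))
      then show "x + y \<in> cbox (- 1) 2" by (simp add: mem_box_cart)
      show "x \<in> cbox (- 1) 2"
        using that by (simp add: mem_box_cart) (smt (verit, best))
    qed
    have shiftm: "(\<lambda>x. x + y) \<in> borel_measurable borel" by simp
    have v_le: "(\<integral>\<^sup>+x. v x \<partial>torus) \<le> ennreal e'"
    proof -
      have "(\<integral>\<^sup>+x. v x \<partial>torus) = (\<integral>\<^sup>+x. v x * indicator (cbox 0 1) x \<partial>lborel)"
        unfolding torus_def by (subst nn_integral_restrict_space) auto
      also have "\<dots> \<le> (\<integral>\<^sup>+x. v x * indicator (cbox (- 1) 2) x \<partial>lborel)"
        using in_K(1) by (intro nn_integral_mono) (auto simp: indicator_def)
      also have "\<dots> \<le> ennreal e'" using kh by (simp add: v_def)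
      finally show ?thesis .
    qed
    have v_le': "(\<integral>\<^sup>+x. v (x + y) \<partial>torus) \<le> ennreal e'"
    proof -
      have "(\<integral>\<^sup>+x. v (x + y) \<partial>torus) = (\<integral>\<^sup>+x. v (x + y) * indicator (cbox 0 1) x \<partial>lborel)"
        unfolding torus_def by (subst nn_integral_restrict_space) auto
      also have "\<dots> \<le> (\<integral>\<^sup>+x. v (x + y) * indicator (cbox (- 1) 2) (x + y) \<partial>lborel)"
        using in_K(2) by (intro nn_integral_mono) (auto simp: indicator_def)
      also have "\<dots> = (\<integral>\<^sup>+x. v x * indicator (cbox (- 1) 2) x \<partial>lborel)"
        using vm by (intro nn_integral_lborel_shift) simp
      also have "\<dots> \<le> ennreal e'" using kh by (simp add: v_def)
      finally show ?thesis .
    qed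
    have "(\<integral>\<^sup>+x. (ennreal (norm (f (x + y) - f x)))\<^sup>2 \<partial>torus)
        \<le> (\<integral>\<^sup>+x. 8 * (u (x + y) + u x + v (x + y) + v x) + 4 * ennreal e' \<partial>torus)"
    proof (rule nn_integral_mono)
      fix x :: "real^'n" assume "x \<in> space torus"
      then have x: "x \<in> cbox 0 1" by (simp add: space_torus)
      define p1 p2 p3 p4 p5 where "p1 = f (x + y) - k (x + y)" and "p2 = f x - k x"
        and "p3 = k (x + y) - h (x + y)" and "p4 = k x - h x" and "p5 = h (x + y) - h x"
      have "norm p5 < sqrt e'"
        using hu[OF in_K[OF x]] y by (simp add: p5_def dist_norm)
      then have "(norm p5)\<^sup>2 \<le> (sqrt e')\<^sup>2" by (intro power_mono) auto
      then have p5: "(norm p5)\<^sup>2 \<le> e'" using e' by simp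
      have "(norm ((p1 - p2) + ((p3 - p4) + p5)))\<^sup>2 \<le> 2 * (norm (p1 - p2))\<^sup>2 + 2 * (norm ((p3 - p4) + p5))\<^sup>2"
        by (rule norm_add_square_le)
      moreover have "(norm (p1 - p2))\<^sup>2 \<le> 2 * (norm p1)\<^sup>2 + 2 * (norm p2)\<^sup>2" "(norm (p3 - p4))\<^sup>2 \<le> 2 * (norm p3)\<^sup>2 + 2 * (norm p4)\<^sup>2"
        using norm_add_square_le[of p1 "- p2"] norm_add_square_le[of p3 "- p4"] by simp_all
      moreover have "(norm ((p3 - p4) + p5))\<^sup>2 \<le> 2 * (norm (p3 - p4))\<^sup>2 + 2 * (norm p5)\<^sup>2"
        by (rule norm_add_square_le)
      moreover have "(p1 - p2) + ((p3 - p4) + p5) = f (x + y) - f x"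
        by (simp add: p1_def p2_def p3_def p4_def p5_def)
      moreover have "N \<le> 8 * (a + b + c + d) + 4 * e'"
        if "N \<le> 2 * s + 2 * t" "s \<le> 2 * a + 2 * b" "r \<le> 2 * c + 2 * d" "t \<le> 2 * r + 2 * q" "q \<le> e'" "0 \<le> a" "0 \<le> b"
        for N s t a b c d r q :: real
        using that by (simp add: distrib_left)
      ultimately have "(norm (f (x + y) - f x))\<^sup>2
          \<le> 8 * ((norm p1)\<^sup>2 + (norm p2)\<^sup>2 + (norm p3)\<^sup>2 + (norm p4)\<^sup>2) + 4 * e'"
        using p5 by (metis zero_le_power2)
      then show "(ennreal (norm (f (x + y) - f x)))\<^sup>2 \<le> 8 * (u (x + y) + u x + v (x + y) + v x) + 4 * ennreal e'"
      proof -
        assume *: "(norm (f (x + y) - f x))\<^sup>2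
          \<le> 8 * ((norm p1)\<^sup>2 + (norm p2)\<^sup>2 + (norm p3)\<^sup>2 + (norm p4)\<^sup>2) + 4 * e'"
        have "(ennreal (norm (f (x + y) - f x)))\<^sup>2 = ennreal ((norm (f (x + y) - f x))\<^sup>2)"
          by (simp add: ennreal_power)
        also have "\<dots> \<le> ennreal (8 * ((norm p1)\<^sup>2 + (norm p2)\<^sup>2 + (norm p3)\<^sup>2 + (norm p4)\<^sup>2) + 4 * e')"
          using * by (rule ennreal_leI)
        also have "\<dots> = 8 * (u (x + y) + u x + v (x + y) + v x) + 4 * ennreal e'"
          using e' by (simp add: u_def v_def p1_def p2_def p3_def p4_def ennreal_mult ennreal_power)
        finally show ?thesis .
      qed
    qed
    also have "\<dots> = 8 * ((\<integral>\<^sup>+x. u (x + y) \<partial>torus) + (\<integral>\<^sup>+x. u x \<partial>torus)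
        + (\<integral>\<^sup>+x. v (x + y) \<partial>torus) + (\<integral>\<^sup>+x. v x \<partial>torus)) + 4 * ennreal e'"
      using measurable_torus[OF um] measurable_torus[OF vm] measurable_torus[OF measurable_compose[OF shiftm um]]
        measurable_torus[OF measurable_compose[OF shiftm vm]]
      by (simp add: nn_integral_add nn_integral_cmult torus.emeasure_space_1)
    also have "\<dots> \<le> 8 * (ennreal e' + ennreal e' + ennreal e' + ennreal e') + 4 * ennreal e'"
      using u_le v_le v_le' nn_integral_torus_shift[OF um up, of y]
      by (intro add_mono mult_left_mono) auto
    also have "\<dots> = ennreal (8 * (e' + e' + e' + e') + 4 * e')"
      using e' by (simp flip: ennreal_numeral ennreal_mult ennreal_plus)
    also have "\<dots> = ennreal e" by (simp add: e'_def)
    finally show "(\<integral>\<^sup>+x. (ennreal (norm (f (x + y) - f x)))\<^sup>2 \<partial>torus) \<le> ennreal e" .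
  qed
qed


subsection \<open>Symmetry of mixed first derivatives\<close>

text \<open>Cauchy-Schwarz on the unit interval for each x, then Tonelli.\<close>

lemma nn_integral_norm_integral_square_le:
  fixes H :: "real \<Rightarrow> real^'n \<Rightarrow> 'b::euclidean_space"
  assumes H: "(\<lambda>(t, x). H t x) \<in> borel_measurable (unit_interval \<Otimes>\<^sub>M torus)"
  shows "(\<integral>\<^sup>+x. (ennreal (norm (LINT t|unit_interval. H t x)))\<^sup>2 \<partial>torus)
    \<le> (\<integral>\<^sup>+t. (\<integral>\<^sup>+x. (ennreal (norm (H t x)))\<^sup>2 \<partial>torus) \<partial>unit_interval)"
proof -
  have H2: "(\<lambda>(t, x). (ennreal (norm (H t x)))\<^sup>2) \<in> borel_measurable (unit_interval \<Otimes>\<^sub>M torus)"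
    using H by (simp add: case_prod_beta')
  have "(\<integral>\<^sup>+x. (ennreal (norm (LINT t|unit_interval. H t x)))\<^sup>2 \<partial>torus)
      \<le> (\<integral>\<^sup>+x. (\<integral>\<^sup>+t. (ennreal (norm (H t x)))\<^sup>2 \<partial>unit_interval) \<partial>torus)"
  proof (rule nn_integral_mono)
    fix x :: "real^'n" assume "x \<in> space torus"
    from measurable_compose[OF measurable_Pair2'[OF this] H]
    have "(\<lambda>t. H t x) \<in> borel_measurable unit_interval" by simp
    then have "(\<integral>\<^sup>+t. ennreal (norm (H t x)) \<partial>unit_interval)\<^sup>2 \<le> (\<integral>\<^sup>+t. (ennreal (norm (H t x)))\<^sup>2 \<partial>unit_interval)"
      by (intro nn_integral_square_le unit_interval.prob_space_axioms) simp
    moreover have "(ennreal (norm (LINT t|unit_interval. H t x)))\<^sup>2 \<le> (\<integral>\<^sup>+t. ennreal (norm (H t x)) \<partial>unit_interval)\<^sup>2"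
      by (intro power_mono norm_integral_le_nn_integral) simp
    ultimately show "(ennreal (norm (LINT t|unit_interval. H t x)))\<^sup>2 \<le> (\<integral>\<^sup>+t. (ennreal (norm (H t x)))\<^sup>2 \<partial>unit_interval)"
      by (rule order.trans[rotated])
  qed
  also have "\<dots> = (\<integral>\<^sup>+t. (\<integral>\<^sup>+x. (ennreal (norm (H t x)))\<^sup>2 \<partial>torus) \<partial>unit_interval)"
    using interval_torus.Fubini'[of "\<lambda>t x. (ennreal (norm (H t x)))\<^sup>2"] H2 by simp
  finally show ?thesis .
qed

lemma nn_integral_square_eq:
  assumes "f \<in> L2 M"
  shows "(\<integral>\<^sup>+x. (ennreal (norm (f x)))\<^sup>2 \<partial>M) = ennreal (LINT x|M. (norm (f x))\<^sup>2)"
  using nn_integral_eq_integral[OF L2D(2)[OF assms]] by (simp add: ennreal_power)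

lemma L2I_nn:
  assumes "f \<in> borel_measurable M" "(\<integral>\<^sup>+x. (ennreal (norm (f x)))\<^sup>2 \<partial>M) \<le> ennreal c"
  shows "f \<in> L2 M"
proof -
  have "(\<integral>\<^sup>+x. ennreal (norm ((norm (f x))\<^sup>2)) \<partial>M) < \<infinity>"
    using assms(2) by (simp add: ennreal_power le_less_trans[OF _ ennreal_less_top])
  then have "integrable M (\<lambda>x. (norm (f x))\<^sup>2)"
    using assms(1) by (intro integrableI_bounded) auto
  then show ?thesis using assms(1) by (simp add: L2_def)
qed

lemma segment_average_measurable:
  fixes g :: "real^'n \<Rightarrow> 'b::euclidean_space"
  assumes "g \<in> Lp 2"
  shows "(\<lambda>x. LINT t|unit_interval. g (x + t *\<^sub>R w)) \<in> borel_measurable torus"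
    and "AE x in torus. integrable unit_interval (\<lambda>t. g (x + t *\<^sub>R w))"
proof -
  have g1: "g \<in> Lp 1" using Lp_mono[OF assms, of 1] by simp
  have 1: "integrable (unit_interval \<Otimes>\<^sub>M torus) (\<lambda>(t, x). g (x + t *\<^sub>R w))"
    using integrable_segment[OF g1, of "\<lambda>_. 1" 1 w] by simp
  show "(\<lambda>x. LINT t|unit_interval. g (x + t *\<^sub>R w)) \<in> borel_measurable torus"
    using interval_torus.integrable_snd[OF 1] by auto
  show "AE x in torus. integrable unit_interval (\<lambda>t. g (x + t *\<^sub>R w))"
    using interval_torus.AE_integrable_snd[OF 1] by simp
qed

lemma segment_average_L2:
  fixes g :: "real^'n \<Rightarrow> 'b::euclidean_space"
  assumes g: "g \<in> Lp 2"
  shows "(\<lambda>x. LINT t|unit_interval. g (x + t *\<^sub>R w)) \<in> L2 torus"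
proof (rule L2I_nn[OF segment_average_measurable(1)[OF g]])
  have m: "(\<lambda>(t, x). g (x + t *\<^sub>R w)) \<in> borel_measurable (unit_interval \<Otimes>\<^sub>M torus)"
    by (intro measurable_interval_torus segment_measurable LpD[OF g])
  have m2: "(\<lambda>x. (ennreal (norm (g x)))\<^sup>2) \<in> borel_measurable borel" and per: "periodic (\<lambda>x. (ennreal (norm (g x)))\<^sup>2)"
    using LpD[OF g] by (auto simp: periodic_def)
  have "(\<integral>\<^sup>+x. (ennreal (norm (LINT t|unit_interval. g (x + t *\<^sub>R w))))\<^sup>2 \<partial>torus)
      \<le> (\<integral>\<^sup>+t. (\<integral>\<^sup>+x. (ennreal (norm (g (x + t *\<^sub>R w))))\<^sup>2 \<partial>torus) \<partial>unit_interval)"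
    by (rule nn_integral_norm_integral_square_le[OF m])
  also have "\<dots> = (\<integral>\<^sup>+x. (ennreal (norm (g x)))\<^sup>2 \<partial>torus)"
    by (simp add: nn_integral_torus_shift[OF m2 per] unit_interval.emeasure_space_1)
  also have "\<dots> = ennreal (LINT x|torus. (norm (g x))\<^sup>2)"
    using g by (simp add: nn_integral_square_eq Lp_2_iff_L2)
  finally show "(\<integral>\<^sup>+x. (ennreal (norm (LINT t|unit_interval. g (x + t *\<^sub>R w))))\<^sup>2 \<partial>torus)
      \<le> ennreal (LINT x|torus. (norm (g x))\<^sup>2)" .
qed

text \<open>Every point of a short segment is a small translation, so the mean-square distance
  between g and its translates is small uniformly in t, and the average over t inherits the
  bound.\<close>

lemma segment_average_tendsto:
  fixes g :: "real^'n \<Rightarrow> 'b::euclidean_space"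
  assumes g: "g \<in> Lp 2" and w: "w \<longlonglongrightarrow> 0"
  shows "(\<lambda>n. LINT x|torus. (norm ((LINT t|unit_interval. g (x + t *\<^sub>R w n)) - g x))\<^sup>2) \<longlonglongrightarrow> 0"
proof (rule LIMSEQ_I)
  fix e :: real assume e: "0 < e"
  then have "0 < e / 2" by simp
  from L2_translation_continuous[OF g this] obtain \<delta> where \<delta>: "0 < \<delta>"
    and close: "\<And>y. norm y < \<delta> \<Longrightarrow> (\<integral>\<^sup>+x. (ennreal (norm (g (x + y) - g x)))\<^sup>2 \<partial>torus) \<le> ennreal (e / 2)"
    by blast
  obtain N where N: "\<And>n. N \<le> n \<Longrightarrow> norm (w n) < \<delta>"
    using LIMSEQ_D[OF w \<delta>] by auto
  have "norm (LINT x|torus. (norm ((LINT t|unit_interval. g (x + t *\<^sub>R w n)) - g x))\<^sup>2) < e" if n: "N \<le> n" for n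
  proof -
    let ?A = "\<lambda>x. LINT t|unit_interval. g (x + t *\<^sub>R w n)"
    have L2: "(\<lambda>x. ?A x - g x) \<in> L2 torus"
      using segment_average_L2[OF g, of "w n"] g by (intro L2_diff) (auto simp: Lp_2_iff_L2)
    \<comment> \<open>The unshifted term is written with displacement 0 so that it is also an
      instance of \<open>segment_measurable\<close>.\<close>
    have m: "(\<lambda>(t, x). g (x + t *\<^sub>R w n) - g (x + t *\<^sub>R 0)) \<in> borel_measurable (unit_interval \<Otimes>\<^sub>M torus)"
      using measurable_interval_torus[OF segment_measurable[OF LpD(2)[OF g]], of "w n"]
        measurable_interval_torus[OF segment_measurable[OF LpD(2)[OF g]], of 0]
      unfolding case_prod_beta' by (rule borel_measurable_diff)
    have "ennreal (LINT x|torus. (norm (?A x - g x))\<^sup>2) = (\<integral>\<^sup>+x. (ennreal (norm (?A x - g x)))\<^sup>2 \<partial>torus)"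
      using nn_integral_square_eq[OF L2] by simp
    also have "\<dots> = (\<integral>\<^sup>+x. (ennreal (norm (LINT t|unit_interval. g (x + t *\<^sub>R w n) - g (x + t *\<^sub>R 0))))\<^sup>2 \<partial>torus)"
      using segment_average_measurable(2)[OF g, of "w n"]
      by (intro nn_integral_cong_AE, eventually_elim) (simp add: unit_interval.prob_space)
    also have "\<dots> \<le> (\<integral>\<^sup>+t. (\<integral>\<^sup>+x. (ennreal (norm (g (x + t *\<^sub>R w n) - g (x + t *\<^sub>R 0))))\<^sup>2 \<partial>torus) \<partial>unit_interval)"
      by (rule nn_integral_norm_integral_square_le[OF m])
    also have "\<dots> \<le> (\<integral>\<^sup>+t. ennreal (e / 2) \<partial>unit_interval)"
    proof (rule nn_integral_mono)
      fix t assume "t \<in> space unit_interval"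
      then have "\<bar>t\<bar> \<le> 1" by (simp add: unit_interval_def space_restrict_space)
      then have "norm (t *\<^sub>R w n) < \<delta>"
        using N[OF n] mult_left_le_one_le[of "norm (w n)" "\<bar>t\<bar>"] by simp
      then show "(\<integral>\<^sup>+x. (ennreal (norm (g (x + t *\<^sub>R w n) - g (x + t *\<^sub>R 0))))\<^sup>2 \<partial>torus) \<le> ennreal (e / 2)"
        using close by simp
    qed
    also have "\<dots> = ennreal (e / 2)" by (simp add: unit_interval.emeasure_space_1)
    finally have "(LINT x|torus. (norm (?A x - g x))\<^sup>2) \<le> e / 2"
      using e by (simp add: ennreal_le_iff)
    moreover have "0 \<le> (LINT x|torus. (norm (?A x - g x))\<^sup>2)" by simp
    ultimately show ?thesis using e by simp
  qed
  then show "\<exists>N. \<forall>n\<ge>N. norm ((LINT x|torus. (norm ((LINT t|unit_interval. g (x + t *\<^sub>R w n)) - g x))\<^sup>2) - 0) < e"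
    by auto
qed

text \<open>With c y the correlation of u and v at displacement y, the left side is c a - c (a + b)
  - c 0 + c b, which is symmetric in a and b. This is the discrete form of integrating by parts
  twice.\<close>

lemma difference_quotients_symmetric:
  fixes u v :: "real^'n \<Rightarrow> 'b::euclidean_space"
  assumes u: "u \<in> Lp 2" and v: "v \<in> Lp 2"
  shows "(LINT x|torus. (u (x + a) - u x) \<bullet> (v x - v (x - b))) = (LINT x|torus. (u (x + b) - u x) \<bullet> (v x - v (x - a)))"
proof -
  define c where "c y = (LINT x|torus. u (x + y) \<bullet> v x)" for y
  have int: "integrable torus (\<lambda>x. u (x + y) \<bullet> v (x + z))" for y z
    using Lp_shift[OF u, of y] Lp_shift[OF v, of z] unfolding Lp_2_iff_L2
    by (intro integrable_bounded_bilinear_L2[OF bounded_bilinear_inner]) auto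
  have shift: "(LINT x|torus. u (x + y) \<bullet> v (x - z)) = c (y + z)" for y z
  proof -
    have per: "periodic (\<lambda>x. u (x + y) \<bullet> v (x - z))"
      using periodic_comp2[of "\<lambda>x. u (x + y)" "\<lambda>x. v (x + - z)" inner] periodic_shift[OF LpD(1)[OF u], of y] periodic_shift[OF LpD(1)[OF v], of "- z"]
      by simp
    have "(\<lambda>x. u (x + y) \<bullet> v (x - z)) \<in> borel_measurable borel"
      using LpD(2)[OF Lp_shift[OF u, of y]] LpD(2)[OF Lp_shift[OF v, of "- z"]] by simp
    from integral_torus_shift[OF this per, of z] show ?thesis
      by (simp add: c_def add_ac)
  qed
  have "(LINT x|torus. (u (x + a) - u x) \<bullet> (v x - v (x - b))) = c a - c (a + b) - c 0 + c b" for a b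
  proof -
    have "(LINT x|torus. (u (x + a) - u x) \<bullet> (v x - v (x - b)))
        = (LINT x|torus. ((u (x + a) \<bullet> v x - u (x + a) \<bullet> v (x - b)) - u x \<bullet> v x) + u x \<bullet> v (x - b))"
      by (simp add: algebra_simps)
    also have "\<dots> = (LINT x|torus. u (x + a) \<bullet> v x) - (LINT x|torus. u (x + a) \<bullet> v (x - b))
        - (LINT x|torus. u x \<bullet> v x) + (LINT x|torus. u x \<bullet> v (x - b))"
      using int[of a 0] int[of a "- b"] int[of 0 0] int[of 0 "- b"]
      by (simp add: Bochner_Integration.integral_add Bochner_Integration.integral_diff)
    finally show ?thesis
      using shift[of a b] shift[of 0 b] by (simp add: c_def)
  qed
  from this[of a b] this[of b a] show ?thesis by (simp add: add.commute)
qed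

text \<open>For smooth functions one would integrate by parts twice, but here only first derivatives
  are available. Difference quotients satisfy the identity exactly, they are averages of the weak
  derivatives along short segments, and they converge to them in mean square.\<close>

theorem integral_mixed_partials:
  fixes u v :: "real^'n \<Rightarrow> 'b::euclidean_space"
  assumes u: "u \<in> W1p 2" and v: "v \<in> W1p 2"
  shows "(LINT x|torus. wd i u x \<bullet> wd j v x) = (LINT x|torus. wd j u x \<bullet> wd i v x)"
proof -
  have du: "wd k u \<in> Lp 2" and dv: "wd k v \<in> Lp 2" for k
    using u v by (auto intro: W1p_weak_partial)
  define A where "A k h x = (LINT t|unit_interval. wd k u (x + t *\<^sub>R axis k h))" for k and h :: real and x
  \<comment> \<open>The differences of v are taken backwards, as in
    \<open>difference_quotients_symmetric\<close>, so their segments run in the negative axis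
    direction.\<close>
  define B where "B k h x = (LINT t|unit_interval. wd k v (x + t *\<^sub>R - axis k h))" for k and h :: real and x
  have A2: "A k h \<in> L2 torus" and B2: "B k h \<in> L2 torus" for k h
    unfolding A_def[abs_def] B_def[abs_def] by (rule segment_average_L2[OF du], rule segment_average_L2[OF dv])
  have Lp1: "u \<in> Lp 1" "v \<in> Lp 1" "wd k u \<in> Lp 1" "wd k v \<in> Lp 1" for k
    using Lp_mono[OF W1p_Lp[OF u], of 1] Lp_mono[OF W1p_Lp[OF v], of 1] Lp_mono[OF du, of 1] Lp_mono[OF dv, of 1] by auto
  have wp: "weak_partial k u (wd k u)" "weak_partial k v (wd k v)" for k
    using u v by (auto intro: W1p_weak_partial)
  have sum_axis: "(\<Sum>l\<in>UNIV. axis k h $ l *\<^sub>R (f l :: 'b)) = h *\<^sub>R f k" for k :: 'n and h :: real and f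
    by (simp add: axis_def if_distrib[where f = "\<lambda>c. c *\<^sub>R _"] cong: if_cong)
  have quot: "(LINT x|torus. (u (x + axis k h) - u x) \<bullet> (v x - v (x - axis l h))) = h\<^sup>2 * (LINT x|torus. A k h x \<bullet> B l h x)" for k l h
  proof -
    have "AE x in torus. u (x + axis k h) - u x = h *\<^sub>R A k h x"
      using weak_FTC[OF Lp1(1) Lp1(3) wp(1), of "axis k h"] by (simp add: sum_axis A_def)
    moreover have "AE x in torus. v x - v (x - axis l h) = h *\<^sub>R B l h x"
      using weak_FTC[OF Lp1(2) Lp1(4) wp(2), of "- axis l h"]
    proof eventually_elim
      case (elim x)
      have "v (x - axis l h) - v x = - (\<Sum>m\<in>UNIV. axis l h $ m *\<^sub>R (LINT t|unit_interval. wd m v (x + t *\<^sub>R - axis l h)))"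
        using elim by (simp add: sum_negf)
      then have "v (x - axis l h) - v x = - (h *\<^sub>R B l h x)"
        by (simp only: sum_axis B_def)
      then show ?case by (simp add: algebra_simps)
    qed
    ultimately have AE: "AE x in torus. (u (x + axis k h) - u x) \<bullet> (v x - v (x - axis l h)) = h\<^sup>2 * (A k h x \<bullet> B l h x)"
      by eventually_elim (simp add: power2_eq_square)
    have "(LINT x|torus. (u (x + axis k h) - u x) \<bullet> (v x - v (x - axis l h))) = (LINT x|torus. h\<^sup>2 * (A k h x \<bullet> B l h x))"
    proof (rule integral_cong_AE[OF _ _ AE])
      show "(\<lambda>x. (u (x + axis k h) - u x) \<bullet> (v x - v (x - axis l h))) \<in> borel_measurable torus"
        using LpD(4)[OF Lp1(1)] LpD(4)[OF Lp1(2)] LpD(4)[OF Lp_shift[OF Lp1(1), of "axis k h"]] LpD(4)[OF Lp_shift[OF Lp1(2), of "- axis l h"]]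
        by simp
      show "(\<lambda>x. h\<^sup>2 * (A k h x \<bullet> B l h x)) \<in> borel_measurable torus"
        using L2D(1)[OF A2[of k h]] L2D(1)[OF B2[of l h]] by simp
    qed
    then show ?thesis by simp
  qed
  have sym: "(LINT x|torus. A i h x \<bullet> B j h x) = (LINT x|torus. A j h x \<bullet> B i h x)" if "h \<noteq> 0" for h
    using difference_quotients_symmetric[OF W1p_Lp[OF u] W1p_Lp[OF v], of "axis i h" "axis j h"] that
    by (simp add: quot)
  define h where "h n = 1 / real (Suc n)" for n
  have h0: "h n \<noteq> 0" for n by (simp add: h_def)
  have hl: "h \<longlonglongrightarrow> 0" unfolding h_def[abs_def] using LIMSEQ_inverse_real_of_nat by (simp add: inverse_eq_divide)
  have ax: "(\<lambda>n. axis k (h n)) \<longlonglongrightarrow> (0 :: real^'n)" for k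
  proof -
    have "axis k c = c *\<^sub>R axis k (1 :: real)" for c by (simp add: vec_eq_iff axis_def)
    then show ?thesis using tendsto_scaleR[OF hl tendsto_const, of "axis k 1"] by (metis (no_types, lifting) ext scaleR_zero_left)
  qed
  have lim: "(\<lambda>n. LINT x|torus. A k (h n) x \<bullet> B l (h n) x) \<longlonglongrightarrow> (LINT x|torus. wd k u x \<bullet> wd l v x)" for k l
  proof (rule integral_inner_tendsto_L2)
    show "A k (h n) \<in> L2 torus" "B l (h n) \<in> L2 torus" for n using A2 B2 by auto
    show "wd k u \<in> L2 torus" "wd l v \<in> L2 torus" using du dv by (auto simp: Lp_2_iff_L2)
    show "(\<lambda>n. LINT x|torus. (norm (A k (h n) x - wd k u x))\<^sup>2) \<longlonglongrightarrow> 0"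
      unfolding A_def by (rule segment_average_tendsto[OF du ax])
    show "(\<lambda>n. LINT x|torus. (norm (B l (h n) x - wd l v x))\<^sup>2) \<longlonglongrightarrow> 0"
      unfolding B_def using tendsto_minus[OF ax[of l]] by (intro segment_average_tendsto[OF dv]) simp
  qed
  have "(\<lambda>n. LINT x|torus. A i (h n) x \<bullet> B j (h n) x) = (\<lambda>n. LINT x|torus. A j (h n) x \<bullet> B i (h n) x)"
    using sym[OF h0] by (rule ext)
  with lim[of i j] lim[of j i] show ?thesis by (simp add: LIMSEQ_unique)
qed

section \<open>Algebra of su(2)-valued forms\<close>

lemma su2_mk_expand: "su2_mk a b c = a *\<^sub>R su2_mk 1 0 0 + b *\<^sub>R su2_mk 0 1 0 + c *\<^sub>R su2_mk 0 0 1"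
  by transfer (simp add: vec_eq_iff forall_2 complex_eq_iff)

lemma lie_bracket_su2_mk:
  "lie_bracket (su2_mk a b c) (su2_mk a' b' c')
    = su2_mk (2 * (b * c' - c * b')) (2 * (c * a' - a * c')) (2 * (a * b' - b * a'))"
  by transfer (simp add: vec_eq_iff forall_2 complex_eq_iff matrix_matrix_mult_def sum_2 algebra_simps)

text \<open>In coordinates the bracket is twice the cross product and the inner product twice the
  dot product, so this is Lagrange's identity for cross products.\<close>

lemma lie_bracket_inner_lie_bracket:
  "lie_bracket x y \<bullet> lie_bracket z w = 2 * ((x \<bullet> z) * (y \<bullet> w) - (x \<bullet> w) * (y \<bullet> z))"
proof -
  obtain a b c a' b' c' d e f d' e' f' where "x = su2_mk a b c" "y = su2_mk a' b' c'" "z = su2_mk d e f" "w = su2_mk d' e' f'"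
    using su2_mk_surj by metis
  then show ?thesis
    by (simp add: lie_bracket_su2_mk inner_su2_mk algebra_simps)
qed

lemma bilinear_lie_bracket: "bilinear lie_bracket"
proof -
  have "lie_bracket (x + y) z = lie_bracket x z + lie_bracket y z" "lie_bracket z (x + y) = lie_bracket z x + lie_bracket z y"
    "lie_bracket (r *\<^sub>R x) z = r *\<^sub>R lie_bracket x z" "lie_bracket z (r *\<^sub>R x) = r *\<^sub>R lie_bracket z x" for x y z r
    by (transfer, simp add: vec_eq_iff matrix_matrix_mult_def algebra_simps sum.distrib scaleR_sum_right)+
  then show ?thesis by (simp add: bilinear_def linear_iff)
qed

lemma bounded_bilinear_lie_bracket: "bounded_bilinear lie_bracket"
  using bilinear_lie_bracket by (simp add: bilinear_conv_bounded_bilinear)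

interpretation lie_bracket: bounded_bilinear lie_bracket
  by (rule bounded_bilinear_lie_bracket)

lemma lie_bracket_antisym: "lie_bracket x y = - lie_bracket y x"
  by transfer (simp add: vec_eq_iff)

lemma lie_bracket_self [simp]: "lie_bracket x x = 0"
  by transfer (simp add: vec_eq_iff)

subsection \<open>Invariant inner products\<close>

lemma Ad_eqI: "U \<in> SU2 \<Longrightarrow> U ** Rep_su2 x ** herm U = Rep_su2 y \<Longrightarrow> Ad U x = y"
  by (simp add: Ad_def Rep_su2_inverse)

text \<open>As rotations of the coordinates these are the half turns about the first and the second
  axis and the third of a turn about the diagonal, which permutes the axes cyclically.\<close>

lemma SU2_elements:
  defines "U1 \<equiv> vector [vector [\<i>, 0], vector [0, - \<i>]] :: complex^2^2"
    and "U2 \<equiv> vector [vector [0, 1], vector [- 1, 0]] :: complex^2^2"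
    and "U3 \<equiv> vector [vector [Complex (1/2) (1/2), Complex (1/2) (1/2)], vector [Complex (- 1/2) (1/2), Complex (1/2) (- 1/2)]] :: complex^2^2"
  shows "U1 \<in> SU2" "U2 \<in> SU2" "U3 \<in> SU2"
    "Ad U1 (su2_mk a b c) = su2_mk a (- b) (- c)"
    "Ad U2 (su2_mk a b c) = su2_mk (- a) b (- c)"
    "Ad U3 (su2_mk a b c) = su2_mk c a b"
proof -
  show U: "U1 \<in> SU2" "U2 \<in> SU2" "U3 \<in> SU2"
    by (auto simp: SU2_def U1_def U2_def U3_def vec_eq_iff forall_2 matrix_matrix_mult_def sum_2 mat_def det_2 complex_eq_iff)
  show "Ad U1 (su2_mk a b c) = su2_mk a (- b) (- c)"
    by (rule Ad_eqI[OF U(1)])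
      (simp add: U1_def su2_mk.rep_eq vec_eq_iff forall_2 matrix_matrix_mult_def sum_2 complex_eq_iff)
  show "Ad U2 (su2_mk a b c) = su2_mk (- a) b (- c)"
    by (rule Ad_eqI[OF U(2)])
      (simp add: U2_def su2_mk.rep_eq vec_eq_iff forall_2 matrix_matrix_mult_def sum_2 complex_eq_iff)
  show "Ad U3 (su2_mk a b c) = su2_mk c a b"
    by (rule Ad_eqI[OF U(3)])
      (simp add: U3_def su2_mk.rep_eq vec_eq_iff forall_2 matrix_matrix_mult_def sum_2 complex_eq_iff field_simps)
qed

text \<open>Schur's lemma by hand. A half turn reverses the sign of the mixed products of basis
  vectors, which are therefore 0, and the cyclic permutation makes the three squares equal.\<close>

lemma Ad_invariant_inner_product_eq:
  assumes "Ad_invariant_inner_product ip"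
  obtains c where "0 < c" "ip = (\<lambda>x y. c * (x \<bullet> y))"
proof -
  have bil: "bilinear ip" and sym: "\<And>x y. ip x y = ip y x" and pos: "\<And>x. x \<noteq> 0 \<Longrightarrow> 0 < ip x x"
    and inv: "\<And>U x y. U \<in> SU2 \<Longrightarrow> ip (Ad U x) (Ad U y) = ip x y"
    using assms by (auto simp: Ad_invariant_inner_product_def)
  define e1 e2 e3 where "e1 = su2_mk 1 0 0" and "e2 = su2_mk 0 1 0" and "e3 = su2_mk 0 0 1"
  have neg: "su2_mk (- 1) 0 0 = - e1" "su2_mk 0 (- 1) 0 = - e2" "su2_mk 0 0 (- 1) = - e3"
    using su2_mk_expand[of "- 1" 0 0] su2_mk_expand[of 0 "- 1" 0] su2_mk_expand[of 0 0 "- 1"] by (simp_all add: e1_def e2_def e3_def)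
  note lneg = bilinear_lneg[OF bil] and rneg = bilinear_rneg[OF bil]
  have "ip e1 e2 = - ip e1 e2" "ip e1 e3 = - ip e1 e3"
    using inv[OF SU2_elements(1), of e1 e2] inv[OF SU2_elements(1), of e1 e3]
    by (simp_all add: e1_def e2_def e3_def SU2_elements(4)) (simp_all add: neg rneg flip: e1_def e2_def e3_def)
  moreover have "ip e2 e3 = - ip e2 e3"
    using inv[OF SU2_elements(2), of e2 e3]
    by (simp add: e1_def e2_def e3_def SU2_elements(5)) (simp_all add: neg rneg flip: e1_def e2_def e3_def)
  ultimately have off: "ip e1 e2 = 0" "ip e1 e3 = 0" "ip e2 e3 = 0" by simp_all
  have diag: "ip e2 e2 = ip e1 e1" "ip e3 e3 = ip e1 e1"
    using inv[OF SU2_elements(3), of e2 e2] inv[OF SU2_elements(3), of e1 e1]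
    unfolding e1_def e2_def e3_def SU2_elements(6) by simp_all
  \<comment> \<open>The vector e1 has Frobenius square 2.\<close>
  define c where "c = ip e1 e1 / 2"
  have "e1 \<noteq> 0"
    using inner_su2_mk[of 1 0 0 1 0 0] by (auto simp: e1_def)
  then have "0 < c" using pos by (simp add: c_def)
  moreover have "ip x y = c * (x \<bullet> y)" for x y
  proof -
    obtain a b d a' b' d' where xy: "x = su2_mk a b d" "y = su2_mk a' b' d'"
      using su2_mk_surj by metis
    have "ip x y = ip (a *\<^sub>R e1 + b *\<^sub>R e2 + d *\<^sub>R e3) (a' *\<^sub>R e1 + b' *\<^sub>R e2 + d' *\<^sub>R e3)"
      unfolding xy e1_def e2_def e3_def by (subst (1 2) su2_mk_expand) (rule refl)
    also have "\<dots> = (a * a' + b * b' + d * d') * ip e1 e1"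
      using off sym[of e2 e1] sym[of e3 e1] sym[of e3 e2] diag
      by (simp add: bilinear_ladd[OF bil] bilinear_radd[OF bil] bilinear_lmul[OF bil] bilinear_rmul[OF bil] algebra_simps)
    finally show ?thesis
      by (simp add: xy inner_su2_mk c_def)
  qed
  ultimately show ?thesis by (intro that[of c]) auto
qed

subsection \<open>Pairings of two-forms\<close>

lemma sum_pairs_symmetric:
  fixes f :: "'n::{finite,linorder} \<Rightarrow> 'n \<Rightarrow> real"
  assumes "\<And>i j. f i j = f j i" "\<And>i. f i i = 0"
  shows "(\<Sum>i\<in>UNIV. \<Sum>j\<in>UNIV. f i j) = 2 * (\<Sum>(i, j) | i < j. f i j)"
proof -
  let ?P = "{(i, j). i < j} :: ('n \<times> 'n) set"
  let ?Q = "{(i, j). j < i} :: ('n \<times> 'n) set"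
  have "(\<Sum>i\<in>UNIV. \<Sum>j\<in>UNIV. f i j) = (\<Sum>(i, j)\<in>UNIV. f i j)"
    by (simp add: sum.cartesian_product UNIV_Times_UNIV)
  also have "\<dots> = (\<Sum>(i, j)\<in>?P \<union> ?Q. f i j)"
    using assms(2) by (intro sum.mono_neutral_right) (auto simp: not_less le_less)
  also have "\<dots> = (\<Sum>(i, j)\<in>?P. f i j) + (\<Sum>(i, j)\<in>?Q. f i j)"
    by (intro sum.union_disjoint) auto
  also have "(\<Sum>(i, j)\<in>?Q. f i j) = (\<Sum>(i, j)\<in>?P. f i j)"
    by (rule sum.reindex_bij_witness[of _ prod.swap prod.swap]) (auto simp: assms(1))
  finally show ?thesis by simp
qed

lemma norm_vec_squared: "(norm (v :: 'b::real_inner^'n))\<^sup>2 = (\<Sum>i\<in>UNIV. (norm (v $ i))\<^sup>2)"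
  by (simp add: power2_norm_eq_inner inner_vec_def)

lemma inner2_abs_le:
  fixes v w :: "'n::{finite,linorder} covec2"
  shows "\<bar>inner2 (\<bullet>) v w\<bar> \<le> norm v * norm w"
proof -
  let ?P = "{(i, j). i < j} :: ('n \<times> 'n) set"
  have le: "(\<Sum>(i, j)\<in>?P. (norm (u $ i $ j))\<^sup>2) \<le> (norm u)\<^sup>2" for u :: "'n covec2"
  proof -
    have "(\<Sum>(i, j)\<in>?P. (norm (u $ i $ j))\<^sup>2) \<le> (\<Sum>(i, j)\<in>UNIV. (norm (u $ i $ j))\<^sup>2)"
      by (intro sum_mono2) auto
    also have "\<dots> = (norm u)\<^sup>2"
      by (simp add: norm_vec_squared sum.cartesian_product UNIV_Times_UNIV)
    finally show ?thesis .
  qed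
  have "\<bar>inner2 (\<bullet>) v w\<bar> \<le> (\<Sum>(i, j)\<in>?P. \<bar>v $ i $ j \<bullet> w $ i $ j\<bar>)"
    unfolding inner2_def by (rule order.trans[OF sum_abs]) (simp add: case_prod_beta')
  also have "\<dots> \<le> (\<Sum>p\<in>?P. \<bar>norm (v $ fst p $ snd p)\<bar> * \<bar>norm (w $ fst p $ snd p)\<bar>)"
    by (intro sum_mono) (auto intro: Cauchy_Schwarz_ineq2)
  also have "\<dots> \<le> L2_set (\<lambda>p. norm (v $ fst p $ snd p)) ?P * L2_set (\<lambda>p. norm (w $ fst p $ snd p)) ?P"
    by (rule L2_set_mult_ineq)
  also have "\<dots> \<le> norm v * norm w"
    using le[of v] le[of w]
    by (intro mult_mono) (auto simp: L2_set_def case_prod_beta' intro!: real_le_lsqrt sum_nonneg)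
  finally show ?thesis .
qed

lemma bounded_bilinear_inner2: "bounded_bilinear (inner2 (\<bullet>))"
proof
  show "\<exists>K. \<forall>a b. norm (inner2 (\<bullet>) a b) \<le> norm a * norm b * K"
    by (intro exI[of _ 1]) (simp add: inner2_abs_le)
qed (simp_all add: inner2_def inner_add_left inner_add_right case_prod_beta' sum.distrib sum_distrib_left)

interpretation inner2: bounded_bilinear "inner2 (\<bullet>)"
  by (rule bounded_bilinear_inner2)

lemma inner2_commute: "inner2 (\<bullet>) v w = inner2 (\<bullet>) w v"
  by (simp add: inner2_def inner_commute)

lemma inner2_nonneg: "0 \<le> inner2 (\<bullet>) v v"
  by (auto simp: inner2_def intro!: sum_nonneg)

lemma bounded_bilinear_bracket_wedge: "bounded_bilinear bracket_wedge"
proof -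
  have "bilinear bracket_wedge"
    by (simp add: bilinear_def linear_iff bracket_wedge_def vec_eq_iff lie_bracket.add_left lie_bracket.add_right
        lie_bracket.scaleR_left lie_bracket.scaleR_right algebra_simps)
  then show ?thesis by (simp add: bilinear_conv_bounded_bilinear)
qed

interpretation bracket_wedge: bounded_bilinear bracket_wedge
  by (rule bounded_bilinear_bracket_wedge)

lemma bracket_wedge_commute: "bracket_wedge v w = bracket_wedge w v"
proof -
  have "lie_bracket (v $ i) (w $ j) - lie_bracket (v $ j) (w $ i) = lie_bracket (w $ i) (v $ j) - lie_bracket (w $ j) (v $ i)" for i j
    using lie_bracket_antisym[of "v $ i" "w $ j"] lie_bracket_antisym[of "v $ j" "w $ i"] by simp
  then show ?thesis by (simp add: bracket_wedge_def vec_eq_iff)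
qed

text \<open>The curvature of the connection with constant connection form k, whose exterior
  derivative vanishes.\<close>

definition const_curv :: "su2^'n \<Rightarrow> su2^'n^'n" where
  "const_curv k = (1/2) *\<^sub>R bracket_wedge k k"

lemma const_curv_nth [simp]: "const_curv k $ i $ j = lie_bracket (k $ i) (k $ j)"
  using lie_bracket_antisym[of "k $ j" "k $ i"] by (simp add: const_curv_def bracket_wedge_def flip: scaleR_2)

lemma inner2_const_curv:
  "inner2 (\<bullet>) (const_curv k) (const_curv k) = (\<Sum>(i, j) | i < j. lie_bracket (k $ i) (k $ j) \<bullet> lie_bracket (k $ i) (k $ j))"
  by (simp add: inner2_def)

text \<open>Lojasiewicz inequality for the quartic form: the test direction \<open>\<eta>\<close> is the part of \<open>k\<close>
  orthogonal to a component of \<open>k\<close> of maximal length. Writing \<open>k\<^sub>i = s\<^sub>i v + \<eta>\<^sub>i\<close>, the brackets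
  \<open>[s\<^sub>i v, \<eta>\<^sub>j] + [\<eta>\<^sub>i, s\<^sub>j v]\<close> and \<open>[\<eta>\<^sub>i, \<eta>\<^sub>j]\<close> are orthogonal, so that all terms of the derivative
  in direction \<open>\<eta>\<close> are nonnegative.\<close>

lemma const_curv_gradient_inequality:
  fixes k :: "su2^'n::{finite,linorder}"
  defines "Q \<equiv> inner2 (\<bullet>) (const_curv k) (const_curv k)"
  obtains \<eta> where "Q \<le> inner2 (\<bullet>) (const_curv k) (bracket_wedge k \<eta>)"
    "(norm \<eta>) ^ 4 \<le> real CARD('n) * Q" "(norm \<eta>)\<^sup>2 * (norm k)\<^sup>2 \<le> real CARD('n) * Q"
proof (cases "k = 0")
  case True
  then have "Q = 0" by (simp add: Q_def inner2_const_curv)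
  then show ?thesis
    using True by (intro that[of 0]) (auto simp: bracket_wedge.zero_right inner2.zero_right)
next
  case False
  obtain m where m: "\<And>i. norm (k $ i) \<le> norm (k $ m)"
  proof -
    have "Max (range (\<lambda>i. norm (k $ i))) \<in> range (\<lambda>i. norm (k $ i))" by (intro Max_in) auto
    then obtain m where "Max (range (\<lambda>i. norm (k $ i))) = norm (k $ m)" by blast
    from this[symmetric] show ?thesis by (intro that[of m]) (auto intro!: Max_ge)
  qed
  define M where "M = norm (k $ m)"
  have "M \<noteq> 0"
  proof
    assume "M = 0"
    then have "norm (k $ i) \<le> 0" for i using m[of i] by (simp add: M_def)
    with False show False by (auto simp: vec_eq_iff)
  qed
  then have M: "0 < M" by (simp add: M_def)
  define v where "v = (1 / M) *\<^sub>R (k $ m)"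
  have vv: "v \<bullet> v = 1"
    using M by (simp add: v_def M_def power2_norm_eq_inner[symmetric] power2_eq_square)
  define s where "s i = k $ i \<bullet> v" for i
  define \<eta> where "\<eta> = (\<chi> i. k $ i - s i *\<^sub>R v)"
  have k: "k $ i = s i *\<^sub>R v + \<eta> $ i" for i by (simp add: \<eta>_def)
  have orth: "v \<bullet> \<eta> $ i = 0" "\<eta> $ i \<bullet> v = 0" for i
    by (simp_all add: \<eta>_def s_def inner_diff_right inner_diff_left vv inner_commute)
  have km: "k $ m = M *\<^sub>R v" using M by (simp add: v_def)
  define A where "A i j = lie_bracket (s i *\<^sub>R v) (\<eta> $ j) + lie_bracket (\<eta> $ i) (s j *\<^sub>R v)" for i j
  define B where "B i j = lie_bracket (\<eta> $ i) (\<eta> $ j)" for i j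
  \<comment> \<open>By Lagrange's identity every term of the product contains the inner product of v
    with some component of \<eta>, which is 0.\<close>
  have AB: "A i j \<bullet> B i j = 0" for i j
    by (simp add: A_def B_def inner_add_left lie_bracket_inner_lie_bracket orth)
  have F: "lie_bracket (k $ i) (k $ j) = A i j + B i j" for i j
    by (simp add: k[of i] k[of j] A_def B_def lie_bracket.add_left lie_bracket.add_right lie_bracket.scaleR_left lie_bracket.scaleR_right)
  \<comment> \<open>A has degree one and B degree two in \<eta>, hence the weights 1 and 2: this is
    the derivative of the curvature in direction \<eta>.\<close>
  have W: "bracket_wedge k \<eta> $ i $ j = A i j + 2 *\<^sub>R B i j" for i j
  proof -
    have "bracket_wedge k \<eta> $ i $ j = lie_bracket (k $ i) (\<eta> $ j) + lie_bracket (\<eta> $ i) (k $ j)"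
      using lie_bracket_antisym[of "\<eta> $ i" "k $ j"] by (simp add: bracket_wedge_def)
    then show ?thesis
      by (simp add: k[of i] k[of j] A_def B_def lie_bracket.add_left lie_bracket.add_right scaleR_2)
  qed
  have Q: "Q = (\<Sum>(i, j) | i < j. (norm (A i j))\<^sup>2 + (norm (B i j))\<^sup>2)"
    by (simp add: Q_def inner2_const_curv F inner_add_left inner_add_right AB inner_commute[of "B _ _" "A _ _"] power2_norm_eq_inner)
  have 1: "Q \<le> inner2 (\<bullet>) (const_curv k) (bracket_wedge k \<eta>)"
    unfolding Q inner2_def
    by (intro sum_mono) (auto simp: F W inner_add_left inner_add_right AB inner_commute[of "B _ _" "A _ _"] power2_norm_eq_inner)
  have norm_\<eta>: "(norm (lie_bracket (k $ m) (k $ j)))\<^sup>2 = 2 * M\<^sup>2 * (norm (\<eta> $ j))\<^sup>2" for j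
  proof -
    have "lie_bracket (k $ m) (k $ j) = M *\<^sub>R lie_bracket v (\<eta> $ j)"
      unfolding km k[of j] by (simp add: lie_bracket.add_right lie_bracket.scaleR_left lie_bracket.scaleR_right)
    then show ?thesis
      by (simp add: power_mult_distrib power2_norm_eq_inner lie_bracket_inner_lie_bracket orth vv)
  qed
  \<comment> \<open>Only the brackets with the longest component are kept; they see exactly \<eta>.
    The factor 2 comes from Lagrange's identity on the left and from counting each pair twice on the
    right.\<close>
  have 2: "2 * (M\<^sup>2 * (norm \<eta>)\<^sup>2) \<le> 2 * Q"
  proof -
    have "2 * (M\<^sup>2 * (norm \<eta>)\<^sup>2) = (\<Sum>j\<in>UNIV. (norm (lie_bracket (k $ m) (k $ j)))\<^sup>2)"
      by (simp add: norm_\<eta> norm_vec_squared sum_distrib_left mult.assoc)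
    also have "\<dots> \<le> (\<Sum>i\<in>UNIV. \<Sum>j\<in>UNIV. (norm (lie_bracket (k $ i) (k $ j)))\<^sup>2)"
      by (rule member_le_sum) (auto intro!: sum_nonneg)
    also have "\<dots> = 2 * Q"
      unfolding Q_def inner2_const_curv power2_norm_eq_inner
      by (rule sum_pairs_symmetric) (auto simp: lie_bracket_inner_lie_bracket algebra_simps)
    finally show ?thesis .
  qed
  have nk: "(norm k)\<^sup>2 \<le> real CARD('n) * M\<^sup>2"
    unfolding norm_vec_squared using m by (intro sum_bounded_above[of UNIV _ "M\<^sup>2", simplified]) (auto simp: M_def power_mono)
  have n\<eta>: "(norm \<eta>)\<^sup>2 \<le> (norm k)\<^sup>2"
    unfolding norm_vec_squared
  proof (rule sum_mono)
    fix i
    have "(norm (k $ i))\<^sup>2 = (s i)\<^sup>2 + (norm (\<eta> $ i))\<^sup>2"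
      unfolding k[of i] power2_norm_eq_inner by (simp add: inner_add_left inner_add_right orth vv power2_eq_square)
    then show "(norm (\<eta> $ i))\<^sup>2 \<le> (norm (k $ i))\<^sup>2" by simp
  qed
  have 3: "(norm \<eta>)\<^sup>2 * (norm k)\<^sup>2 \<le> real CARD('n) * Q"
  proof -
    have "(norm \<eta>)\<^sup>2 * (norm k)\<^sup>2 \<le> (norm \<eta>)\<^sup>2 * (real CARD('n) * M\<^sup>2)"
      using nk by (intro mult_left_mono) auto
    also have "\<dots> = real CARD('n) * (M\<^sup>2 * (norm \<eta>)\<^sup>2)" by simp
    also have "\<dots> \<le> real CARD('n) * Q" using 2 by (intro mult_left_mono) auto
    finally show ?thesis .
  qed
  have 4: "(norm \<eta>) ^ 4 \<le> real CARD('n) * Q"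
  proof -
    have "(norm \<eta>) ^ 4 = (norm \<eta>)\<^sup>2 * (norm \<eta>)\<^sup>2" by (simp flip: power_add)
    also have "\<dots> \<le> (norm \<eta>)\<^sup>2 * (norm k)\<^sup>2" using n\<eta> by (intro mult_left_mono) auto
    finally show ?thesis using 3 by linarith
  qed
  from 1 4 3 show ?thesis by (rule that)
qed

section \<open>Quadratic estimates around constant forms\<close>

lemma L2_scaleR: "f \<in> L2 M \<Longrightarrow> (\<lambda>x. c *\<^sub>R f x) \<in> L2 M"
  by (rule L2_bounded_linear[OF bounded_linear_scaleR_right])

lemma L2_sum: "finite I \<Longrightarrow> (\<And>i. i \<in> I \<Longrightarrow> f i \<in> L2 M) \<Longrightarrow> (\<lambda>x. \<Sum>i\<in>I. f i x) \<in> L2 M"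
proof (induction I rule: finite_induct)
  case empty
  then show ?case by (simp add: L2_def)
next
  case (insert i I)
  then have "(\<lambda>x. f i x + (\<Sum>i\<in>I. f i x)) \<in> L2 M" by (intro L2_add) auto
  then show ?case using insert by simp
qed

lemma L2_torus_integrable:
  assumes "f \<in> L2 torus"
  shows "integrable torus f"
proof (rule Bochner_Integration.integrable_bound)
  show "integrable torus (\<lambda>x. 1 + (norm (f x))\<^sup>2)" using L2D(2)[OF assms] by simp
  have "norm (f x) \<le> 1 + (norm (f x))\<^sup>2" for x
  proof -
    have "2 * norm (f x) \<le> 1 + (norm (f x))\<^sup>2"
      using sum_squares_bound[of 1 "norm (f x)"] by simp
    then show ?thesis using norm_ge_zero[of "f x"] by linarith
  qed
  then show "AE x in torus. norm (f x) \<le> norm (1 + (norm (f x))\<^sup>2)"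
    by (auto intro!: AE_I2)
qed (rule L2D(1)[OF assms])

lemma L2_const: "(\<lambda>x. c) \<in> L2 torus"
  by (simp add: L2_def)

lemma bounded_bilinear_measurable:
  assumes "bounded_bilinear P" "f \<in> borel_measurable M" "g \<in> borel_measurable M"
  shows "(\<lambda>x. P (f x :: 'a::euclidean_space) (g x :: 'b::euclidean_space) :: 'c::euclidean_space) \<in> borel_measurable M"
proof -
  have "continuous_on UNIV (\<lambda>z. P (fst z) (snd z))"
    by (intro bounded_bilinear.continuous_on[OF assms(1)] continuous_intros)
  then show ?thesis
    by (rule borel_measurable_continuous_Pair[OF assms(2,3)])
qed

text \<open>A product of two square-integrable functions is in general only integrable; a pointwise
  bound on one factor keeps it square-integrable. This is how the quadratic term of the curvature
  stays in L2.\<close>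

lemma L2_bilinear_bounded:
  assumes P: "bounded_bilinear P" and f: "f \<in> borel_measurable M" "AE x in M. norm (f x) \<le> r" and g: "g \<in> L2 M"
  shows "(\<lambda>x. P (f x :: 'a::euclidean_space) (g x :: 'b::euclidean_space) :: 'c::euclidean_space) \<in> L2 M"
proof -
  obtain K where K: "0 < K" "\<And>a b. norm (P a b) \<le> norm a * norm b * K"
    using bounded_bilinear.pos_bounded[OF P] by auto
  show ?thesis
  proof (rule L2I_bound[OF bounded_bilinear_measurable[OF P f(1) L2D(1)[OF g]]])
    show "integrable M (\<lambda>x. (r * K)\<^sup>2 * (norm (g x))\<^sup>2)" using L2D(2)[OF g] by simp
    show "AE x in M. (norm (P (f x) (g x)))\<^sup>2 \<le> (r * K)\<^sup>2 * (norm (g x))\<^sup>2"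
      using f(2)
    proof eventually_elim
      case (elim x)
      have "norm (P (f x) (g x)) \<le> norm (f x) * norm (g x) * K" by (rule K(2))
      also have "\<dots> \<le> r * norm (g x) * K" using elim K(1) by (intro mult_right_mono) auto
      finally have "(norm (P (f x) (g x)))\<^sup>2 \<le> (r * norm (g x) * K)\<^sup>2" by (intro power_mono) auto
      then show ?case by (simp add: power_mult_distrib mult_ac)
    qed
  qed
qed

text \<open>The entry with indices i and j is the derivative of the j-th component in direction i.
  Exterior derivative and codifferential become fixed linear maps of this matrix, so that pointwise
  estimates are linear algebra.\<close>

definition grad_form :: "'n one_form \<Rightarrow> real^'n \<Rightarrow> su2^'n^'n" where
  "grad_form a x = (\<chi> i. wd i a x)"

definition alternation :: "su2^'n^'n \<Rightarrow> su2^'n^'n" where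
  "alternation D = (\<chi> i j. D $ i $ j - D $ j $ i)"

definition contraction :: "su2^'n^'n \<Rightarrow> su2" where
  "contraction D = (\<Sum>i\<in>UNIV. D $ i $ i)"

lemma ext_d_eq: "ext_d a x = alternation (grad_form a x)"
  by (simp add: ext_d_def alternation_def grad_form_def)

lemma codiff_eq: "codiff a x = - contraction (grad_form a x)"
  by (simp add: codiff_def contraction_def grad_form_def)

lemma bounded_linear_alternation: "bounded_linear alternation"
  by (subst linear_conv_bounded_linear[symmetric]) (simp add: linear_iff alternation_def vec_eq_iff algebra_simps)

lemma bounded_linear_contraction: "bounded_linear contraction"
  by (subst linear_conv_bounded_linear[symmetric]) (simp add: linear_iff contraction_def sum.distrib scaleR_sum_right)

text \<open>The two sides differ from the plain square by expressions of the form of two-by-two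
  minors. These are null Lagrangians: for a matrix of derivatives their integrals vanish by the
  symmetry of mixed derivatives.\<close>

lemma alternation_contraction_identity:
  "inner2 (\<bullet>) (alternation D) (alternation D) + contraction D \<bullet> contraction D
    = (norm D)\<^sup>2 + (\<Sum>i\<in>UNIV. \<Sum>j\<in>UNIV. D $ i $ i \<bullet> D $ j $ j - D $ i $ j \<bullet> D $ j $ i)"
proof -
  let ?f = "\<lambda>i j. (D $ i $ j - D $ j $ i) \<bullet> (D $ i $ j - D $ j $ i)"
  have "2 * inner2 (\<bullet>) (alternation D) (alternation D) = (\<Sum>i\<in>UNIV. \<Sum>j\<in>UNIV. ?f i j)"
    using sum_pairs_symmetric[of ?f] by (simp add: inner2_def alternation_def inner_diff_left inner_diff_right)
  also have "\<dots> = (\<Sum>i\<in>UNIV. \<Sum>j\<in>UNIV. (norm (D $ i $ j))\<^sup>2) + (\<Sum>i\<in>UNIV. \<Sum>j\<in>UNIV. (norm (D $ j $ i))\<^sup>2)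
      - 2 * (\<Sum>i\<in>UNIV. \<Sum>j\<in>UNIV. D $ i $ j \<bullet> D $ j $ i)"
    by (simp add: inner_diff_left inner_diff_right power2_norm_eq_inner sum.distrib sum_subtractf sum_distrib_left
        inner_commute algebra_simps)
  also have "(\<Sum>i\<in>UNIV. \<Sum>j\<in>UNIV. (norm (D $ j $ i))\<^sup>2) = (\<Sum>i\<in>UNIV. \<Sum>j\<in>UNIV. (norm (D $ i $ j))\<^sup>2)"
    by (rule sum.swap)
  also have "(\<Sum>i\<in>UNIV. \<Sum>j\<in>UNIV. (norm (D $ i $ j))\<^sup>2) = (norm D)\<^sup>2"
    by (simp add: norm_vec_squared)
  finally have "inner2 (\<bullet>) (alternation D) (alternation D) = (norm D)\<^sup>2 - (\<Sum>i\<in>UNIV. \<Sum>j\<in>UNIV. D $ i $ j \<bullet> D $ j $ i)"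
    by simp
  moreover have "contraction D \<bullet> contraction D = (\<Sum>i\<in>UNIV. \<Sum>j\<in>UNIV. D $ i $ i \<bullet> D $ j $ j)"
    unfolding contraction_def inner_sum_left inner_sum_right by (rule sum.swap)
  ultimately show ?thesis by (simp add: sum_subtractf)
qed

lemma grad_form_L2:
  assumes "a \<in> W1p 2"
  shows "grad_form a \<in> L2 torus"
proof -
  have "grad_form a x = (\<Sum>i\<in>UNIV. axis i (wd i a x))" for x
    by (simp add: grad_form_def vec_eq_iff axis_def if_distrib[where f = "\<lambda>u. u $ _"] cong: if_cong)
  moreover have "(\<lambda>x. \<Sum>i\<in>UNIV. axis i (wd i a x)) \<in> L2 torus"
  proof (intro L2_sum finite)
    fix i :: 'a
    have "bounded_linear (axis i :: su2^'a \<Rightarrow> _)"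
      by (subst linear_conv_bounded_linear[symmetric]) (simp add: linear_iff axis_def vec_eq_iff)
    moreover have "wd i a \<in> L2 torus"
      using W1p_weak_partial(1)[OF assms, of i] by (simp add: Lp_2_iff_L2)
    ultimately show "(\<lambda>x. axis i (wd i a x)) \<in> L2 torus"
      by (rule L2_bounded_linear)
  qed
  ultimately show ?thesis by presburger
qed

lemma integral_wd_eq_0:
  assumes "f \<in> W1p p" "1 \<le> p"
  shows "(LINT x|torus. wd i f x) = 0"
  using W1p_weak_partial(2)[OF assms, of i] test_function_const[of 1]
  unfolding weak_partial_def by fastforce

lemma integral_grad_form_eq_0:
  assumes "a \<in> W1p 2"
  shows "(LINT x|torus. grad_form a x) = 0"
proof -
  have int: "integrable torus (grad_form a)"
    by (rule L2_torus_integrable[OF grad_form_L2[OF assms]])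
  have "(LINT x|torus. grad_form a x) $ i = (LINT x|torus. wd i a x)" for i
    using integral_bounded_linear[OF bounded_linear_vec_nth int, of i] by (simp add: grad_form_def[abs_def])
  then show ?thesis using integral_wd_eq_0[OF assms] by (simp add: vec_eq_iff)
qed

text \<open>By the pointwise identity only the minors remain to be integrated, and
  \<open>integral_mixed_partials\<close>, applied to components, gives 0 for each. This is the
  coercivity that gauge fixing provides: exterior derivative and codifferential together control all
  first derivatives.\<close>

theorem hodge_identity:
  fixes a :: "'n::{finite,linorder} one_form"
  assumes a: "a \<in> W1p 2"
  shows "(LINT x|torus. inner2 (\<bullet>) (ext_d a x) (ext_d a x) + codiff a x \<bullet> codiff a x) = (LINT x|torus. (norm (grad_form a x))\<^sup>2)"
proof -
  \<comment> \<open>The derivative chosen for a component and the component of the chosen derivative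
    may be different representatives; they agree almost everywhere.\<close>
  have comp: "(\<lambda>x. a x $ j) \<in> W1p 2" "AE x in torus. wd i (\<lambda>x. a x $ j) x = wd i a x $ j" for i j
    using W1p_bounded_linear[OF a _ bounded_linear_vec_nth, of j] wd_bounded_linear[OF a _ bounded_linear_vec_nth, of i j] by simp_all
  have wL2: "(\<lambda>x. wd i a x $ j) \<in> L2 torus" for i j
    using W1p_weak_partial(1)[OF a, of i] by (intro L2_bounded_linear[OF bounded_linear_vec_nth]) (simp add: Lp_2_iff_L2)
  have int: "integrable torus (\<lambda>x. wd i a x $ j \<bullet> wd k a x $ l)" for i j k l
    by (rule integrable_bounded_bilinear_L2[OF bounded_bilinear_inner wL2 wL2])
  have eq: "(LINT x|torus. wd i (\<lambda>x. a x $ j) x \<bullet> wd k (\<lambda>x. a x $ l) x) = (LINT x|torus. wd i a x $ j \<bullet> wd k a x $ l)" for i j k l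
  proof (rule integral_cong_AE)
    show "(\<lambda>x. wd i (\<lambda>x. a x $ j) x \<bullet> wd k (\<lambda>x. a x $ l) x) \<in> borel_measurable torus"
      using LpD(4)[OF W1p_weak_partial(1)[OF comp(1)]] by (intro borel_measurable_inner) auto
    show "(\<lambda>x. wd i a x $ j \<bullet> wd k a x $ l) \<in> borel_measurable torus"
      using int by auto
    show "AE x in torus. wd i (\<lambda>x. a x $ j) x \<bullet> wd k (\<lambda>x. a x $ l) x = wd i a x $ j \<bullet> wd k a x $ l"
      using comp(2)[of i j] comp(2)[of k l] by eventually_elim simp
  qed
  have sym: "(LINT x|torus. wd i a x $ i \<bullet> wd j a x $ j) = (LINT x|torus. wd i a x $ j \<bullet> wd j a x $ i)" for i j
    using integral_mixed_partials[OF comp(1)[of i] comp(1)[of j], of i j] unfolding eq by (simp add: inner_commute)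
  have "(LINT x|torus. inner2 (\<bullet>) (ext_d a x) (ext_d a x) + codiff a x \<bullet> codiff a x)
      = (LINT x|torus. (norm (grad_form a x))\<^sup>2 + (\<Sum>i\<in>UNIV. \<Sum>j\<in>UNIV. wd i a x $ i \<bullet> wd j a x $ j - wd i a x $ j \<bullet> wd j a x $ i))"
    using alternation_contraction_identity[of "grad_form a x" for x] by (simp add: ext_d_eq codiff_eq) (simp add: grad_form_def)
  also have "\<dots> = (LINT x|torus. (norm (grad_form a x))\<^sup>2)
      + (\<Sum>i\<in>UNIV. \<Sum>j\<in>UNIV. (LINT x|torus. wd i a x $ i \<bullet> wd j a x $ j) - (LINT x|torus. wd i a x $ j \<bullet> wd j a x $ i))"
    using int L2D(2)[OF grad_form_L2[OF a]] by simp
  also have "(\<Sum>i\<in>UNIV. \<Sum>j\<in>UNIV. (LINT x|torus. wd i a x $ i \<bullet> wd j a x $ j) - (LINT x|torus. wd i a x $ j \<bullet> wd j a x $ i)) = 0"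
  proof (intro sum.neutral ballI)
    show "(LINT x|torus. wd i a x $ i \<bullet> wd j a x $ j) - (LINT x|torus. wd i a x $ j \<bullet> wd j a x $ i) = 0" for i j
      using sym[of i j] by (rule right_minus_eq[THEN iffD2])
  qed
  finally show ?thesis by simp
qed

text \<open>The factor comes from Cauchy-Schwarz for the sum over directions, which
  \<open>poincare_inequality\<close> has inside the square.\<close>

lemma poincare_mean_zero:
  fixes z :: "'n::finite one_form"
  assumes z: "z \<in> W1p 2" and mean: "(LINT x|torus. z x) = 0"
  shows "(LINT x|torus. (norm (z x))\<^sup>2) \<le> real CARD('n) * (LINT x|torus. (norm (grad_form z x))\<^sup>2)"
proof -
  let ?S = "LINT x|torus. (norm (grad_form z x))\<^sup>2"
  have zL2: "z \<in> L2 torus" using W1p_Lp[OF z] by (simp add: Lp_2_iff_L2)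
  have z1: "z \<in> Lp 1" "wd i z \<in> Lp 1" "weak_partial i z (wd i z)" for i
    using Lp_mono[OF W1p_Lp[OF z], of 1] Lp_mono[OF W1p_weak_partial(1)[OF z], of 1 i] W1p_weak_partial(2)[OF z] by auto
  have "ennreal (LINT x|torus. (norm (z x))\<^sup>2) = (\<integral>\<^sup>+x. (ennreal (norm (z x)))\<^sup>2 \<partial>torus)"
    using nn_integral_square_eq[OF zL2] by simp
  also have "\<dots> \<le> (\<integral>\<^sup>+x. (ennreal (\<Sum>i\<in>UNIV. norm (wd i z x)))\<^sup>2 \<partial>torus)"
    using poincare_inequality[OF z1] by (simp add: mean)
  also have "\<dots> \<le> (\<integral>\<^sup>+x. ennreal (real CARD('n)) * (ennreal (norm (grad_form z x)))\<^sup>2 \<partial>torus)"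
  proof (rule nn_integral_mono)
    fix x
    have "(\<Sum>i\<in>UNIV. norm (wd i z x))\<^sup>2 \<le> real CARD('n) * (norm (grad_form z x))\<^sup>2"
      using sum_squared_le_sum_of_squares[of "\<lambda>i. norm (wd i z x)" UNIV] by (simp add: norm_vec_squared[where 'n = 'n] grad_form_def mult.commute)
    then have "ennreal ((\<Sum>i\<in>UNIV. norm (wd i z x))\<^sup>2) \<le> ennreal (real CARD('n) * (norm (grad_form z x))\<^sup>2)"
      by (rule ennreal_leI)
    then show "(ennreal (\<Sum>i\<in>UNIV. norm (wd i z x)))\<^sup>2 \<le> ennreal (real CARD('n)) * (ennreal (norm (grad_form z x)))\<^sup>2"
      by (simp add: ennreal_power ennreal_mult sum_nonneg)
  qed
  also have "\<dots> = ennreal (real CARD('n)) * ennreal ?S"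
    using L2D(1)[OF grad_form_L2[OF z]] nn_integral_square_eq[OF grad_form_L2[OF z]] by (simp add: nn_integral_cmult)
  also have "\<dots> = ennreal (real CARD('n) * ?S)" by (simp add: ennreal_mult)
  finally show ?thesis by (simp add: ennreal_le_iff)
qed

subsection \<open>Pointwise bounds\<close>

lemma form_bound_constant:
  "\<exists>K\<ge>1. (\<forall>v w :: su2^'n. norm (bracket_wedge v w) \<le> K * (norm v * norm w)) \<and>
    (\<forall>D :: su2^'n^'n. norm (alternation D) \<le> K * norm D) \<and> (\<forall>D :: su2^'n^'n. norm (contraction D) \<le> K * norm D)"
proof -
  obtain K1 where K1: "0 < K1" "\<And>v w :: su2^'n. norm (bracket_wedge v w) \<le> norm v * norm w * K1"
    using bracket_wedge.pos_bounded by blast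
  obtain K2 where K2: "0 < K2" "\<And>D :: su2^'n^'n. norm (alternation D) \<le> norm D * K2"
    using bounded_linear.pos_bounded[OF bounded_linear_alternation] by blast
  obtain K3 where K3: "0 < K3" "\<And>D :: su2^'n^'n. norm (contraction D) \<le> norm D * K3"
    using bounded_linear.pos_bounded[OF bounded_linear_contraction] by blast
  define K where "K = 1 + K1 + K2 + K3"
  have K: "K1 \<le> K" "K2 \<le> K" "K3 \<le> K" "1 \<le> K" using K1 K2 K3 by (simp_all add: K_def)
  show ?thesis
  proof (intro exI[of _ K] conjI allI K(4))
    fix v w :: "su2^'n"
    have "norm v * norm w * K1 \<le> norm v * norm w * K" using K by (intro mult_left_mono) auto
    with K1(2)[of v w] show "norm (bracket_wedge v w) \<le> K * (norm v * norm w)" by (simp add: mult_ac)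
  next
    fix D :: "su2^'n^'n"
    have "norm D * K2 \<le> norm D * K" "norm D * K3 \<le> norm D * K" using K by (auto intro: mult_left_mono)
    with K2(2)[of D] K3(2)[of D] show "norm (alternation D) \<le> K * norm D" "norm (contraction D) \<le> K * norm D"
      by (simp_all add: mult_ac)
  qed
qed

lemma curv_const_plus:
  "curv a x = alternation (grad_form a x) + (const_curv k + bracket_wedge k (z x) + (1/2) *\<^sub>R bracket_wedge (z x) (z x))"
  if "a x = k + z x"
proof -
  have "(1/2) *\<^sub>R bracket_wedge (k + z x) (k + z x)
      = const_curv k + bracket_wedge k (z x) + (1/2) *\<^sub>R bracket_wedge (z x) (z x)"
    using bracket_wedge_commute[of "z x" k]
    by (simp add: const_curv_def bracket_wedge.add_left bracket_wedge.add_right scaleR_add_right flip: scaleR_2)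
  then show ?thesis by (simp add: curv_def ext_d_eq that)
qed

text \<open>The integrand of the gradient tested with z itself, with D in the role of its
  derivative. The terms linear in z and D are kept exactly because they will integrate to 0. Apart
  from the square of the alternation, what is left is quadratic in (z, D) with one more factor
  bounded by r.\<close>

lemma gradient_density_bound:
  obtains C where "0 < C" "\<And>(k :: 'n::{finite,linorder} covec) z D r.
      0 \<le> r \<Longrightarrow> r \<le> 1 \<Longrightarrow> norm k \<le> r \<Longrightarrow> norm z \<le> r \<Longrightarrow>
      inner2 (\<bullet>) (alternation D) (alternation D) + inner2 (\<bullet>) (const_curv k) (alternation D + bracket_wedge k z)
        - C * r * ((norm z)\<^sup>2 + (norm D)\<^sup>2)
      \<le> inner2 (\<bullet>) (alternation D + (const_curv k + bracket_wedge k z + (1/2) *\<^sub>R bracket_wedge z z))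
          (alternation D + bracket_wedge (k + z) z)"
proof -
  obtain K where K: "1 \<le> K" "\<And>v w :: 'n covec. norm (bracket_wedge v w) \<le> K * (norm v * norm w)"
    "\<And>D :: 'n covec2. norm (alternation D) \<le> K * norm D" "\<And>D :: 'n covec2. norm (contraction D) \<le> K * norm D"
    using form_bound_constant[where 'n = 'n] by auto
  show ?thesis
  proof (rule that[of "7 * K\<^sup>2"])
    \<comment> \<open>The three error terms add up to K^2 r (5 |z|^2 + 4 |D| |z|), and 2 |D| |z| <=
      |D|^2 + |z|^2 leads to the factor 7.\<close>
    show "0 < 7 * K\<^sup>2" using K(1) by simp
    fix k z :: "'n covec" and D :: "'n covec2" and r :: real
    assume r: "0 \<le> r" "r \<le> 1" and k: "norm k \<le> r" and z: "norm z \<le> r"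
    define A where "A = alternation D"
    define F where "F = const_curv k"
    define kz where "kz = bracket_wedge k z"
    define zz where "zz = bracket_wedge z z"
    have K0: "0 \<le> K" using K(1) by simp
    have A: "norm A \<le> K * norm D" unfolding A_def by (rule K)
    have kz: "norm kz \<le> K * (r * norm z)"
      unfolding kz_def using K0 k by (intro order.trans[OF K(2)] mult_left_mono mult_right_mono) auto
    have zz: "norm zz \<le> K * (r * norm z)"
      unfolding zz_def using K0 z by (intro order.trans[OF K(2)] mult_left_mono mult_right_mono) auto
    have zz': "norm zz \<le> K * (norm z)\<^sup>2" using K(2)[of z z] by (simp add: zz_def power2_eq_square)
    have F: "norm F \<le> K * r"
    proof -
      have "norm F \<le> norm (bracket_wedge k k)" by (simp add: F_def const_curv_def)
      also have "\<dots> \<le> K * (norm k * norm k)" by (rule K)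
      also have "\<dots> \<le> K * (r * 1)" using K0 k r by (intro mult_left_mono mult_mono) auto
      finally show ?thesis by simp
    qed
    have rz: "r * norm z \<le> norm z" using r by (simp add: mult_left_le_one_le)
    have 1: "\<bar>inner2 (\<bullet>) F zz\<bar> \<le> (K * r) * (K * (norm z)\<^sup>2)"
      using K0 r by (intro order.trans[OF inner2_abs_le] mult_mono F zz') auto
    have s1: "norm (kz + zz) \<le> 2 * (K * (r * norm z))"
      using norm_triangle_ineq[of kz zz] kz zz by simp
    have 2: "\<bar>inner2 (\<bullet>) A (kz + zz)\<bar> \<le> (K * norm D) * (2 * (K * (r * norm z)))"
      using K0 r by (intro order.trans[OF inner2_abs_le] mult_mono A s1) auto
    have s2: "norm (kz + (1/2) *\<^sub>R zz) \<le> 2 * (K * (r * norm z))"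
    proof -
      have "norm ((1/2) *\<^sub>R zz) \<le> norm zz" by simp
      then show ?thesis using norm_triangle_ineq[of kz "(1/2) *\<^sub>R zz"] kz zz by linarith
    qed
    have s3: "norm (A + (kz + zz)) \<le> K * norm D + 2 * (K * norm z)"
    proof -
      have "2 * (K * (r * norm z)) \<le> 2 * (K * norm z)" using K0 rz by (intro mult_left_mono) auto
      then show ?thesis using norm_triangle_ineq[of A "kz + zz"] A s1 by linarith
    qed
    have 3: "\<bar>inner2 (\<bullet>) (kz + (1/2) *\<^sub>R zz) (A + (kz + zz))\<bar> \<le> (2 * (K * (r * norm z))) * (K * norm D + 2 * (K * norm z))"
      using K0 r by (intro order.trans[OF inner2_abs_le] mult_mono s2 s3) auto
    have "(K * r) * (K * (norm z)\<^sup>2) + (K * norm D) * (2 * (K * (r * norm z))) + (2 * (K * (r * norm z))) * (K * norm D + 2 * (K * norm z))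
        = K\<^sup>2 * r * (5 * (norm z)\<^sup>2 + 2 * (2 * norm D * norm z))"
      by (simp add: power2_eq_square algebra_simps)
    also have "\<dots> \<le> K\<^sup>2 * r * (5 * (norm z)\<^sup>2 + 2 * ((norm D)\<^sup>2 + (norm z)\<^sup>2))"
      using r sum_squares_bound[of "norm D" "norm z"] by (intro mult_left_mono add_left_mono) auto
    also have "\<dots> \<le> K\<^sup>2 * r * (7 * ((norm z)\<^sup>2 + (norm D)\<^sup>2))"
      using r by (intro mult_left_mono) auto
    also have "\<dots> = 7 * K\<^sup>2 * r * ((norm z)\<^sup>2 + (norm D)\<^sup>2)" by (simp only: mult_ac)
    finally have bound: "(K * r) * (K * (norm z)\<^sup>2) + (K * norm D) * (2 * (K * (r * norm z))) + (2 * (K * (r * norm z))) * (K * norm D + 2 * (K * norm z))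
        \<le> 7 * K\<^sup>2 * r * ((norm z)\<^sup>2 + (norm D)\<^sup>2)" .
    have "inner2 (\<bullet>) (A + (F + kz + (1/2) *\<^sub>R zz)) (A + (kz + zz))
        = inner2 (\<bullet>) A A + inner2 (\<bullet>) F (A + kz)
          + (inner2 (\<bullet>) F zz + inner2 (\<bullet>) A (kz + zz) + inner2 (\<bullet>) (kz + (1/2) *\<^sub>R zz) (A + (kz + zz)))"
      by (simp add: inner2.add_left inner2.add_right)
    then have "inner2 (\<bullet>) A A + inner2 (\<bullet>) F (A + kz) - 7 * K\<^sup>2 * r * ((norm z)\<^sup>2 + (norm D)\<^sup>2)
        \<le> inner2 (\<bullet>) (A + (F + kz + (1/2) *\<^sub>R zz)) (A + (kz + zz))"
      using 1 2 3 bound by linarith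
    moreover have "kz + zz = bracket_wedge (k + z) z"
      by (simp add: kz_def zz_def bracket_wedge.add_left)
    ultimately show "inner2 (\<bullet>) (alternation D) (alternation D) + inner2 (\<bullet>) (const_curv k) (alternation D + bracket_wedge k z)
        - 7 * K\<^sup>2 * r * ((norm z)\<^sup>2 + (norm D)\<^sup>2)
      \<le> inner2 (\<bullet>) (alternation D + (const_curv k + bracket_wedge k z + (1/2) *\<^sub>R bracket_wedge z z))
          (alternation D + bracket_wedge (k + z) z)"
      unfolding A_def F_def kz_def zz_def by simp
  qed
qed

text \<open>The test form is now constant, so the leading term is the derivative of the quartic
  form. The linear terms are again kept because they integrate to 0. The quadratic remainder may be
  large compared with the leading term: its integral will be controlled by the gradient in the
  direction z.\<close>

lemma gradient_const_density_bound:
  obtains C where "0 < C" "\<And>(k :: 'n::{finite,linorder} covec) z D \<eta>.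
      norm k \<le> 1 \<Longrightarrow> norm z \<le> 1 \<Longrightarrow>
      inner2 (\<bullet>) (const_curv k) (bracket_wedge k \<eta>)
        + (inner2 (\<bullet>) (alternation D + bracket_wedge k z) (bracket_wedge k \<eta>) + inner2 (\<bullet>) (const_curv k) (bracket_wedge z \<eta>))
        - C * norm \<eta> * ((norm z)\<^sup>2 + (norm D)\<^sup>2)
      \<le> inner2 (\<bullet>) (alternation D + (const_curv k + bracket_wedge k z + (1/2) *\<^sub>R bracket_wedge z z)) (bracket_wedge (k + z) \<eta>)
      \<and> inner2 (\<bullet>) (alternation D + (const_curv k + bracket_wedge k z + (1/2) *\<^sub>R bracket_wedge z z)) (bracket_wedge (k + z) \<eta>)
      \<le> inner2 (\<bullet>) (const_curv k) (bracket_wedge k \<eta>)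
        + (inner2 (\<bullet>) (alternation D + bracket_wedge k z) (bracket_wedge k \<eta>) + inner2 (\<bullet>) (const_curv k) (bracket_wedge z \<eta>))
        + C * norm \<eta> * ((norm z)\<^sup>2 + (norm D)\<^sup>2)"
proof -
  obtain K where K: "1 \<le> K" "\<And>v w :: 'n covec. norm (bracket_wedge v w) \<le> K * (norm v * norm w)"
    "\<And>D :: 'n covec2. norm (alternation D) \<le> K * norm D" "\<And>D :: 'n covec2. norm (contraction D) \<le> K * norm D"
    using form_bound_constant[where 'n = 'n] by auto
  show ?thesis
  proof (rule that[of "4 * K\<^sup>2"])
    show "0 < 4 * K\<^sup>2" using K(1) by simp
    fix k z \<eta> :: "'n covec" and D :: "'n covec2"
    assume k: "norm k \<le> 1" and z: "norm z \<le> 1"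
    define A where "A = alternation D"
    define F where "F = const_curv k"
    define kz where "kz = bracket_wedge k z"
    define zz where "zz = bracket_wedge z z"
    define k\<eta> where "k\<eta> = bracket_wedge k \<eta>"
    define z\<eta> where "z\<eta> = bracket_wedge z \<eta>"
    have K0: "0 \<le> K" using K(1) by simp
    have A: "norm A \<le> K * norm D" unfolding A_def by (rule K)
    have kz: "norm kz \<le> K * (1 * norm z)"
      unfolding kz_def using K0 k by (intro order.trans[OF K(2)] mult_left_mono mult_right_mono) auto
    have zz: "norm zz \<le> K * (norm z * norm z)" unfolding zz_def by (rule K)
    have k\<eta>: "norm k\<eta> \<le> K * (1 * norm \<eta>)"
      unfolding k\<eta>_def using K0 k by (intro order.trans[OF K(2)] mult_left_mono mult_right_mono) auto
    have z\<eta>: "norm z\<eta> \<le> K * (norm z * norm \<eta>)" unfolding z\<eta>_def by (rule K)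
    have z\<eta>': "norm z\<eta> \<le> K * (1 * norm \<eta>)"
      unfolding z\<eta>_def using K0 z by (intro order.trans[OF K(2)] mult_left_mono mult_right_mono) auto
    have 1: "\<bar>inner2 (\<bullet>) A z\<eta>\<bar> \<le> (K * norm D) * (K * (norm z * norm \<eta>))"
      using K0 by (intro order.trans[OF inner2_abs_le] mult_mono A z\<eta>) auto
    have 2: "\<bar>inner2 (\<bullet>) kz z\<eta>\<bar> \<le> (K * (1 * norm z)) * (K * (norm z * norm \<eta>))"
      using K0 by (intro order.trans[OF inner2_abs_le] mult_mono kz z\<eta>) auto
    have 3: "\<bar>inner2 (\<bullet>) zz (k\<eta> + z\<eta>)\<bar> \<le> (K * (norm z * norm z)) * (K * (1 * norm \<eta>) + K * (1 * norm \<eta>))"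
      using K0 norm_triangle_ineq[of k\<eta> z\<eta>] k\<eta> z\<eta>' by (intro order.trans[OF inner2_abs_le] mult_mono zz) auto
    have "(K * norm D) * (K * (norm z * norm \<eta>)) + (K * (1 * norm z)) * (K * (norm z * norm \<eta>))
        + (1/2) * ((K * (norm z * norm z)) * (K * (1 * norm \<eta>) + K * (1 * norm \<eta>)))
        = K\<^sup>2 * norm \<eta> * (norm D * norm z + 2 * (norm z)\<^sup>2)"
      by (simp add: power2_eq_square algebra_simps)
    also have "\<dots> \<le> K\<^sup>2 * norm \<eta> * (4 * ((norm z)\<^sup>2 + (norm D)\<^sup>2))"
    proof (intro mult_left_mono)
      have "0 \<le> norm D * norm z" by simp
      moreover have "2 * (norm D * norm z) \<le> (norm D)\<^sup>2 + (norm z)\<^sup>2"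
        using sum_squares_bound[of "norm D" "norm z"] by (simp only: mult.assoc)
      ultimately have "norm D * norm z \<le> (norm D)\<^sup>2 + (norm z)\<^sup>2" by linarith
      then show "norm D * norm z + 2 * (norm z)\<^sup>2 \<le> 4 * ((norm z)\<^sup>2 + (norm D)\<^sup>2)"
        unfolding distrib_left using zero_le_power2[of "norm z"] zero_le_power2[of "norm D"] by linarith
    qed auto
    also have "\<dots> = 4 * K\<^sup>2 * norm \<eta> * ((norm z)\<^sup>2 + (norm D)\<^sup>2)" by (simp only: mult_ac)
    finally have bound: "(K * norm D) * (K * (norm z * norm \<eta>)) + (K * (1 * norm z)) * (K * (norm z * norm \<eta>))
        + (1/2) * ((K * (norm z * norm z)) * (K * (1 * norm \<eta>) + K * (1 * norm \<eta>)))
        \<le> 4 * K\<^sup>2 * norm \<eta> * ((norm z)\<^sup>2 + (norm D)\<^sup>2)" .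
    have eq: "inner2 (\<bullet>) (A + (F + kz + (1/2) *\<^sub>R zz)) (k\<eta> + z\<eta>)
        = inner2 (\<bullet>) F k\<eta> + (inner2 (\<bullet>) (A + kz) k\<eta> + inner2 (\<bullet>) F z\<eta>)
          + (inner2 (\<bullet>) A z\<eta> + inner2 (\<bullet>) kz z\<eta> + (1/2) * inner2 (\<bullet>) zz (k\<eta> + z\<eta>))"
      by (simp add: inner2.add_left inner2.add_right inner2.scaleR_left)
    have "\<bar>inner2 (\<bullet>) A z\<eta> + inner2 (\<bullet>) kz z\<eta> + (1/2) * inner2 (\<bullet>) zz (k\<eta> + z\<eta>)\<bar> \<le> 4 * K\<^sup>2 * norm \<eta> * ((norm z)\<^sup>2 + (norm D)\<^sup>2)"
      using 1 2 3 bound by linarith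
    then show "inner2 (\<bullet>) (const_curv k) (bracket_wedge k \<eta>)
        + (inner2 (\<bullet>) (alternation D + bracket_wedge k z) (bracket_wedge k \<eta>) + inner2 (\<bullet>) (const_curv k) (bracket_wedge z \<eta>))
        - 4 * K\<^sup>2 * norm \<eta> * ((norm z)\<^sup>2 + (norm D)\<^sup>2)
      \<le> inner2 (\<bullet>) (alternation D + (const_curv k + bracket_wedge k z + (1/2) *\<^sub>R bracket_wedge z z)) (bracket_wedge (k + z) \<eta>)
      \<and> inner2 (\<bullet>) (alternation D + (const_curv k + bracket_wedge k z + (1/2) *\<^sub>R bracket_wedge z z)) (bracket_wedge (k + z) \<eta>)
      \<le> inner2 (\<bullet>) (const_curv k) (bracket_wedge k \<eta>)
        + (inner2 (\<bullet>) (alternation D + bracket_wedge k z) (bracket_wedge k \<eta>) + inner2 (\<bullet>) (const_curv k) (bracket_wedge z \<eta>))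
        + 4 * K\<^sup>2 * norm \<eta> * ((norm z)\<^sup>2 + (norm D)\<^sup>2)"
      unfolding bracket_wedge.add_left[of k z \<eta>] A_def[symmetric] F_def[symmetric] kz_def[symmetric] zz_def[symmetric] k\<eta>_def[symmetric] z\<eta>_def[symmetric] eq
      by linarith
  qed
qed

lemma inner2_add_square_le:
  "inner2 (\<bullet>) (v + w) (v + w) \<le> 2 * inner2 (\<bullet>) v v + 2 * inner2 (\<bullet>) w w"
  using inner2_nonneg[of "v - w"] inner2_commute[of w v]
  by (simp add: inner2.add_left inner2.add_right inner2.diff_left inner2.diff_right)

text \<open>Separates the constant part of the curvature from the rest by
  \<open>inner2_add_square_le\<close>. The factor 2 is harmless, since only the order of magnitude
  of the energy matters for the exponent.\<close>

lemma energy_density_bound: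
  obtains C where "0 < C" "\<And>(k :: 'n::{finite,linorder} covec) z D.
      norm k \<le> 1 \<Longrightarrow> norm z \<le> 1 \<Longrightarrow>
      inner2 (\<bullet>) (alternation D + (const_curv k + bracket_wedge k z + (1/2) *\<^sub>R bracket_wedge z z))
        (alternation D + (const_curv k + bracket_wedge k z + (1/2) *\<^sub>R bracket_wedge z z)) + (norm (contraction D))\<^sup>2
      \<le> 2 * inner2 (\<bullet>) (const_curv k) (const_curv k) + C * ((norm z)\<^sup>2 + (norm D)\<^sup>2)"
proof -
  obtain K where K: "1 \<le> K" "\<And>v w :: 'n covec. norm (bracket_wedge v w) \<le> K * (norm v * norm w)"
    "\<And>D :: 'n covec2. norm (alternation D) \<le> K * norm D" "\<And>D :: 'n covec2. norm (contraction D) \<le> K * norm D"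
    using form_bound_constant[where 'n = 'n] by auto
  show ?thesis
  proof (rule that[of "16 * K\<^sup>2"])
    show "0 < 16 * K\<^sup>2" using K(1) by simp
    fix k z :: "'n covec" and D :: "'n covec2"
    assume k: "norm k \<le> 1" and z: "norm z \<le> 1"
    define E where "E = alternation D + (bracket_wedge k z + (1/2) *\<^sub>R bracket_wedge z z)"
    have K0: "0 \<le> K" using K(1) by simp
    have kz: "norm (bracket_wedge k z) \<le> K * (1 * norm z)"
      using K0 k by (intro order.trans[OF K(2)] mult_left_mono mult_right_mono) auto
    have zz: "norm (bracket_wedge z z) \<le> K * (1 * norm z)"
      using K0 z by (intro order.trans[OF K(2)] mult_left_mono mult_right_mono) auto
    have "norm E \<le> norm (alternation D) + (norm (bracket_wedge k z) + norm ((1/2) *\<^sub>R bracket_wedge z z))"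
      unfolding E_def by (intro order.trans[OF norm_triangle_ineq] add_left_mono norm_triangle_ineq)
    also have "\<dots> \<le> K * norm D + 2 * (K * norm z)"
    proof -
      have "norm ((1/2) *\<^sub>R bracket_wedge z z) \<le> norm (bracket_wedge z z)" by simp
      then show ?thesis using kz zz K(3)[of D] unfolding mult_1 by linarith
    qed
    finally have nE: "norm E \<le> K * norm D + 2 * (K * norm z)" .
    have "inner2 (\<bullet>) E E \<le> norm E * norm E"
      using inner2_abs_le[of E E] by linarith
    also have "\<dots> \<le> (K * norm D + 2 * (K * norm z)) * (K * norm D + 2 * (K * norm z))"
      using nE K0 by (intro mult_mono) auto
    also have "\<dots> = K\<^sup>2 * ((norm D)\<^sup>2 + 2 * (2 * norm D * norm z) + 4 * (norm z)\<^sup>2)"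
      by (simp add: power2_eq_square algebra_simps)
    also have "\<dots> \<le> K\<^sup>2 * ((norm D)\<^sup>2 + 2 * ((norm D)\<^sup>2 + (norm z)\<^sup>2) + 4 * (norm z)\<^sup>2)"
      using sum_squares_bound[of "norm D" "norm z"] by (intro mult_left_mono) auto
    finally have E: "inner2 (\<bullet>) E E \<le> K\<^sup>2 * (3 * (norm D)\<^sup>2 + 6 * (norm z)\<^sup>2)" by (simp add: add.commute)
    have c: "(norm (contraction D))\<^sup>2 \<le> K\<^sup>2 * (norm D)\<^sup>2"
      using power_mono[OF K(4)[of D] norm_ge_zero, of 2] by (simp add: power_mult_distrib)
    have "2 * (K\<^sup>2 * (3 * (norm D)\<^sup>2 + 6 * (norm z)\<^sup>2)) + K\<^sup>2 * (norm D)\<^sup>2 = K\<^sup>2 * (7 * (norm D)\<^sup>2 + 12 * (norm z)\<^sup>2)"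
      by (simp add: algebra_simps)
    also have "\<dots> \<le> K\<^sup>2 * (16 * ((norm z)\<^sup>2 + (norm D)\<^sup>2))" by (intro mult_left_mono) auto
    also have "\<dots> = 16 * K\<^sup>2 * ((norm z)\<^sup>2 + (norm D)\<^sup>2)" by (simp only: mult_ac)
    finally have "2 * (K\<^sup>2 * (3 * (norm D)\<^sup>2 + 6 * (norm z)\<^sup>2)) + K\<^sup>2 * (norm D)\<^sup>2 \<le> 16 * K\<^sup>2 * ((norm z)\<^sup>2 + (norm D)\<^sup>2)" .
    moreover have eqE: "alternation D + (const_curv k + bracket_wedge k z + (1/2) *\<^sub>R bracket_wedge z z) = const_curv k + E"
      by (simp add: E_def)
    ultimately show "inner2 (\<bullet>) (alternation D + (const_curv k + bracket_wedge k z + (1/2) *\<^sub>R bracket_wedge z z))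
        (alternation D + (const_curv k + bracket_wedge k z + (1/2) *\<^sub>R bracket_wedge z z)) + (norm (contraction D))\<^sup>2
      \<le> 2 * inner2 (\<bullet>) (const_curv k) (const_curv k) + 16 * K\<^sup>2 * ((norm z)\<^sup>2 + (norm D)\<^sup>2)"
      unfolding eqE using inner2_add_square_le[of "const_curv k" E] E c by linarith
  qed
qed

subsection \<open>Integrated estimates\<close>

lemma grad_form_const_plus:
  assumes "z \<in> W1p p" "1 \<le> p"
  shows "AE x in torus. grad_form (\<lambda>x. k + z x) x = grad_form z x"
proof -
  have "AE x in torus. wd i (\<lambda>x. k + z x) x = wd i z x" for i
    using wd_add[OF W1p_const assms(1,2), of i k] wd_const[of i k] by eventually_elim simp
  then have "AE x in torus. \<forall>i. wd i (\<lambda>x. k + z x) x = wd i z x"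
    by (simp add: AE_all_countable)
  then show ?thesis by eventually_elim (simp add: grad_form_def)
qed

lemma grad_form_const: "AE x in torus. grad_form (\<lambda>x. k) x = 0"
proof -
  have "AE x in torus. \<forall>i. wd i (\<lambda>x. k) x = 0"
    by (simp add: AE_all_countable wd_const)
  then show ?thesis by eventually_elim (simp add: grad_form_def vec_eq_iff)
qed

lemma cov_d_eq: "cov_d a b x = alternation (grad_form b x) + bracket_wedge (a x) (b x)"
  by (simp add: cov_d_def ext_d_eq)

lemma grad_form_measurable:
  assumes "a \<in> W1p q" "1 \<le> q"
  shows "grad_form a \<in> borel_measurable torus"
proof (subst borel_measurable_euclidean_space, intro ballI)
  fix e :: "su2^'a^'a" assume "e \<in> Basis"
  then obtain i u where "e = axis i u" by (auto simp: Basis_vec_def)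
  moreover have "(\<lambda>x. wd i a x \<bullet> u) \<in> borel_measurable torus"
    using LpD(4)[OF W1p_weak_partial(1)[OF assms, of i]] by simp
  ultimately show "(\<lambda>x. grad_form a x \<bullet> e) \<in> borel_measurable torus"
    by (simp add: inner_axis grad_form_def)
qed

lemma ext_d_measurable: "a \<in> W1p q \<Longrightarrow> 1 \<le> q \<Longrightarrow> ext_d a \<in> borel_measurable torus"
  unfolding ext_d_eq[abs_def]
  by (rule borel_measurable_continuous_on[OF linear_continuous_on[OF bounded_linear_alternation] grad_form_measurable])

lemma codiff_measurable: "a \<in> W1p q \<Longrightarrow> 1 \<le> q \<Longrightarrow> codiff a \<in> borel_measurable torus"
  unfolding codiff_eq[abs_def]
  by (rule borel_measurable_continuous_on[OF linear_continuous_on[OF bounded_linear_minus[OF bounded_linear_contraction]] grad_form_measurable])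

lemma curv_measurable:
  assumes "a \<in> W1p q" "1 \<le> q"
  shows "curv a \<in> borel_measurable torus"
  using ext_d_measurable[OF assms] bounded_bilinear_measurable[OF bounded_bilinear_bracket_wedge LpD(4) LpD(4), OF W1p_Lp W1p_Lp, OF assms(1) assms(1)]
  by (simp add: curv_def[abs_def])

lemma cov_d_measurable:
  assumes "a \<in> borel_measurable torus" "b \<in> W1p q" "1 \<le> q"
  shows "cov_d a b \<in> borel_measurable torus"
  using ext_d_measurable[OF assms(2,3)] bounded_bilinear_measurable[OF bounded_bilinear_bracket_wedge assms(1) LpD(4), OF W1p_Lp, OF assms(2)]
  by (simp add: cov_d_def[abs_def])

text \<open>A form near 0, split into its mean k and its mean-free part z. The pointwise bound on z
  is what Morrey's inequality will supply; the derivatives of z are controlled in mean square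
  only.\<close>

locale const_perturbation =
  fixes k :: "'n::{finite,linorder} covec" and z :: "'n one_form" and r :: real
  assumes z: "z \<in> W1p 2" and mean: "(LINT x|torus. z x) = 0" and r: "0 \<le> r" "r \<le> 1"
    and k_bound: "norm k \<le> r" and z_bound: "AE x in torus. norm (z x) \<le> r"
begin

text \<open>The curvature of k + z, written through the chosen derivative of z. The derivative of k
  + z is a separate choice, so the two versions agree only almost everywhere.\<close>

definition curvature where
  "curvature x = alternation (grad_form z x) + (const_curv k + bracket_wedge k (z x) + (1/2) *\<^sub>R bracket_wedge (z x) (z x))"

definition dirichlet where
  "dirichlet = (LINT x|torus. (norm (grad_form z x))\<^sup>2)"

lemma dirichlet_nonneg: "0 \<le> dirichlet"
  by (simp add: dirichlet_def)

lemma zL2: "z \<in> L2 torus"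
  using W1p_Lp[OF z] by (simp add: Lp_2_iff_L2)

lemma DL2: "grad_form z \<in> L2 torus"
  by (rule grad_form_L2[OF z])

lemma AL2: "(\<lambda>x. alternation (grad_form z x)) \<in> L2 torus"
  by (rule L2_bounded_linear[OF bounded_linear_alternation DL2])

lemma kzL2: "(\<lambda>x. bracket_wedge k (z x)) \<in> L2 torus"
  by (rule L2_bounded_linear[OF bracket_wedge.bounded_linear_right zL2])

lemma zzL2: "(\<lambda>x. bracket_wedge (z x) (z x)) \<in> L2 torus"
  by (rule L2_bilinear_bounded[OF bounded_bilinear_bracket_wedge L2D(1)[OF zL2] z_bound zL2])

lemma curvature_L2: "curvature \<in> L2 torus"
  unfolding curvature_def[abs_def]
  by (intro L2_add AL2 L2_const kzL2 L2_scaleR zzL2)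

lemma form_measurable: "(\<lambda>x. k + z x) \<in> borel_measurable torus"
  using L2D(1)[OF zL2] by simp

lemma form_W1p: "(\<lambda>x. k + z x) \<in> W1p 2"
  by (rule W1p_add[OF W1p_const z]) simp

lemma AE_curv: "AE x in torus. curv (\<lambda>x. k + z x) x = curvature x"
  using grad_form_const_plus[OF z one_le_numeral, of k]
proof eventually_elim
  case (elim x)
  show ?case
    by (subst curv_const_plus[where z = z and k = k]) (simp_all add: elim curvature_def)
qed

lemma AE_codiff: "AE x in torus. codiff (\<lambda>x. k + z x) x = codiff z x"
  using grad_form_const_plus[OF z one_le_numeral, of k] by eventually_elim (simp add: codiff_eq)

lemma codiff_L2: "codiff a \<in> L2 torus" if "a \<in> W1p 2" for a :: "'n one_form"
proof -
  have "(\<lambda>x. - contraction (grad_form a x)) \<in> L2 torus"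
    by (intro L2_bounded_linear[OF bounded_linear_minus[OF bounded_linear_contraction]] grad_form_L2 that)
  then show ?thesis by (simp add: codiff_eq[abs_def])
qed

text \<open>Together with its analogue for the derivatives, this removes the linear terms from the
  pointwise expansions.\<close>

lemma integral_linear_z: "integrable torus (\<lambda>x. T (z x))" "(LINT x|torus. T (z x)) = 0"
  if "bounded_linear T" for T :: "'n covec \<Rightarrow> real"
  using integral_bounded_linear[OF that L2_torus_integrable[OF zL2]]
    integrable_bounded_linear[OF that L2_torus_integrable[OF zL2]] mean linear_0[OF bounded_linear.linear[OF that]] by auto

lemma integral_linear_grad: "integrable torus (\<lambda>x. T (grad_form z x))" "(LINT x|torus. T (grad_form z x)) = 0"
  if "bounded_linear T" for T :: "'n covec2 \<Rightarrow> real"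
  using integral_bounded_linear[OF that L2_torus_integrable[OF DL2]]
    integrable_bounded_linear[OF that L2_torus_integrable[OF DL2]] integral_grad_form_eq_0[OF z]
    linear_0[OF bounded_linear.linear[OF that]] by auto

lemma square_integrals:
  "integrable torus (\<lambda>x. (norm (z x))\<^sup>2 + (norm (grad_form z x))\<^sup>2)"
  "(LINT x|torus. (norm (z x))\<^sup>2 + (norm (grad_form z x))\<^sup>2) \<le> (real CARD('n) + 1) * dirichlet"
proof -
  show "integrable torus (\<lambda>x. (norm (z x))\<^sup>2 + (norm (grad_form z x))\<^sup>2)"
    using L2D(2)[OF zL2] L2D(2)[OF DL2] by simp
  have "(LINT x|torus. (norm (z x))\<^sup>2 + (norm (grad_form z x))\<^sup>2) = (LINT x|torus. (norm (z x))\<^sup>2) + dirichlet"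
    using L2D(2)[OF zL2] L2D(2)[OF DL2] by (simp add: dirichlet_def)
  also have "\<dots> \<le> (real CARD('n) + 1) * dirichlet"
    using poincare_mean_zero[OF z mean] by (simp add: dirichlet_def algebra_simps)
  finally show "(LINT x|torus. (norm (z x))\<^sup>2 + (norm (grad_form z x))\<^sup>2) \<le> (real CARD('n) + 1) * dirichlet" .
qed

lemma gradient_z_eq:
  "gradient (\<bullet>) (\<lambda>x. k + z x) z
    = (LINT x|torus. inner2 (\<bullet>) (curvature x) (alternation (grad_form z x) + bracket_wedge (k + z x) (z x)))
      + (LINT x|torus. codiff z x \<bullet> codiff z x)"
proof -
  have m: "(\<lambda>x. alternation (grad_form z x) + bracket_wedge (k + z x) (z x)) \<in> borel_measurable torus"
    using cov_d_measurable[OF form_measurable z one_le_numeral] by (simp add: cov_d_eq[abs_def])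
  have "(LINT x|torus. inner2 (\<bullet>) (curv (\<lambda>x. k + z x) x) (cov_d (\<lambda>x. k + z x) z x))
      = (LINT x|torus. inner2 (\<bullet>) (curvature x) (alternation (grad_form z x) + bracket_wedge (k + z x) (z x)))"
    using AE_curv
    by (intro integral_cong_AE bounded_bilinear_measurable[OF bounded_bilinear_inner2] curv_measurable[OF form_W1p one_le_numeral]
        cov_d_measurable[OF form_measurable z one_le_numeral] L2D(1)[OF curvature_L2] m) (auto simp: cov_d_eq elim: eventually_mono)
  moreover have "(LINT x|torus. codiff (\<lambda>x. k + z x) x \<bullet> codiff z x) = (LINT x|torus. codiff z x \<bullet> codiff z x)"
    using AE_codiff L2D(1)[OF codiff_L2[OF form_W1p]] L2D(1)[OF codiff_L2[OF z]]
    by (intro integral_cong_AE borel_measurable_inner) (auto elim: eventually_mono)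
  ultimately show ?thesis by (simp add: gradient_def)
qed

lemma hodge_dirichlet:
  "(LINT x|torus. inner2 (\<bullet>) (alternation (grad_form z x)) (alternation (grad_form z x)))
    + (LINT x|torus. codiff z x \<bullet> codiff z x) = dirichlet"
  using hodge_identity[OF z] integrable_bounded_bilinear_L2[OF bounded_bilinear_inner2 AL2 AL2]
    integrable_bounded_bilinear_L2[OF bounded_bilinear_inner codiff_L2[OF z] codiff_L2[OF z]]
  by (simp add: dirichlet_def ext_d_eq)

text \<open>Integrate the pointwise bound: the linear terms vanish, the main terms add up to the
  Dirichlet integral by the Hodge identity, and Poincare bounds the error by it. The pointwise bound
  enters as a hypothesis so that its constant can be fixed before k, z and r.\<close>

lemma gradient_z_lower:
  assumes C: "0 < C"
    and bound: "\<And>z D :: _. norm z \<le> r \<Longrightarrow>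
      inner2 (\<bullet>) (alternation D) (alternation D) + inner2 (\<bullet>) (const_curv k) (alternation D + bracket_wedge k z)
        - C * r * ((norm z)\<^sup>2 + (norm D)\<^sup>2)
      \<le> inner2 (\<bullet>) (alternation D + (const_curv k + bracket_wedge k z + (1/2) *\<^sub>R bracket_wedge z z))
          (alternation D + bracket_wedge (k + z) z)"
  shows "(1 - C * (real CARD('n) + 1) * r) * dirichlet \<le> gradient (\<bullet>) (\<lambda>x. k + z x) z"
proof -
  let ?A = "\<lambda>x. alternation (grad_form z x)"
  let ?I = "\<lambda>x. inner2 (\<bullet>) (curvature x) (?A x + bracket_wedge (k + z x) (z x))"
  have i1: "integrable torus (\<lambda>x. inner2 (\<bullet>) (?A x) (?A x))"
    by (rule integrable_bounded_bilinear_L2[OF bounded_bilinear_inner2 AL2 AL2])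
  have T1: "bounded_linear (\<lambda>D. inner2 (\<bullet>) (const_curv k) (alternation D))"
    by (rule bounded_linear_compose[OF inner2.bounded_linear_right bounded_linear_alternation])
  have T2: "bounded_linear (\<lambda>v. inner2 (\<bullet>) (const_curv k) (bracket_wedge k v))"
    by (rule bounded_linear_compose[OF inner2.bounded_linear_right bracket_wedge.bounded_linear_right])
  note i2 = integral_linear_grad[OF T1] and i3 = integral_linear_z[OF T2]
  have "(\<lambda>x. bracket_wedge (k + z x) (z x)) \<in> L2 torus"
    unfolding bracket_wedge.add_left by (intro L2_add kzL2 zzL2)
  then have i4: "integrable torus ?I"
    by (intro integrable_bounded_bilinear_L2[OF bounded_bilinear_inner2 curvature_L2] L2_add AL2)
  have "(LINT x|torus. inner2 (\<bullet>) (?A x) (?A x) + (inner2 (\<bullet>) (const_curv k) (?A x) + inner2 (\<bullet>) (const_curv k) (bracket_wedge k (z x)))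
      - C * r * ((norm (z x))\<^sup>2 + (norm (grad_form z x))\<^sup>2)) \<le> (LINT x|torus. ?I x)"
  proof (rule integral_mono_AE[OF _ i4])
    show "integrable torus (\<lambda>x. inner2 (\<bullet>) (?A x) (?A x) + (inner2 (\<bullet>) (const_curv k) (?A x) + inner2 (\<bullet>) (const_curv k) (bracket_wedge k (z x)))
      - C * r * ((norm (z x))\<^sup>2 + (norm (grad_form z x))\<^sup>2))"
      by (intro Bochner_Integration.integrable_diff Bochner_Integration.integrable_add integrable_mult_right i1 i2 i3 square_integrals)
    show "AE x in torus. inner2 (\<bullet>) (?A x) (?A x) + (inner2 (\<bullet>) (const_curv k) (?A x) + inner2 (\<bullet>) (const_curv k) (bracket_wedge k (z x)))
      - C * r * ((norm (z x))\<^sup>2 + (norm (grad_form z x))\<^sup>2) \<le> ?I x"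
      using z_bound
    proof eventually_elim
      case (elim x)
      then show ?case using bound[of "z x" "grad_form z x"] by (simp add: curvature_def inner2.add_right)
    qed
  qed
  also have "(LINT x|torus. inner2 (\<bullet>) (?A x) (?A x) + (inner2 (\<bullet>) (const_curv k) (?A x) + inner2 (\<bullet>) (const_curv k) (bracket_wedge k (z x)))
      - C * r * ((norm (z x))\<^sup>2 + (norm (grad_form z x))\<^sup>2))
    = (LINT x|torus. inner2 (\<bullet>) (?A x) (?A x)) - C * r * (LINT x|torus. (norm (z x))\<^sup>2 + (norm (grad_form z x))\<^sup>2)"
    using i1 i2 i3 square_integrals(1)
    by (simp only: Bochner_Integration.integral_diff Bochner_Integration.integral_add Bochner_Integration.integrable_add
        integrable_mult_right Bochner_Integration.integral_mult_right_zero)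
  finally have 1: "(LINT x|torus. inner2 (\<bullet>) (?A x) (?A x)) - C * r * (LINT x|torus. (norm (z x))\<^sup>2 + (norm (grad_form z x))\<^sup>2)
      \<le> (LINT x|torus. ?I x)" .
  have "C * r * (LINT x|torus. (norm (z x))\<^sup>2 + (norm (grad_form z x))\<^sup>2) \<le> C * r * ((real CARD('n) + 1) * dirichlet)"
    using C r square_integrals(2) by (intro mult_left_mono) auto
  with 1 hodge_dirichlet have "dirichlet - C * r * ((real CARD('n) + 1) * dirichlet) \<le> gradient (\<bullet>) (\<lambda>x. k + z x) z"
    unfolding gradient_z_eq by linarith
  then show ?thesis by (simp add: algebra_simps)
qed

lemma gradient_const_eq:
  "gradient (\<bullet>) (\<lambda>x. k + z x) (const_form \<eta>) = (LINT x|torus. inner2 (\<bullet>) (curvature x) (bracket_wedge (k + z x) \<eta>))"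
proof -
  have c: "const_form \<eta> \<in> W1p 2" unfolding const_form_def by (rule W1p_const)
  have m: "(\<lambda>x. bracket_wedge (k + z x) \<eta>) \<in> borel_measurable torus"
    by (rule bounded_bilinear_measurable[OF bounded_bilinear_bracket_wedge form_measurable]) simp
  have g0: "AE x in torus. grad_form (const_form \<eta>) x = 0"
    unfolding const_form_def by (rule grad_form_const)
  have "(LINT x|torus. inner2 (\<bullet>) (curv (\<lambda>x. k + z x) x) (cov_d (\<lambda>x. k + z x) (const_form \<eta>) x))
      = (LINT x|torus. inner2 (\<bullet>) (curvature x) (bracket_wedge (k + z x) \<eta>))"
  proof (intro integral_cong_AE bounded_bilinear_measurable[OF bounded_bilinear_inner2] curv_measurable[OF form_W1p one_le_numeral]
        cov_d_measurable[OF form_measurable c one_le_numeral] L2D(1)[OF curvature_L2] m)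
    show "AE x in torus. inner2 (\<bullet>) (curv (\<lambda>x. k + z x) x) (cov_d (\<lambda>x. k + z x) (const_form \<eta>) x)
        = inner2 (\<bullet>) (curvature x) (bracket_wedge (k + z x) \<eta>)"
      using AE_curv g0
      by eventually_elim (simp add: cov_d_eq linear_0[OF bounded_linear.linear[OF bounded_linear_alternation]] const_form_def)
  qed
  moreover have "(LINT x|torus. codiff (\<lambda>x. k + z x) x \<bullet> codiff (const_form \<eta>) x) = 0"
  proof (rule integral_eq_zero_AE)
    show "AE x in torus. codiff (\<lambda>x. k + z x) x \<bullet> codiff (const_form \<eta>) x = 0"
      using g0 by eventually_elim (simp add: codiff_eq linear_0[OF bounded_linear.linear[OF bounded_linear_contraction]])
  qed
  ultimately show ?thesis by (simp add: gradient_def)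
qed

text \<open>The same integration with a constant test form. Its codifferential vanishes, the linear
  terms integrate to 0, and since the torus has measure 1 the leading constant is its own
  integral.\<close>

lemma gradient_const_lower:
  assumes C: "0 < C"
    and bound: "\<And>z D :: _. norm z \<le> 1 \<Longrightarrow>
      inner2 (\<bullet>) (const_curv k) (bracket_wedge k \<eta>)
        + (inner2 (\<bullet>) (alternation D + bracket_wedge k z) (bracket_wedge k \<eta>) + inner2 (\<bullet>) (const_curv k) (bracket_wedge z \<eta>))
        - C * norm \<eta> * ((norm z)\<^sup>2 + (norm D)\<^sup>2)
      \<le> inner2 (\<bullet>) (alternation D + (const_curv k + bracket_wedge k z + (1/2) *\<^sub>R bracket_wedge z z)) (bracket_wedge (k + z) \<eta>)"
  shows "inner2 (\<bullet>) (const_curv k) (bracket_wedge k \<eta>) - C * (real CARD('n) + 1) * norm \<eta> * dirichlet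
    \<le> gradient (\<bullet>) (\<lambda>x. k + z x) (const_form \<eta>)"
proof -
  let ?A = "\<lambda>x. alternation (grad_form z x)"
  let ?I = "\<lambda>x. inner2 (\<bullet>) (curvature x) (bracket_wedge (k + z x) \<eta>)"
  let ?c = "inner2 (\<bullet>) (const_curv k) (bracket_wedge k \<eta>)"
  let ?L = "\<lambda>x. inner2 (\<bullet>) (?A x) (bracket_wedge k \<eta>)"
  let ?M = "\<lambda>x. inner2 (\<bullet>) (bracket_wedge k (z x)) (bracket_wedge k \<eta>)"
  let ?N = "\<lambda>x. inner2 (\<bullet>) (const_curv k) (bracket_wedge (z x) \<eta>)"
  have T1: "bounded_linear (\<lambda>D. inner2 (\<bullet>) (alternation D) (bracket_wedge k \<eta>))"
    by (rule bounded_linear_compose[OF inner2.bounded_linear_left bounded_linear_alternation])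
  have T2: "bounded_linear (\<lambda>v. inner2 (\<bullet>) (bracket_wedge k v) (bracket_wedge k \<eta>))"
    by (rule bounded_linear_compose[OF inner2.bounded_linear_left bracket_wedge.bounded_linear_right])
  have T3: "bounded_linear (\<lambda>v. inner2 (\<bullet>) (const_curv k) (bracket_wedge v \<eta>))"
    by (rule bounded_linear_compose[OF inner2.bounded_linear_right bracket_wedge.bounded_linear_left])
  note i1 = integral_linear_grad[OF T1] and i2 = integral_linear_z[OF T2] and i3 = integral_linear_z[OF T3]
  have "(\<lambda>x. bracket_wedge (k + z x) \<eta>) \<in> L2 torus"
    by (intro L2_bounded_linear[OF bracket_wedge.bounded_linear_left] L2_add L2_const zL2)
  then have i4: "integrable torus ?I"
    by (rule integrable_bounded_bilinear_L2[OF bounded_bilinear_inner2 curvature_L2])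
  have "(LINT x|torus. ?c + (?L x + ?M x + ?N x) - C * norm \<eta> * ((norm (z x))\<^sup>2 + (norm (grad_form z x))\<^sup>2)) \<le> (LINT x|torus. ?I x)"
  proof (rule integral_mono_AE[OF _ i4])
    show "integrable torus (\<lambda>x. ?c + (?L x + ?M x + ?N x) - C * norm \<eta> * ((norm (z x))\<^sup>2 + (norm (grad_form z x))\<^sup>2))"
      by (intro Bochner_Integration.integrable_diff Bochner_Integration.integrable_add integrable_mult_right i1 i2 i3 square_integrals) simp
    show "AE x in torus. ?c + (?L x + ?M x + ?N x) - C * norm \<eta> * ((norm (z x))\<^sup>2 + (norm (grad_form z x))\<^sup>2) \<le> ?I x"
      using z_bound
    proof eventually_elim
      case (elim x)
      then show ?case using bound[of "z x" "grad_form z x"] r by (simp add: curvature_def inner2.add_left)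
    qed
  qed
  also have "(LINT x|torus. ?c + (?L x + ?M x + ?N x) - C * norm \<eta> * ((norm (z x))\<^sup>2 + (norm (grad_form z x))\<^sup>2))
    = ?c - C * norm \<eta> * (LINT x|torus. (norm (z x))\<^sup>2 + (norm (grad_form z x))\<^sup>2)"
  proof -
    have "integrable torus (\<lambda>x. ?L x + ?M x + ?N x)" "(LINT x|torus. ?L x + ?M x + ?N x) = 0"
      using i1 i2 i3 by simp_all
    moreover have "integrable torus (\<lambda>x. C * norm \<eta> * ((norm (z x))\<^sup>2 + (norm (grad_form z x))\<^sup>2))"
      by (intro integrable_mult_right square_integrals)
    ultimately show ?thesis
      by (subst Bochner_Integration.integral_diff, simp, simp, subst Bochner_Integration.integral_add, simp, simp)
        (simp add: torus.prob_space)
  qed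
  finally have 1: "?c - C * norm \<eta> * (LINT x|torus. (norm (z x))\<^sup>2 + (norm (grad_form z x))\<^sup>2) \<le> gradient (\<bullet>) (\<lambda>x. k + z x) (const_form \<eta>)"
    by (simp only: gradient_const_eq)
  have "C * norm \<eta> * (LINT x|torus. (norm (z x))\<^sup>2 + (norm (grad_form z x))\<^sup>2) \<le> C * norm \<eta> * ((real CARD('n) + 1) * dirichlet)"
    using C square_integrals(2) by (intro mult_left_mono) auto
  with 1 show ?thesis by (simp add: mult_ac)
qed

lemma energy_upper:
  assumes C: "0 < C"
    and bound: "\<And>z D :: _. norm z \<le> 1 \<Longrightarrow>
      inner2 (\<bullet>) (alternation D + (const_curv k + bracket_wedge k z + (1/2) *\<^sub>R bracket_wedge z z))
        (alternation D + (const_curv k + bracket_wedge k z + (1/2) *\<^sub>R bracket_wedge z z)) + (norm (contraction D))\<^sup>2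
      \<le> 2 * inner2 (\<bullet>) (const_curv k) (const_curv k) + C * ((norm z)\<^sup>2 + (norm D)\<^sup>2)"
  shows "energy (\<bullet>) (\<lambda>x. k + z x) \<le> inner2 (\<bullet>) (const_curv k) (const_curv k) + C * (real CARD('n) + 1) * dirichlet"
proof -
  have eq1: "(LINT x|torus. inner2 (\<bullet>) (curv (\<lambda>x. k + z x) x) (curv (\<lambda>x. k + z x) x))
      = (LINT x|torus. inner2 (\<bullet>) (curvature x) (curvature x))"
    using AE_curv
    by (intro integral_cong_AE bounded_bilinear_measurable[OF bounded_bilinear_inner2] curv_measurable[OF form_W1p one_le_numeral]
        L2D(1)[OF curvature_L2]) (auto elim: eventually_mono)
  have eq2: "(LINT x|torus. codiff (\<lambda>x. k + z x) x \<bullet> codiff (\<lambda>x. k + z x) x) = (LINT x|torus. codiff z x \<bullet> codiff z x)"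
    using AE_codiff L2D(1)[OF codiff_L2[OF form_W1p]] L2D(1)[OF codiff_L2[OF z]]
    by (intro integral_cong_AE borel_measurable_inner) (auto elim: eventually_mono)
  have i1: "integrable torus (\<lambda>x. inner2 (\<bullet>) (curvature x) (curvature x))"
    by (rule integrable_bounded_bilinear_L2[OF bounded_bilinear_inner2 curvature_L2 curvature_L2])
  have i2: "integrable torus (\<lambda>x. codiff z x \<bullet> codiff z x)"
    by (rule integrable_bounded_bilinear_L2[OF bounded_bilinear_inner codiff_L2[OF z] codiff_L2[OF z]])
  have "(LINT x|torus. inner2 (\<bullet>) (curvature x) (curvature x) + codiff z x \<bullet> codiff z x)
      \<le> (LINT x|torus. 2 * inner2 (\<bullet>) (const_curv k) (const_curv k) + C * ((norm (z x))\<^sup>2 + (norm (grad_form z x))\<^sup>2))"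
  proof (rule integral_mono_AE)
    show "AE x in torus. inner2 (\<bullet>) (curvature x) (curvature x) + codiff z x \<bullet> codiff z x
        \<le> 2 * inner2 (\<bullet>) (const_curv k) (const_curv k) + C * ((norm (z x))\<^sup>2 + (norm (grad_form z x))\<^sup>2)"
      using z_bound
    proof eventually_elim
      case (elim x)
      then show ?case using bound[of "z x" "grad_form z x"] r
        by (simp add: curvature_def codiff_eq power2_norm_eq_inner[of "contraction _"])
    qed
    show "integrable torus (\<lambda>x. inner2 (\<bullet>) (curvature x) (curvature x) + codiff z x \<bullet> codiff z x)"
      by (intro Bochner_Integration.integrable_add i1 i2)
    show "integrable torus (\<lambda>x. 2 * inner2 (\<bullet>) (const_curv k) (const_curv k) + C * ((norm (z x))\<^sup>2 + (norm (grad_form z x))\<^sup>2))"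
      by (intro Bochner_Integration.integrable_add integrable_mult_right square_integrals) simp
  qed
  also have "\<dots> = 2 * inner2 (\<bullet>) (const_curv k) (const_curv k) + C * (LINT x|torus. (norm (z x))\<^sup>2 + (norm (grad_form z x))\<^sup>2)"
    using integrable_mult_right[OF square_integrals(1), of C]
    by (subst Bochner_Integration.integral_add, simp, simp) (simp add: torus.prob_space)
  also have "\<dots> \<le> 2 * inner2 (\<bullet>) (const_curv k) (const_curv k) + C * ((real CARD('n) + 1) * dirichlet)"
    using C square_integrals(2) by (intro add_left_mono mult_left_mono) auto
  finally have "(LINT x|torus. inner2 (\<bullet>) (curvature x) (curvature x)) + (LINT x|torus. codiff z x \<bullet> codiff z x)
      \<le> 2 * inner2 (\<bullet>) (const_curv k) (const_curv k) + C * ((real CARD('n) + 1) * dirichlet)"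
    using i1 i2 by simp
  \<comment> \<open>Halving the integrated bound gives exactly coefficient 1 for the quartic term;
    on the remainder the factor 1/2 is given away, which requires its sign.\<close>
  moreover have "0 \<le> C * ((real CARD('n) + 1) * dirichlet)"
    using C dirichlet_nonneg by simp
  ultimately show ?thesis
    unfolding energy_def eq1 eq2 mult.assoc by linarith
qed

end

text \<open>One constant, depending on the dimension alone, for all k, z and r. This uniformity is
  what later permits choosing r with C r <= 1/2.\<close>

theorem perturbation_estimates:
  obtains C where "0 < C"
    "\<And>(k :: 'n::{finite,linorder} covec) z r. const_perturbation k z r \<Longrightarrow>
      (1 - C * r) * (LINT x|torus. (norm (grad_form z x))\<^sup>2) \<le> gradient (\<bullet>) (\<lambda>x. k + z x) z"
    "\<And>(k :: 'n covec) z r \<eta>. const_perturbation k z r \<Longrightarrow>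
      inner2 (\<bullet>) (const_curv k) (bracket_wedge k \<eta>) - C * norm \<eta> * (LINT x|torus. (norm (grad_form z x))\<^sup>2)
      \<le> gradient (\<bullet>) (\<lambda>x. k + z x) (const_form \<eta>)"
    "\<And>(k :: 'n covec) z r. const_perturbation k z r \<Longrightarrow>
      energy (\<bullet>) (\<lambda>x. k + z x) \<le> inner2 (\<bullet>) (const_curv k) (const_curv k) + C * (LINT x|torus. (norm (grad_form z x))\<^sup>2)"
proof -
  let ?n = "real CARD('n) + 1"
  obtain C1 where C1: "0 < C1" and b1: "\<And>(k :: 'n covec) z D r. 0 \<le> r \<Longrightarrow> r \<le> 1 \<Longrightarrow> norm k \<le> r \<Longrightarrow> norm z \<le> r \<Longrightarrow>
      inner2 (\<bullet>) (alternation D) (alternation D) + inner2 (\<bullet>) (const_curv k) (alternation D + bracket_wedge k z)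
        - C1 * r * ((norm z)\<^sup>2 + (norm D)\<^sup>2)
      \<le> inner2 (\<bullet>) (alternation D + (const_curv k + bracket_wedge k z + (1/2) *\<^sub>R bracket_wedge z z))
          (alternation D + bracket_wedge (k + z) z)"
    using gradient_density_bound[where 'n = 'n] by metis
  obtain C2 where C2: "0 < C2" and b2: "\<And>(k :: 'n covec) z D \<eta>. norm k \<le> 1 \<Longrightarrow> norm z \<le> 1 \<Longrightarrow>
      inner2 (\<bullet>) (const_curv k) (bracket_wedge k \<eta>)
        + (inner2 (\<bullet>) (alternation D + bracket_wedge k z) (bracket_wedge k \<eta>) + inner2 (\<bullet>) (const_curv k) (bracket_wedge z \<eta>))
        - C2 * norm \<eta> * ((norm z)\<^sup>2 + (norm D)\<^sup>2)
      \<le> inner2 (\<bullet>) (alternation D + (const_curv k + bracket_wedge k z + (1/2) *\<^sub>R bracket_wedge z z)) (bracket_wedge (k + z) \<eta>)"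
    using gradient_const_density_bound[where 'n = 'n] by metis
  obtain C3 where C3: "0 < C3" and b3: "\<And>(k :: 'n covec) z D. norm k \<le> 1 \<Longrightarrow> norm z \<le> 1 \<Longrightarrow>
      inner2 (\<bullet>) (alternation D + (const_curv k + bracket_wedge k z + (1/2) *\<^sub>R bracket_wedge z z))
        (alternation D + (const_curv k + bracket_wedge k z + (1/2) *\<^sub>R bracket_wedge z z)) + (norm (contraction D))\<^sup>2
      \<le> 2 * inner2 (\<bullet>) (const_curv k) (const_curv k) + C3 * ((norm z)\<^sup>2 + (norm D)\<^sup>2)"
    using energy_density_bound[where 'n = 'n] by metis
  define C where "C = (C1 + C2 + C3) * ?n"
  have C: "C1 * ?n \<le> C" "C2 * ?n \<le> C" "C3 * ?n \<le> C" "0 < C"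
    unfolding C_def using C1 C2 C3 by (auto intro!: mult_right_mono mult_pos_pos add_pos_nonneg)
  show ?thesis
  proof (rule that[OF C(4)])
    fix k :: "'n covec" and z r
    assume "const_perturbation k z r"
    then interpret const_perturbation k z r .
    have k1: "norm k \<le> 1" using k_bound r by simp
    have "(1 - C * r) * dirichlet \<le> (1 - C1 * ?n * r) * dirichlet"
      using C(1) r dirichlet_nonneg by (intro mult_right_mono diff_left_mono) auto
    also have "\<dots> \<le> gradient (\<bullet>) (\<lambda>x. k + z x) z"
      by (rule gradient_z_lower[OF C1 b1[OF r k_bound]])
    finally show "(1 - C * r) * (LINT x|torus. (norm (grad_form z x))\<^sup>2) \<le> gradient (\<bullet>) (\<lambda>x. k + z x) z"
      by (simp only: dirichlet_def)
    fix \<eta> :: "'n covec"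
    have "C2 * ?n * (norm \<eta> * dirichlet) \<le> C * (norm \<eta> * dirichlet)"
      using C(2) dirichlet_nonneg by (intro mult_right_mono) auto
    moreover have "inner2 (\<bullet>) (const_curv k) (bracket_wedge k \<eta>) - C2 * ?n * norm \<eta> * dirichlet \<le> gradient (\<bullet>) (\<lambda>x. k + z x) (const_form \<eta>)"
      by (rule gradient_const_lower[OF C2 b2[OF k1]])
    ultimately have "inner2 (\<bullet>) (const_curv k) (bracket_wedge k \<eta>) - C * norm \<eta> * dirichlet \<le> gradient (\<bullet>) (\<lambda>x. k + z x) (const_form \<eta>)"
      unfolding mult.assoc by linarith
    then show "inner2 (\<bullet>) (const_curv k) (bracket_wedge k \<eta>) - C * norm \<eta> * (LINT x|torus. (norm (grad_form z x))\<^sup>2)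
      \<le> gradient (\<bullet>) (\<lambda>x. k + z x) (const_form \<eta>)"
      by (simp only: dirichlet_def)
  next
    fix k :: "'n covec" and z r
    assume "const_perturbation k z r"
    then interpret const_perturbation k z r .
    have k1: "norm k \<le> 1" using k_bound r by simp
    have "C3 * ?n * dirichlet \<le> C * dirichlet"
      using C(3) dirichlet_nonneg by (intro mult_right_mono) auto
    moreover have "energy (\<bullet>) (\<lambda>x. k + z x) \<le> inner2 (\<bullet>) (const_curv k) (const_curv k) + C3 * ?n * dirichlet"
      by (rule energy_upper[OF C3 b3[OF k1]])
    ultimately have "energy (\<bullet>) (\<lambda>x. k + z x) \<le> inner2 (\<bullet>) (const_curv k) (const_curv k) + C * dirichlet"
      by linarith
    then show "energy (\<bullet>) (\<lambda>x. k + z x) \<le> inner2 (\<bullet>) (const_curv k) (const_curv k) + C * (LINT x|torus. (norm (grad_form z x))\<^sup>2)"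
      by (simp only: dirichlet_def)
  qed
qed

section \<open>Sobolev norms and dual norms\<close>

text \<open>The p-th power of the Sobolev norm, which is additive over its terms. Bounds by s powr p
  then translate into bounds of the norm by s.\<close>

definition sobolev_sum :: "real \<Rightarrow> (real^'n \<Rightarrow> 'b::euclidean_space) \<Rightarrow> real" where
  "sobolev_sum p f = (LINT x|torus. norm (f x) powr p) + (\<Sum>i\<in>UNIV. LINT x|torus. norm (wd i f x) powr p)"

lemma sobolev_norm_eq: "sobolev_norm p f = sobolev_sum p f powr (1 / p)"
  by (simp add: sobolev_norm_def sobolev_sum_def)

lemma sobolev_sum_nonneg: "0 \<le> sobolev_sum p f"
  by (simp add: sobolev_sum_def sum_nonneg)

lemma sobolev_sum_summands:
  "(LINT x|torus. norm (f x) powr p) \<le> sobolev_sum p f"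
  "(\<Sum>i\<in>UNIV. LINT x|torus. norm (wd i f x) powr p) \<le> sobolev_sum p f"
  "(LINT x|torus. norm (wd i f x) powr p) \<le> sobolev_sum p f"
proof -
  have 0: "0 \<le> (LINT x|torus. norm (f x) powr p)" "0 \<le> (LINT x|torus. norm (wd j f x) powr p)" for j
    by simp_all
  have le: "(LINT x|torus. norm (wd i f x) powr p) \<le> (\<Sum>i\<in>UNIV. LINT x|torus. norm (wd i f x) powr p)"
    by (rule member_le_sum) auto
  show "(LINT x|torus. norm (f x) powr p) \<le> sobolev_sum p f"
    by (simp add: sobolev_sum_def sum_nonneg)
  show "(\<Sum>i\<in>UNIV. LINT x|torus. norm (wd i f x) powr p) \<le> sobolev_sum p f"
    using 0 by (simp add: sobolev_sum_def)
  with le show "(LINT x|torus. norm (wd i f x) powr p) \<le> sobolev_sum p f" by linarith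
qed

lemma sobolev_norm_le_iff:
  assumes "0 < p" "0 \<le> s"
  shows "sobolev_norm p f \<le> s \<longleftrightarrow> sobolev_sum p f \<le> s powr p"
proof
  assume "sobolev_norm p f \<le> s"
  then have "(sobolev_sum p f powr (1 / p)) powr p \<le> s powr p"
    using assms by (intro powr_mono2) (auto simp: sobolev_norm_eq)
  then show "sobolev_sum p f \<le> s powr p"
    using assms sobolev_sum_nonneg[of p f] by (simp add: powr_powr)
next
  assume "sobolev_sum p f \<le> s powr p"
  then have "sobolev_sum p f powr (1 / p) \<le> (s powr p) powr (1 / p)"
    using assms sobolev_sum_nonneg by (intro powr_mono2) auto
  then show "sobolev_norm p f \<le> s"
    using assms by (simp add: powr_powr sobolev_norm_eq)
qed

lemma sobolev_norm_nonneg: "0 \<le> sobolev_norm p f"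
  by (simp add: sobolev_norm_eq)

lemma sobolev_sum_scaleR:
  assumes "f \<in> W1p p" "1 \<le> p"
  shows "sobolev_sum p (\<lambda>x. c *\<^sub>R f x) = \<bar>c\<bar> powr p * sobolev_sum p f"
proof -
  have "(LINT x|torus. norm (wd i (\<lambda>x. c *\<^sub>R f x) x) powr p) = \<bar>c\<bar> powr p * (LINT x|torus. norm (wd i f x) powr p)" for i
  proof -
    have "(LINT x|torus. norm (wd i (\<lambda>x. c *\<^sub>R f x) x) powr p) = (LINT x|torus. \<bar>c\<bar> powr p * norm (wd i f x) powr p)"
    proof (rule integral_cong_AE)
      show "(\<lambda>x. norm (wd i (\<lambda>x. c *\<^sub>R f x) x) powr p) \<in> borel_measurable torus"
        using LpD(4)[OF W1p_weak_partial(1)[OF W1p_scaleR[OF assms] assms(2)]] by auto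
      show "(\<lambda>x. \<bar>c\<bar> powr p * norm (wd i f x) powr p) \<in> borel_measurable torus"
        using LpD(4)[OF W1p_weak_partial(1)[OF assms]] by auto
      show "AE x in torus. norm (wd i (\<lambda>x. c *\<^sub>R f x) x) powr p = \<bar>c\<bar> powr p * norm (wd i f x) powr p"
        using wd_scaleR[OF assms, of i c] by eventually_elim (simp add: powr_mult)
    qed
    then show ?thesis by simp
  qed
  then show ?thesis
    by (simp add: sobolev_sum_def powr_mult sum_distrib_left distrib_left)
qed

lemma sobolev_sum_const: "1 \<le> p \<Longrightarrow> sobolev_sum p (\<lambda>x :: real^'n. c :: 'b::euclidean_space) = norm c powr p"
proof -
  assume "1 \<le> p"
  have "(LINT x|torus. norm (wd i (\<lambda>x :: real^'n. c) x) powr p) = 0" for i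
  proof (rule integral_eq_zero_AE)
    show "AE x in torus. norm (wd i (\<lambda>x :: real^'n. c) x) powr p = 0"
      using wd_const[of i c] by eventually_elim simp
  qed
  then show ?thesis by (simp add: sobolev_sum_def torus.prob_space)
qed

lemma integral_norm_le_of_powr:
  fixes f :: "real^'n \<Rightarrow> 'b::euclidean_space"
  assumes f: "f \<in> Lp p" and p: "1 \<le> p" and s: "0 < s" and le: "(LINT x|torus. norm (f x) powr p) \<le> s powr p"
  shows "(LINT x|torus. norm (f x)) \<le> 2 * s"
proof -
  have int: "integrable torus (\<lambda>x. s * (1 + norm (f x) powr p / s powr p))"
    using LpD(3)[OF f] by simp
  have "(LINT x|torus. norm (f x)) \<le> (LINT x|torus. s * (1 + norm (f x) powr p / s powr p))"
  proof (rule integral_mono[OF _ int])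
    show "integrable torus (\<lambda>x. norm (f x))" using Lp_integrable[OF f p] by simp
    show "norm (f x) \<le> s * (1 + norm (f x) powr p / s powr p)" for x
      using le_scaled_powr[OF s norm_ge_zero p, of "f x"] s by (simp add: powr_divide)
  qed
  also have "\<dots> = s * (1 + (LINT x|torus. norm (f x) powr p) / s powr p)"
    using LpD(3)[OF f] by (simp add: torus.prob_space)
  also have "\<dots> \<le> s * (1 + 1)"
    using s le by (intro mult_left_mono add_left_mono) (auto simp: divide_le_eq)
  finally show ?thesis by simp
qed

lemma norm_mean_le:
  fixes f :: "real^'n \<Rightarrow> 'b::euclidean_space"
  assumes f: "f \<in> Lp p" and p: "1 \<le> p" and s: "0 < s" and le: "sobolev_sum p f \<le> s powr p"
  shows "norm (LINT x|torus. f x) \<le> 2 * s"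
  using integral_norm_le_of_powr[OF f p s] sobolev_sum_summands(1)[of f p] le integral_norm_bound[of torus f] by linarith

text \<open>Morrey's inequality is stated for the sum of the norms of the derivatives; passing to
  the sum of their p-th powers costs a factor d in s.\<close>

theorem sobolev_embedding:
  fixes f :: "real^'n \<Rightarrow> 'b::euclidean_space"
  assumes f: "f \<in> W1p p" and p: "real CARD('n) < p" and s: "0 < s" and le: "sobolev_sum p f \<le> s powr p"
  shows "AE x in torus. norm (f x - (LINT y|torus. f y)) \<le> 2 * real CARD('n) / (1 - real CARD('n) / p) * s"
proof -
  let ?d = "real CARD('n)"
  have d: "1 \<le> ?d" using zero_less_card_finite[where 'a = 'n] by linarith
  have p1: "1 \<le> p" using p d by linarith
  have Lp: "wd i f \<in> Lp p" for i by (rule W1p_weak_partial[OF f p1])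
  have L1: "f \<in> Lp 1" "wd i f \<in> Lp 1" for i
    using Lp_mono[OF W1p_Lp[OF f], of 1] Lp_mono[OF Lp, of 1] p1 by auto
  have "AE x in torus. norm (f x - (LINT y|torus. f y)) \<le> 2 * (?d * s) / (1 - ?d / p)"
  proof (rule morrey_inequality[OF L1 W1p_weak_partial(2)[OF f p1] p])
    show "0 < ?d * s" using s d by simp
    have int: "integrable torus (\<lambda>x. ?d powr p * (\<Sum>i\<in>UNIV. norm (wd i f x) powr p))"
      using LpD(3)[OF Lp] by simp
    have "(\<integral>\<^sup>+x. ennreal ((\<Sum>i\<in>UNIV. norm (wd i f x)) powr p) \<partial>torus)
        \<le> (\<integral>\<^sup>+x. ennreal (?d powr p * (\<Sum>i\<in>UNIV. norm (wd i f x) powr p)) \<partial>torus)"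
      using p1 by (intro nn_integral_mono ennreal_leI powr_sum_le) auto
    also have "\<dots> = ennreal (LINT x|torus. ?d powr p * (\<Sum>i\<in>UNIV. norm (wd i f x) powr p))"
      by (intro nn_integral_eq_integral[OF int]) (auto intro!: mult_nonneg_nonneg sum_nonneg)
    also have "(LINT x|torus. ?d powr p * (\<Sum>i\<in>UNIV. norm (wd i f x) powr p)) = ?d powr p * (\<Sum>i\<in>UNIV. LINT x|torus. norm (wd i f x) powr p)"
      using LpD(3)[OF Lp] by simp
    also have "\<dots> \<le> ?d powr p * s powr p"
      using le sobolev_sum_summands(2)[of f p] by (intro mult_left_mono) auto
    also have "\<dots> = (?d * s) powr p" using s by (simp add: powr_mult)
    finally show "(\<integral>\<^sup>+x. ennreal ((\<Sum>i\<in>UNIV. norm (wd i f x)) powr p) \<partial>torus) \<le> ennreal ((?d * s) powr p)"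
      by (simp add: ennreal_leI)
  qed
  then show ?thesis by (simp add: mult_ac)
qed

lemma sobolev_sum_0_imp_AE:
  fixes f :: "real^'n \<Rightarrow> 'b::euclidean_space"
  assumes f: "f \<in> W1p p" and p: "0 < p" and 0: "sobolev_sum p f = 0"
  shows "AE x in torus. f x = 0"
proof -
  have "(LINT x|torus. norm (f x) powr p) = 0"
  proof (rule antisym)
    show "(LINT x|torus. norm (f x) powr p) \<le> 0"
      using sobolev_sum_summands(1)[of f p] 0 by simp
  qed simp
  then have "AE x in torus. norm (f x) powr p = 0"
    using LpD(3)[OF W1p_Lp[OF f]] integral_nonneg_eq_0_iff_AE[of torus "\<lambda>x. norm (f x) powr p"] by simp
  then show ?thesis by eventually_elim simp
qed

lemma norm_grad_form_squared: "(norm (grad_form f x))\<^sup>2 = (\<Sum>i\<in>UNIV. (norm (wd i f x))\<^sup>2)"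
  by (subst norm_vec_squared) (simp add: grad_form_def)

text \<open>After division by s, \<open>powr_le_one_plus\<close> compares squares with p-th powers;
  the factor 2 is the price.\<close>

lemma dirichlet_le:
  fixes f :: "'n::finite one_form"
  assumes f: "f \<in> W1p p" and p: "2 \<le> p" and s: "0 < s" and le: "sobolev_sum p f \<le> s powr p"
  shows "(LINT x|torus. (norm (grad_form f x))\<^sup>2) \<le> 2 * real CARD('n) * s\<^sup>2"
proof -
  have Lp: "wd i f \<in> Lp p" for i using p by (intro W1p_weak_partial[OF f]) auto
  have "(LINT x|torus. (norm (wd i f x))\<^sup>2) \<le> 2 * s\<^sup>2" for i
  proof -
    have int: "integrable torus (\<lambda>x. s\<^sup>2 * (1 + norm (wd i f x) powr p / s powr p))"
      using LpD(3)[OF Lp] by simp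
    have "(LINT x|torus. (norm (wd i f x))\<^sup>2) \<le> (LINT x|torus. s\<^sup>2 * (1 + norm (wd i f x) powr p / s powr p))"
    proof (rule integral_mono[OF _ int])
      show "integrable torus (\<lambda>x. (norm (wd i f x))\<^sup>2)" using Lp_imp_L2[OF Lp p] by (rule L2D)
      show "(norm (wd i f x))\<^sup>2 \<le> s\<^sup>2 * (1 + norm (wd i f x) powr p / s powr p)" for x
        using powr_le_one_plus[of 2 p "norm (wd i f x) / s"] s p by (simp add: powr_divide power_divide field_simps)
    qed
    also have "\<dots> = s\<^sup>2 * (1 + (LINT x|torus. norm (wd i f x) powr p) / s powr p)"
      using LpD(3)[OF Lp] by (simp add: torus.prob_space)
    also have "\<dots> \<le> s\<^sup>2 * (1 + 1)"
      using s le sobolev_sum_summands(3)[of i f p] by (intro mult_left_mono add_left_mono) (auto simp: divide_le_eq)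
    finally show ?thesis by simp
  qed
  then have "(\<Sum>i\<in>UNIV. LINT x|torus. (norm (wd i f x))\<^sup>2) \<le> of_nat (card (UNIV :: 'n set)) * (2 * s\<^sup>2)"
    by (intro sum_bounded_above) auto
  moreover have "(LINT x|torus. (norm (grad_form f x))\<^sup>2) = (\<Sum>i\<in>UNIV. LINT x|torus. (norm (wd i f x))\<^sup>2)"
    using Lp_imp_L2[OF Lp p] by (simp add: norm_grad_form_squared L2D)
  ultimately show ?thesis by simp
qed

lemma conj_exp_bounds:
  assumes "2 \<le> p"
  shows "1 < conj_exp p" "conj_exp p \<le> 2" "1 / p + 1 / conj_exp p = 1"
  using assms by (auto simp: field_simps)

text \<open>For q at most 2 the Sobolev norm of a mean-free form is controlled by the mean square of
  its derivatives. This makes a multiple of z an admissible test form for the dual norm, with a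
  normalisation independent of q.\<close>

lemma sobolev_sum_normalized:
  fixes z :: "'n::finite one_form"
  assumes z: "z \<in> W1p 2" and mean: "(LINT x|torus. z x) = 0" and q: "1 \<le> q" "q \<le> 2"
    and S: "S = (LINT x|torus. (norm (grad_form z x))\<^sup>2)" "0 < S"
  shows "sobolev_sum q (\<lambda>x. (1 / ((2 * real CARD('n) + 2) * sqrt S)) *\<^sub>R z x) \<le> 1"
proof -
  let ?d = "real CARD('n)"
  have zq: "z \<in> W1p q" using W1p_mono[OF z] q by simp
  have part: "(LINT x|torus. norm (f x) powr q) \<le> sqrt S powr q * (1 + (LINT x|torus. (norm (f x))\<^sup>2) / S)"
    if f: "f \<in> Lp 2" for f :: "real^'n \<Rightarrow> su2^'n"
  proof -
    have int: "integrable torus (\<lambda>x. sqrt S powr q * (1 + (norm (f x))\<^sup>2 / S))"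
      using f by (simp add: Lp_2_iff_L2 L2_def)
    have "(LINT x|torus. norm (f x) powr q) \<le> (LINT x|torus. sqrt S powr q * (1 + (norm (f x))\<^sup>2 / S))"
    proof (rule integral_mono[OF _ int])
      show "integrable torus (\<lambda>x. norm (f x) powr q)"
        using Lp_mono[OF f, of q] q by (auto dest: LpD)
      show "norm (f x) powr q \<le> sqrt S powr q * (1 + (norm (f x))\<^sup>2 / S)" for x
      proof -
        have "(norm (f x) / sqrt S) powr q \<le> 1 + (norm (f x) / sqrt S) powr 2"
          using q S by (intro powr_le_one_plus) auto
        then have "norm (f x) powr q / sqrt S powr q \<le> 1 + (norm (f x))\<^sup>2 / S"
          using S(2) by (simp add: powr_divide power_divide)
        then show ?thesis using S(2) by (simp add: divide_le_eq mult.commute)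
      qed
    qed
    also have "\<dots> = sqrt S powr q * (1 + (LINT x|torus. (norm (f x))\<^sup>2) / S)"
      using f by (simp add: Lp_2_iff_L2 L2_def torus.prob_space)
    finally show ?thesis .
  qed
  have wL: "wd i z \<in> Lp 2" for i by (rule W1p_weak_partial[OF z]) simp
  have S_sum: "S = (\<Sum>i\<in>UNIV. LINT x|torus. (norm (wd i z x))\<^sup>2)"
    using wL by (simp add: S(1) norm_grad_form_squared Lp_2_iff_L2 L2_def)
  have "sobolev_sum q z \<le> sqrt S powr q * (1 + (LINT x|torus. (norm (z x))\<^sup>2) / S)
      + (\<Sum>i\<in>UNIV. sqrt S powr q * (1 + (LINT x|torus. (norm (wd i z x))\<^sup>2) / S))"
    unfolding sobolev_sum_def by (intro add_mono sum_mono part wL W1p_Lp[OF z])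
  also have "\<dots> = sqrt S powr q * (2 + ?d + (LINT x|torus. (norm (z x))\<^sup>2) / S)"
  proof -
    have "(\<Sum>i\<in>UNIV. sqrt S powr q * (1 + (LINT x|torus. (norm (wd i z x))\<^sup>2) / S))
        = sqrt S powr q * (\<Sum>i\<in>UNIV. 1 + (LINT x|torus. (norm (wd i z x))\<^sup>2) / S)"
      by (simp only: sum_distrib_left)
    also have "(\<Sum>i\<in>UNIV. 1 + (LINT x|torus. (norm (wd i z x))\<^sup>2) / S) = ?d + S / S"
      unfolding sum.distrib sum_divide_distrib[symmetric] S_sum[symmetric] by simp
    finally show ?thesis using S(2) by (simp add: algebra_simps)
  qed
  also have "\<dots> \<le> sqrt S powr q * (2 + 2 * ?d)"
    using poincare_mean_zero[OF z mean] S by (intro mult_left_mono) (auto simp: divide_le_eq)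
  finally have le: "sobolev_sum q z \<le> sqrt S powr q * (2 + 2 * ?d)" .
  \<comment> \<open>1 and the Poincare constant d for z, d and S / S = 1 for the derivatives:
    altogether 2 d + 2. As c and q are at least 1, dividing by c instead of its q-th root is
    enough.\<close>
  define c where "c = 2 * ?d + 2"
  have c: "1 \<le> c" by (simp add: c_def)
  have "(1 / c) powr q \<le> (1 / c) powr 1"
    using q c by (intro powr_mono') auto
  then have "(1 / c) powr q \<le> 1 / c"
    using c by simp
  then have "(1 / c) powr q * c \<le> 1 / c * c" using c by (intro mult_right_mono) auto
  then have cq: "(1 / c) powr q * c \<le> 1" using c by simp
  have "sobolev_sum q (\<lambda>x. (1 / (c * sqrt S)) *\<^sub>R z x) = \<bar>1 / (c * sqrt S)\<bar> powr q * sobolev_sum q z"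
    by (rule sobolev_sum_scaleR[OF zq q(1)])
  also have "\<bar>1 / (c * sqrt S)\<bar> powr q = (1 / c) powr q / sqrt S powr q"
    using c S(2) by (simp add: powr_divide powr_mult)
  also have "(1 / c) powr q / sqrt S powr q * sobolev_sum q z \<le> (1 / c) powr q / sqrt S powr q * (sqrt S powr q * c)"
    using le by (intro mult_left_mono) (auto simp: c_def add.commute)
  also have "\<dots> = (1 / c) powr q * c" using S(2) by simp
  finally show ?thesis using cq by (simp add: c_def)
qed

lemma grad_form_scaleR:
  assumes "b \<in> W1p q" "1 \<le> q"
  shows "AE x in torus. grad_form (\<lambda>x. c *\<^sub>R b x) x = c *\<^sub>R grad_form b x"
proof -
  have "AE x in torus. \<forall>i. wd i (\<lambda>x. c *\<^sub>R b x) x = c *\<^sub>R wd i b x"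
    by (simp add: AE_all_countable wd_scaleR[OF assms])
  then show ?thesis by eventually_elim (simp add: grad_form_def vec_eq_iff)
qed

lemma gradient_scaleR:
  fixes a b :: "'n::{finite,linorder} one_form"
  assumes a: "a \<in> W1p p" "1 \<le> p" and b: "b \<in> W1p q" "1 \<le> q"
  shows "gradient (\<bullet>) a (\<lambda>x. c *\<^sub>R b x) = c * gradient (\<bullet>) a b"
proof -
  have cb: "(\<lambda>x. c *\<^sub>R b x) \<in> W1p q" by (rule W1p_scaleR[OF b])
  have am: "a \<in> borel_measurable torus" by (rule LpD(4)[OF W1p_Lp[OF a(1)]])
  have "(LINT x|torus. inner2 (\<bullet>) (curv a x) (cov_d a (\<lambda>x. c *\<^sub>R b x) x)) = (LINT x|torus. c * inner2 (\<bullet>) (curv a x) (cov_d a b x))"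
  proof (rule integral_cong_AE)
    show "(\<lambda>x. inner2 (\<bullet>) (curv a x) (cov_d a (\<lambda>x. c *\<^sub>R b x) x)) \<in> borel_measurable torus"
      by (rule bounded_bilinear_measurable[OF bounded_bilinear_inner2 curv_measurable[OF a] cov_d_measurable[OF am cb b(2)]])
    show "(\<lambda>x. c * inner2 (\<bullet>) (curv a x) (cov_d a b x)) \<in> borel_measurable torus"
      using bounded_bilinear_measurable[OF bounded_bilinear_inner2 curv_measurable[OF a] cov_d_measurable[OF am b]] by simp
    show "AE x in torus. inner2 (\<bullet>) (curv a x) (cov_d a (\<lambda>x. c *\<^sub>R b x) x) = c * inner2 (\<bullet>) (curv a x) (cov_d a b x)"
      using grad_form_scaleR[OF b, of c]
      by eventually_elim (simp add: cov_d_eq linear_scale[OF bounded_linear.linear[OF bounded_linear_alternation]]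
          bracket_wedge.scaleR_right inner2.scaleR_right flip: scaleR_add_right)
  qed
  moreover have "(LINT x|torus. codiff a x \<bullet> codiff (\<lambda>x. c *\<^sub>R b x) x) = (LINT x|torus. c * (codiff a x \<bullet> codiff b x))"
  proof (rule integral_cong_AE)
    show "(\<lambda>x. codiff a x \<bullet> codiff (\<lambda>x. c *\<^sub>R b x) x) \<in> borel_measurable torus"
      using codiff_measurable[OF a] codiff_measurable[OF cb b(2)] by simp
    show "(\<lambda>x. c * (codiff a x \<bullet> codiff b x)) \<in> borel_measurable torus"
      using codiff_measurable[OF a] codiff_measurable[OF b] by simp
    show "AE x in torus. codiff a x \<bullet> codiff (\<lambda>x. c *\<^sub>R b x) x = c * (codiff a x \<bullet> codiff b x)"
      using grad_form_scaleR[OF b, of c]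
      by eventually_elim (simp add: codiff_eq linear_scale[OF bounded_linear.linear[OF bounded_linear_contraction]])
  qed
  ultimately show ?thesis by (simp add: gradient_def distrib_left)
qed

section \<open>The gradient as a bounded functional and its dual norm\<close>

lemma abs_integral_le:
  assumes "integrable M g" "AE x in M. \<bar>f x\<bar> \<le> g x"
  shows "\<bar>LINT x|M. f x\<bar> \<le> (LINT x|M. (g x :: real))"
proof (cases "integrable M f")
  case True
  have "\<bar>LINT x|M. f x\<bar> \<le> (LINT x|M. \<bar>f x\<bar>)" by (rule integral_abs_bound)
  also have "\<dots> \<le> (LINT x|M. g x)" using True assms by (intro integral_mono_AE) auto
  finally show ?thesis .
next
  case False
  have "0 \<le> (LINT x|M. g x)"
    using assms(2) by (intro integral_nonneg_AE) (auto elim: eventually_mono)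
  then show ?thesis using False by (simp add: not_integrable_integral_eq)
qed

lemma norm_grad_form_le: "norm (grad_form a x) \<le> (\<Sum>i\<in>UNIV. norm (wd i a x))"
  by (simp add: norm_vec_def grad_form_def L2_set_le_sum)

lemma W1p_bounded:
  fixes f :: "real^'n \<Rightarrow> 'b::euclidean_space"
  assumes f: "f \<in> W1p p" and p: "real CARD('n) < p"
  obtains m where "0 \<le> m" "AE x in torus. norm (f x) \<le> m"
proof -
  have p0: "1 \<le> p" "0 < p" using p zero_less_card_finite[where 'a = 'n] by linarith+
  define s where "s = 1 + sobolev_norm p f"
  have s: "0 < s" using sobolev_norm_nonneg[of p f] by (simp add: s_def)
  have le: "sobolev_sum p f \<le> s powr p"
    using s p0 by (subst sobolev_norm_le_iff[symmetric]) (auto simp: s_def)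
  let ?m = "2 * real CARD('n) / (1 - real CARD('n) / p) * s + 2 * s"
  have "AE x in torus. norm (f x) \<le> ?m"
    using sobolev_embedding[OF f p s le]
  proof eventually_elim
    case (elim x)
    then show ?case
      using norm_mean_le[OF W1p_Lp[OF f] p0(1) s le] norm_triangle_sub[of "f x" "LINT y|torus. f y"] by linarith
  qed
  then have "AE x in torus. norm (f x) \<le> max 0 ?m"
    by eventually_elim simp
  then show ?thesis by (intro that[of "max 0 ?m"]) auto
qed

text \<open>\<open>Y_norm\<close> is a supremum of reals and dominates its terms only if these are
  bounded. Curvature and covariant derivative are at most K u and K v, with u p-integrable and v
  q-integrable, and Young's inequality bounds the product pointwise. The pointwise bound on a comes
  from p > d.\<close>

lemma gradient_bounded:
  fixes a :: "'n::{finite,linorder} one_form"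
  assumes a: "a \<in> W1p p" and p: "real CARD('n) < p" "2 \<le> p"
  obtains B where "\<And>b. b \<in> W1p (conj_exp p) \<Longrightarrow> sobolev_norm (conj_exp p) b \<le> 1 \<Longrightarrow> \<bar>gradient (\<bullet>) a b\<bar> \<le> B"
proof -
  define q where "q = conj_exp p"
  have q: "1 < q" "1 / p + 1 / q = 1" using conj_exp_bounds[OF p(2)] by (auto simp: q_def)
  obtain K where K: "1 \<le> K" "\<And>v w :: 'n covec. norm (bracket_wedge v w) \<le> K * (norm v * norm w)"
    "\<And>D :: 'n covec2. norm (alternation D) \<le> K * norm D" "\<And>D :: 'n covec2. norm (contraction D) \<le> K * norm D"
    using form_bound_constant[where 'n = 'n] by auto
  obtain m where m: "0 \<le> m" "AE x in torus. norm (a x) \<le> m"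
    using W1p_bounded[OF a p(1)] by blast
  define u where "u x = (\<Sum>i\<in>UNIV. norm (wd i a x)) + m\<^sup>2" for x
  define v where "v b x = (\<Sum>i\<in>UNIV. norm (wd i b x)) + m * norm (b x)" for b :: "'n one_form" and x
  have u0: "0 \<le> u x" for x by (simp add: u_def sum_nonneg)
  have v0: "0 \<le> v b x" for b x using m by (simp add: v_def sum_nonneg)
  let ?d = "real CARD('n)"
  define U where "U x = 2 powr p * (?d powr p * (\<Sum>i\<in>UNIV. norm (wd i a x) powr p) + (m\<^sup>2) powr p)" for x
  define V where "V b x = 2 powr q * (?d powr q * (\<Sum>i\<in>UNIV. norm (wd i b x) powr q) + m powr q * norm (b x) powr q)" for b :: "'n one_form" and x
  have uU: "u x powr p \<le> U x" for x
  proof -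
    have "u x powr p \<le> 2 powr p * ((\<Sum>i\<in>UNIV. norm (wd i a x)) powr p + (m\<^sup>2) powr p)"
      unfolding u_def using p by (intro powr_add_le sum_nonneg) auto
    also have "\<dots> \<le> U x"
      unfolding U_def using p by (intro mult_left_mono add_right_mono powr_sum_le) auto
    finally show ?thesis .
  qed
  have vV: "v b x powr q \<le> V b x" for b x
  proof -
    have "v b x powr q \<le> 2 powr q * ((\<Sum>i\<in>UNIV. norm (wd i b x)) powr q + (m * norm (b x)) powr q)"
      unfolding v_def using q m by (intro powr_add_le sum_nonneg) auto
    also have "\<dots> \<le> V b x"
      unfolding V_def powr_mult using q by (intro mult_left_mono add_right_mono powr_sum_le) auto
    finally show ?thesis .
  qed
  have Up: "integrable torus U"
    unfolding U_def using LpD(3)[OF W1p_weak_partial(1)[OF a]] p by simp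
  define B0 where "B0 = (LINT x|torus. U x) + 2 powr q * (?d powr q + m powr q)"
  define B where "B = 2 * (K\<^sup>2 * B0)"
  have "\<bar>gradient (\<bullet>) a b\<bar> \<le> B" if b: "b \<in> W1p q" "sobolev_norm q b \<le> 1" for b
  proof -
    have wb: "wd i b \<in> Lp q" for i by (rule W1p_weak_partial(1)[OF b(1)]) (use q in simp)
    have sb: "sobolev_sum q b \<le> 1"
      using b(2) q sobolev_norm_le_iff[of q 1 b] by simp
    have Vi: "integrable torus (V b)"
      unfolding V_def using LpD(3)[OF wb] LpD(3)[OF W1p_Lp[OF b(1)]] by simp
    have "(LINT x|torus. V b x) = 2 powr q * (?d powr q * (\<Sum>i\<in>UNIV. LINT x|torus. norm (wd i b x) powr q) + m powr q * (LINT x|torus. norm (b x) powr q))"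
      unfolding V_def using LpD(3)[OF wb] LpD(3)[OF W1p_Lp[OF b(1)]] by simp
    also have "\<dots> \<le> 2 powr q * (?d powr q * 1 + m powr q * 1)"
      using sobolev_sum_summands(1)[of b q] sobolev_sum_summands(2)[of b q] sb
      by (intro mult_left_mono add_mono) auto
    finally have VB: "(LINT x|torus. U x + V b x) \<le> B0"
      using Up Vi by (simp add: B0_def)
    have young: "u x * v b x \<le> U x + V b x" for x
    proof -
      have "u x * v b x \<le> u x powr p / p + v b x powr q / q"
        using p q u0 v0 by (intro Youngs_inequality) auto
      also have "\<dots> \<le> u x powr p + v b x powr q"
        using p q by (intro add_mono) (auto simp: divide_le_eq mult_le_cancel_left1)
      finally show ?thesis using uU[of x] vV[of b x] by linarith
    qed
    have K0: "0 \<le> K" using K(1) by simp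
    have K2: "K \<le> K * K" using K(1) by (simp add: mult_le_cancel_left1)
    have int: "integrable torus (\<lambda>x. K\<^sup>2 * (U x + V b x))" using Up Vi by simp
    have 1: "\<bar>LINT x|torus. inner2 (\<bullet>) (curv a x) (cov_d a b x)\<bar> \<le> (LINT x|torus. K\<^sup>2 * (U x + V b x))"
    proof (rule abs_integral_le[OF int])
      show "AE x in torus. \<bar>inner2 (\<bullet>) (curv a x) (cov_d a b x)\<bar> \<le> K\<^sup>2 * (U x + V b x)"
        using m(2)
      proof eventually_elim
        case (elim x)
        have "norm (curv a x) \<le> norm (ext_d a x) + norm ((1/2) *\<^sub>R bracket_wedge (a x) (a x))"
          unfolding curv_def by (rule norm_triangle_ineq)
        also have "\<dots> \<le> K * norm (grad_form a x) + K * (norm (a x) * norm (a x))"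
        proof -
          have "norm ((1/2) *\<^sub>R bracket_wedge (a x) (a x)) \<le> norm (bracket_wedge (a x) (a x))" by simp
          then show ?thesis
            unfolding ext_d_eq using K(2)[of "a x" "a x"] K(3)[of "grad_form a x"] by linarith
        qed
        also have "\<dots> \<le> K * (\<Sum>i\<in>UNIV. norm (wd i a x)) + K * (m * m)"
          using K0 elim m(1) by (intro add_mono mult_left_mono mult_mono norm_grad_form_le) auto
        finally have n1: "norm (curv a x) \<le> K * u x"
          by (simp add: u_def distrib_left power2_eq_square)
        have "norm (cov_d a b x) \<le> norm (ext_d b x) + norm (bracket_wedge (a x) (b x))"
          unfolding cov_d_def by (rule norm_triangle_ineq)
        also have "\<dots> \<le> K * norm (grad_form b x) + K * (norm (a x) * norm (b x))"
          unfolding ext_d_eq by (intro add_mono K)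
        also have "\<dots> \<le> K * (\<Sum>i\<in>UNIV. norm (wd i b x)) + K * (m * norm (b x))"
          using K0 elim by (intro add_mono mult_left_mono mult_right_mono norm_grad_form_le) auto
        finally have n2: "norm (cov_d a b x) \<le> K * v b x"
          by (simp add: v_def distrib_left)
        have "\<bar>inner2 (\<bullet>) (curv a x) (cov_d a b x)\<bar> \<le> norm (curv a x) * norm (cov_d a b x)"
          by (rule inner2_abs_le)
        also have "\<dots> \<le> (K * u x) * (K * v b x)"
          using n1 n2 K0 u0 by (intro mult_mono) auto
        also have "\<dots> = K\<^sup>2 * (u x * v b x)" by (simp add: power2_eq_square mult_ac)
        also have "\<dots> \<le> K\<^sup>2 * (U x + V b x)" using young by (intro mult_left_mono) auto
        finally show ?case .
      qed
    qed
    have 2: "\<bar>LINT x|torus. codiff a x \<bullet> codiff b x\<bar> \<le> (LINT x|torus. K\<^sup>2 * (U x + V b x))"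
    proof (rule abs_integral_le[OF int], rule AE_I2)
      fix x
      have "\<bar>codiff a x \<bullet> codiff b x\<bar> \<le> norm (codiff a x) * norm (codiff b x)" by (rule Cauchy_Schwarz_ineq2)
      also have "\<dots> \<le> (K * u x) * (K * v b x)"
      proof (intro mult_mono)
        have "K * norm (grad_form a x) \<le> K * u x" "K * norm (grad_form b x) \<le> K * v b x"
          using K0 m norm_grad_form_le[of a x] norm_grad_form_le[of b x]
          by (auto simp: u_def v_def intro!: mult_left_mono add_increasing2)
        then show "norm (codiff a x) \<le> K * u x" "norm (codiff b x) \<le> K * v b x"
          using K(4)[of "grad_form a x"] K(4)[of "grad_form b x"] by (simp_all add: codiff_eq)
      qed (use K0 u0 in auto)
      also have "\<dots> = K\<^sup>2 * (u x * v b x)" by (simp add: power2_eq_square mult_ac)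
      also have "\<dots> \<le> K\<^sup>2 * (U x + V b x)" using young by (intro mult_left_mono) auto
      finally show "\<bar>codiff a x \<bullet> codiff b x\<bar> \<le> K\<^sup>2 * (U x + V b x)" .
    qed
    have "(LINT x|torus. K\<^sup>2 * (U x + V b x)) = K\<^sup>2 * (LINT x|torus. U x + V b x)" by simp
    also have "\<dots> \<le> K\<^sup>2 * B0" using VB by (intro mult_left_mono) auto
    finally show ?thesis using 1 2 unfolding gradient_def B_def by linarith
  qed
  then show ?thesis by (intro that[of B]) (auto simp: q_def)
qed

lemma Y_norm_upper:
  fixes a b :: "'n::{finite,linorder} one_form"
  assumes a: "a \<in> W1p p" and p: "real CARD('n) < p" "2 \<le> p"
    and b: "b \<in> W1p (conj_exp p)" "sobolev_norm (conj_exp p) b \<le> 1"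
  shows "\<bar>gradient (\<bullet>) a b\<bar> \<le> Y_norm p (gradient (\<bullet>) a)"
proof -
  obtain B where B: "\<And>b. b \<in> W1p (conj_exp p) \<Longrightarrow> sobolev_norm (conj_exp p) b \<le> 1 \<Longrightarrow> \<bar>gradient (\<bullet>) a b\<bar> \<le> B"
    using gradient_bounded[OF a p] by blast
  show ?thesis
    unfolding Y_norm_def using b B by (intro cSUP_upper) (auto intro!: bdd_aboveI2[where M = B])
qed

lemma zero_in_unit_ball: "1 \<le> q \<Longrightarrow> (\<lambda>x. 0) \<in> {b \<in> W1p q. sobolev_norm q b \<le> 1}"
  by (auto simp: W1p_const sobolev_norm_eq sobolev_sum_const)

lemma Y_norm_gradient_nonneg:
  fixes a :: "'n::{finite,linorder} one_form"
  assumes "a \<in> W1p p" "real CARD('n) < p" "2 \<le> p"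
  shows "0 \<le> Y_norm p (gradient (\<bullet>) a)"
  using Y_norm_upper[OF assms, of "\<lambda>x. 0"] zero_in_unit_ball[of "conj_exp p"] conj_exp_bounds[OF assms(3)] by force

lemma Y_norm_scaled:
  assumes a: "a \<in> W1p p" and p: "real CARD('n::{finite,linorder}) < p" "2 \<le> p" and c: "0 < c"
  shows "Y_norm p (\<lambda>b. c * gradient (\<bullet>) (a :: 'n one_form) b) = c * Y_norm p (gradient (\<bullet>) a)"
proof -
  let ?U = "{b :: 'n one_form. b \<in> W1p (conj_exp p) \<and> sobolev_norm (conj_exp p) b \<le> 1}"
  have ne: "?U \<noteq> {}" using zero_in_unit_ball[of "conj_exp p"] conj_exp_bounds[OF p(2)] by force
  obtain B where B: "\<And>b. b \<in> W1p (conj_exp p) \<Longrightarrow> sobolev_norm (conj_exp p) b \<le> 1 \<Longrightarrow> \<bar>gradient (\<bullet>) a b\<bar> \<le> B"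
    using gradient_bounded[OF a p] by blast
  show ?thesis
    unfolding Y_norm_def
  proof (rule antisym)
    show "(SUP b\<in>?U. \<bar>c * gradient (\<bullet>) a b\<bar>) \<le> c * (SUP b\<in>?U. \<bar>gradient (\<bullet>) a b\<bar>)"
    proof (rule cSUP_least[OF ne])
      fix b assume "b \<in> ?U"
      then have "\<bar>gradient (\<bullet>) a b\<bar> \<le> (SUP b\<in>?U. \<bar>gradient (\<bullet>) a b\<bar>)"
        using B by (intro cSUP_upper) (auto intro!: bdd_aboveI2[where M = B])
      then show "\<bar>c * gradient (\<bullet>) a b\<bar> \<le> c * (SUP b\<in>?U. \<bar>gradient (\<bullet>) a b\<bar>)"
        using c by (simp add: abs_mult)
    qed
    have "(SUP b\<in>?U. \<bar>gradient (\<bullet>) a b\<bar>) \<le> (SUP b\<in>?U. \<bar>c * gradient (\<bullet>) a b\<bar>) / c"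
    proof (rule cSUP_least[OF ne])
      fix b assume b: "b \<in> ?U"
      have "\<bar>c * gradient (\<bullet>) a b\<bar> \<le> (SUP b\<in>?U. \<bar>c * gradient (\<bullet>) a b\<bar>)"
        using b B c by (intro cSUP_upper) (auto intro!: bdd_aboveI2[where M = "c * B"] simp: abs_mult)
      then show "\<bar>gradient (\<bullet>) a b\<bar> \<le> (SUP b\<in>?U. \<bar>c * gradient (\<bullet>) a b\<bar>) / c"
        using c by (simp add: abs_mult le_divide_eq mult.commute)
    qed
    then show "c * (SUP b\<in>?U. \<bar>gradient (\<bullet>) a b\<bar>) \<le> (SUP b\<in>?U. \<bar>c * gradient (\<bullet>) a b\<bar>)"
      using c by (simp add: le_divide_eq mult.commute)
  qed
qed

section \<open>Energy and gradient near constant forms\<close>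

lemma grad_form_AE_const:
  fixes a :: "'n::finite one_form"
  assumes a: "a \<in> borel_measurable torus" "AE x in torus. a x = k"
  shows "AE x in torus. grad_form a x = 0"
proof -
  have "wd i a = wd i (\<lambda>x. k)" for i
    using a by (intro wd_cong_AE) auto
  then have "grad_form a = grad_form (\<lambda>x. k)" by (simp add: grad_form_def[abs_def])
  then show ?thesis using grad_form_const[of k] by simp
qed

lemma linear_zeros: "alternation 0 = 0" "contraction 0 = 0"
  by (simp_all add: alternation_def contraction_def vec_eq_iff)

text \<open>Stated for forms that are constant almost everywhere, because a Lyapunov-Schmidt
  correction is determined only up to null sets.\<close>

lemma energy_AE_const:
  fixes a :: "'n::{finite,linorder} one_form"
  assumes a: "a \<in> borel_measurable torus" "AE x in torus. a x = k"
  shows "energy (\<bullet>) a = 1/2 * inner2 (\<bullet>) (const_curv k) (const_curv k)"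
proof -
  have g: "AE x in torus. grad_form a x = 0" by (rule grad_form_AE_const[OF a])
  have wd: "wd i a = wd i (\<lambda>x. k)" for i
    using a by (intro wd_cong_AE) auto
  have gm: "grad_form a = grad_form (\<lambda>x. k)" by (simp add: wd grad_form_def[abs_def])
  have em: "ext_d a \<in> borel_measurable torus" "codiff a \<in> borel_measurable torus"
    using ext_d_measurable[OF W1p_const[of k 1]] codiff_measurable[OF W1p_const[of k 1]]
    by (simp_all add: ext_d_eq[abs_def] codiff_eq[abs_def] gm)
  have cm: "curv a \<in> borel_measurable torus"
    using em(1) bounded_bilinear_measurable[OF bounded_bilinear_bracket_wedge a(1) a(1)] by (simp add: curv_def[abs_def])
  have AE: "AE x in torus. inner2 (\<bullet>) (curv a x) (curv a x) = inner2 (\<bullet>) (const_curv k) (const_curv k)"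
    using g a(2) by eventually_elim (simp add: curv_def ext_d_eq linear_zeros const_curv_def)
  have "(LINT x|torus. inner2 (\<bullet>) (curv a x) (curv a x)) = inner2 (\<bullet>) (const_curv k) (const_curv k)"
    by (subst integral_cong_AE[OF bounded_bilinear_measurable[OF bounded_bilinear_inner2 cm cm] _ AE])
      (simp_all add: torus.prob_space)
  moreover have "(LINT x|torus. codiff a x \<bullet> codiff a x) = 0"
  proof (rule integral_eq_zero_AE)
    show "AE x in torus. codiff a x \<bullet> codiff a x = 0"
      using g by eventually_elim (simp add: codiff_eq linear_zeros)
  qed
  ultimately show ?thesis by (simp add: energy_def torus.prob_space)
qed

lemma energy_const_form:
  "energy (\<bullet>) (const_form k :: 'n::{finite,linorder} one_form) = 1/2 * inner2 (\<bullet>) (const_curv k) (const_curv k)"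
  unfolding const_form_def by (rule energy_AE_const) auto

text \<open>The curvature of a constant form is constant, the derivatives of b integrate to 0 and
  the codifferential of a constant vanishes, so only the mean of b is seen. Hence the gradient at a
  constant form is itself represented by a constant form, cubic in k.\<close>

lemma gradient_const_form:
  fixes b :: "'n::{finite,linorder} one_form"
  assumes b: "b \<in> W1p q" "1 \<le> q"
  shows "gradient (\<bullet>) (const_form k) b = inner2 (\<bullet>) (const_curv k) (bracket_wedge k (LINT x|torus. b x))"
proof -
  have g: "AE x in torus. grad_form (const_form k :: 'n one_form) x = 0"
    unfolding const_form_def by (rule grad_form_const)
  have W: "const_form k \<in> W1p 1" unfolding const_form_def by (rule W1p_const)
  have m: "const_form k \<in> borel_measurable torus" by (simp add: const_form_def)
  have bi: "integrable torus b" by (rule W1p_integrable(1)[OF b])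
  have gi: "integrable torus (grad_form b)" "(LINT x|torus. grad_form b x) = 0"
  proof -
    have wi: "integrable torus (wd i b)" for i by (rule W1p_integrable(2)[OF b])
    have eq: "grad_form b x = (\<Sum>i\<in>UNIV. axis i (wd i b x))" for x
      by (simp add: grad_form_def vec_eq_iff axis_def if_distrib[where f = "\<lambda>u. u $ _"] cong: if_cong)
    have "bounded_linear (axis i :: 'n covec \<Rightarrow> _)" for i :: 'n
      by (subst linear_conv_bounded_linear[symmetric]) (simp add: linear_iff axis_def vec_eq_iff)
    then have "integrable torus (\<lambda>x. \<Sum>i\<in>UNIV. axis i (wd i b x))"
      by (intro Bochner_Integration.integrable_sum integrable_bounded_linear[OF _ wi])
    then show int: "integrable torus (grad_form b)" by (simp add: eq[abs_def])
    have "(LINT x|torus. grad_form b x) $ i = (LINT x|torus. wd i b x)" for i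
      using integral_bounded_linear[OF bounded_linear_vec_nth int, of i] by (simp add: grad_form_def[abs_def])
    then show "(LINT x|torus. grad_form b x) = 0"
      using integral_wd_eq_0[OF b] by (simp add: vec_eq_iff)
  qed
  let ?T1 = "\<lambda>D. inner2 (\<bullet>) (const_curv k) (alternation D)"
  let ?T2 = "\<lambda>v. inner2 (\<bullet>) (const_curv k) (bracket_wedge k v)"
  have T1: "bounded_linear ?T1"
    by (rule bounded_linear_compose[OF inner2.bounded_linear_right bounded_linear_alternation])
  have T2: "bounded_linear ?T2"
    by (rule bounded_linear_compose[OF inner2.bounded_linear_right bracket_wedge.bounded_linear_right])
  have "(LINT x|torus. inner2 (\<bullet>) (curv (const_form k) x) (cov_d (const_form k) b x))
      = (LINT x|torus. ?T1 (grad_form b x) + ?T2 (b x))"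
  proof (rule integral_cong_AE)
    show "(\<lambda>x. inner2 (\<bullet>) (curv (const_form k) x) (cov_d (const_form k) b x)) \<in> borel_measurable torus"
      by (rule bounded_bilinear_measurable[OF bounded_bilinear_inner2 curv_measurable[OF W] cov_d_measurable[OF m b]]) simp
    show "(\<lambda>x. ?T1 (grad_form b x) + ?T2 (b x)) \<in> borel_measurable torus"
      using integrable_bounded_linear[OF T1 gi(1)] integrable_bounded_linear[OF T2 bi] by auto
    show "AE x in torus. inner2 (\<bullet>) (curv (const_form k) x) (cov_d (const_form k) b x) = ?T1 (grad_form b x) + ?T2 (b x)"
      using g
      by eventually_elim (simp add: curv_def ext_d_eq linear_zeros const_form_def cov_d_eq inner2.add_right flip: const_curv_def)
  qed
  also have "\<dots> = ?T1 (LINT x|torus. grad_form b x) + ?T2 (LINT x|torus. b x)"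
    using integrable_bounded_linear[OF T1 gi(1)] integrable_bounded_linear[OF T2 bi]
      integral_bounded_linear[OF T1 gi(1)] integral_bounded_linear[OF T2 bi] by simp
  finally have 1: "(LINT x|torus. inner2 (\<bullet>) (curv (const_form k) x) (cov_d (const_form k) b x)) = ?T2 (LINT x|torus. b x)"
    by (simp add: gi(2) linear_zeros inner2.zero_right)
  have "(LINT x|torus. codiff (const_form k) x \<bullet> codiff b x) = 0"
  proof (rule integral_eq_zero_AE)
    show "AE x in torus. codiff (const_form k) x \<bullet> codiff b x = 0"
      using g by eventually_elim (simp add: codiff_eq linear_zeros)
  qed
  with 1 show ?thesis by (simp add: gradient_def)
qed

section \<open>Pointwise bounds in terms of the Sobolev norm\<close>

lemma norm_mean_le_sobolev_norm:
  fixes f :: "real^'n \<Rightarrow> 'b::euclidean_space"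
  assumes f: "f \<in> W1p p" and p: "1 \<le> p"
  shows "norm (LINT x|torus. f x) \<le> 2 * sobolev_norm p f"
proof (rule field_le_epsilon)
  fix e :: real assume e: "0 < e"
  define s where "s = sobolev_norm p f + e / 2"
  have s: "0 < s" using e sobolev_norm_nonneg[of p f] by (simp add: s_def)
  have "sobolev_sum p f \<le> s powr p"
    using s p e by (subst sobolev_norm_le_iff[symmetric]) (auto simp: s_def)
  from norm_mean_le[OF W1p_Lp[OF f] p s this] show "norm (LINT x|torus. f x) \<le> 2 * sobolev_norm p f + e"
    by (simp add: s_def)
qed

text \<open>Morrey's constant for the oscillation, plus the constant 2 that bounds the mean.\<close>

definition embedding_const :: "nat \<Rightarrow> real \<Rightarrow> real" where
  "embedding_const d p = 2 * real d / (1 - real d / p) + 2"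

lemma embedding_const_ge:
  assumes "real d < p"
  shows "2 \<le> embedding_const d p"
proof -
  have "0 \<le> 1 - real d / p" using assms by (cases "p = 0") (auto simp: field_simps)
  then show ?thesis by (simp add: embedding_const_def)
qed

lemma AE_norm_le_sobolev_norm:
  fixes f :: "real^'n \<Rightarrow> 'b::euclidean_space"
  assumes f: "f \<in> W1p p" and p: "real CARD('n) < p"
  shows "AE x in torus. norm (f x) \<le> embedding_const CARD('n) p * sobolev_norm p f"
proof (cases "sobolev_norm p f = 0")
  case True
  have p0: "0 < p" using p by (smt (verit) of_nat_0_le_iff)
  have "sobolev_sum p f = 0"
    using True sobolev_norm_le_iff[OF p0, of 0 f] sobolev_sum_nonneg[of p f] p0 by simp
  from sobolev_sum_0_imp_AE[OF f p0 this] show ?thesis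
    by eventually_elim (simp add: True)
next
  case False
  then have s: "0 < sobolev_norm p f" using sobolev_norm_nonneg[of p f] by simp
  have p1: "1 \<le> p" using p zero_less_card_finite[where 'a = 'n] by linarith
  have le: "sobolev_sum p f \<le> sobolev_norm p f powr p"
    using s p1 by (subst sobolev_norm_le_iff[symmetric]) auto
  show ?thesis
    using sobolev_embedding[OF f p s le]
  proof eventually_elim
    case (elim x)
    then show ?case
      using norm_mean_le_sobolev_norm[OF f p1] norm_triangle_sub[of "f x" "LINT y|torus. f y"]
      by (simp add: embedding_const_def distrib_right)
  qed
qed

lemma AE_oscillation_le_sobolev_norm:
  fixes f :: "real^'n \<Rightarrow> 'b::euclidean_space"
  assumes f: "f \<in> W1p p" and p: "real CARD('n) < p" and s: "sobolev_norm p f < s"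
  shows "AE x in torus. norm (f x - (LINT y|torus. f y)) \<le> embedding_const CARD('n) p * s"
proof -
  have p1: "1 \<le> p" using p zero_less_card_finite[where 'a = 'n] by linarith
  have s0: "0 < s" using s sobolev_norm_nonneg[of p f] by linarith
  have le: "sobolev_sum p f \<le> s powr p"
    using s s0 p1 by (subst sobolev_norm_le_iff[symmetric]) auto
  show ?thesis
    using sobolev_embedding[OF f p s0 le]
    by eventually_elim (use s0 in \<open>auto simp: embedding_const_def distrib_right\<close>)
qed

lemma le_powr_quarter:
  fixes x :: real
  assumes "0 \<le> x" "x ^ 4 \<le> y"
  shows "x \<le> y powr (1/4)"
proof -
  have "x = (x ^ 4) powr (1/4)"
  proof (cases "x = 0")
    case False
    then have "x ^ 4 = x powr real 4" using assms(1) by (subst powr_realpow) auto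
    then have "(x ^ 4) powr (1/4) = x powr (real 4 * (1/4))" by (simp only: powr_powr)
    then show ?thesis using assms(1) by simp
  qed simp
  also have "\<dots> \<le> y powr (1/4)" using assms by (intro powr_mono2) auto
  finally show ?thesis .
qed

text \<open>Here k is the mean of the whole form, Q measures its curvature, S the deviation from it
  and N the gradient. The bound in terms of S comes from testing with z, the two bounds in terms of
  Q from testing with the direction of \<open>const_curv_gradient_inequality\<close>. Taking k0 = 0
  or k0 flat and nonzero will give the two exponents.\<close>

theorem gradient_estimates_near_constants:
  fixes p :: real
  assumes p: "real CARD('n::{finite,linorder}) < p" "2 \<le> p"
  obtains c \<rho> where "0 < c" "0 < \<rho>"
    "\<And>(k0 :: 'n covec) b k Q S N. norm k0 < \<rho> \<Longrightarrow> b \<in> W1p p \<Longrightarrow> sobolev_norm p b < \<rho> \<Longrightarrow>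
      k = k0 + (LINT x|torus. b x) \<Longrightarrow> Q = inner2 (\<bullet>) (const_curv k) (const_curv k) \<Longrightarrow>
      S = (LINT x|torus. (norm (grad_form b x))\<^sup>2) \<Longrightarrow> N = Y_norm p (gradient (\<bullet>) (\<lambda>x. k0 + b x)) \<Longrightarrow>
      0 \<le> S \<and> S \<le> 1 \<and> c * sqrt S \<le> N \<and> c * Q powr (3/4) \<le> N \<and> c * (norm k * sqrt Q) \<le> N \<and>
      c * energy (\<bullet>) (\<lambda>x. k0 + b x) \<le> Q + S"
proof -
  let ?d = "real CARD('n)"
  define q where "q = conj_exp p"
  have q: "1 < q" "q \<le> 2" using conj_exp_bounds[OF p(2)] by (auto simp: q_def)
  have d: "1 \<le> ?d" using zero_less_card_finite[where 'a = 'n] by linarith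
  obtain C where C: "0 < C"
    and est1: "\<And>(k :: 'n covec) z r. const_perturbation k z r \<Longrightarrow>
      (1 - C * r) * (LINT x|torus. (norm (grad_form z x))\<^sup>2) \<le> gradient (\<bullet>) (\<lambda>x. k + z x) z"
    and est2: "\<And>(k :: 'n covec) z r \<eta>. const_perturbation k z r \<Longrightarrow>
      inner2 (\<bullet>) (const_curv k) (bracket_wedge k \<eta>) - C * norm \<eta> * (LINT x|torus. (norm (grad_form z x))\<^sup>2)
      \<le> gradient (\<bullet>) (\<lambda>x. k + z x) (const_form \<eta>)"
    and est3: "\<And>(k :: 'n covec) z r. const_perturbation k z r \<Longrightarrow>
      energy (\<bullet>) (\<lambda>x. k + z x) \<le> inner2 (\<bullet>) (const_curv k) (const_curv k) + C * (LINT x|torus. (norm (grad_form z x))\<^sup>2)"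
    using perturbation_estimates[where 'n = 'n] by metis
  define M where "M = embedding_const CARD('n) p"
  have M: "2 \<le> M" unfolding M_def by (rule embedding_const_ge[OF p(1)])
  \<comment> \<open>Makes the factor 1 - C r in the estimate for the direction z at least
    1/2.\<close>
  define r where "r = min 1 (1 / (2 * C))"
  have r: "0 < r" "r \<le> 1" "C * r \<le> 1/2"
    using C by (auto simp: r_def min_def field_simps)
  \<comment> \<open>The first bound keeps k and z below r, since 3 \<rho> <= 2 M \<rho> <= r; the
    second serves to make the Dirichlet integral at most 1.\<close>
  define \<rho> where "\<rho> = min (r / (2 * M)) (1 / (2 * ?d))"
  have \<rho>: "0 < \<rho>" "\<rho> \<le> r / (2 * M)" "\<rho> \<le> 1 / (2 * ?d)" using r M d by (auto simp: \<rho>_def)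
  \<comment> \<open>The 1/2 left by the choice of r and the normalisation 1 / (2 d + 2) of z,
    inverted.\<close>
  define A where "A = 2 * (2 * ?d + 2)"
  have A: "0 < A" using d by (simp add: A_def)
  \<comment> \<open>The error C |\<eta>| S is at most C |\<eta>| A N because S <= sqrt S <= A N for
    S <= 1; D adds this to the direct term.\<close>
  define D where "D = 1 + C * A"
  have D: "1 \<le> D" using C A by (simp add: D_def)
  define c where "c = min (min (1 / A) (1 / (D * ?d))) (min 1 (1 / C))"
  have c: "0 < c" "c \<le> 1 / A" "c \<le> 1 / (D * ?d)" "c \<le> 1" "c \<le> 1 / C"
    using A D d C by (auto simp: c_def)
  show ?thesis
  proof (rule that[OF c(1) \<rho>(1)])
    fix k0 :: "'n covec" and b k Q S N
    assume k0: "norm k0 < \<rho>" and b: "b \<in> W1p p" and bs: "sobolev_norm p b < \<rho>"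
      and k: "k = k0 + (LINT x|torus. b x)" and Q: "Q = inner2 (\<bullet>) (const_curv k) (const_curv k)"
      and S: "S = (LINT x|torus. (norm (grad_form b x))\<^sup>2)" and N: "N = Y_norm p (gradient (\<bullet>) (\<lambda>x. k0 + b x))"
    define m where "m = (LINT x|torus. b x)"
    define z where "z x = - m + b x" for x
    have p1: "1 \<le> p" using p by simp
    have zp: "z \<in> W1p p" unfolding z_def by (rule W1p_add[OF W1p_const b p1])
    have z2: "z \<in> W1p 2" using W1p_mono[OF zp] p by simp
    have mean: "(LINT x|torus. z x) = 0"
      using W1p_integrable(1)[OF b p1] by (simp add: z_def m_def torus.prob_space)
    have a: "(\<lambda>x. k0 + b x) = (\<lambda>x. k + z x)" by (simp add: z_def k m_def)
    have aW: "(\<lambda>x. k + z x) \<in> W1p p" by (rule W1p_add[OF W1p_const zp p1])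
    have le: "sobolev_sum p b \<le> \<rho> powr p"
      using bs \<rho> p by (subst sobolev_norm_le_iff[symmetric]) auto
    have Mr: "M * \<rho> \<le> r / 2" using \<rho>(2) M by (simp add: field_simps)
    have kr: "norm k \<le> r"
    proof -
      have "norm m \<le> 2 * \<rho>" unfolding m_def by (rule norm_mean_le[OF W1p_Lp[OF b] p1 \<rho>(1) le])
      then have "norm k \<le> 3 * \<rho>" using norm_triangle_ineq[of k0 m] k0 by (simp add: k m_def)
      also have "\<dots> \<le> 2 * (M * \<rho>)" using M \<rho>(1) mult_right_mono[of 2 M \<rho>] by linarith
      finally show ?thesis using Mr by linarith
    qed
    have zr: "AE x in torus. norm (z x) \<le> r"
      using AE_oscillation_le_sobolev_norm[OF b p(1) bs]
    proof eventually_elim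
      case (elim x)
      then have "norm (z x) \<le> M * \<rho>" by (simp add: z_def m_def M_def)
      then show ?case using Mr r by linarith
    qed
    have P: "const_perturbation k z r"
      using z2 mean r kr zr by unfold_locales auto
    have Sz: "S = (LINT x|torus. (norm (grad_form z x))\<^sup>2)"
    proof -
      have "grad_form z \<in> L2 torus" "grad_form b \<in> L2 torus"
        using z2 W1p_mono[OF b, of 2] p by (auto intro: grad_form_L2)
      then show ?thesis
        unfolding S using grad_form_const_plus[OF b p1, of "- m"]
        by (intro integral_cong_AE) (auto simp: z_def[abs_def] dest: L2D elim: eventually_mono)
    qed
    have S0: "0 \<le> S" by (simp add: S)
    have S1: "S \<le> 1"
    proof -
      have "\<rho>\<^sup>2 \<le> \<rho> * (1 / (2 * ?d))" unfolding power2_eq_square using \<rho> by (intro mult_left_mono) auto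
      also have "\<dots> \<le> 1 * (1 / (2 * ?d))"
      proof (rule mult_right_mono)
        have "r / (2 * M) \<le> 1" using r M by (simp add: divide_le_eq)
        then show "\<rho> \<le> 1" using \<rho> by linarith
      qed (use d in simp)
      finally have "2 * ?d * \<rho>\<^sup>2 \<le> 1" using d by (simp add: field_simps)
      then show ?thesis using dirichlet_le[OF b p(2) \<rho>(1) le] S by linarith
    qed
    have N_upper: "\<bar>gradient (\<bullet>) (\<lambda>x. k + z x) u\<bar> \<le> N" if "u \<in> W1p q" "sobolev_sum q u \<le> 1" for u
      unfolding N a using that q sobolev_norm_le_iff[of q 1 u] by (intro Y_norm_upper[OF aW p]) (auto simp: q_def)
    have N0: "0 \<le> N" unfolding N a by (rule Y_norm_gradient_nonneg[OF aW p])
    have NS: "sqrt S \<le> A * N"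
    proof (cases "S = 0")
      case False
      then have Sp: "0 < S" using S0 by simp
      let ?t = "1 / ((2 * ?d + 2) * sqrt S)"
      have zq: "z \<in> W1p q" using W1p_mono[OF z2] q by simp
      have "\<bar>gradient (\<bullet>) (\<lambda>x. k + z x) (\<lambda>x. ?t *\<^sub>R z x)\<bar> \<le> N"
      proof (rule N_upper)
        show "(\<lambda>x. ?t *\<^sub>R z x) \<in> W1p q" using q by (intro W1p_scaleR[OF zq]) simp
        show "sobolev_sum q (\<lambda>x. ?t *\<^sub>R z x) \<le> 1"
          using q by (intro sobolev_sum_normalized[OF z2 mean _ _ Sz Sp]) auto
      qed
      moreover have "gradient (\<bullet>) (\<lambda>x. k + z x) (\<lambda>x. ?t *\<^sub>R z x) = ?t * gradient (\<bullet>) (\<lambda>x. k + z x) z"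
        using q by (intro gradient_scaleR[OF aW p1 zq]) simp
      ultimately have 1: "?t * gradient (\<bullet>) (\<lambda>x. k + z x) z \<le> N" by linarith
      have "1/2 * S \<le> (1 - C * r) * S" using r S0 by (intro mult_right_mono) auto
      then have 2: "1/2 * S \<le> gradient (\<bullet>) (\<lambda>x. k + z x) z" using est1[OF P] unfolding Sz[symmetric] by linarith
      have "?t * (1/2 * S) \<le> N"
        using 1 2 d S0 by (intro order.trans[OF mult_left_mono 1]) auto
      moreover have "?t * (1/2 * S) = sqrt S / A"
      proof -
        have "1 / (e * w) * (1/2 * (w * w)) = w / (2 * e)" if "0 < e" "0 < w" for e w :: real
          using that by (simp add: field_simps)
        from this[of "2 * ?d + 2" "sqrt S"] show ?thesis using Sp S0 d by (simp add: A_def)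
      qed
      ultimately have "sqrt S / A \<le> N" by (simp only:)
      then show ?thesis using A by (simp add: divide_le_eq mult.commute)
    qed (use A N0 in simp)
    obtain \<eta> where \<eta>: "Q \<le> inner2 (\<bullet>) (const_curv k) (bracket_wedge k \<eta>)"
      "(norm \<eta>) ^ 4 \<le> ?d * Q" "(norm \<eta>)\<^sup>2 * (norm k)\<^sup>2 \<le> ?d * Q"
      using const_curv_gradient_inequality[of k] unfolding Q by blast
    have Q0: "0 \<le> Q" by (simp add: Q inner2_nonneg)
    \<comment> \<open>The test form is \<eta> divided by its norm, a constant form in the unit ball;
      the quadratic error is absorbed by \<open>NS\<close>.\<close>
    have main: "Q \<le> D * N * norm \<eta>"
    proof (cases "\<eta> = 0")
      case True
      then show ?thesis using \<eta>(1) by (simp add: bracket_wedge.zero_right inner2.zero_right)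
    next
      case False
      let ?t = "1 / norm \<eta>"
      have cq: "const_form \<eta> \<in> W1p q" unfolding const_form_def by (rule W1p_const)
      have "\<bar>gradient (\<bullet>) (\<lambda>x. k + z x) (\<lambda>x. ?t *\<^sub>R const_form \<eta> x)\<bar> \<le> N"
      proof (rule N_upper)
        show "(\<lambda>x. ?t *\<^sub>R const_form \<eta> x) \<in> W1p q" using q by (intro W1p_scaleR[OF cq]) simp
        show "sobolev_sum q (\<lambda>x. ?t *\<^sub>R const_form \<eta> x) \<le> 1"
          using q False by (simp add: const_form_def sobolev_sum_const)
      qed
      moreover have "gradient (\<bullet>) (\<lambda>x. k + z x) (\<lambda>x. ?t *\<^sub>R const_form \<eta> x) = ?t * gradient (\<bullet>) (\<lambda>x. k + z x) (const_form \<eta>)"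
        using q by (intro gradient_scaleR[OF aW p1 cq]) simp
      ultimately have "?t * gradient (\<bullet>) (\<lambda>x. k + z x) (const_form \<eta>) \<le> N" by linarith
      then have 1: "gradient (\<bullet>) (\<lambda>x. k + z x) (const_form \<eta>) \<le> N * norm \<eta>"
        using False by (simp add: divide_le_eq)
      have "S \<le> sqrt S"
      proof -
        have "S = sqrt S * sqrt S" using S0 by simp
        also have "\<dots> \<le> sqrt S * 1" using S1 S0 by (intro mult_left_mono) auto
        finally show ?thesis by simp
      qed
      then have "C * norm \<eta> * S \<le> C * norm \<eta> * (A * N)"
        using NS C by (intro mult_left_mono) auto
      then have "Q \<le> N * norm \<eta> + C * norm \<eta> * (A * N)"
        using est2[OF P, of \<eta>] 1 \<eta>(1) unfolding Sz[symmetric] by linarith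
      then show ?thesis by (simp add: D_def algebra_simps)
    qed
    \<comment> \<open>By the choice of the direction, |\<eta>| is at most (d Q) powr (1/4);
      inserting this into \<open>main\<close> allows Q powr (1/4) to be cancelled.\<close>
    have Q34: "Q powr (3/4) \<le> D * ?d * N"
    proof (cases "Q = 0")
      case False
      then have Qp: "0 < Q" using Q0 by simp
      have "norm \<eta> \<le> (?d * Q) powr (1/4)"
        by (rule le_powr_quarter) (use \<eta> in auto)
      also have "\<dots> = ?d powr (1/4) * Q powr (1/4)" by (simp add: powr_mult)
      also have "\<dots> \<le> ?d * Q powr (1/4)"
      proof (rule mult_right_mono)
        show "?d powr (1/4) \<le> ?d" using powr_mono[of "1/4" 1 ?d] d by simp
      qed simp
      finally have "norm \<eta> \<le> ?d * Q powr (1/4)" .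
      then have "D * N * norm \<eta> \<le> D * N * (?d * Q powr (1/4))"
        using D N0 by (intro mult_left_mono) auto
      then have "Q \<le> D * ?d * N * Q powr (1/4)" using main by (simp add: mult_ac)
      moreover have "Q = Q powr (3/4) * Q powr (1/4)" using Qp by (simp flip: powr_add)
      ultimately have "Q powr (3/4) * Q powr (1/4) \<le> D * ?d * N * Q powr (1/4)" by simp
      then show ?thesis using Qp by (simp add: mult_le_cancel_right)
    qed (use D d N0 in simp)
    \<comment> \<open>Multiply \<open>main\<close> by |k|, use |\<eta>| |k| <= d sqrt Q, and cancel
      sqrt Q.\<close>
    have Qk: "norm k * sqrt Q \<le> D * ?d * N"
    proof (cases "Q = 0")
      case False
      then have Qp: "0 < Q" using Q0 by simp
      have "(norm \<eta> * norm k)\<^sup>2 \<le> (?d * sqrt Q)\<^sup>2"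
      proof -
        have "?d * Q \<le> ?d * ?d * Q" using d Q0 by (intro mult_right_mono) auto
        with \<eta>(3) have "(norm \<eta>)\<^sup>2 * (norm k)\<^sup>2 \<le> ?d * ?d * Q" by (rule order.trans)
        then show ?thesis using Q0 by (simp add: power_mult_distrib power2_eq_square[of ?d])
      qed
      then have "norm \<eta> * norm k \<le> ?d * sqrt Q"
        by (rule power2_le_imp_le) (use d Q0 in simp)
      then have "D * N * (norm \<eta> * norm k) \<le> D * N * (?d * sqrt Q)"
        using D N0 by (intro mult_left_mono) auto
      moreover have "Q * norm k \<le> D * N * norm \<eta> * norm k" using main by (intro mult_right_mono) auto
      ultimately have "Q * norm k \<le> D * N * (?d * sqrt Q)" by (simp add: mult_ac)
      moreover have "Q * norm k = (norm k * sqrt Q) * sqrt Q" using Q0 by (simp add: mult_ac)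
      ultimately have "(norm k * sqrt Q) * sqrt Q \<le> (D * ?d * N) * sqrt Q" by (simp add: mult_ac)
      then show ?thesis using Qp by (simp add: mult_le_cancel_right)
    qed (use D d N0 in simp)
    have cA: "c * (A * N) \<le> N"
      using c(2) A N0 mult_right_mono[of "c * A" 1 N] by (simp add: field_simps)
    have cD: "c * (D * ?d * N) \<le> N"
      using c(3) D d N0 mult_right_mono[of "c * (D * ?d)" 1 N] by (simp add: field_simps)
    have e1: "c * sqrt S \<le> N"
      using mult_left_mono[OF NS, of c] c(1) cA by linarith
    have e2: "c * Q powr (3/4) \<le> N"
      using mult_left_mono[OF Q34, of c] c(1) cD by linarith
    have e3: "c * (norm k * sqrt Q) \<le> N"
      using mult_left_mono[OF Qk, of c] c(1) cD by linarith
    have e4: "c * energy (\<bullet>) (\<lambda>x. k0 + b x) \<le> Q + S"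
    proof -
      have "energy (\<bullet>) (\<lambda>x. k0 + b x) \<le> Q + C * S"
        unfolding a Q Sz by (rule est3[OF P])
      then have "c * energy (\<bullet>) (\<lambda>x. k0 + b x) \<le> c * (Q + C * S)"
        using c(1) by (intro mult_left_mono) auto
      also have "\<dots> = c * Q + (c * C) * S" by (simp add: algebra_simps)
      also have "\<dots> \<le> 1 * Q + 1 * S"
        using c C Q0 S0 by (intro add_mono mult_right_mono) (auto simp: field_simps)
      finally show ?thesis by simp
    qed
    show "0 \<le> S \<and> S \<le> 1 \<and> c * sqrt S \<le> N \<and> c * Q powr (3/4) \<le> N \<and> c * (norm k * sqrt Q) \<le> N \<and>
      c * energy (\<bullet>) (\<lambda>x. k0 + b x) \<le> Q + S"
      using S0 S1 e1 e2 e3 e4 by blast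
  qed
qed

section \<open>Scaling of the inner product\<close>

lemma inner2_scaled: "inner2 (\<lambda>x y. c * (x \<bullet> y)) v w = c * inner2 (\<bullet>) v w"
  by (simp add: inner2_def sum_distrib_left case_prod_beta')

lemma energy_scaled: "energy (\<lambda>x y. c * (x \<bullet> y)) a = c * energy (\<bullet>) a"
  by (simp add: energy_def inner2_scaled algebra_simps)

lemma gradient_scaled: "gradient (\<lambda>x y. c * (x \<bullet> y)) a b = c * gradient (\<bullet>) a b"
  by (simp add: gradient_def inner2_scaled algebra_simps)

lemma L2_pairing_scaled: "L2_pairing (\<lambda>x y. c * (x \<bullet> y)) a b = c * (LINT x|torus. a x \<bullet> b x)"
  by (simp add: L2_pairing_def inner1_def inner_vec_def flip: sum_distrib_left)

text \<open>Energy and gradient are both multiplied by c, so the inequality for \<theta> persists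
  once C is replaced by C c / c powr \<theta>. The set of admissible exponents stays the
  same.\<close>

lemma theta_LS_scaled:
  fixes a0 :: "'n::{finite,linorder} one_form"
  assumes p: "real CARD('n) < p" "2 \<le> p" and c: "0 < c"
  shows "theta_LS p (\<lambda>x y. c * (x \<bullet> y)) a0 = theta_LS p (\<bullet>) a0"
proof -
  let ?ip = "\<lambda>x y :: su2. c * (x \<bullet> y)"
  have iff: "Y_norm p (gradient ?ip a) \<ge> C * (c / c powr \<theta>) * \<bar>energy ?ip a - energy ?ip a0\<bar> powr \<theta>
      \<longleftrightarrow> Y_norm p (gradient (\<bullet>) a) \<ge> C * \<bar>energy (\<bullet>) a - energy (\<bullet>) a0\<bar> powr \<theta>"
    if "a \<in> W1p p" for a :: "'n one_form" and C \<theta>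
  proof -
    have "Y_norm p (gradient ?ip a) = c * Y_norm p (gradient (\<bullet>) a)"
      using Y_norm_scaled[OF that p c] by (simp add: gradient_scaled[abs_def])
    moreover have "\<bar>energy ?ip a - energy ?ip a0\<bar> powr \<theta> = c powr \<theta> * \<bar>energy (\<bullet>) a - energy (\<bullet>) a0\<bar> powr \<theta>"
      using c by (simp add: energy_scaled abs_mult powr_mult flip: right_diff_distrib)
    ultimately show ?thesis using c by (simp add: mult_ac)
  qed
  have "(\<exists>C>0. \<exists>\<delta>>0. \<forall>a\<in>W1p p. sobolev_norm p (\<lambda>x. a x - a0 x) < \<delta> \<longrightarrow>
        Y_norm p (gradient ?ip a) \<ge> C * \<bar>energy ?ip a - energy ?ip a0\<bar> powr \<theta>)
      \<longleftrightarrow> (\<exists>C>0. \<exists>\<delta>>0. \<forall>a\<in>W1p p. sobolev_norm p (\<lambda>x. a x - a0 x) < \<delta> \<longrightarrow>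
        Y_norm p (gradient (\<bullet>) a) \<ge> C * \<bar>energy (\<bullet>) a - energy (\<bullet>) a0\<bar> powr \<theta>)" (is "?L \<longleftrightarrow> ?R") for \<theta>
  proof
    assume ?L
    then obtain C \<delta> where "C > 0" "\<delta> > 0" and H: "\<And>a. a \<in> W1p p \<Longrightarrow> sobolev_norm p (\<lambda>x. a x - a0 x) < \<delta> \<Longrightarrow>
        Y_norm p (gradient ?ip a) \<ge> C * \<bar>energy ?ip a - energy ?ip a0\<bar> powr \<theta>" by blast
    have "C = (C * c powr \<theta> / c) * (c / c powr \<theta>)" using c by simp
    then have "Y_norm p (gradient (\<bullet>) a) \<ge> (C * c powr \<theta> / c) * \<bar>energy (\<bullet>) a - energy (\<bullet>) a0\<bar> powr \<theta>"
      if "a \<in> W1p p" "sobolev_norm p (\<lambda>x. a x - a0 x) < \<delta>" for a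
      using H[OF that] iff[OF that(1), of "C * c powr \<theta> / c" \<theta>] by simp
    then show ?R using \<open>C > 0\<close> \<open>\<delta> > 0\<close> c
      by (intro exI[of _ "C * c powr \<theta> / c"] conjI exI[of _ \<delta>]) auto
  next
    assume ?R
    then obtain C \<delta> where "C > 0" "\<delta> > 0" and H: "\<And>a. a \<in> W1p p \<Longrightarrow> sobolev_norm p (\<lambda>x. a x - a0 x) < \<delta> \<Longrightarrow>
        Y_norm p (gradient (\<bullet>) a) \<ge> C * \<bar>energy (\<bullet>) a - energy (\<bullet>) a0\<bar> powr \<theta>" by blast
    then show ?L using c iff
      by (intro exI[of _ "C * (c / c powr \<theta>)"] conjI exI[of _ \<delta>]) auto
  qed
  then show ?thesis by (simp only: theta_LS_def)
qed

section \<open>The Lojasiewicz--Simon exponents\<close>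

lemma norm_const_curv_le:
  obtains K where "0 < K" "\<And>k v :: 'n::{finite,linorder} covec. \<bar>inner2 (\<bullet>) (const_curv k) (bracket_wedge k v)\<bar> \<le> K * (norm k) ^ 3 * norm v"
proof -
  obtain K where K: "1 \<le> K" "\<And>v w :: 'n covec. norm (bracket_wedge v w) \<le> K * (norm v * norm w)"
    using form_bound_constant[where 'n = 'n] by auto
  show ?thesis
  proof (rule that[of "K\<^sup>2"])
    show "0 < K\<^sup>2" using K(1) by simp
    fix k v :: "'n covec"
    have "norm (const_curv k) \<le> norm (bracket_wedge k k)" by (simp add: const_curv_def)
    then have 1: "norm (const_curv k) \<le> K * (norm k * norm k)" using K(2)[of k k] by linarith
    have "\<bar>inner2 (\<bullet>) (const_curv k) (bracket_wedge k v)\<bar> \<le> norm (const_curv k) * norm (bracket_wedge k v)"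
      by (rule inner2_abs_le)
    also have "\<dots> \<le> (K * (norm k * norm k)) * (K * (norm k * norm v))"
      using K(1) 1 K(2)[of k v] by (intro mult_mono) auto
    also have "\<dots> = K\<^sup>2 * (norm k) ^ 3 * norm v" by (simp add: power2_eq_square power3_eq_cube mult_ac)
    finally show "\<bar>inner2 (\<bullet>) (const_curv k) (bracket_wedge k v)\<bar> \<le> K\<^sup>2 * (norm k) ^ 3 * norm v" .
  qed
qed

text \<open>Test forms act only through their mean, whose norm is at most 2 on the unit
  ball.\<close>

lemma Y_norm_const_form_le:
  assumes p: "2 \<le> p"
  obtains K where "0 < K" "\<And>k :: 'n::{finite,linorder} covec. Y_norm p (gradient (\<bullet>) (const_form k)) \<le> K * (norm k) ^ 3"
proof -
  obtain K where K: "0 < K" "\<And>k v :: 'n covec. \<bar>inner2 (\<bullet>) (const_curv k) (bracket_wedge k v)\<bar> \<le> K * (norm k) ^ 3 * norm v"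
    using norm_const_curv_le[where 'n = 'n] by metis
  have q: "1 \<le> conj_exp p" using conj_exp_bounds[OF p] by simp
  show ?thesis
  proof (rule that[of "K * 2"])
    show "0 < K * 2" using K by simp
    fix k :: "'n covec"
    show "Y_norm p (gradient (\<bullet>) (const_form k)) \<le> K * 2 * (norm k) ^ 3"
      unfolding Y_norm_def
    proof (rule cSUP_least)
      show "{b :: 'n one_form. b \<in> W1p (conj_exp p) \<and> sobolev_norm (conj_exp p) b \<le> 1} \<noteq> {}"
        using zero_in_unit_ball[OF q] by blast
      fix b :: "'n one_form" assume "b \<in> {b \<in> W1p (conj_exp p). sobolev_norm (conj_exp p) b \<le> 1}"
      then have b: "b \<in> W1p (conj_exp p)" "sobolev_norm (conj_exp p) b \<le> 1" by auto
      have "\<bar>gradient (\<bullet>) (const_form k) b\<bar> \<le> K * (norm k) ^ 3 * norm (LINT x|torus. b x)"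
        unfolding gradient_const_form[OF b(1) q] by (rule K(2))
      also have "\<dots> \<le> K * (norm k) ^ 3 * 2"
        using norm_mean_le_sobolev_norm[OF b(1) q] b(2) K(1) by (intro mult_left_mono) auto
      finally show "\<bar>gradient (\<bullet>) (const_form k) b\<bar> \<le> K * 2 * (norm k) ^ 3" by (simp add: mult_ac)
    qed
  qed
qed

lemma const_curv_scaleR: "const_curv (t *\<^sub>R k) = t\<^sup>2 *\<^sub>R const_curv k"
  by (simp add: const_curv_def bracket_wedge.scaleR_left bracket_wedge.scaleR_right power2_eq_square)

text \<open>Two non-commuting basis vectors placed in two different directions, which takes
  dimension at least 2.\<close>

lemma ex_const_curv_nonzero:
  assumes "CARD('n::{finite,linorder}) \<ge> 2"
  obtains k :: "'n::{finite,linorder} covec" where "0 < inner2 (\<bullet>) (const_curv k) (const_curv k)"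
proof -
  obtain i j :: 'n where ij: "i < j"
  proof -
    have "\<not> (\<forall>i j :: 'n. i = j)"
      using assms card_le_Suc0_iff_eq[of "UNIV :: 'n set"] by auto
    then obtain i j :: 'n where "i \<noteq> j" by blast
    then show ?thesis using that by (cases "i < j") (auto simp: not_less le_less)
  qed
  define k :: "'n covec" where "k = (\<chi> l. if l = i then su2_mk 1 0 0 else if l = j then su2_mk 0 1 0 else 0)"
  have "lie_bracket (k $ i) (k $ j) \<bullet> lie_bracket (k $ i) (k $ j) \<le> inner2 (\<bullet>) (const_curv k) (const_curv k)"
    unfolding inner2_const_curv
    using ij by (intro member_le_sum[of "(i, j)" _ "\<lambda>(i, j). lie_bracket (k $ i) (k $ j) \<bullet> lie_bracket (k $ i) (k $ j)", simplified]) auto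
  moreover have "lie_bracket (k $ i) (k $ j) \<bullet> lie_bracket (k $ i) (k $ j) = 8"
    using ij by (simp add: k_def lie_bracket_su2_mk inner_su2_mk)
  ultimately show ?thesis by (intro that[of k]) simp
qed

text \<open>The exponent 3/4 is admissible because the energy is of order Q + S, where Q powr (3/4)
  is bounded by the gradient and S powr (3/4) <= sqrt S is so too. It is minimal because on a ray of
  constant forms with curvature the energy is of order t^4 and the gradient at most of order
  t^3.\<close>

lemma theta_LS_zero:
  assumes card: "CARD('n::{finite,linorder}) \<ge> 2" and p: "real CARD('n) < p"
  shows "theta_LS p (\<bullet>) (const_form 0 :: 'n one_form) = 3/4"
proof -
  have p2: "2 \<le> p" using card p by linarith
  have p1: "1 \<le> p" using p2 by simp
  define \<Theta> where "\<Theta> = {\<theta>. 1/2 \<le> \<theta> \<and> \<theta> < 1 \<and> (\<exists>C>0. \<exists>\<delta>>0. \<forall>a\<in>W1p p.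
     sobolev_norm p (\<lambda>x. a x - (const_form 0 :: 'n one_form) x) < \<delta> \<longrightarrow>
       Y_norm p (gradient (\<bullet>) a) \<ge> C * \<bar>energy (\<bullet>) a - energy (\<bullet>) (const_form 0 :: 'n one_form)\<bar> powr \<theta>)}"
  have E0: "energy (\<bullet>) (const_form 0 :: 'n one_form) = 0"
    by (simp add: energy_const_form const_curv_def bracket_wedge.zero_left inner2.zero_left)
  have mem: "3/4 \<in> \<Theta>"
  proof -
    obtain c \<rho> where c: "0 < c" and \<rho>: "0 < \<rho>"
      and est: "\<And>(k0 :: 'n covec) b k Q S N. norm k0 < \<rho> \<Longrightarrow> b \<in> W1p p \<Longrightarrow> sobolev_norm p b < \<rho> \<Longrightarrow>
      k = k0 + (LINT x|torus. b x) \<Longrightarrow> Q = inner2 (\<bullet>) (const_curv k) (const_curv k) \<Longrightarrow>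
      S = (LINT x|torus. (norm (grad_form b x))\<^sup>2) \<Longrightarrow> N = Y_norm p (gradient (\<bullet>) (\<lambda>x. k0 + b x)) \<Longrightarrow>
      0 \<le> S \<and> S \<le> 1 \<and> c * sqrt S \<le> N \<and> c * Q powr (3/4) \<le> N \<and> c * (norm k * sqrt Q) \<le> N \<and>
      c * energy (\<bullet>) (\<lambda>x. k0 + b x) \<le> Q + S"
      by (rule gradient_estimates_near_constants[OF p p2]) blast
    \<comment> \<open>c powr (3/4) from the energy bound, c from the gradient bounds; 4 is the
      factor 2 of the power of a sum times two terms that are at most N each.\<close>
    define C where "C = c powr (3/4) * c / 4"
    have C: "0 < C" using c by (simp add: C_def)
    have "C * \<bar>energy (\<bullet>) a\<bar> powr (3/4) \<le> Y_norm p (gradient (\<bullet>) a)"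
      if a: "a \<in> W1p p" "sobolev_norm p a < \<rho>" for a :: "'n one_form"
    proof -
      define k where "k = 0 + (LINT x|torus. a x)"
      define Q where "Q = inner2 (\<bullet>) (const_curv k) (const_curv k)"
      define S where "S = (LINT x|torus. (norm (grad_form a x))\<^sup>2)"
      define N where "N = Y_norm p (gradient (\<bullet>) a)"
      have e: "0 \<le> S" "S \<le> 1" "c * sqrt S \<le> N" "c * Q powr (3/4) \<le> N" "c * energy (\<bullet>) a \<le> Q + S"
        using est[of 0 a k Q S N] a \<rho> by (auto simp: k_def Q_def S_def N_def)
      have Q0: "0 \<le> Q" by (simp add: Q_def inner2_nonneg)
      have E: "0 \<le> energy (\<bullet>) a"
        by (auto simp: energy_def inner2_nonneg intro!: add_nonneg_nonneg)
      have "(c * energy (\<bullet>) a) powr (3/4) \<le> (Q + S) powr (3/4)"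
        using E c e(5) by (intro powr_mono2) auto
      also have "\<dots> \<le> 2 powr (3/4) * (Q powr (3/4) + S powr (3/4))"
        using Q0 e(1) by (intro powr_add_le) auto
      also have "\<dots> \<le> 2 * (Q powr (3/4) + sqrt S)"
      proof (intro mult_mono add_left_mono)
        show "2 powr (3/4) \<le> (2::real)" using powr_mono[of "3/4" 1 "2::real"] by simp
        have "S powr (3/4) \<le> S powr (1/2)" using e by (intro powr_mono') auto
        then show "S powr (3/4) \<le> sqrt S" using e by (simp add: powr_half_sqrt)
      qed (use e in auto)
      finally have "c powr (3/4) * energy (\<bullet>) a powr (3/4) \<le> 2 * (Q powr (3/4) + sqrt S)"
        by (simp add: powr_mult)
      then have "c powr (3/4) * energy (\<bullet>) a powr (3/4) * c \<le> 2 * (Q powr (3/4) + sqrt S) * c"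
        using c by (intro mult_right_mono) auto
      also have "\<dots> = 2 * (c * Q powr (3/4)) + 2 * (c * sqrt S)" by (simp add: algebra_simps)
      also have "\<dots> \<le> 4 * N" using e by linarith
      finally show ?thesis using E by (simp add: C_def N_def mult_ac)
    qed
    then show ?thesis
      unfolding \<Theta>_def E0 mem_Collect_eq using C \<rho>
      by (intro conjI, simp, simp, rule_tac exI[of _ C], rule_tac conjI[OF C], rule_tac exI[of _ \<rho>])
        (auto simp: const_form_def)
  qed
  have lower: "3/4 \<le> \<theta>" if mem_\<theta>: "\<theta> \<in> \<Theta>" for \<theta>
  proof (rule ccontr)
    assume "\<not> 3/4 \<le> \<theta>"
    then have \<theta>: "\<theta> < 3/4" "1/2 \<le> \<theta>" using mem_\<theta> by (auto simp: \<Theta>_def)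
    obtain C \<delta> where C: "0 < C" and \<delta>: "0 < \<delta>" and H: "\<And>a. a \<in> W1p p \<Longrightarrow>
       sobolev_norm p (\<lambda>x. a x - (const_form 0 :: 'n one_form) x) < \<delta> \<Longrightarrow>
       Y_norm p (gradient (\<bullet>) a) \<ge> C * \<bar>energy (\<bullet>) a\<bar> powr \<theta>"
      using mem_\<theta> unfolding \<Theta>_def E0 by auto
    obtain k :: "'n covec" where k: "0 < inner2 (\<bullet>) (const_curv k) (const_curv k)"
      by (rule ex_const_curv_nonzero[OF card])
    define e where "e = 1/2 * inner2 (\<bullet>) (const_curv k) (const_curv k)"
    have e: "0 < e" using k by (simp add: e_def)
    have k0: "0 < norm k"
      using k by (auto simp: const_curv_def bracket_wedge.zero_left inner2.zero_left)
    obtain K where K: "0 < K" "\<And>k :: 'n covec. Y_norm p (gradient (\<bullet>) (const_form k)) \<le> K * (norm k) ^ 3"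
      using Y_norm_const_form_le[OF p2, where 'n = 'n] by metis
    define L where "L = C * e powr \<theta> / (K * (norm k) ^ 3)"
    have L: "0 < L" using C e K k0 by (simp add: L_def)
    have ineq: "L \<le> t powr (3 - 4 * \<theta>)" if t: "0 < t" "t * norm k < \<delta>" for t
    proof -
      have "sobolev_norm p (\<lambda>x. const_form (t *\<^sub>R k) x - (const_form 0 :: 'n one_form) x) = t * norm k"
        using t p1 by (simp add: const_form_def sobolev_norm_eq sobolev_sum_const powr_powr)
      moreover have "const_form (t *\<^sub>R k) \<in> W1p p" unfolding const_form_def by (rule W1p_const)
      ultimately have "C * \<bar>energy (\<bullet>) (const_form (t *\<^sub>R k) :: 'n one_form)\<bar> powr \<theta> \<le> K * (norm (t *\<^sub>R k)) ^ 3"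
        using t by (intro order.trans[OF H K(2)]) auto
      moreover have "energy (\<bullet>) (const_form (t *\<^sub>R k) :: 'n one_form) = t ^ 4 * e"
        by (simp add: energy_const_form const_curv_scaleR inner2.scaleR_left inner2.scaleR_right e_def flip: power_add)
      moreover have "(t ^ 4) powr \<theta> = t powr (4 * \<theta>)"
        using t powr_realpow[of t 4] powr_powr[of t 4 \<theta>] by simp
      ultimately have "C * (t powr (4 * \<theta>) * e powr \<theta>) \<le> K * (t ^ 3 * (norm k) ^ 3)"
        using t e by (simp add: powr_mult power_mult_distrib)
      then have "t powr (4 * \<theta>) * (C * e powr \<theta>) \<le> t ^ 3 * (K * (norm k) ^ 3)" by (simp add: mult_ac)
      then have "t powr (4 * \<theta>) * L \<le> t ^ 3"
        using K k0 by (simp add: L_def divide_le_eq)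
      also have "t ^ 3 = t powr (4 * \<theta>) * t powr (3 - 4 * \<theta>)"
        using t powr_realpow[of t 3] by (simp flip: powr_add)
      finally show ?thesis using t by simp
    qed
    define s where "s = 3 - 4 * \<theta>"
    have s: "0 < s" using \<theta> by (simp add: s_def)
    \<comment> \<open>Small enough for the neighbourhood and for t powr s <= L / 2, which
      contradicts \<open>ineq\<close> as L > 0.\<close>
    define t where "t = min (\<delta> / (2 * norm k)) ((L / 2) powr (1 / s))"
    have t: "0 < t" using \<delta> k0 L by (simp add: t_def)
    have "t * norm k \<le> \<delta> / (2 * norm k) * norm k"
      by (intro mult_right_mono) (auto simp: t_def)
    also have "\<dots> < \<delta>" using \<delta> k0 by simp
    finally have "L \<le> t powr s" using ineq[OF t] by (simp add: s_def)
    also have "\<dots> \<le> ((L / 2) powr (1 / s)) powr s"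
      using t s by (intro powr_mono2) (auto simp: t_def)
    also have "\<dots> = L / 2" using s L by (simp add: powr_powr)
    finally show False using L by simp
  qed
  have "theta_LS p (\<bullet>) (const_form 0 :: 'n one_form) = Inf \<Theta>"
    by (simp add: theta_LS_def \<Theta>_def)
  also have "\<dots> = 3/4" by (rule cInf_eq_minimum[OF mem lower])
  finally show ?thesis .
qed

text \<open>Near k0 the mean k has at least half the norm of k0, so the bound by |k| sqrt Q amounts
  to one by sqrt Q. The radius \<epsilon> is uniform, while C and \<delta> depend on k0. The value
  1/2 is the least that the definition admits.\<close>

lemma theta_LS_flat:
  assumes p: "real CARD('n::{finite,linorder}) < p" "2 \<le> p"
  obtains \<epsilon> where "0 < \<epsilon>" "\<And>k0 :: 'n covec. k0 \<noteq> 0 \<Longrightarrow> norm k0 < \<epsilon> \<Longrightarrow> const_curv k0 = 0 \<Longrightarrow>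
    theta_LS p (\<bullet>) (const_form k0) = 1/2"
proof -
  have p1: "1 \<le> p" using p by simp
  obtain c \<rho> where c: "0 < c" and \<rho>: "0 < \<rho>"
    and est: "\<And>(k0 :: 'n covec) b k Q S N. norm k0 < \<rho> \<Longrightarrow> b \<in> W1p p \<Longrightarrow> sobolev_norm p b < \<rho> \<Longrightarrow>
      k = k0 + (LINT x|torus. b x) \<Longrightarrow> Q = inner2 (\<bullet>) (const_curv k) (const_curv k) \<Longrightarrow>
      S = (LINT x|torus. (norm (grad_form b x))\<^sup>2) \<Longrightarrow> N = Y_norm p (gradient (\<bullet>) (\<lambda>x. k0 + b x)) \<Longrightarrow>
      0 \<le> S \<and> S \<le> 1 \<and> c * sqrt S \<le> N \<and> c * Q powr (3/4) \<le> N \<and> c * (norm k * sqrt Q) \<le> N \<and>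
      c * energy (\<bullet>) (\<lambda>x. k0 + b x) \<le> Q + S"
    by (rule gradient_estimates_near_constants[OF p]) blast
  show ?thesis
  proof (rule that[OF \<rho>])
    fix k0 :: "'n covec" assume k0: "k0 \<noteq> 0" "norm k0 < \<rho>" "const_curv k0 = 0"
    define \<Theta> where "\<Theta> = {\<theta>. 1/2 \<le> \<theta> \<and> \<theta> < 1 \<and> (\<exists>C>0. \<exists>\<delta>>0. \<forall>a\<in>W1p p.
       sobolev_norm p (\<lambda>x. a x - const_form k0 x) < \<delta> \<longrightarrow>
         Y_norm p (gradient (\<bullet>) a) \<ge> C * \<bar>energy (\<bullet>) a - energy (\<bullet>) (const_form k0)\<bar> powr \<theta>)}"
    have E0: "energy (\<bullet>) (const_form k0) = 0"
      by (simp add: energy_const_form k0 inner2.zero_left)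
    \<comment> \<open>The mean of b is at most twice its Sobolev norm, so a quarter of |k0| keeps
      |k| above half of it.\<close>
    define \<delta> where "\<delta> = min \<rho> (norm k0 / 4)"
    have \<delta>: "0 < \<delta>" "\<delta> \<le> \<rho>" "\<delta> \<le> norm k0 / 4" using \<rho> k0 by (auto simp: \<delta>_def)
    define C where "C = sqrt c * c * min 1 (norm k0 / 2) / 2"
    have C: "0 < C" using c k0 by (simp add: C_def)
    have "C * \<bar>energy (\<bullet>) a\<bar> powr (1/2) \<le> Y_norm p (gradient (\<bullet>) a)"
      if a: "a \<in> W1p p" "sobolev_norm p (\<lambda>x. a x - const_form k0 x) < \<delta>" for a :: "'n one_form"
    proof -
      define b where "b x = - k0 + a x" for x
      have b: "b \<in> W1p p" unfolding b_def by (rule W1p_add[OF W1p_const a(1) p1])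
      have bs: "sobolev_norm p b < \<delta>" using a(2) by (simp add: b_def[abs_def] const_form_def)
      have ab: "a = (\<lambda>x. k0 + b x)" by (simp add: b_def)
      define k where "k = k0 + (LINT x|torus. b x)"
      define Q where "Q = inner2 (\<bullet>) (const_curv k) (const_curv k)"
      define S where "S = (LINT x|torus. (norm (grad_form b x))\<^sup>2)"
      define N where "N = Y_norm p (gradient (\<bullet>) a)"
      have e: "0 \<le> S" "S \<le> 1" "c * sqrt S \<le> N" "c * (norm k * sqrt Q) \<le> N" "c * energy (\<bullet>) a \<le> Q + S"
        using est[of k0 b k Q S N] k0 b bs \<delta> by (auto simp: k_def Q_def S_def N_def ab)
      have Q0: "0 \<le> Q" by (simp add: Q_def inner2_nonneg)
      have E: "0 \<le> energy (\<bullet>) a"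
        by (auto simp: energy_def inner2_nonneg intro!: add_nonneg_nonneg)
      define \<mu> where "\<mu> = min 1 (norm k0 / 2)"
      have \<mu>: "0 \<le> \<mu>" "\<mu> \<le> 1" "\<mu> \<le> norm k0 / 2" by (auto simp: \<mu>_def)
      have "norm (LINT x|torus. b x) \<le> norm k0 / 2"
        using norm_mean_le_sobolev_norm[OF b p1] bs \<delta> by linarith
      then have "norm k0 / 2 \<le> norm k"
        using norm_triangle_ineq4[of k "LINT x|torus. b x"] by (simp add: k_def)
      then have "c * (\<mu> * sqrt Q) \<le> c * (norm k * sqrt Q)"
        using \<mu> c Q0 by (intro mult_left_mono mult_right_mono) auto
      then have 1: "c * (\<mu> * sqrt Q) \<le> N" using e by linarith
      have "c * (\<mu> * sqrt S) \<le> c * (1 * sqrt S)"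
        using \<mu> c e by (intro mult_left_mono mult_right_mono) auto
      then have 2: "c * (\<mu> * sqrt S) \<le> N" using e by simp
      have "sqrt (c * energy (\<bullet>) a) \<le> sqrt (Q + S)" using e by simp
      also have "\<dots> \<le> sqrt Q + sqrt S" using Q0 e by (intro sqrt_add_le_add_sqrt) auto
      finally have "sqrt c * sqrt (energy (\<bullet>) a) \<le> sqrt Q + sqrt S" by (simp add: real_sqrt_mult)
      then have "c * (\<mu> * (sqrt c * sqrt (energy (\<bullet>) a))) \<le> c * (\<mu> * (sqrt Q + sqrt S))"
        using c \<mu> by (intro mult_left_mono) auto
      also have "\<dots> \<le> 2 * N" using 1 2 by (simp add: distrib_left)
      finally show ?thesis using E by (simp add: C_def N_def powr_half_sqrt mult_ac flip: \<mu>_def)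
    qed
    then have mem: "1/2 \<in> \<Theta>"
      unfolding \<Theta>_def E0 mem_Collect_eq using C \<delta>
      by (intro conjI, simp, simp, rule_tac exI[of _ C], rule_tac conjI[OF C], rule_tac exI[of _ \<delta>]) auto
    have "theta_LS p (\<bullet>) (const_form k0) = Inf \<Theta>" by (simp add: theta_LS_def \<Theta>_def)
    also have "\<dots> = 1/2" by (rule cInf_eq_minimum[OF mem]) (simp add: \<Theta>_def)
    finally show "theta_LS p (\<bullet>) (const_form k0) = 1/2" .
  qed
qed

section \<open>The Lyapunov--Schmidt correction\<close>

lemma covec_functional_representation:
  fixes T :: "'n::finite covec \<Rightarrow> real"
  assumes "linear T"
  obtains \<eta> where "\<And>v. T v = \<eta> \<bullet> v"
  using adjoint_works[OF assms, of _ "1::real"] by (intro that[of "adjoint T 1"]) (simp add: inner_commute)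

lemma integral_add_W1p:
  "a \<in> W1p q \<Longrightarrow> b \<in> W1p q \<Longrightarrow> 1 \<le> q \<Longrightarrow> (LINT x|torus. a x + b x) = (LINT x|torus. a x) + (LINT x|torus. b x)"
  by (intro Bochner_Integration.integral_add W1p_integrable(1))

lemma gradient_const_form_in_Y_space:
  assumes p: "2 \<le> p"
  shows "gradient (\<lambda>x y. c * (x \<bullet> y)) (const_form k :: 'n::{finite,linorder} one_form) \<in> Y_space p"
proof -
  have q: "1 \<le> conj_exp p" using conj_exp_bounds[OF p] by simp
  define T where "T v = c * inner2 (\<bullet>) (const_curv k) (bracket_wedge k v)" for v
  have G: "gradient (\<lambda>x y. c * (x \<bullet> y)) (const_form k) b = T (LINT x|torus. b x)" if "b \<in> W1p (conj_exp p)" for b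
    by (simp add: gradient_scaled gradient_const_form[OF that q] T_def)
  have T: "bounded_linear T"
    unfolding T_def
    by (intro bounded_linear_const_mult bounded_linear_compose[OF inner2.bounded_linear_right bracket_wedge.bounded_linear_right])
  obtain B where B: "0 < B" "\<And>v. norm (T v) \<le> norm v * B"
    using bounded_linear.pos_bounded[OF T] by auto
  show ?thesis
    unfolding Y_space_def mem_Collect_eq
  proof (intro conjI ballI allI exI[of _ "2 * B"])
    fix a b :: "'n one_form" assume a: "a \<in> W1p (conj_exp p)" and b: "b \<in> W1p (conj_exp p)"
    show "gradient (\<lambda>x y. c * (x \<bullet> y)) (const_form k) (\<lambda>x. a x + b x)
        = gradient (\<lambda>x y. c * (x \<bullet> y)) (const_form k) a + gradient (\<lambda>x y. c * (x \<bullet> y)) (const_form k) b"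
      by (simp add: G W1p_add[OF a b q] a b integral_add_W1p[OF a b q] linear_add[OF bounded_linear.linear[OF T]])
  next
    fix t and b :: "'n one_form" assume b: "b \<in> W1p (conj_exp p)"
    show "gradient (\<lambda>x y. c * (x \<bullet> y)) (const_form k) (\<lambda>x. t *\<^sub>R b x) = t * gradient (\<lambda>x y. c * (x \<bullet> y)) (const_form k) b"
      by (simp add: G W1p_scaleR[OF b q] b linear_scale[OF bounded_linear.linear[OF T]])
  next
    fix b :: "'n one_form" assume b: "b \<in> W1p (conj_exp p)"
    have "norm (T (LINT x|torus. b x)) \<le> norm (LINT x|torus. b x) * B" by (rule B(2))
    also have "\<dots> \<le> (2 * sobolev_norm (conj_exp p) b) * B"
      using norm_mean_le_sobolev_norm[OF b q] B(1) by (intro mult_right_mono) auto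
    finally show "\<bar>gradient (\<lambda>x y. c * (x \<bullet> y)) (const_form k) b\<bar> \<le> 2 * B * sobolev_norm (conj_exp p) b"
      by (simp add: G[OF b] mult_ac)
  qed
qed

lemma zero_in_range: "in_Ran p (\<lambda>x y. c * (x \<bullet> y)) (\<lambda>b :: 'n::{finite,linorder} one_form. 0)"
  unfolding in_Ran_def
proof (intro bexI[of _ "\<lambda>x. 0"] ballI)
  fix b :: "'n one_form"
  have g: "AE x in torus. grad_form (\<lambda>x. 0 :: 'n covec) x = 0" by (rule grad_form_const)
  have "(LINT x|torus. inner2 (\<lambda>x y. c * (x \<bullet> y)) (ext_d (\<lambda>x. 0) x) (ext_d b x)) = 0"
  proof (rule integral_eq_zero_AE)
    show "AE x in torus. inner2 (\<lambda>x y. c * (x \<bullet> y)) (ext_d (\<lambda>x. 0) x) (ext_d b x) = 0"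
      using g by eventually_elim (simp add: ext_d_eq linear_zeros inner2_scaled inner2.zero_left)
  qed
  moreover have "(LINT x|torus. c * (codiff (\<lambda>x. 0) x \<bullet> codiff b x)) = 0"
  proof (rule integral_eq_zero_AE)
    show "AE x in torus. c * (codiff (\<lambda>x. 0) x \<bullet> codiff b x) = 0"
      using g by eventually_elim (simp add: codiff_eq linear_zeros)
  qed
  ultimately show "0 = hodge_laplacian (\<lambda>x y. c * (x \<bullet> y)) (\<lambda>x. 0) b"
    by (simp add: hodge_laplacian_def)
qed (rule W1p_const)

text \<open>By \<open>gradient_const_form\<close> the gradient at a constant form is the pairing
  with a constant form, so it lies in the summand that R annihilates.\<close>

lemma LS_correction_zero:
  assumes p: "2 \<le> p" and c: "0 < c"
  shows "LS_correction p (\<lambda>x y. c * (x \<bullet> y)) (\<lambda>(\<xi> :: 'n::{finite,linorder} covec) x. 0)"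
proof -
  let ?ip = "\<lambda>x y :: su2. c * (x \<bullet> y)"
  have p1: "1 \<le> p" using p by simp
  have s0: "sobolev_norm p (\<lambda>x. 0 :: 'n covec) = 0"
    using p1 by (simp add: sobolev_norm_eq sobolev_sum_const)
  have germ: "analytic_germ p (\<lambda>(\<xi> :: 'n covec) x. 0)"
    unfolding analytic_germ_def
    by (rule exI[of _ "\<lambda>_ _. 0"], rule exI[of _ 1]) (simp add: W1p_const s0)
  have main: "((\<lambda>x. 0) :: 'n one_form) \<in> Z_space p ?ip \<and>
      proj_R p ?ip (gradient ?ip (\<lambda>x. const_form \<xi> x + 0)) (\<lambda>b. 0)" for \<xi> :: "'n covec"
  proof
    show "((\<lambda>x. 0) :: 'n one_form) \<in> Z_space p ?ip"
      by (simp add: Z_space_def W1p_const L2_pairing_scaled)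
    have q: "1 \<le> conj_exp p" using conj_exp_bounds[OF p] by simp
    have "linear (\<lambda>v. inner2 (\<bullet>) (const_curv \<xi>) (bracket_wedge \<xi> v))"
      by (intro bounded_linear.linear bounded_linear_compose[OF inner2.bounded_linear_right bracket_wedge.bounded_linear_right])
    then obtain \<eta> where \<eta>: "\<And>v. inner2 (\<bullet>) (const_curv \<xi>) (bracket_wedge \<xi> v) = \<eta> \<bullet> v"
      by (rule covec_functional_representation) blast
    have "in_K p (\<lambda>x y. c * (x \<bullet> y)) (\<lambda>b. gradient (\<lambda>x y. c * (x \<bullet> y)) (const_form \<xi>) b - 0)"
      unfolding in_K_def
    proof (intro exI[of _ \<eta>] ballI)
      fix b :: "'n one_form" assume b: "b \<in> W1p (conj_exp p)"
      have "\<eta> \<bullet> (LINT x|torus. b x) = (LINT x|torus. \<eta> \<bullet> b x)"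
        using integral_bounded_linear[OF bounded_linear_inner_right W1p_integrable(1)[OF b q]] by simp
      then show "gradient (\<lambda>x y. c * (x \<bullet> y)) (const_form \<xi>) b - 0 = L2_pairing (\<lambda>x y. c * (x \<bullet> y)) (const_form \<eta>) b"
        by (simp add: gradient_scaled gradient_const_form[OF b q] \<eta> L2_pairing_scaled) (simp add: const_form_def)
    qed
    then show "proj_R p ?ip (gradient ?ip (\<lambda>x. const_form \<xi> x + 0)) (\<lambda>b. 0)"
      using gradient_const_form_in_Y_space[OF p, of c \<xi>] zero_in_range[of p c]
      by (simp add: proj_R_def)
  qed
  show ?thesis
    unfolding LS_correction_def using germ main by simp
qed

section \<open>Smallness and uniqueness of analytic corrections\<close>

lemma W1p_sum:
  assumes "finite I" "\<And>i. i \<in> I \<Longrightarrow> f i \<in> W1p p" "1 \<le> p"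
  shows "(\<lambda>x. \<Sum>i\<in>I. f i x) \<in> W1p p"
  using assms(1,2)
proof (induction I rule: finite_induct)
  case empty
  then show ?case by (simp add: W1p_const)
next
  case (insert i I)
  then have "(\<lambda>x. f i x + (\<Sum>i\<in>I. f i x)) \<in> W1p p" using assms(3) by (intro W1p_add) auto
  then show ?case using insert by simp
qed

text \<open>One factor of the monomial is bounded by |\<xi>| and the others by r. Against an
  absolutely convergent series this yields a bound linear in |\<xi>|.\<close>

lemma abs_monomial_le:
  fixes \<xi> :: "'a::euclidean_space"
  assumes r: "norm \<xi> < r" and \<alpha>: "(\<Sum>e\<in>Basis. \<alpha> e) \<noteq> (0::nat)"
  shows "\<bar>\<Prod>e\<in>Basis. (\<xi> \<bullet> e) ^ \<alpha> e\<bar> \<le> norm \<xi> / r * r ^ (\<Sum>e\<in>Basis. \<alpha> e)"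
proof -
  have r0: "0 < r" using r norm_ge_zero[of \<xi>] by linarith
  obtain m where m: "(\<Sum>e\<in>Basis. \<alpha> e) = Suc m" using \<alpha> not0_implies_Suc by blast
  have "\<bar>\<Prod>e\<in>Basis. (\<xi> \<bullet> e) ^ \<alpha> e\<bar> = (\<Prod>e\<in>Basis. \<bar>\<xi> \<bullet> e\<bar> ^ \<alpha> e)"
    by (simp add: abs_prod power_abs)
  also have "\<dots> \<le> (\<Prod>e\<in>Basis. norm \<xi> ^ \<alpha> e)"
    by (intro prod_mono conjI power_mono Basis_le_norm) auto
  also have "\<dots> = norm \<xi> ^ (\<Sum>e\<in>Basis. \<alpha> e)" by (simp add: power_sum)
  also have "\<dots> = norm \<xi> * norm \<xi> ^ m" by (simp add: m)
  also have "\<dots> \<le> norm \<xi> * r ^ m" using r by (intro mult_left_mono power_mono) auto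
  also have "\<dots> = norm \<xi> / r * r ^ (\<Sum>e\<in>Basis. \<alpha> e)" using r0 by (simp add: m)
  finally show ?thesis .
qed

text \<open>The Sobolev embedding turns the coefficients of the power series into uniform bounds, so that
  the triangle inequality for Sobolev norms is not needed.\<close>

lemma analytic_germ_AE_bound:
  fixes \<psi> :: "'n::{finite,linorder} covec \<Rightarrow> 'n one_form"
  assumes germ: "analytic_germ p \<psi>" and \<psi>0: "AE x in lborel. \<psi> 0 x = 0" and p: "real CARD('n) < p"
  obtains M r where "0 < M" "0 < r" "\<And>\<xi>. norm \<xi> < r \<Longrightarrow> \<psi> \<xi> \<in> W1p p"
    "\<And>\<xi>. norm \<xi> < r \<Longrightarrow> AE x in torus. norm (\<psi> \<xi> x) \<le> M * norm \<xi>"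
proof -
  let ?I = "Basis \<rightarrow>\<^sub>E (UNIV :: nat set) :: ('n covec \<Rightarrow> nat) set"
  obtain c r where H: "0 < r \<and> (\<forall>\<alpha>. c \<alpha> \<in> W1p p) \<and>
     (\<lambda>\<alpha>. sobolev_norm p (c \<alpha>) * r ^ (\<Sum>e\<in>Basis. \<alpha> e)) summable_on ?I \<and>
     (\<forall>\<xi>. norm \<xi> < r \<longrightarrow> \<psi> \<xi> \<in> W1p p \<and>
       ((\<lambda>S. sobolev_norm p
           (\<lambda>x. \<psi> \<xi> x - (\<Sum>\<alpha>\<in>S. (\<Prod>e\<in>Basis. (\<xi> \<bullet> e) ^ \<alpha> e) *\<^sub>R c \<alpha> x))) \<longlongrightarrow> 0)
         (finite_subsets_at_top ?I))"
    using germ unfolding analytic_germ_def by (elim exE)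
  then have r: "0 < r" and cW: "\<And>\<alpha>. c \<alpha> \<in> W1p p"
    and sm: "(\<lambda>\<alpha>. sobolev_norm p (c \<alpha>) * r ^ (\<Sum>e\<in>Basis. \<alpha> e)) summable_on ?I"
    and \<psi>W: "\<And>\<xi>. norm \<xi> < r \<Longrightarrow> \<psi> \<xi> \<in> W1p p"
    and lim: "\<And>\<xi>. norm \<xi> < r \<Longrightarrow> ((\<lambda>S. sobolev_norm p
           (\<lambda>x. \<psi> \<xi> x - (\<Sum>\<alpha>\<in>S. (\<Prod>e\<in>Basis. (\<xi> \<bullet> e) ^ \<alpha> e) *\<^sub>R c \<alpha> x))) \<longlongrightarrow> 0)
         (finite_subsets_at_top ?I)"
    by simp_all
  have p1: "1 \<le> p" using p zero_less_card_finite[where 'a = 'n] by linarith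
  define m where "m \<xi> \<alpha> = (\<Prod>e\<in>Basis. (\<xi> \<bullet> e) ^ \<alpha> e)" for \<xi> :: "'n covec" and \<alpha> :: "'n covec \<Rightarrow> nat"
  define A where "A = embedding_const CARD('n) p"
  have A: "0 < A" using embedding_const_ge[OF p] by (simp add: A_def)
  \<comment> \<open>The zero multi-index as an extensional function: 0 on \<open>Basis\<close> and
    \<open>undefined\<close> elsewhere. This makes it the only index of degree 0.\<close>
  define \<alpha>0 :: "'n covec \<Rightarrow> nat" where "\<alpha>0 = (\<lambda>e\<in>Basis. 0)"
  have \<alpha>0: "\<alpha>0 \<in> ?I" by (simp add: \<alpha>0_def)
  have \<alpha>0_unique: "\<alpha> = \<alpha>0" if "\<alpha> \<in> ?I" "(\<Sum>e\<in>Basis. \<alpha> e) = 0" for \<alpha>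
    using that by (intro PiE_ext[OF that(1) \<alpha>0]) (simp add: \<alpha>0_def)
  have rem_W: "(\<lambda>x. \<psi> \<xi> x - (\<Sum>\<alpha>\<in>S. m \<xi> \<alpha> *\<^sub>R c \<alpha> x)) \<in> W1p p" if "norm \<xi> < r" "finite S" for \<xi> S
  proof -
    have "(\<lambda>x. \<Sum>\<alpha>\<in>S. (- m \<xi> \<alpha>) *\<^sub>R c \<alpha> x) \<in> W1p p"
      by (rule W1p_sum[OF that(2) W1p_scaleR[OF cW p1] p1])
    from W1p_add[OF \<psi>W[OF that(1)] this p1] show ?thesis by (simp add: sum_negf)
  qed
  \<comment> \<open>At \<xi> = 0 every monomial but the constant one vanishes, so the partial sums
    are eventually this one coefficient, and the value of the series is \<psi> 0 = 0.\<close>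
  have c0: "AE x in torus. c \<alpha>0 x = 0"
  proof -
    have m0: "m 0 \<alpha> = (if \<alpha> = \<alpha>0 then 1 else 0)" if "\<alpha> \<in> ?I" for \<alpha>
    proof (cases "\<alpha> = \<alpha>0")
      case True
      then show ?thesis by (simp add: m_def \<alpha>0_def)
    next
      case False
      then have "(\<Sum>e\<in>Basis. \<alpha> e) \<noteq> 0" using \<alpha>0_unique that by blast
      then obtain e where "e \<in> Basis" "\<alpha> e \<noteq> 0" by (auto simp: sum_eq_0_iff)
      then have "m 0 \<alpha> = 0" unfolding m_def by (intro prod_zero) (auto intro!: bexI[of _ e])
      then show ?thesis using False by simp
    qed
    have "\<forall>\<^sub>F S in finite_subsets_at_top ?I. sobolev_norm p (\<lambda>x. \<psi> 0 x - (\<Sum>\<alpha>\<in>S. m 0 \<alpha> *\<^sub>R c \<alpha> x))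
        = sobolev_norm p (\<lambda>x. \<psi> 0 x - c \<alpha>0 x)"
      unfolding eventually_finite_subsets_at_top
    proof (intro exI[of _ "{\<alpha>0}"] conjI allI impI)
      fix S assume S: "finite S \<and> {\<alpha>0} \<subseteq> S \<and> S \<subseteq> ?I"
      have "(\<Sum>\<alpha>\<in>S. m 0 \<alpha> *\<^sub>R c \<alpha> x) = c \<alpha>0 x" for x
      proof -
        have "(\<Sum>\<alpha>\<in>S. m 0 \<alpha> *\<^sub>R c \<alpha> x) = (\<Sum>\<alpha>\<in>S. if \<alpha> = \<alpha>0 then c \<alpha> x else 0)"
          using S m0 by (intro sum.cong) auto
        then show ?thesis using S by (simp add: sum.delta)
      qed
      then show "sobolev_norm p (\<lambda>x. \<psi> 0 x - (\<Sum>\<alpha>\<in>S. m 0 \<alpha> *\<^sub>R c \<alpha> x)) = sobolev_norm p (\<lambda>x. \<psi> 0 x - c \<alpha>0 x)"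
        by simp
    qed (use \<alpha>0 in auto)
    then have "((\<lambda>S. sobolev_norm p (\<lambda>x. \<psi> 0 x - (\<Sum>\<alpha>\<in>S. m 0 \<alpha> *\<^sub>R c \<alpha> x))) \<longlongrightarrow> sobolev_norm p (\<lambda>x. \<psi> 0 x - c \<alpha>0 x))
        (finite_subsets_at_top ?I)"
      by (rule tendsto_eventually)
    moreover have "((\<lambda>S. sobolev_norm p (\<lambda>x. \<psi> 0 x - (\<Sum>\<alpha>\<in>S. m 0 \<alpha> *\<^sub>R c \<alpha> x))) \<longlongrightarrow> 0) (finite_subsets_at_top ?I)"
      using lim[of 0] r by (simp add: m_def)
    ultimately have "sobolev_norm p (\<lambda>x. \<psi> 0 x - c \<alpha>0 x) = 0"
      by (rule tendsto_unique[rotated]) simp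
    moreover have "(\<lambda>x. \<psi> 0 x - c \<alpha>0 x) \<in> W1p p"
      using W1p_add[OF \<psi>W W1p_scaleR[OF cW p1, of "- 1"] p1, of 0 \<alpha>0] r by simp
    ultimately have "AE x in torus. norm (\<psi> 0 x - c \<alpha>0 x) \<le> 0"
      using AE_norm_le_sobolev_norm[OF _ p, of "\<lambda>x. \<psi> 0 x - c \<alpha>0 x"] by simp
    then show ?thesis
      using AE_lborel_imp_torus[OF \<psi>0] by eventually_elim simp
  qed
  define T where "T = (\<Sum>\<^sub>\<infinity>\<alpha>\<in>?I. sobolev_norm p (c \<alpha>) * r ^ (\<Sum>e\<in>Basis. \<alpha> e))"
  have T: "0 \<le> T"
    unfolding T_def using r by (intro infsum_nonneg mult_nonneg_nonneg zero_le_power sobolev_norm_nonneg) auto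
  \<comment> \<open>A for the remainder and A T / r for the partial sum.\<close>
  define M where "M = A * (1 + T / r)"
  have bound: "AE x in torus. norm (\<psi> \<xi> x) \<le> M * norm \<xi>" if \<xi>: "norm \<xi> < r" "\<xi> \<noteq> 0" for \<xi>
  proof -
    have "0 < norm \<xi>" using \<xi> by simp
    \<comment> \<open>A single partial sum with remainder below |\<xi>| in Sobolev norm is enough.
      It is bounded term by term, on a finite intersection of sets of full measure.\<close>
    define close where "close S \<longleftrightarrow> sobolev_norm p (\<lambda>x. \<psi> \<xi> x - (\<Sum>\<alpha>\<in>S. m \<xi> \<alpha> *\<^sub>R c \<alpha> x)) < norm \<xi>" for S
    have "\<forall>\<^sub>F S in finite_subsets_at_top ?I. close S"
      unfolding close_def m_def by (rule order_tendstoD(2)[OF lim[OF \<xi>(1)] \<open>0 < norm \<xi>\<close>])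
    then have "\<exists>X. finite X \<and> X \<subseteq> ?I \<and> (\<forall>Y. finite Y \<and> X \<subseteq> Y \<and> Y \<subseteq> ?I \<longrightarrow> close Y)"
      by (rule eventually_finite_subsets_at_top[THEN iffD1])
    then obtain S0 where S0': "finite S0 \<and> S0 \<subseteq> ?I \<and> (\<forall>Y. finite Y \<and> S0 \<subseteq> Y \<and> Y \<subseteq> ?I \<longrightarrow> close Y)"
      by (elim exE)
    have S0: "finite S0" using S0' by (rule conjunct1)
    have S0I: "S0 \<subseteq> ?I" using S0' by (elim conjE)
    have "close S0" using conjunct2[OF conjunct2[OF S0']] S0 S0I by (metis subset_refl)
    define R where "R x = \<psi> \<xi> x - (\<Sum>\<alpha>\<in>S0. m \<xi> \<alpha> *\<^sub>R c \<alpha> x)" for x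
    have R: "R \<in> W1p p" "sobolev_norm p R < norm \<xi>"
      using rem_W[OF \<xi>(1) S0] \<open>close S0\<close> by (simp_all only: R_def[abs_def] close_def)
    have "AE x in torus. \<forall>\<alpha>\<in>S0. norm (c \<alpha> x) \<le> A * sobolev_norm p (c \<alpha>)"
      using S0 AE_norm_le_sobolev_norm[OF cW p] by (simp add: AE_finite_all A_def)
    moreover have "AE x in torus. norm (R x) \<le> A * sobolev_norm p R"
      unfolding A_def by (rule AE_norm_le_sobolev_norm[OF R(1) p])
    ultimately show ?thesis
      using c0
    proof eventually_elim
      case (elim x)
      have term_le: "norm (m \<xi> \<alpha> *\<^sub>R c \<alpha> x) \<le> A * (norm \<xi> / r) * (sobolev_norm p (c \<alpha>) * r ^ (\<Sum>e\<in>Basis. \<alpha> e))" if "\<alpha> \<in> S0" for \<alpha>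
      proof (cases "\<alpha> = \<alpha>0")
        case True
        have "0 \<le> A * (norm \<xi> / r) * (sobolev_norm p (c \<alpha>) * r ^ (\<Sum>e\<in>Basis. \<alpha> e))"
          using A r sobolev_norm_nonneg[of p "c \<alpha>"] by (intro mult_nonneg_nonneg) auto
        then show ?thesis using elim True by simp
      next
        case False
        then have "(\<Sum>e\<in>Basis. \<alpha> e) \<noteq> 0" using \<alpha>0_unique that S0I by blast
        then have "\<bar>m \<xi> \<alpha>\<bar> \<le> norm \<xi> / r * r ^ (\<Sum>e\<in>Basis. \<alpha> e)"
          unfolding m_def by (rule abs_monomial_le[OF \<xi>(1)])
        then have "norm (m \<xi> \<alpha> *\<^sub>R c \<alpha> x) \<le> (norm \<xi> / r * r ^ (\<Sum>e\<in>Basis. \<alpha> e)) * (A * sobolev_norm p (c \<alpha>))"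
          unfolding norm_scaleR using elim that r by (intro mult_mono) auto
        then show ?thesis by (simp only: mult_ac)
      qed
      have "norm (\<psi> \<xi> x) \<le> norm (R x) + norm (\<Sum>\<alpha>\<in>S0. m \<xi> \<alpha> *\<^sub>R c \<alpha> x)"
        using norm_triangle_ineq[of "R x" "\<Sum>\<alpha>\<in>S0. m \<xi> \<alpha> *\<^sub>R c \<alpha> x"] by (simp add: R_def)
      also have "norm (\<Sum>\<alpha>\<in>S0. m \<xi> \<alpha> *\<^sub>R c \<alpha> x) \<le> (\<Sum>\<alpha>\<in>S0. A * (norm \<xi> / r) * (sobolev_norm p (c \<alpha>) * r ^ (\<Sum>e\<in>Basis. \<alpha> e)))"
        by (rule order.trans[OF norm_sum sum_mono[OF term_le]])
      also have "\<dots> = A * (norm \<xi> / r) * (\<Sum>\<alpha>\<in>S0. sobolev_norm p (c \<alpha>) * r ^ (\<Sum>e\<in>Basis. \<alpha> e))"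
        by (simp only: sum_distrib_left)
      also have "\<dots> \<le> A * (norm \<xi> / r) * T"
        unfolding T_def using A r S0 S0I
        by (intro mult_left_mono finite_sum_le_infsum[OF sm] mult_nonneg_nonneg zero_le_power sobolev_norm_nonneg) auto
      also have "norm (R x) \<le> A * norm \<xi>"
        using elim R(2) A by (smt (verit) mult_left_mono)
      finally show ?case by (simp add: M_def algebra_simps)
    qed
  qed
  show ?thesis
  proof (rule that)
    show "0 < M" unfolding M_def using A T r by (intro mult_pos_pos add_pos_nonneg) auto
    show "0 < r" by (rule r)
    show "\<psi> \<xi> \<in> W1p p" if "norm \<xi> < r" for \<xi> by (rule \<psi>W[OF that])
    show "AE x in torus. norm (\<psi> \<xi> x) \<le> M * norm \<xi>" if "norm \<xi> < r" for \<xi>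
    proof (cases "\<xi> = 0")
      case True
      then show ?thesis using AE_lborel_imp_torus[OF \<psi>0] by (auto elim: eventually_mono)
    qed (use bound that in auto)
  qed
qed

text \<open>The reduced equation makes the gradient at \<xi> + \<psi> \<xi> the pairing with a
  constant form, which vanishes on the mean-free form \<psi> \<xi>. The lower bound for the gradient
  in this direction forces the Dirichlet integral of \<psi> \<xi> to be 0, and Poincare gives \<psi>
  \<xi> = 0. The linear bound for the germ at 0 supplies the pointwise smallness that the lower
  bound requires.\<close>

lemma LS_correction_unique:
  fixes \<psi> :: "'n::{finite,linorder} covec \<Rightarrow> 'n one_form"
  assumes LS: "LS_correction p (\<lambda>x y. c * (x \<bullet> y)) \<psi>" and p: "real CARD('n) < p" "2 \<le> p" and c: "0 < c"
  shows "\<forall>\<^sub>F \<xi> in nhds 0. (AE x in lborel. \<psi> \<xi> x = 0) \<and>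
    reduced_energy (\<lambda>x y. c * (x \<bullet> y)) \<psi> \<xi> = c * (1/2 * inner2 (\<bullet>) (const_curv \<xi>) (const_curv \<xi>))"
proof -
  let ?ip = "\<lambda>x y :: su2. c * (x \<bullet> y)"
  have p1: "1 \<le> p" using p by simp
  have germ: "analytic_germ p \<psi>" "AE x in lborel. \<psi> 0 x = 0"
    using LS by (simp_all add: LS_correction_def)
  obtain M r where M: "0 < M" and r: "0 < r" and W: "\<And>\<xi>. norm \<xi> < r \<Longrightarrow> \<psi> \<xi> \<in> W1p p"
    and bound: "\<And>\<xi>. norm \<xi> < r \<Longrightarrow> AE x in torus. norm (\<psi> \<xi> x) \<le> M * norm \<xi>"
    by (rule analytic_germ_AE_bound[OF germ p(1)]) blast
  obtain C where C: "0 < C" and est: "\<And>(k :: 'n covec) z r. const_perturbation k z r \<Longrightarrow>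
      (1 - C * r) * (LINT x|torus. (norm (grad_form z x))\<^sup>2) \<le> gradient (\<bullet>) (\<lambda>x. k + z x) z"
    using perturbation_estimates[where 'n = 'n] by metis
  define r1 where "r1 = min 1 (1 / (2 * C))"
  have r1: "0 < r1" "r1 \<le> 1" "C * r1 \<le> 1/2" using C by (auto simp: r1_def min_def field_simps)
  \<comment> \<open>Keeps both |\<xi>| and the pointwise bound M |\<xi>| of the correction below
    r1.\<close>
  define r2 where "r2 = min r (min r1 (r1 / M))"
  have r2: "0 < r2" using r r1 M by (simp add: r2_def)
  have "\<forall>\<^sub>F \<xi> in nhds 0. norm \<xi> < r2"
    unfolding eventually_nhds_metric using r2 by (auto simp: dist_norm intro!: exI[of _ r2])
  moreover have "\<forall>\<^sub>F \<xi> in nhds 0. \<psi> \<xi> \<in> Z_space p ?ip \<and> proj_R p ?ip (gradient ?ip (\<lambda>x. const_form \<xi> x + \<psi> \<xi> x)) (\<lambda>b. 0)"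
    using LS by (simp add: LS_correction_def)
  ultimately show ?thesis
  proof eventually_elim
    case (elim \<xi>)
    define z where "z = \<psi> \<xi>"
    have \<xi>r: "norm \<xi> < r" "norm \<xi> \<le> r1" "M * norm \<xi> \<le> r1"
      using elim(1) M by (auto simp: r2_def less_divide_eq mult.commute)
    have zW: "z \<in> W1p p" using W[OF \<xi>r(1)] by (simp add: z_def)
    have z2: "z \<in> W1p 2" using W1p_mono[OF zW] p by simp
    have zi: "integrable torus z" by (rule W1p_integrable(1)[OF zW p1])
    have zZ: "L2_pairing ?ip z (const_form \<zeta>) = 0" for \<zeta>
      using elim(2) by (simp add: Z_space_def z_def)
    have mean: "(LINT x|torus. z x) = 0"
    proof -
      have "(LINT x|torus. z x) \<bullet> \<zeta> = 0" for \<zeta>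
      proof -
        have "(LINT x|torus. z x) \<bullet> \<zeta> = (LINT x|torus. z x \<bullet> \<zeta>)"
          using integral_bounded_linear[OF bounded_linear_inner_left zi] by simp
        then show ?thesis using zZ[of \<zeta>] c by (simp add: L2_pairing_scaled const_form_def)
      qed
      from this[of "LINT x|torus. z x"] show ?thesis by simp
    qed
    have P: "const_perturbation \<xi> z r1"
    proof
      show "AE x in torus. norm (z x) \<le> r1"
        using bound[OF \<xi>r(1)] unfolding z_def by eventually_elim (use \<xi>r in linarith)
    qed (use z2 mean r1 \<xi>r in auto)
    obtain \<eta> where "\<forall>b\<in>W1p (conj_exp p). gradient ?ip (\<lambda>x. const_form \<xi> x + \<psi> \<xi> x) b - 0 = L2_pairing ?ip (const_form \<eta>) b"
      using elim(2) unfolding proj_R_def in_K_def by blast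
    moreover have "z \<in> W1p (conj_exp p)"
      using W1p_mono[OF z2, of "conj_exp p"] conj_exp_bounds[OF p(2)] by simp
    ultimately have "gradient ?ip (\<lambda>x. const_form \<xi> x + \<psi> \<xi> x) z = L2_pairing ?ip (const_form \<eta>) z"
      by simp
    also have "\<dots> = L2_pairing ?ip z (const_form \<eta>)" by (simp add: L2_pairing_scaled inner_commute)
    finally have "c * gradient (\<bullet>) (\<lambda>x. \<xi> + z x) z = 0"
      using zZ by (simp add: gradient_scaled z_def const_form_def)
    then have g0: "gradient (\<bullet>) (\<lambda>x. \<xi> + z x) z = 0" using c by simp
    define S where "S = (LINT x|torus. (norm (grad_form z x))\<^sup>2)"
    have S0: "0 \<le> S" by (simp add: S_def)
    have "1/2 * S \<le> (1 - C * r1) * S" using r1 S0 by (intro mult_right_mono) auto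
    then have "S \<le> 0" using est[OF P] g0 unfolding S_def[symmetric] by linarith
    then have "S = 0" using S0 by simp
    then have "(LINT x|torus. (norm (z x))\<^sup>2) \<le> 0"
      using poincare_mean_zero[OF z2 mean] by (simp add: S_def)
    moreover have zL2: "integrable torus (\<lambda>x. (norm (z x))\<^sup>2)"
      using W1p_Lp[OF z2] by (simp add: Lp_2_iff_L2 L2_def)
    moreover have "0 \<le> (LINT x|torus. (norm (z x))\<^sup>2)" by simp
    ultimately have "AE x in torus. (norm (z x))\<^sup>2 = 0"
      using integral_nonneg_eq_0_iff_AE[OF zL2] by simp
    then have AE0: "AE x in torus. z x = 0" by eventually_elim simp
    have "AE x in lborel. z x = 0"
    proof (rule AE_torus_imp_lborel[OF AE0])
      note [measurable] = LpD(2)[OF W1p_Lp[OF zW]]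
      show "Measurable.pred borel (\<lambda>x. z x = 0)" by measurable
      show "periodic (\<lambda>x. z x = 0)" by (rule periodic_comp[OF LpD(1)[OF W1p_Lp[OF zW]]])
    qed
    moreover have "energy (\<bullet>) (\<lambda>x. \<xi> + z x) = 1/2 * inner2 (\<bullet>) (const_curv \<xi>) (const_curv \<xi>)"
    proof (rule energy_AE_const)
      show "(\<lambda>x. \<xi> + z x) \<in> borel_measurable torus" using LpD(4)[OF W1p_Lp[OF zW]] by simp
      show "AE x in torus. \<xi> + z x = \<xi>" using AE0 by eventually_elim simp
    qed
    ultimately show ?case
      by (simp add: reduced_energy_def energy_scaled z_def const_form_def)
  qed
qed

text \<open>The derivative inside \<open>curv\<close> is a representative that is 0 almost
  everywhere on the torus, and a constant that vanishes almost everywhere on a probability space is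
  0.\<close>

lemma curv_const_form_AE_eq_0:
  fixes k :: "'n::{finite,linorder} covec"
  assumes "AE x in lborel. curv (const_form k) x = 0"
  shows "const_curv k = 0"
proof -
  have g: "AE x in torus. grad_form (const_form k :: 'n one_form) x = 0"
    unfolding const_form_def by (rule grad_form_const)
  have "AE x in (torus :: (real, 'n) vec measure). const_curv k = 0"
    using AE_lborel_imp_torus[OF assms] g
    by eventually_elim (simp add: curv_def ext_d_eq linear_zeros const_form_def flip: const_curv_def)
  then show ?thesis by (simp add: torus.prob_space_axioms prob_space.AE_const)
qed

theorem theorem4p7:
  assumes "CARD('n::{finite,linorder}) \<ge> 2"
  shows "\<exists>\<kappa>>0. \<forall>p ip. p > real CARD('n) \<and> Ad_invariant_inner_product ip \<longrightarrow>
    LS_correction p ip (\<lambda>(\<xi> :: 'n covec) x. 0) \<and>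
    (\<forall>\<psi> :: 'n covec \<Rightarrow> 'n one_form. LS_correction p ip \<psi> \<longrightarrow>
      (\<forall>\<^sub>F \<xi> in nhds 0. (AE x in lborel. \<psi> \<xi> x = 0) \<and>
        reduced_energy ip \<psi> \<xi> = \<kappa> * (\<Sum>(i, j) | i < j.
          ip (lie_bracket (\<xi> $ i) (\<xi> $ j)) (lie_bracket (\<xi> $ i) (\<xi> $ j))))) \<and>
    theta_LS p ip (const_form 0 :: 'n one_form) = 3/4 \<and>
    (\<exists>\<epsilon>>0. \<forall>\<xi>0 :: 'n covec. \<xi>0 \<noteq> 0 \<and> norm \<xi>0 < \<epsilon> \<and>
      (AE x in lborel. curv (const_form \<xi>0) x = 0) \<longrightarrow>
        theta_LS p ip (const_form \<xi>0) = 1/2)"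
proof (intro exI[of _ "1/2 :: real"] conjI[where P = "0 < (1/2 :: real)"] allI impI)
  \<comment> \<open>The energy carries the factor 1/2 and the torus has volume 1. The constant
    serves every p and every inner product, since the sum is formed with \<open>ip\<close>
    itself.\<close>
  show "0 < (1/2 :: real)" by simp
next
  fix p ip
  assume "p > real CARD('n) \<and> Ad_invariant_inner_product ip"
  then have p: "p > real CARD('n)" and inv: "Ad_invariant_inner_product ip" by auto
  have p2: "2 \<le> p" using p assms by linarith
  obtain c where c: "0 < c" and ip: "ip = (\<lambda>x y. c * (x \<bullet> y))"
    by (rule Ad_invariant_inner_product_eq[OF inv])
  show "LS_correction p ip (\<lambda>(\<xi> :: 'n covec) x. 0) \<and>
    (\<forall>\<psi> :: 'n covec \<Rightarrow> 'n one_form. LS_correction p ip \<psi> \<longrightarrow>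
      (\<forall>\<^sub>F \<xi> in nhds 0. (AE x in lborel. \<psi> \<xi> x = 0) \<and>
        reduced_energy ip \<psi> \<xi> = 1/2 * (\<Sum>(i, j) | i < j.
          ip (lie_bracket (\<xi> $ i) (\<xi> $ j)) (lie_bracket (\<xi> $ i) (\<xi> $ j))))) \<and>
    theta_LS p ip (const_form 0 :: 'n one_form) = 3/4 \<and>
    (\<exists>\<epsilon>>0. \<forall>\<xi>0 :: 'n covec. \<xi>0 \<noteq> 0 \<and> norm \<xi>0 < \<epsilon> \<and>
      (AE x in lborel. curv (const_form \<xi>0) x = 0) \<longrightarrow>
        theta_LS p ip (const_form \<xi>0) = 1/2)"
  proof (intro conjI allI impI)
    show "LS_correction p ip (\<lambda>(\<xi> :: 'n covec) x. 0)"
      unfolding ip by (rule LS_correction_zero[OF p2 c])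
    show "theta_LS p ip (const_form 0 :: 'n one_form) = 3/4"
      unfolding ip theta_LS_scaled[OF p p2 c] by (rule theta_LS_zero[OF assms p])
    show "\<exists>\<epsilon>>0. \<forall>\<xi>0 :: 'n covec. \<xi>0 \<noteq> 0 \<and> norm \<xi>0 < \<epsilon> \<and>
        (AE x in lborel. curv (const_form \<xi>0) x = 0) \<longrightarrow> theta_LS p ip (const_form \<xi>0) = 1/2"
    proof -
      obtain \<epsilon> where "0 < \<epsilon>" and \<epsilon>: "\<And>k0 :: 'n covec. k0 \<noteq> 0 \<Longrightarrow> norm k0 < \<epsilon> \<Longrightarrow> const_curv k0 = 0 \<Longrightarrow>
          theta_LS p (\<bullet>) (const_form k0) = 1/2"
        using theta_LS_flat[OF p p2] by metis
      then show ?thesis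
        unfolding ip theta_LS_scaled[OF p p2 c] using curv_const_form_AE_eq_0 by blast
    qed
    fix \<psi> :: "'n covec \<Rightarrow> 'n one_form"
    assume "LS_correction p ip \<psi>"
    from LS_correction_unique[OF this[unfolded ip] p p2 c]
    show "\<forall>\<^sub>F \<xi> in nhds 0. (AE x in lborel. \<psi> \<xi> x = 0) \<and>
          reduced_energy ip \<psi> \<xi> = 1/2 * (\<Sum>(i, j) | i < j.
            ip (lie_bracket (\<xi> $ i) (\<xi> $ j)) (lie_bracket (\<xi> $ i) (\<xi> $ j)))"
      by eventually_elim (simp add: ip inner2_const_curv sum_distrib_left case_prod_beta' mult_ac)
  qed
qed

end
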